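(* Fix $\theta\in(0,1)$ and let $(\mathcal{T}_n)_{n\ge 1}$ be the recursive trees with limited memory in the macroscopic regime, i.e. with $j(n)=\lfloor\theta n\rfloor$. Then $\mathcal{T}_n$ converges in probability in the extended fringe sense, as $n\to\infty$, to the unique infinite sin-tree with fringe distribution $\varpi_\theta$, where $\varpi_\theta$ is the law of $\mathrm{BP}_\theta(T_1)$ viewed as a random finite rooted tree.
   Context: **Model.** Let $j:\mathbb{N}\to\mathbb{Z}_{\ge 0}$ be non-decreasing with $j(n)\le n$. $\mathcal{T}_1$ is the tree with the single vertex $1$ (the root of all the trees) and no edges. Given $\mathcal{T}_n$ (vertex set $\{1,\dots,n\}$), $\mathcal{T}_{n+1}$ is obtained by adding vertex $n+1$ and an edge between $n+1$ and a vertex chosen uniformly at random, independently of the past, from $\{v\in\{1,\dots,n\}: j(n)\le v\le n\}$. Macroscopic regime: $j(n)=\lfloor\theta n\rfloor$. **The law $\varpi_\theta$.** Let $c_\theta=\log(1/\theta)$ and let $\mathcal{N}_\theta$ be a Poisson process of constant rate $(1-\theta)^{-1}$ on $[0,c_\theta]$. $\mathrm{BP}_\theta$ is the continuous-time branching process started from one individual born at time $0$, in which each individual, born at time $s$, has children at the times $s+x$ for $x$ ranging over the points of its own independent copy of $\mathcal{N}_\theta$; individuals never die. $\mathrm{BP}_\theta(t)$ denotes the genealogical tree of all individuals born up to time $t$, rooted at the initial individual. $T_1$ is an exponential random variable of mean $1$ independent of $\mathrm{BP}_\theta$. $\varpi_\theta$ is the law of $\mathrm{BP}_\theta(T_1)$,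 retaining only genealogical information. **Fringe convergence.** $\mathbb{T}$ is the set of finite rooted trees (including the empty tree $\emptyset$), considered up to root-preserving isomorphism, with metric $d_{\mathbb{T}}(\mathbf{s},\mathbf{t})=1/(1+R^* )$, $R^*=\sup\{r: B(\mathbf{t},r)\simeq B(\mathbf{s},r)\}$, where $B(\mathbf{t},r)$ is the ball of radius $r$ about the root. Sequences of trees carry the metric $\sum_i 2^{-i}d_{\mathbb{T}}(\mathbf{t}_i,\mathbf{s}_i)$. For $\mathbf{t}\in\mathbb{T}$ with root $\rho$ and a vertex $v$ at distance $h$ from $\rho$, let $(v_0=v,v_1,\dots,v_h=\rho)$ be the path from $v$ to $\rho$. Let $f_0(v,\mathbf{t})$ be the subtree rooted at $v$ of all vertices whose path from the root passes through $v$; for $1\le i\le h$ let $f_i(v,\mathbf{t})$ be the subtree rooted at $v_i$ of all vertices whose path from the root passes through $v_i$ but not through $v_{i-1}$; and let $f_i(v,\mathbf{t})=\emptyset$ for $i>h$. Put $F_k(v,\mathbf{t})=(f_0(v,\mathbf{t}),\dots,f_k(v,\mathbf{t}))$. A sin-tree is a sequence $(\mathbf{t}_0,\mathbf{t}_1,\dots)$ of non-empty finite rooted trees, thought of as the infinite tree obtained by attaching $\mathbf{t}_i$ by its root at vertex $i$ of the path $0,1,2,\dots$; put $F_k(0,(\mathbf{t}_i)_i)=(\mathbf{t}_0,\dots,\mathbf{t}_k)$. Its monotone representation is $(\bar{\mathbf{t}}_0,\bar{\mathbf{t}}_1,\dots)$, where $\bar{\mathbf{t}}_i$ is the finite tree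 rooted at $i$ formed by $\mathbf{t}_0,\dots,\mathbf{t}_i$ and the path edges between $0,\dots,i$. For $\mathbf{s},\mathbf{t}\in\mathbb{T}$ let $Q(\mathbf{s},\mathbf{t})$ be the number of children of the root of $\mathbf{s}$ whose descendant subtree is root-isomorphic to $\mathbf{t}$. A probability measure $\varpi$ on $\mathbb{T}$ is a fringe distribution if $\sum_{\mathbf{s}}\varpi(\mathbf{s})Q(\mathbf{s},\mathbf{t})=\varpi(\mathbf{t})$ for all $\mathbf{t}$. The unique sin-tree with fringe distribution $\varpi$ is the random sin-tree whose monotone representation satisfies, for all $i\ge0$ and all $\bar{\mathbf{t}}_0,\dots,\bar{\mathbf{t}}_i$, $$\mathbb{P}\big((\bar{\mathbf{t}}_0(\mathcal{T}),\dots,\bar{\mathbf{t}}_i(\mathcal{T}))=(\bar{\mathbf{t}}_0,\dots,\bar{\mathbf{t}}_i)\big)=\varpi(\bar{\mathbf{t}}_i)\prod_{m=1}^i Q(\bar{\mathbf{t}}_m,\bar{\mathbf{t}}_{m-1}).$$ $\mathcal{T}_n$ converges in probability in the extended fringe sense to a random sin-tree $\mathcal{T}_\infty$ if for every $k\ge0$ the random empirical measure $\frac1n\sum_{v\in\mathcal{T}_n}\delta_{F_k(v,\mathcal{T}_n)}$ converges in probability, in the topology of weak convergence of probability measures, to the law of $F_k(0,\mathcal{T}_\infty)$. *)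

theory Defs
  imports "HOL-Probability.Probability" "HOL-Library.Multiset" "HOL-Library.Extended_Nat"
begin

text \<open>
  A nested finite multiset is a finite non-empty rooted tree up to root-preserving isomorphism:
  the root of \<open>Node A\<close> has one child for each member of \<open>A\<close>, counted with multiplicity.  The
  space of the paper also contains the empty tree, which is \<open>None\<close>.
\<close>

datatype rtree = Node (subtrees: "rtree multiset")

type_synonym ftree = "rtree option"

primrec trunc :: "nat \<Rightarrow> rtree \<Rightarrow> rtree" where
  "trunc 0 t = Node {#}"
| "trunc (Suc r) t = Node (image_mset (trunc r) (subtrees t))"

definition tree_ball :: "nat \<Rightarrow> ftree \<Rightarrow> ftree" where
  "tree_ball r t = map_option (trunc r) t"

text \<open>The radii range over the naturals, and the supremum over no radius at all (exactly one of
  the two trees is empty) is \<open>0\<close>.\<close>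

definition agreement_radius :: "ftree \<Rightarrow> ftree \<Rightarrow> enat" where
  "agreement_radius s t = Sup (enat ` {r. tree_ball r t = tree_ball r s})"

definition tree_dist :: "ftree \<Rightarrow> ftree \<Rightarrow> real" where
  "tree_dist s t = (case agreement_radius s t of enat R \<Rightarrow> 1 / (1 + real R) | \<infinity> \<Rightarrow> 0)"

definition tuples :: "nat \<Rightarrow> ftree list set" where
  "tuples k = {ts. length ts = Suc k}"

definition tuple_dist :: "nat \<Rightarrow> ftree list \<Rightarrow> ftree list \<Rightarrow> real" where
  "tuple_dist k ss ts = (\<Sum>i\<le>k. (1 / 2) ^ i * tree_dist (ts ! i) (ss ! i))"

definition tuple_topology :: "nat \<Rightarrow> ftree list topology" where
  "tuple_topology k = Metric_space.mtopology (tuples k) (tuple_dist k)"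

lemma trunc_trunc: "r \<le> q \<Longrightarrow> trunc r (trunc q t) = trunc r t"
proof (induction r arbitrary: q t)
  case (Suc r)
  then obtain p where p: "q = Suc p" "r \<le> p" by (cases q) auto
  show ?case using p Suc.IH by (simp add: multiset.map_comp comp_def)
qed simp

lemma tree_ball_mono: "r \<le> q \<Longrightarrow> tree_ball q s = tree_ball q t \<Longrightarrow> tree_ball r s = tree_ball r t"
proof -
  assume a: "r \<le> q" "tree_ball q s = tree_ball q t"
  have "tree_ball r (tree_ball q x) = tree_ball r x" for x
    using a(1) by (cases x) (simp_all add: tree_ball_def trunc_trunc)
  then show ?thesis using a(2) by metis
qed

lemma trunc_eventually: "\<exists>q. \<forall>r\<ge>q. trunc r t = t"
proof (induction t)
  case (Node A)
  then obtain q where q: "\<And>x. x \<in># A \<Longrightarrow> \<forall>r\<ge>q x. trunc r x = x" by metis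
  define m where "m = Max (insert 0 (q ` set_mset A))"
  have m: "x \<in># A \<Longrightarrow> q x \<le> m" for x by (simp add: m_def)
  have "trunc r (Node A) = Node A" if r: "r \<ge> Suc m" for r
  proof -
    obtain p where p: "r = Suc p" "m \<le> p" using r by (cases r) auto
    have "image_mset (trunc p) A = image_mset (\<lambda>x. x) A"
      by (rule image_mset_cong) (use q m p(2) le_trans in blast)
    then show ?thesis using p by simp
  qed
  then show ?case by blast
qed

lemma tree_ball_eventually: "\<exists>q. \<forall>r\<ge>q. tree_ball r t = t"
  using trunc_eventually by (cases t) (auto simp: tree_ball_def)

lemma agreement_radius_eq_infinity: "agreement_radius s t = \<infinity> \<longleftrightarrow> s = t"
proof
  assume inf: "agreement_radius s t = \<infinity>"
  obtain p q where pq: "\<forall>r\<ge>p. tree_ball r s = s" "\<forall>r\<ge>q. tree_ball r t = t"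
    using tree_ball_eventually by metis
  have "\<exists>r \<ge> max p q. tree_ball r t = tree_ball r s"
  proof (rule ccontr)
    assume "\<not> ?thesis"
    then have "agreement_radius s t \<le> enat (max p q)"
      unfolding agreement_radius_def
      by (intro Sup_least) (auto, meson nat_le_linear max.boundedI max.bounded_iff)
    then show False using inf by simp
  qed
  then show "s = t" using pq by auto
next
  assume "s = t"
  have "enat n \<le> agreement_radius s t" for n
    unfolding agreement_radius_def by (rule Sup_upper) (use \<open>s = t\<close> in auto)
  then show "agreement_radius s t = \<infinity>"
    by (metis enat_ord_simps(1) enat_ord_code(3) not_enat_eq order_antisym_conv Suc_n_not_le_n enat.exhaust)
qed

lemma agreement_radius_min:
  "min (agreement_radius s t) (agreement_radius t u) \<le> agreement_radius s u"
proof (rule ccontr)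
  assume "\<not> ?thesis"
  then have lt: "agreement_radius s u < agreement_radius s t" "agreement_radius s u < agreement_radius t u"
    by (auto simp: not_le)
  obtain a where a: "tree_ball a t = tree_ball a s" "agreement_radius s u < enat a"
    using lt(1) unfolding agreement_radius_def[of s t] less_Sup_iff by auto
  obtain b where b: "tree_ball b u = tree_ball b t" "agreement_radius s u < enat b"
    using lt(2) unfolding agreement_radius_def[of t u] less_Sup_iff by auto
  have "tree_ball (min a b) u = tree_ball (min a b) s"
    using tree_ball_mono[OF _ a(1), of "min a b"] tree_ball_mono[OF _ b(1), of "min a b"] by simp
  then have "enat (min a b) \<le> agreement_radius s u"
    unfolding agreement_radius_def by (intro Sup_upper) auto
  then show False using a(2) b(2) by (metis min_def not_le)
qed

lemma tree_dist_nonneg: "0 \<le> tree_dist s t"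
  by (auto simp: tree_dist_def split: enat.split)

lemma tree_dist_commute: "tree_dist s t = tree_dist t s"
proof -
  have "agreement_radius s t = agreement_radius t s"
    unfolding agreement_radius_def by (metis)
  then show ?thesis by (simp add: tree_dist_def)
qed

lemma tree_dist_eq_0: "tree_dist s t = 0 \<longleftrightarrow> s = t"
  using agreement_radius_eq_infinity[of s t]
  by (auto simp: tree_dist_def split: enat.split)

lemma tree_dist_triangle: "tree_dist s u \<le> tree_dist s t + tree_dist t u"
proof -
  have mono: "tree_dist x y \<le> tree_dist x' y'" if "agreement_radius x' y' \<le> agreement_radius x y" for x y x' y'
    using that by (auto simp: tree_dist_def frac_le split: enat.split dest: enat_ile)
  have "tree_dist s u \<le> tree_dist s t \<or> tree_dist s u \<le> tree_dist t u"
    using agreement_radius_min[of s t u] mono by (auto simp: min_def split: if_splits)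
  then show ?thesis using tree_dist_nonneg[of s t] tree_dist_nonneg[of t u] by auto
qed

lemma Metric_space_tree: "Metric_space UNIV tree_dist"
  by unfold_locales
    (auto simp: tree_dist_nonneg tree_dist_eq_0 tree_dist_triangle intro: tree_dist_commute)

lemma Metric_space_tuples: "Metric_space (tuples k) (tuple_dist k)"
proof
  show "0 \<le> tuple_dist k x y" for x y
    unfolding tuple_dist_def by (intro sum_nonneg mult_nonneg_nonneg tree_dist_nonneg) simp
  show "tuple_dist k x y = tuple_dist k y x" for x y
    unfolding tuple_dist_def by (intro sum.cong refl arg_cong2[where f = "(*)"] tree_dist_commute)
  show "tuple_dist k x y = 0 \<longleftrightarrow> x = y" if xy: "x \<in> tuples k" "y \<in> tuples k" for x y
  proof -
    have "tuple_dist k x y = 0 \<longleftrightarrow> (\<forall>i\<in>{..k}. (1 / 2 :: real) ^ i * tree_dist (y ! i) (x ! i) = 0)"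
      unfolding tuple_dist_def
      by (intro sum_nonneg_eq_0_iff) (simp_all add: tree_dist_nonneg)
    also have "\<dots> \<longleftrightarrow> (\<forall>i\<le>k. x ! i = y ! i)" by (auto simp: tree_dist_eq_0)
    also have "\<dots> \<longleftrightarrow> x = y" using xy by (auto simp: tuples_def list_eq_iff_nth_eq less_Suc_eq_le)
    finally show ?thesis .
  qed
  show "tuple_dist k x z \<le> tuple_dist k x y + tuple_dist k y z" for x y z
  proof -
    have "tuple_dist k x z
        \<le> (\<Sum>i\<le>k. (1 / 2) ^ i * (tree_dist (y ! i) (x ! i) + tree_dist (z ! i) (y ! i)))"
      unfolding tuple_dist_def
      by (intro sum_mono mult_left_mono) (use tree_dist_triangle add.commute in metis, simp)
    then show ?thesis by (simp add: tuple_dist_def distrib_left sum.distrib)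
  qed
qed

text \<open>A concrete rooted tree is given by its vertices, its root and the map sending each non-root
  vertex to its neighbour on the path to the root; the value of \<open>parent\<close> elsewhere is immaterial.\<close>

record 'v vtree =
  verts :: "'v set"
  troot :: 'v
  parent :: "'v \<Rightarrow> 'v"

definition rooted_tree :: "'v vtree \<Rightarrow> bool" where
  "rooted_tree t \<longleftrightarrow> troot t \<in> verts t \<and> (\<forall>v \<in> verts t - {troot t}. parent t v \<in> verts t) \<and>
     (\<forall>v \<in> verts t. \<exists>h. (parent t ^^ h) v = troot t)"

definition depth :: "'v vtree \<Rightarrow> 'v \<Rightarrow> nat" where
  "depth t v = (LEAST h. (parent t ^^ h) v = troot t)"

definition root_path :: "'v vtree \<Rightarrow> 'v \<Rightarrow> 'v set" where
  "root_path t v = {(parent t ^^ i) v | i. i \<le> depth t v}"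

definition kids :: "'v vtree \<Rightarrow> 'v \<Rightarrow> 'v set" where
  "kids t v = {w \<in> verts t. w \<noteq> troot t \<and> parent t w = v}"

text \<open>\<open>shape_upto h t v\<close> is the descendant tree of \<open>v\<close> cut off at height \<open>h\<close>.  A finite
  tree has height less than its number of vertices, so nothing is cut off in \<open>iso_class\<close>.
  By convention infinite trees go to \<open>None\<close>; a branching process is infinite
  at a given time only on a null event.\<close>

primrec shape_upto :: "nat \<Rightarrow> 'v vtree \<Rightarrow> 'v \<Rightarrow> rtree" where
  "shape_upto 0 t v = Node {#}"
| "shape_upto (Suc h) t v = Node (image_mset (shape_upto h t) (mset_set (kids t v)))"

definition iso_class :: "'v vtree \<Rightarrow> ftree" where
  "iso_class t = (if finite (verts t) \<and> verts t \<noteq> {}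
     then Some (shape_upto (card (verts t)) t (troot t)) else None)"

definition root_isomorphic :: "'v vtree \<Rightarrow> 'w vtree \<Rightarrow> bool" where
  "root_isomorphic s t \<longleftrightarrow> (\<exists>\<phi>. bij_betw \<phi> (verts s) (verts t) \<and> \<phi> (troot s) = troot t \<and>
     (\<forall>v \<in> verts s - {troot s}. \<phi> (parent s v) = parent t (\<phi> v)))"

context
  fixes t :: "'v vtree"
  assumes t: "rooted_tree t"
begin

lemma depth_path: "v \<in> verts t \<Longrightarrow> (parent t ^^ depth t v) v = troot t"
  using t unfolding rooted_tree_def depth_def by (metis (mono_tags, lifting) LeastI_ex)

lemma depth_root: "depth t (troot t) = 0"
  unfolding depth_def by (rule Least_eq_0) simp

lemma depth_parent:
  assumes v: "v \<in> verts t" "v \<noteq> troot t"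
  shows "depth t v = Suc (depth t (parent t v))"
proof -
  have "parent t v \<in> verts t" using t v by (auto simp: rooted_tree_def)
  then have 1: "(parent t ^^ Suc (depth t (parent t v))) v = troot t"
    using depth_path by (simp only: funpow_Suc_right comp_apply)
  have "depth t v \<noteq> 0" using depth_path[OF v(1)] v(2) by (metis funpow_0)
  then obtain d where d: "depth t v = Suc d" by (cases "depth t v") auto
  have "(parent t ^^ d) (parent t v) = troot t"
    using depth_path[OF v(1)] by (simp add: d funpow_swap1)
  then have "depth t (parent t v) \<le> d" unfolding depth_def by (rule Least_le)
  moreover have "depth t v \<le> Suc (depth t (parent t v))"
    using 1 unfolding depth_def[of t v] by (rule Least_le)
  ultimately show ?thesis using d by simp
qed

lemma depth_less_card:
  assumes "finite (verts t)" "v \<in> verts t"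
  shows "depth t v < card (verts t)"
proof -
  have *: "(parent t ^^ i) v \<in> verts t \<and> depth t ((parent t ^^ i) v) = depth t v - i" if "i \<le> depth t v" for i
    using that
  proof (induction i)
    case (Suc i)
    let ?w = "(parent t ^^ i) v"
    have w: "?w \<in> verts t" "depth t ?w = depth t v - i" using Suc by auto
    then have "?w \<noteq> troot t" using Suc.prems depth_root by auto
    then show ?case using w depth_parent[OF w(1)] t by (auto simp: rooted_tree_def)
  qed (use assms in simp)
  have "inj_on (\<lambda>i. (parent t ^^ i) v) {..depth t v}"
    by (rule inj_onI) (metis * atMost_iff diff_diff_cancel)
  then have "card {..depth t v} \<le> card (verts t)"
    by (rule card_inj_on_le) (use * assms in auto)
  then show ?thesis by simp
qed

lemma kids_depth: "w \<in> kids t v \<Longrightarrow> w \<in> verts t \<and> depth t w = Suc (depth t v)"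
  using depth_parent by (auto simp: kids_def)

lemma shape_upto_add:
  assumes "\<And>x. x \<in> verts t \<Longrightarrow> depth t x \<le> depth t v + h"
  shows "shape_upto (h + d) t v = shape_upto h t v"
  using assms
proof (induction h arbitrary: v)
  case 0
  have "kids t v = {}"
  proof (rule equals0I)
    fix w assume "w \<in> kids t v"
    with kids_depth[of w v] 0[of w] show False by simp
  qed
  then show ?case by (cases d) simp_all
next
  case (Suc h)
  have "image_mset (shape_upto (h + d) t) (mset_set (kids t v)) = image_mset (shape_upto h t) (mset_set (kids t v))"
  proof (rule image_mset_cong)
    fix w assume "w \<in># mset_set (kids t v)"
    then have "w \<in> kids t v" by (metis elem_mset_set empty_iff mset_set.infinite set_mset_empty)
    then have "x \<in> verts t \<Longrightarrow> depth t x \<le> depth t w + h" for x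
      using Suc.prems[of x] kids_depth by simp
    then show "shape_upto (h + d) t w = shape_upto h t w" by (rule Suc.IH)
  qed
  then show ?case by simp
qed

end

inductive_set desc :: "'v vtree \<Rightarrow> 'v \<Rightarrow> 'v set" for t v where
  desc_refl: "v \<in> desc t v"
| desc_kid: "x \<in> desc t v \<Longrightarrow> y \<in> kids t x \<Longrightarrow> y \<in> desc t v"

lemma desc_trans: "x \<in> desc t w \<Longrightarrow> w \<in> desc t v \<Longrightarrow> x \<in> desc t v"
  by (induction rule: desc.induct) (auto intro: desc_kid)

lemma desc_unfold: "desc t v = insert v (\<Union>w\<in>kids t v. desc t w)"
proof (intro equalityI subsetI)
  fix x assume "x \<in> desc t v"
  then show "x \<in> insert v (\<Union>w\<in>kids t v. desc t w)"
    by (induction rule: desc.induct) (auto intro: desc_refl desc_kid)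
next
  fix x assume "x \<in> insert v (\<Union>w\<in>kids t v. desc t w)"
  then show "x \<in> desc t v" by (auto intro: desc_refl desc_trans[OF _ desc_kid[OF desc_refl]])
qed

lemma desc_depth:
  assumes t: "rooted_tree t" and "x \<in> desc t v"
  shows "depth t v \<le> depth t x \<and> (parent t ^^ (depth t x - depth t v)) x = v"
  using assms(2)
proof (induction rule: desc.induct)
  case (desc_kid x y)
  have "parent t y = x" using desc_kid.hyps(2) by (simp add: kids_def)
  moreover have "depth t y = Suc (depth t x)" using kids_depth[OF t desc_kid.hyps(2)] by simp
  ultimately show ?case
    using desc_kid.IH by (simp add: Suc_diff_le funpow_Suc_right del: funpow.simps)
qed simp

lemma desc_root:
  assumes t: "rooted_tree t"
  shows "desc t (troot t) = verts t"
proof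
  have "x \<in> desc t v \<Longrightarrow> v \<in> verts t \<Longrightarrow> x \<in> verts t" for x v
    by (induction rule: desc.induct) (auto simp: kids_def)
  then show "desc t (troot t) \<subseteq> verts t" using t by (auto simp: rooted_tree_def)
  have "x \<in> verts t \<Longrightarrow> depth t x = d \<Longrightarrow> x \<in> desc t (troot t)" for x d
  proof (induction d arbitrary: x)
    case 0
    then show ?case using depth_path[OF t, of x] by (simp add: desc_refl)
  next
    case (Suc d)
    then have "x \<noteq> troot t" using depth_root[OF t] by auto
    then have "depth t (parent t x) = d" "parent t x \<in> verts t" "x \<in> kids t (parent t x)"
      using Suc.prems depth_parent[OF t, of x] t by (auto simp: rooted_tree_def kids_def)
    then show ?case using Suc.IH desc_kid by metis
  qed
  then show "verts t \<subseteq> desc t (troot t)" by blast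
qed

lemma image_mset_eq_imp_bij:
  assumes "finite A" "finite B" "image_mset f (mset_set A) = image_mset g (mset_set B)"
  shows "\<exists>b. bij_betw b A B \<and> (\<forall>a\<in>A. g (b a) = f a)"
  using assms
proof (induction A arbitrary: B rule: finite_induct)
  case empty
  then have "B = {}" by (simp add: mset_set_empty_iff)
  then show ?case by (simp add: bij_betw_def)
next
  case (insert a A)
  then have "f a \<in># image_mset g (mset_set B)" by (metis image_mset_add_mset mset_set.insert union_single_eq_member)
  then obtain y where y: "y \<in> B" "g y = f a" using insert.prems by auto
  define C where "C = B - {y}"
  have B: "B = insert y C" "y \<notin> C" "finite C" using y insert.prems by (auto simp: C_def)
  then obtain b where b: "bij_betw b A C" "\<forall>a\<in>A. g (b a) = f a"
    using insert.IH[of C] insert.prems insert.hyps y by auto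
  have "bij_betw (b(a := y)) A C"
    using b(1) insert.hyps by (subst bij_betw_cong[where g = b]) auto
  then have "bij_betw (b(a := y)) (insert a A) (insert y C)"
    using insert.hyps B(2) by (auto simp: bij_betw_def)
  moreover have "g ((b(a := y)) x) = f x" if "x \<in> insert a A" for x
    using that b(2) y(2) by auto
  ultimately show ?case unfolding B(1) by blast
qed

lemma bij_betw_insert_both:
  "bij_betw f A B \<Longrightarrow> a \<notin> A \<Longrightarrow> b \<notin> B \<Longrightarrow> f a = b \<Longrightarrow> bij_betw f (insert a A) (insert b B)"
  by (auto simp: bij_betw_def)

lemma shape_upto_eq_imp_bij:
  assumes s: "rooted_tree s" "finite (verts s)" and t: "rooted_tree t" "finite (verts t)"
    and "\<And>x. x \<in> verts s \<Longrightarrow> depth s x \<le> depth s v + h"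
    and "\<And>x. x \<in> verts t \<Longrightarrow> depth t x \<le> depth t w + h"
    and "shape_upto h s v = shape_upto h t w"
  shows "\<exists>\<phi>. bij_betw \<phi> (desc s v) (desc t w) \<and> \<phi> v = w \<and>
    (\<forall>x \<in> desc s v - {v}. \<phi> (parent s x) = parent t (\<phi> x))"
  using assms(5-)
proof (induction h arbitrary: v w)
  case 0
  have "kids s v = {}" "kids t w = {}"
    using kids_depth[OF s(1)] 0(1) kids_depth[OF t(1)] 0(2) by fastforce+
  then show ?case using desc_unfold[of s v] desc_unfold[of t w] by (intro exI[of _ "\<lambda>_. w"]) (auto simp: bij_betw_def)
next
  case (Suc h)
  have fin: "finite (kids s v)" "finite (kids t w)" using s(2) t(2) by (simp_all add: kids_def)
  obtain b where b: "bij_betw b (kids s v) (kids t w)"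
      "\<And>a. a \<in> kids s v \<Longrightarrow> shape_upto h t (b a) = shape_upto h s a"
    using image_mset_eq_imp_bij[OF fin, of "shape_upto h s" "shape_upto h t"] Suc.prems(3) by auto
  have bk: "b a \<in> kids t w" if "a \<in> kids s v" for a using b(1) that by (auto simp: bij_betw_def)
  have "\<exists>\<phi>. bij_betw \<phi> (desc s a) (desc t (b a)) \<and> \<phi> a = b a \<and>
      (\<forall>x \<in> desc s a - {a}. \<phi> (parent s x) = parent t (\<phi> x))" if a: "a \<in> kids s v" for a
  proof (rule Suc.IH)
    show "depth s x \<le> depth s a + h" if "x \<in> verts s" for x
      using Suc.prems(1)[OF that] kids_depth[OF s(1) a] by simp
    show "depth t x \<le> depth t (b a) + h" if "x \<in> verts t" for x
      using Suc.prems(2)[OF that] kids_depth[OF t(1) bk[OF a]] by simp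
  qed (simp add: b(2) a)
  then obtain f where f: "\<And>a. a \<in> kids s v \<Longrightarrow> bij_betw (f a) (desc s a) (desc t (b a))"
      "\<And>a. a \<in> kids s v \<Longrightarrow> f a a = b a"
      "\<And>a x. a \<in> kids s v \<Longrightarrow> x \<in> desc s a - {a} \<Longrightarrow> f a (parent s x) = parent t (f a x)"
    by metis
  define kid where "kid x = (parent s ^^ (depth s x - Suc (depth s v))) x" for x
  define \<phi> where "\<phi> x = (if x = v then w else f (kid x) x)" for x
  have kid: "kid x = a" "x \<noteq> v" if "a \<in> kids s v" "x \<in> desc s a" for a x
    using desc_depth[OF s(1) that(2)] kids_depth[OF s(1) that(1)] by (auto simp: kid_def)
  have \<phi>: "\<phi> x = f a x" if "a \<in> kids s v" "x \<in> desc s a" for a x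
    using kid[OF that] by (simp add: \<phi>_def)
  have "bij_betw \<phi> (\<Union>a\<in>kids s v. desc s a) (\<Union>a\<in>kids s v. desc t (b a))"
  proof (rule bij_betw_UNION_disjoint)
    show "disjoint_family_on (\<lambda>a. desc t (b a)) (kids s v)"
    proof (unfold disjoint_family_on_def, intro ballI impI equals0I)
      fix a a' y assume a: "a \<in> kids s v" "a' \<in> kids s v" "a \<noteq> a'" "y \<in> desc t (b a) \<inter> desc t (b a')"
      then have "b a = b a'"
        using desc_depth[OF t(1), of y "b a"] desc_depth[OF t(1), of y "b a'"]
          kids_depth[OF t(1) bk] by auto
      then show False using a b(1) by (auto simp: bij_betw_def inj_on_def)
    qed
    show "bij_betw \<phi> (desc s a) (desc t (b a))" if "a \<in> kids s v" for a
      using f(1)[OF that] \<phi>[OF that] by (metis bij_betw_cong)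
  qed
  moreover have "(\<Union>a\<in>kids s v. desc t (b a)) = (\<Union>a\<in>kids t w. desc t a)"
    using b(1) unfolding bij_betw_def by (metis (no_types) image_image)
  moreover have "v \<notin> (\<Union>a\<in>kids s v. desc s a)" using kid(2) by blast
  moreover have "w \<notin> (\<Union>a\<in>kids t w. desc t a)"
  proof
    assume "w \<in> (\<Union>a\<in>kids t w. desc t a)"
    then obtain a where "a \<in> kids t w" "w \<in> desc t a" by blast
    then show False using desc_depth[OF t(1), of w a] kids_depth[OF t(1), of a w] by simp
  qed
  moreover have \<phi>v: "\<phi> v = w" by (simp add: \<phi>_def)
  ultimately have "bij_betw \<phi> (desc s v) (desc t w)"
    unfolding desc_unfold[of s v] desc_unfold[of t w] by (metis bij_betw_insert_both)
  moreover have "\<phi> (parent s x) = parent t (\<phi> x)" if x: "x \<in> desc s v - {v}" for x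
  proof -
    obtain a where a: "a \<in> kids s v" "x \<in> desc s a" using x desc_unfold[of s v] by auto
    show ?thesis
    proof (cases "x = a")
      case True
      then show ?thesis using a \<phi>v \<phi>[OF a] f(2)[OF a(1)] bk[OF a(1)] by (simp add: kids_def)
    next
      case False
      then obtain y where "y \<in> desc s a" "x \<in> kids s y" using a(2) by (auto elim: desc.cases)
      then have "parent s x \<in> desc s a" by (auto simp: kids_def)
      then show ?thesis using \<phi>[OF a] \<phi>[OF a(1)] f(3)[OF a(1), of x] a(2) False by simp
    qed
  qed
  ultimately show ?case using \<phi>v by blast
qed

lemma root_isomorphic_shape_upto:
  assumes s: "rooted_tree s" "finite (verts s)"
    and \<phi>: "bij_betw \<phi> (verts s) (verts t)" "\<phi> (troot s) = troot t"
      "\<And>v. v \<in> verts s - {troot s} \<Longrightarrow> \<phi> (parent s v) = parent t (\<phi> v)"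
    and v: "v \<in> verts s"
  shows "shape_upto h s v = shape_upto h t (\<phi> v)"
  using v
proof (induction h arbitrary: v)
  case (Suc h)
  have inj: "inj_on \<phi> (verts s)" and im: "\<phi> ` verts s = verts t" using \<phi>(1) by (auto simp: bij_betw_def)
  have r: "troot s \<in> verts s" "\<And>w. w \<in> verts s \<Longrightarrow> w \<noteq> troot s \<Longrightarrow> parent s w \<in> verts s"
    using s by (auto simp: rooted_tree_def)
  have ne: "\<phi> w \<noteq> troot t \<longleftrightarrow> w \<noteq> troot s" if "w \<in> verts s" for w
    using inj_on_eq_iff[OF inj that r(1)] \<phi>(2) by simp
  have "kids t (\<phi> v) = \<phi> ` kids s v"
  proof (intro equalityI subsetI)
    fix y assume y: "y \<in> kids t (\<phi> v)"
    then obtain w where w: "w \<in> verts s" "y = \<phi> w" using im by (auto simp: kids_def)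
    then have "w \<noteq> troot s" using y ne by (auto simp: kids_def)
    then have "\<phi> (parent s w) = \<phi> v" using w y \<phi>(3)[of w] by (simp add: kids_def)
    then have "parent s w = v" using inj_on_eq_iff[OF inj] r(2) w(1) \<open>w \<noteq> troot s\<close> Suc.prems by blast
    then show "y \<in> \<phi> ` kids s v" using w \<open>w \<noteq> troot s\<close> by (auto simp: kids_def)
  next
    fix y assume "y \<in> \<phi> ` kids s v"
    then show "y \<in> kids t (\<phi> v)" using im ne \<phi>(3) by (auto simp: kids_def)
  qed
  moreover have "inj_on \<phi> (kids s v)" using inj by (rule inj_on_subset) (auto simp: kids_def)
  moreover have "image_mset (\<lambda>w. shape_upto h t (\<phi> w)) (mset_set (kids s v))
      = image_mset (shape_upto h s) (mset_set (kids s v))"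
    using Suc.IH s(2) by (intro image_mset_cong) (auto simp: kids_def)
  ultimately show ?case
    by (simp add: multiset.map_comp comp_def flip: image_mset_mset_set)
qed simp

lemma iso_class_eq_iff:
  assumes s: "rooted_tree s" "finite (verts s)" and t: "rooted_tree t" "finite (verts t)"
  shows "iso_class s = iso_class t \<longleftrightarrow> root_isomorphic s t"
proof
  have ne: "verts s \<noteq> {}" "verts t \<noteq> {}" using s t by (auto simp: rooted_tree_def)
  {
    assume eq: "iso_class s = iso_class t"
    define h where "h = card (verts s) + card (verts t)"
    have "shape_upto h s (troot s) = shape_upto (card (verts s)) s (troot s)"
      unfolding h_def
      by (rule shape_upto_add[OF s(1)]) (use depth_less_card[OF s(1,2)] in \<open>simp add: less_imp_le trans_le_add2\<close>)
    moreover have "shape_upto h t (troot t) = shape_upto (card (verts t)) t (troot t)"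
      unfolding h_def add.commute[of "card (verts s)"]
      by (rule shape_upto_add[OF t(1)]) (use depth_less_card[OF t(1,2)] in \<open>simp add: less_imp_le trans_le_add2\<close>)
    ultimately have "shape_upto h s (troot s) = shape_upto h t (troot t)"
      using eq ne s t by (simp add: iso_class_def)
    then have "\<exists>\<phi>. bij_betw \<phi> (desc s (troot s)) (desc t (troot t)) \<and> \<phi> (troot s) = troot t \<and>
        (\<forall>x \<in> desc s (troot s) - {troot s}. \<phi> (parent s x) = parent t (\<phi> x))"
      by (intro shape_upto_eq_imp_bij[OF s t, where h = h])
        (use depth_less_card[OF s] depth_less_card[OF t] in \<open>force simp: h_def\<close>)+
    then show "root_isomorphic s t"
      unfolding root_isomorphic_def desc_root[OF s(1)] desc_root[OF t(1)] .
  }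
  assume "root_isomorphic s t"
  then obtain \<phi> where \<phi>: "bij_betw \<phi> (verts s) (verts t)" "\<phi> (troot s) = troot t"
      "\<And>v. v \<in> verts s - {troot s} \<Longrightarrow> \<phi> (parent s v) = parent t (\<phi> v)"
    by (auto simp: root_isomorphic_def)
  have "troot s \<in> verts s" using s by (simp add: rooted_tree_def)
  then have "shape_upto h s (troot s) = shape_upto h t (\<phi> (troot s))" for h
    by (intro root_isomorphic_shape_upto[OF s, where \<phi> = \<phi>] \<phi>)
  with \<phi>(2) bij_betw_same_card[OF \<phi>(1)]
  show "iso_class s = iso_class t" using s t ne by (simp add: iso_class_def)
qed

text \<open>\<open>fringe_part t v i\<close> is the paper's \<open>f\<^sub>i(v, t)\<close>; the path from \<open>v\<close> to the root is
  \<open>v\<^sub>i = (parent t ^^ i) v\<close> for \<open>i \<le> depth t v\<close>.\<close>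

definition fringe_part :: "'v vtree \<Rightarrow> 'v \<Rightarrow> nat \<Rightarrow> ftree" where
  "fringe_part t v i = (if i \<le> depth t v then
     iso_class (t\<lparr>verts := {u \<in> verts t. (parent t ^^ i) v \<in> root_path t u \<and>
                            (i = 0 \<or> (parent t ^^ (i - 1)) v \<notin> root_path t u)},
                  troot := (parent t ^^ i) v\<rparr>)
     else None)"

definition fringe :: "nat \<Rightarrow> 'v vtree \<Rightarrow> 'v \<Rightarrow> ftree list" where
  "fringe k t v = map (fringe_part t v) [0..<Suc k]"

definition child_count :: "ftree \<Rightarrow> ftree \<Rightarrow> nat" where
  "child_count s t = (case (s, t) of (Some s', Some t') \<Rightarrow> count (subtrees s') t' | _ \<Rightarrow> 0)"

definition fringe_distribution :: "ftree measure \<Rightarrow> bool" where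
  "fringe_distribution \<pi> \<longleftrightarrow> prob_space \<pi> \<and> sets \<pi> = UNIV \<and>
     (\<forall>t. ((\<lambda>s. measure \<pi> {s} * real (child_count s t)) has_sum measure \<pi> {t}) UNIV)"

text \<open>A sin-tree is a sequence of non-empty finite trees.  \<open>monotone_rep \<tau> i\<close> has root \<open>i\<close>, the
  vertex \<open>i - 1\<close> being one more child of that root in addition to those in \<open>\<tau> i\<close>.\<close>

type_synonym sin_tree = "nat \<Rightarrow> rtree"

primrec monotone_rep :: "sin_tree \<Rightarrow> nat \<Rightarrow> rtree" where
  "monotone_rep \<tau> 0 = \<tau> 0"
| "monotone_rep \<tau> (Suc i) = Node (add_mset (monotone_rep \<tau> i) (subtrees (\<tau> (Suc i))))"

definition sin_fringe :: "nat \<Rightarrow> sin_tree \<Rightarrow> ftree list" where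
  "sin_fringe k \<tau> = map (\<lambda>i. Some (\<tau> i)) [0..<Suc k]"

definition sin_tree_law :: "ftree measure \<Rightarrow> sin_tree measure \<Rightarrow> bool" where
  "sin_tree_law \<pi> S \<longleftrightarrow> prob_space S \<and> sets S = sets (PiM UNIV (\<lambda>_. count_space UNIV)) \<and>
     (\<forall>i. \<forall>s :: nat \<Rightarrow> ftree.
        measure S {\<tau> \<in> space S. \<forall>m\<le>i. Some (monotone_rep \<tau> m) = s m}
          = measure \<pi> {s i} * (\<Prod>m=1..i. real (child_count (s m) (s (m - 1)))))"

definition the_sin_tree :: "ftree measure \<Rightarrow> sin_tree measure" where
  "the_sin_tree \<pi> = (THE S. sin_tree_law \<pi> S)"

definition borel_of :: "'a topology \<Rightarrow> 'a measure" where
  "borel_of X = sigma (topspace X) {U. openin X U}"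

definition prob_measures :: "'a topology \<Rightarrow> 'a measure set" where
  "prob_measures X = {\<mu>. prob_space \<mu> \<and> sets \<mu> = sets (borel_of X)}"

text \<open>The coarsest topology making \<open>\<mu> \<mapsto> \<integral>f d\<mu>\<close> continuous for all bounded continuous \<open>f\<close>.\<close>

definition weak_topology :: "'a topology \<Rightarrow> 'a measure topology" where
  "weak_topology X = topology_generated_by
     {{\<mu> \<in> prob_measures X. integral\<^sup>L \<mu> f \<in> U} | f U.
        continuous_map X euclideanreal f \<and> bounded (f ` topspace X) \<and> open U}"

definition converges_in_prob ::
    "'w measure \<Rightarrow> 'x topology \<Rightarrow> (nat \<Rightarrow> 'w \<Rightarrow> 'x) \<Rightarrow> 'x \<Rightarrow> bool" where
  "converges_in_prob M X Y l \<longleftrightarrow> l \<in> topspace X \<and>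
     (\<forall>U. openin X U \<and> l \<in> U \<longrightarrow>
        (\<forall>n. {\<omega> \<in> space M. Y n \<omega> \<notin> U} \<in> sets M) \<and>
        (\<lambda>n. measure M {\<omega> \<in> space M. Y n \<omega> \<notin> U}) \<longlonglongrightarrow> 0)"

text \<open>The image of the uniform distribution on the vertices, i.e. \<open>1/n \<Sum>\<^sub>v \<delta>(F\<^sub>k(v, t))\<close>.\<close>

definition empirical_fringe :: "nat \<Rightarrow> 'v vtree \<Rightarrow> ftree list measure" where
  "empirical_fringe k t = distr (uniform_count_measure (verts t)) (borel_of (tuple_topology k)) (fringe k t)"

definition converges_extended_fringe ::
    "'w measure \<Rightarrow> (nat \<Rightarrow> 'w \<Rightarrow> 'v vtree) \<Rightarrow> sin_tree measure \<Rightarrow> bool" where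
  "converges_extended_fringe M T S \<longleftrightarrow>
     (\<forall>k. converges_in_prob M (weak_topology (tuple_topology k)) (\<lambda>n \<omega>. empirical_fringe k (T n \<omega>))
            (distr S (borel_of (tuple_topology k)) (sin_fringe k)))"

text \<open>In \<open>recursive_tree c n\<close> the vertex \<open>m + 1\<close> is attached to \<open>c m\<close>.  The model starts at
  \<open>n = 1\<close>; the value at \<open>n = 0\<close> (no vertices) is a convention.\<close>

primrec recursive_tree :: "(nat \<Rightarrow> nat) \<Rightarrow> nat \<Rightarrow> nat vtree" where
  "recursive_tree c 0 = \<lparr>verts = {}, troot = 1, parent = (\<lambda>v. v)\<rparr>"
| "recursive_tree c (Suc n) =
     (if n = 0 then \<lparr>verts = {1}, troot = 1, parent = (\<lambda>v. v)\<rparr>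
      else (recursive_tree c n)
        \<lparr>verts := insert (Suc n) (verts (recursive_tree c n)),
         parent := (parent (recursive_tree c n))(Suc n := c n)\<rparr>)"

definition limited_memory_choices :: "'w measure \<Rightarrow> (nat \<Rightarrow> nat) \<Rightarrow> (nat \<Rightarrow> 'w \<Rightarrow> nat) \<Rightarrow> bool" where
  "limited_memory_choices M j C \<longleftrightarrow> prob_space M \<and>
     prob_space.indep_vars M (\<lambda>_. count_space UNIV) C {1..} \<and>
     (\<forall>n\<ge>1. distr M (count_space UNIV) (C n) = measure_pmf (pmf_of_set {v \<in> {1..n}. j n \<le> v}))"

text \<open>Finite point configurations in \<open>I\<close>, with the \<sigma>-algebra generated by the counts.\<close>

definition point_configs :: "real set \<Rightarrow> real set measure" where
  "point_configs I = sigma {S. finite S \<and> S \<subseteq> I}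
     {{S. finite S \<and> S \<subseteq> I \<and> card (S \<inter> A) = k} | A k. A \<in> sets borel}"

definition poisson_process :: "'w measure \<Rightarrow> real \<Rightarrow> real set \<Rightarrow> ('w \<Rightarrow> real set) \<Rightarrow> bool" where
  "poisson_process N r I X \<longleftrightarrow> X \<in> measurable N (point_configs I) \<and>
     (\<forall>A \<in> sets borel. A \<subseteq> I \<longrightarrow> (\<forall>k. measure N {\<omega> \<in> space N. card (X \<omega> \<inter> A) = k}
        = (r * measure lborel A) ^ k / fact k * exp (- (r * measure lborel A)))) \<and>
     (\<forall>(A :: nat \<Rightarrow> real set) n. (\<forall>i<n. A i \<in> sets borel \<and> A i \<subseteq> I) \<longrightarrow> disjoint_family_on A {..<n} \<longrightarrow>
        prob_space.indep_vars N (\<lambda>_. count_space UNIV) (\<lambda>i \<omega>. card (X \<omega> \<inter> A i)) {..<n})"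

text \<open>Individuals are Ulam--Harris words, written from the last generation backwards: the initial
  individual is \<open>[]\<close> and \<open>k # u\<close> is the \<open>k\<close>-th child of \<open>u\<close> in the order of birth, counted from
  \<open>0\<close>.  \<open>x u\<close> is the set of ages at which \<open>u\<close> has a child.\<close>

primrec born :: "(nat list \<Rightarrow> real set) \<Rightarrow> nat list \<Rightarrow> bool" where
  "born x [] \<longleftrightarrow> True"
| "born x (k # u) \<longleftrightarrow> born x u \<and> k < card (x u)"

primrec birth_time :: "(nat list \<Rightarrow> real set) \<Rightarrow> nat list \<Rightarrow> real" where
  "birth_time x [] = 0"
| "birth_time x (k # u) = birth_time x u + sorted_list_of_set (x u) ! k"

definition genealogy :: "(nat list \<Rightarrow> real set) \<Rightarrow> real \<Rightarrow> nat list vtree" where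
  "genealogy x t = \<lparr>verts = {u. born x u \<and> birth_time x u \<le> t}, troot = [], parent = tl\<rparr>"

text \<open>\<open>X\<close> holds the independent Poisson processes driving the branching process and \<open>T\<close> the
  independent exponential time.\<close>

definition branching_model ::
    "'w measure \<Rightarrow> real \<Rightarrow> (nat list \<Rightarrow> 'w \<Rightarrow> real set) \<Rightarrow> ('w \<Rightarrow> real) \<Rightarrow> bool" where
  "branching_model N \<theta> X T \<longleftrightarrow> prob_space N \<and>
     (\<forall>u. poisson_process N (1 / (1 - \<theta>)) {0..ln (1 / \<theta>)} (X u)) \<and>
     prob_space.indep_vars N (\<lambda>_. point_configs {0..ln (1 / \<theta>)}) X UNIV \<and>
     distributed N lborel T (exponential_density 1) \<and>
     prob_space.indep_set N (sets (vimage_algebra (space N) T borel))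
       (sets (vimage_algebra (space N) (\<lambda>\<omega> u. X u \<omega>) (PiM UNIV (\<lambda>_. point_configs {0..ln (1 / \<theta>)}))))"

definition genealogy_law :: "'w measure \<Rightarrow> (nat list \<Rightarrow> 'w \<Rightarrow> real set) \<Rightarrow> ('w \<Rightarrow> real) \<Rightarrow> ftree measure" where
  "genealogy_law N X T = distr N (count_space UNIV) (\<lambda>\<omega>. iso_class (genealogy (\<lambda>u. X u \<omega>) (T \<omega>)))"

end

theory Submission
  imports Defs
begin

text \<open>
  Three ideas carry the proof.

  \<^emph>\<open>Revealing the choices backwards.\<close>  The fringe tree \<open>vshape c n w\<close> of a vertex \<open>w\<close> at time \<open>n\<close> depends
  only on the choices \<open>c k\<close> with \<open>k \<ge> w\<close>.  Revealing the choices from the last to the first, one knows the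
  fringe tree of the vertex \<open>k + 1\<close> before the parent \<open>c k\<close> of that vertex is drawn, and \<open>c k\<close> is independent of
  it.  Hence, for weights \<open>s\<close> on trees, the product of the weights of the subtrees at the children of \<open>v\<close> acquires
  at each step a factor whose conditional mean is \<open>1 + drift\<close>, where the drift is that of a vertex \<open>k + 1\<close> of known
  fringe tree being attached to \<open>v\<close>; dividing by these means gives a martingale
  (\<open>expectation_prod_normalised\<close>).  If the product of the means converges to a constant \<open>d\<close>, then so does
  the mean of the product (\<open>pgf_error_bound\<close>).  The same computation with two vertices gives the product
  of two constants, that is, asymptotic independence.

  \<^emph>\<open>Time as logarithmic age.\<close>  Let \<open>x\<close> be exponential of mean 1; then the vertex \<open>pos n x = \<lceil>n e\<^sup>-\<^sup>x\<rceil>\<close> is uniform.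
  In these coordinates the sum of the drifts is an integral against \<open>expo\<close> whose density \<open>attach\<close> converges to
  \<open>kernel\<close>, the intensity of the Poisson process of rate \<open>1 / (1 - \<theta>)\<close> on \<open>[0, ln (1 / \<theta>)]\<close> written relative to the
  exponential law.  So the generating function of the children of \<open>pos n x\<close> converges to
  \<open>exp (\<integral>z. kernel \<theta> x z * (G z - 1))\<close> as soon as the average of \<open>s\<close> over the fringe trees of age \<open>z\<close>
  is close to \<open>G z\<close> (\<open>pgf_pair_limit\<close>).  The branching process satisfies the same equation
  (\<open>children_laplace\<close>), because its genealogy splits at the root into independent genealogies born at
  Poisson times.  A finite tree is determined by the finite multiset of its smaller subtrees, and the
  probability of a multiset can be recovered from generating functions with weights supported on that multiset
  (\<open>pgf_inversion\<close>).  Therefore an induction on the tree \<open>t\<close> shows that the vertices \<open>pos n x\<close> and \<open>pos n y\<close> have the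
  fringe tree \<open>t\<close> with asymptotically independent probabilities, the limits being those of the branching process
  at ages \<open>x\<close> and \<open>y\<close> (\<open>fringe_tree_limits\<close>).  A second moment bound closes the induction step, and
  also yields the concentration of the proportion of vertices with fringe tree \<open>t\<close>.

  \<^emph>\<open>From fringe trees to extended fringes.\<close>  The first entries of the extended fringe of \<open>v\<close> determine, and are
  determined by, the fringe trees of the ancestors of \<open>v\<close>.  So the number of vertices with a given extended fringe
  is the number of vertices with a given fringe tree times a product of child counts
  (\<open>card_ancestral_line\<close>), which is the formula that defines the law of the sin-tree.  The tuples of trees form
  a discrete space, so convergence of the point masses to a probability measure is weak convergence.

  The law \<open>\<varpi>\<^sub>\<theta>\<close> is a fringe distribution because of the identity \<open>\<integral>y. kernel \<theta> y z = 1\<close>, integrated against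
  \<open>expo\<close> (\<open>kernel_left_total\<close>), which expresses that every vertex has one parent.  For any fringe
  distribution the sin-tree exists as a Markov chain of growing trees, whose transition probabilities sum to one
  by the defining identity.
\<close>

section \<open>Fringe trees of a recursive tree\<close>

text \<open>The fringe tree at time \<open>n\<close> of the vertex \<open>w\<close>, expressed by the choices: \<open>c k\<close> is the parent of \<open>Suc k\<close>.
  The bound \<open>w \<le> k\<close> makes the recursion terminate for arbitrary \<open>c\<close>; a valid choice of \<open>w\<close> satisfies it anyway.\<close>

function vshape :: "(nat \<Rightarrow> nat) \<Rightarrow> nat \<Rightarrow> nat \<Rightarrow> rtree" where
  "vshape c n w = Node (image_mset (\<lambda>k. vshape c n (Suc k)) (mset_set {k \<in> {w..<n}. c k = w}))"
  by auto
termination by (relation "Wellfounded.measure (\<lambda>(c, n, w). n - w)") auto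

declare vshape.simps [simp del]

lemma vshape_cong: "(\<And>k. w \<le> k \<Longrightarrow> k < n \<Longrightarrow> c k = c' k) \<Longrightarrow> vshape c n w = vshape c' n w"
proof (induction c n w rule: vshape.induct)
  case (1 c n w)
  have eq: "{k \<in> {w..<n}. c k = w} = {k \<in> {w..<n}. c' k = w}" using 1(2)
    by (intro Collect_cong conj_cong) simp_all
  show ?case
    unfolding vshape.simps[of c n w] vshape.simps[of c' n w] eq[symmetric]
    using 1 by (intro arg_cong[of _ _ Node] image_mset_cong) auto
qed

definition choices_valid :: "nat \<Rightarrow> (nat \<Rightarrow> nat) \<Rightarrow> bool" where
  "choices_valid n c \<longleftrightarrow> (\<forall>m\<in>{1..<n}. 1 \<le> c m \<and> c m \<le> m)"

lemma verts_recursive_tree [simp]: "verts (recursive_tree c n) = {1..n}"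
  by (induction n) (auto simp: atLeastAtMostSuc_conv)

lemma troot_recursive_tree [simp]: "troot (recursive_tree c n) = 1"
  by (induction n) auto

lemma parent_recursive_tree:
  "parent (recursive_tree c n) v = (if 2 \<le> v \<and> v \<le> n then c (v - 1) else v)"
  by (induction n) auto

lemma recursive_tree_cong:
  assumes "\<And>m. m \<in> {1..<n} \<Longrightarrow> c m = c' m"
  shows "recursive_tree c n = recursive_tree c' n"
  using assms by (induction n) auto

lemma kids_recursive_tree:
  assumes "choices_valid n c" "1 \<le> w"
  shows "kids (recursive_tree c n) w = Suc ` {k \<in> {w..<n}. c k = w}"
proof (intro equalityI subsetI)
  fix x assume x: "x \<in> kids (recursive_tree c n) w"
  then have x': "2 \<le> x" "x \<le> n" "c (x - 1) = w" by (auto simp: kids_def parent_recursive_tree split: if_splits)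
  then have "w \<le> x - 1" using assms(1) unfolding choices_valid_def by fastforce
  then show "x \<in> Suc ` {k \<in> {w..<n}. c k = w}" using x' by (intro image_eqI[of _ _ "x - 1"]) auto
qed (use assms in \<open>auto simp: kids_def parent_recursive_tree\<close>)

lemma Node_remove_iff:
  "a \<in># subtrees B \<Longrightarrow> Node (subtrees B - {#a#}) = t \<longleftrightarrow> B = Node (add_mset a (subtrees t))"
  by (cases B; cases t) auto

context
  fixes n :: nat and c :: "nat \<Rightarrow> nat"
  assumes valid: "choices_valid n c" and n: "1 \<le> n"
begin

abbreviation (input) "RT \<equiv> recursive_tree c n"

lemma rooted_recursive_tree: "rooted_tree RT"
proof -
  have "\<exists>h. (parent RT ^^ h) v = 1" if "v \<in> {1..n}" for v
    using that
  proof (induction v rule: less_induct)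
    case (less v)
    show ?case
    proof (cases "v = 1")
      case True then show ?thesis by (intro exI[of _ 0]) auto
    next
      case False
      then have "1 \<le> v - 1 \<and> v - 1 < n" using less.prems by auto
      then have p: "parent RT v = c (v - 1)" "1 \<le> c (v - 1)" "c (v - 1) \<le> v - 1"
        using less.prems bspec[OF valid[unfolded choices_valid_def], of "v - 1"] by (auto simp: parent_recursive_tree)
      moreover have "c (v - 1) < v" using p \<open>1 \<le> v - 1 \<and> v - 1 < n\<close> by linarith
      moreover have "c (v - 1) \<in> {1..n}" using p \<open>1 \<le> v - 1 \<and> v - 1 < n\<close> by simp
      ultimately obtain h where "(parent RT ^^ h) (c (v - 1)) = 1"
        using less.IH[of "c (v - 1)"] by blast
      then have "(parent RT ^^ Suc h) v = 1" using p by (simp add: funpow_swap1)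
      then show ?thesis by blast
    qed
  qed
  moreover have "parent RT v \<in> {1..n}" if "v \<in> {1..n} - {1}" for v
  proof -
    have "v - 1 \<in> {1..<n}" using that by auto
    with valid have "1 \<le> c (v - 1)" "c (v - 1) \<le> v - 1" by (auto simp: choices_valid_def)
    moreover have "v - 1 \<le> n" using that by auto
    ultimately show ?thesis using that by (auto simp: parent_recursive_tree)
  qed
  ultimately show ?thesis using n by (simp add: rooted_tree_def)
qed

lemma vshape_kids:
  assumes "1 \<le> w"
  shows "vshape c n w = Node (image_mset (vshape c n) (mset_set (kids RT w)))"
proof -
  have "image_mset (\<lambda>k. vshape c n (Suc k)) (mset_set {k \<in> {w..<n}. c k = w})
    = image_mset (vshape c n) (image_mset Suc (mset_set {k \<in> {w..<n}. c k = w}))"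
    by (simp add: multiset.map_comp comp_def)
  then show ?thesis
    unfolding vshape.simps[of c n w] kids_recursive_tree[OF valid assms] by (simp add: image_mset_mset_set)
qed

lemma finite_kids: "finite (kids RT w)" by (simp add: kids_def)

lemma desc_subset: "w \<in> {1..n} \<Longrightarrow> desc RT w \<subseteq> {1..n}"
proof
  fix x assume w: "w \<in> {1..n}" and "x \<in> desc RT w"
  from this(2) show "x \<in> {1..n}" by (induction rule: desc.induct) (use w in \<open>auto simp: kids_def\<close>)
qed

lemma finite_desc: "w \<in> {1..n} \<Longrightarrow> finite (desc RT w)"
  using desc_subset finite_subset by blast

lemma desc_kid_strict:
  assumes "x \<in> kids RT w"
  shows "w \<notin> desc RT x" "desc RT x \<subseteq> desc RT w"
proof -
  show "w \<notin> desc RT x"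
  proof
    assume "w \<in> desc RT x"
    then show False using desc_depth[OF rooted_recursive_tree, of w x] kids_depth[OF rooted_recursive_tree assms] by simp
  qed
  show "desc RT x \<subseteq> desc RT w" using desc_unfold[of RT w] assms by auto
qed

text \<open>A vertex has only one ancestor at each depth.\<close>

lemma desc_siblings_disjoint:
  assumes "x \<in> kids RT w" "x' \<in> kids RT w" "x \<noteq> x'"
  shows "desc RT x \<inter> desc RT x' = {}"
proof (rule equals0I)
  fix y assume "y \<in> desc RT x \<inter> desc RT x'"
  then have "(parent RT ^^ (depth RT y - depth RT x)) y = x" "(parent RT ^^ (depth RT y - depth RT x')) y = x'"
    using desc_depth[OF rooted_recursive_tree] by blast+
  moreover have "depth RT x = depth RT x'"
    using kids_depth[OF rooted_recursive_tree assms(1)] kids_depth[OF rooted_recursive_tree assms(2)] by simp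
  ultimately show False using assms(3) by simp
qed

text \<open>The parts of an extended fringe are shapes of the tree cut down to some vertices and rooted anew.
  A shape only sees the descendants, so it stays the same as long as these survive and none of them becomes
  the root.\<close>

lemma shape_upto_restrict:
  assumes "w \<in> {1..n}" "\<And>x. x \<in> desc RT w \<Longrightarrow> x \<in> V \<and> (x = w \<or> x \<noteq> \<rho>)" "V \<subseteq> {1..n}" "1 \<notin> V \<or> \<rho> = 1"
    and "card (desc RT w) \<le> h"
  shows "shape_upto h (RT\<lparr>verts := V, troot := \<rho>\<rparr>) w = vshape c n w"
  using assms(1,2,5)
proof (induction h arbitrary: w)
  case 0
  then show ?case using finite_desc[of w] desc_refl[of w RT] by auto
next
  case (Suc h)
  let ?T = "RT\<lparr>verts := V, troot := \<rho>\<rparr>"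
  have kd: "x \<in> desc RT w" "x \<in> {1..n}" "x \<noteq> w" if "x \<in> kids RT w" for x
    using desc_kid[OF desc_refl that] desc_kid_strict[OF that] desc_refl that by (auto simp: kids_def)
  have kids: "kids ?T w = kids RT w"
  proof (intro equalityI subsetI)
    fix x assume x: "x \<in> kids RT w"
    then show "x \<in> kids ?T w" using kd[OF x] Suc.prems(2) by (auto simp: kids_def)
  next
    fix x assume "x \<in> kids ?T w" then show "x \<in> kids RT w" using assms(3,4) by (auto simp: kids_def)
  qed
  have "shape_upto h ?T x = vshape c n x" if x: "x \<in> kids RT w" for x
  proof (rule Suc.IH)
    show "x \<in> {1..n}" by (rule kd[OF x])
    have sub: "desc RT x \<subset> desc RT w" using desc_kid_strict[OF x] desc_refl[of w RT] by auto
    from psubset_card_mono[OF finite_desc[OF Suc.prems(1)] sub] Suc.prems(3) show "card (desc RT x) \<le> h" by simp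
    show "y \<in> V \<and> (y = x \<or> y \<noteq> \<rho>)" if "y \<in> desc RT x" for y
      using Suc.prems(2)[of y] that desc_kid_strict[OF x] by auto
  qed
  then have "image_mset (shape_upto h ?T) (mset_set (kids RT w)) = image_mset (vshape c n) (mset_set (kids RT w))"
    using finite_kids by (intro image_mset_cong) simp
  then show ?case using Suc.prems(1) by (simp add: kids vshape_kids)
qed

lemma root_path_iff_desc:
  assumes "u \<in> {1..n}"
  shows "w \<in> root_path RT u \<longleftrightarrow> u \<in> desc RT w"
proof
  assume "u \<in> desc RT w"
  then show "w \<in> root_path RT u"
    using desc_depth[OF rooted_recursive_tree, of u w] unfolding root_path_def
    by (intro CollectI exI[of _ "depth RT u - depth RT w"]) simp
next
  have "(parent RT ^^ i) u \<in> {1..n} \<and> depth RT ((parent RT ^^ i) u) = depth RT u - i \<and> u \<in> desc RT ((parent RT ^^ i) u)"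
    if "i \<le> depth RT u" for i
    using that
  proof (induction i)
    case (Suc i)
    let ?x = "(parent RT ^^ i) u"
    have x: "?x \<in> {1..n}" "depth RT ?x > 0" "u \<in> desc RT ?x" "depth RT ?x = depth RT u - i" using Suc by auto
    then have "?x \<noteq> 1" using depth_root[OF rooted_recursive_tree] by auto
    then have "?x \<in> kids RT (parent RT ?x)" "parent RT ?x \<in> {1..n}"
      using x rooted_recursive_tree by (auto simp: kids_def rooted_tree_def)
    moreover have "depth RT ?x = Suc (depth RT (parent RT ?x))"
      using depth_parent[OF rooted_recursive_tree, of ?x] x \<open>?x \<noteq> 1\<close> by simp
    ultimately show ?case
      using x desc_kid_strict(2)[of ?x "parent RT ?x"] by auto
  qed (use assms desc_refl in auto)
  moreover assume "w \<in> root_path RT u"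
  ultimately show "u \<in> desc RT w" unfolding root_path_def by auto
qed

lemma ancestor_kid:
  assumes "v \<in> {1..n}" "Suc i \<le> depth RT v"
  shows "(parent RT ^^ i) v \<in> kids RT ((parent RT ^^ Suc i) v)"
proof -
  have *: "(parent RT ^^ j) v \<in> {1..n} \<and> depth RT ((parent RT ^^ j) v) = depth RT v - j" if "j \<le> depth RT v" for j
    using that
  proof (induction j)
    case (Suc j)
    let ?x = "(parent RT ^^ j) v"
    have x: "?x \<in> {1..n}" "depth RT ?x = depth RT v - j" using Suc by auto
    have "?x \<noteq> 1" using depth_root[OF rooted_recursive_tree] x Suc.prems by auto
    then show ?case using x depth_parent[OF rooted_recursive_tree, of ?x] rooted_recursive_tree
      by (auto simp: rooted_tree_def)
  qed (use assms in auto)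
  have "(parent RT ^^ i) v \<noteq> 1" using *[of i] assms depth_root[OF rooted_recursive_tree] by auto
  then show ?thesis using *[of i] assms by (auto simp: kids_def)
qed

lemma ancestor_in: "v \<in> {1..n} \<Longrightarrow> i \<le> depth RT v \<Longrightarrow> (parent RT ^^ i) v \<in> {1..n}"
  using ancestor_kid[of v i] ancestor_kid[of v "i - 1"]
proof (cases i)
  case (Suc j)
  assume "v \<in> {1..n}" "i \<le> depth RT v"
  then have "(parent RT ^^ j) v \<in> kids RT ((parent RT ^^ i) v)" using ancestor_kid[of v j] Suc by simp
  then have "(parent RT ^^ j) v \<in> {1..n}" "(parent RT ^^ j) v \<noteq> 1" "parent RT ((parent RT ^^ j) v) = (parent RT ^^ i) v"
    by (auto simp: kids_def)
  moreover have "parent RT x \<in> {1..n}" if "x \<in> {1..n}" "x \<noteq> 1" for x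
    using rooted_recursive_tree that by (simp add: rooted_tree_def)
  from this[OF calculation(1,2)] show ?thesis using calculation(3) by (simp only:)
qed auto

text \<open>The shape of a fringe part is read off up to a height equal to its number of vertices, which the number of
  descendants does not exceed.\<close>

lemma fringe_part_0:
  assumes v: "v \<in> {1..n}"
  shows "fringe_part RT v 0 = Some (vshape c n v)"
proof -
  let ?V = "{u \<in> {1..n}. v \<in> root_path RT u}"
  have V: "?V = desc RT v" using root_path_iff_desc desc_subset[OF v] by auto
  have "1 \<notin> desc RT v \<or> v = 1"
    using desc_depth[OF rooted_recursive_tree, of 1 v] depth_root[OF rooted_recursive_tree] by auto
  then have "shape_upto (card (desc RT v)) (RT\<lparr>verts := desc RT v, troot := v\<rparr>) v = vshape c n v"
    using v desc_subset[OF v] by (intro shape_upto_restrict) auto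
  then show ?thesis
    using V finite_desc[OF v] desc_refl[of v RT] by (auto simp: fringe_part_def iso_class_def)
qed

lemma fringe_part_Suc:
  assumes v: "v \<in> {1..n}" and i: "Suc i \<le> depth RT v"
  shows "fringe_part RT v (Suc i) = Some (Node (subtrees (vshape c n ((parent RT ^^ Suc i) v)) - {#vshape c n ((parent RT ^^ i) v)#}))"
proof -
  define a where "a = (parent RT ^^ i) v"
  define b where "b = (parent RT ^^ Suc i) v"
  have ab: "a \<in> kids RT b" unfolding a_def b_def by (rule ancestor_kid[OF v i])
  have b: "b \<in> {1..n}" and a: "a \<in> {1..n}" unfolding a_def b_def using ancestor_in[OF v i] ancestor_in[OF v, of i] i by auto
  define V where "V = desc RT b - desc RT a"
  have V: "{u \<in> {1..n}. b \<in> root_path RT u \<and> a \<notin> root_path RT u} = V"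
    unfolding V_def using root_path_iff_desc desc_subset[OF b] by auto
  let ?T = "RT\<lparr>verts := V, troot := b\<rparr>"
  have bV: "b \<in> V" using desc_refl[of b RT] desc_kid_strict[OF ab] by (auto simp: V_def)
  have finV: "finite V" using finite_desc[OF b] by (simp add: V_def)
  have one: "1 \<notin> V \<or> b = 1"
    using desc_depth[OF rooted_recursive_tree, of 1 b] depth_root[OF rooted_recursive_tree] by (auto simp: V_def)
  obtain h where h: "card V = Suc h" using bV finV by (metis card_gt_0_iff empty_iff gr0_implies_Suc)
  have sub: "desc RT x \<subseteq> V - {b}" "x \<in> {1..n}" if x: "x \<in> kids RT b - {a}" for x
  proof -
    show "x \<in> {1..n}" using x by (auto simp: kids_def)
    have "desc RT x \<inter> desc RT a = {}" using x ab by (intro desc_siblings_disjoint) auto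
    then show "desc RT x \<subseteq> V - {b}" using x desc_kid_strict[of x b] by (auto simp: V_def)
  qed
  have kids: "kids ?T b = kids RT b - {a}"
  proof (intro equalityI subsetI)
    fix x assume "x \<in> kids RT b - {a}"
    then show "x \<in> kids ?T b" using sub[of x] desc_refl[of x RT] by (auto simp: kids_def)
  next
    fix x assume x: "x \<in> kids ?T b"
    then have "x \<in> V" "x \<noteq> b" "parent RT x = b" by (auto simp: kids_def)
    moreover have "x \<noteq> 1" using one \<open>x \<in> V\<close> \<open>x \<noteq> b\<close> by auto
    moreover have "x \<noteq> a" using \<open>x \<in> V\<close> desc_refl[of a RT] by (auto simp: V_def)
    moreover have "x \<in> {1..n}" using \<open>x \<in> V\<close> desc_subset[OF b] by (auto simp: V_def)
    ultimately show "x \<in> kids RT b - {a}" by (auto simp: kids_def)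
  qed
  have "shape_upto h ?T x = vshape c n x" if x: "x \<in> kids RT b - {a}" for x
  proof (rule shape_upto_restrict)
    show "x \<in> {1..n}" by (rule sub[OF x])
    have "card (desc RT x) \<le> card (V - {b})" using sub[OF x] finV by (intro card_mono) auto
    then show "card (desc RT x) \<le> h" using h bV finV by simp
    show "V \<subseteq> {1..n}" using desc_subset[OF b] by (auto simp: V_def)
  qed (use sub[OF x] one in auto)
  then have "image_mset (shape_upto h ?T) (mset_set (kids RT b - {a})) = image_mset (vshape c n) (mset_set (kids RT b - {a}))"
    using finite_kids by (intro image_mset_cong) simp
  also have "\<dots> = subtrees (vshape c n b) - {#vshape c n a#}"
    using b ab finite_kids[of b] by (simp add: vshape_kids mset_set_Diff image_mset_Diff)
  finally have "shape_upto (card V) ?T b = Node (subtrees (vshape c n b) - {#vshape c n a#})"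
    by (simp add: h kids)
  then show ?thesis
    using i bV finV V unfolding fringe_part_def a_def[symmetric] b_def[symmetric]
    by (auto simp: iso_class_def a_def[symmetric] b_def[symmetric] simp del: funpow.simps)
qed

lemma vshape_kid: "a \<in> kids RT b \<Longrightarrow> 1 \<le> b \<Longrightarrow> vshape c n a \<in># subtrees (vshape c n b)"
  using finite_kids by (simp add: vshape_kids)

text \<open>The fringe of \<open>v\<close> records, up to the choice of coordinates, the fringe trees of the ancestors
  of \<open>v\<close>: these are what the monotone representation keeps.\<close>

lemma fringe_eq_sin_fringe_iff:
  assumes v: "v \<in> {1..n}"
  shows "fringe k RT v = sin_fringe k \<tau> \<longleftrightarrow>
    k \<le> depth RT v \<and> (\<forall>i\<le>k. vshape c n ((parent RT ^^ i) v) = monotone_rep \<tau> i)"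
proof -
  have "fringe k RT v = sin_fringe k \<tau> \<longleftrightarrow> (\<forall>i\<le>k. fringe_part RT v i = Some (\<tau> i))"
    by (auto simp: fringe_def sin_fringe_def list_eq_iff_nth_eq less_Suc_eq_le nth_append simp del: upt_Suc)
  also have "\<dots> \<longleftrightarrow> k \<le> depth RT v \<and> (\<forall>i\<le>k. vshape c n ((parent RT ^^ i) v) = monotone_rep \<tau> i)"
  proof (induction k)
    case 0
    then show ?case using fringe_part_0[OF v] by simp
  next
    case (Suc k)
    show ?case
    proof (cases "Suc k \<le> depth RT v")
      case False
      then have "fringe_part RT v (Suc k) = None" by (simp add: fringe_part_def)
      then show ?thesis using False by auto
    next
      case True
      let ?a = "(parent RT ^^ k) v" and ?b = "(parent RT ^^ Suc k) v"
      have kid: "vshape c n ?a \<in># subtrees (vshape c n ?b)"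
        using ancestor_kid[OF v True] ancestor_in[OF v True] by (intro vshape_kid) auto
      have "fringe_part RT v (Suc k) = Some (\<tau> (Suc k)) \<longleftrightarrow> vshape c n ?b = monotone_rep \<tau> (Suc k)"
        if "vshape c n ?a = monotone_rep \<tau> k"
        unfolding fringe_part_Suc[OF v True] option.inject monotone_rep.simps that[symmetric]
        by (rule Node_remove_iff[OF kid])
      then show ?thesis using Suc True by (auto simp: le_Suc_eq simp del: monotone_rep.simps funpow.simps)
    qed
  qed
  finally show ?thesis .
qed

text \<open>Counting the vertices whose ancestral line shows prescribed fringe trees: going down from the
  last ancestor, each step multiplies by the number of children of the right shape.\<close>

lemma card_ancestral_line:
  "card {v \<in> {1..n}. k \<le> depth RT v \<and> (\<forall>i\<le>k. vshape c n ((parent RT ^^ i) v) = tb i)}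
    = card {w \<in> {1..n}. vshape c n w = tb k} * (\<Prod>m=1..k. count (subtrees (tb m)) (tb (m - 1)))"
proof (induction k arbitrary: tb)
  case 0
  then show ?case by simp
next
  case (Suc k)
  let ?S = "{v \<in> {1..n}. k \<le> depth RT v \<and> (\<forall>i\<le>k. vshape c n ((parent RT ^^ i) v) = tb (Suc i))}"
  let ?K = "\<lambda>w. {x \<in> kids RT w. vshape c n x = tb 0}"
  have K: "card (?K w) = count (subtrees (tb 1)) (tb 0)" if "w \<in> ?S" for w
  proof -
    have "vshape c n w = tb 1" "1 \<le> w" using that by auto
    from arg_cong[OF this(1)[symmetric], of subtrees] vshape_kids[OF this(2)]
    have eq: "subtrees (tb 1) = image_mset (vshape c n) (mset_set (kids RT w))" by (simp only: rtree.sel)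
    have "count (subtrees (tb 1)) (tb 0) = (\<Sum>x | x \<in> kids RT w \<and> tb 0 = vshape c n x. 1)"
      unfolding eq count_image_mset' using finite_kids[of w] by (intro sum.cong) auto
    then show ?thesis by (simp add: eq_commute[of "tb 0"])
  qed
  have "{v \<in> {1..n}. Suc k \<le> depth RT v \<and> (\<forall>i\<le>Suc k. vshape c n ((parent RT ^^ i) v) = tb i)} = (\<Union>w\<in>?S. ?K w)" (is "?L = ?R")
  proof (intro equalityI subsetI)
    fix v assume v: "v \<in> ?L"
    let ?w = "parent RT v"
    have kid: "v \<in> kids RT ?w" using ancestor_kid[of v 0] v by auto
    have d: "depth RT v = Suc (depth RT ?w)" using kids_depth[OF rooted_recursive_tree kid] by simp
    have "?w \<in> {1..n}" using ancestor_in[of v 1] v by auto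
    moreover have "vshape c n ((parent RT ^^ i) ?w) = tb (Suc i)" if "i \<le> k" for i
    proof -
      have "\<forall>i\<le>Suc k. vshape c n ((parent RT ^^ i) v) = tb i" using v by blast
      then have "vshape c n ((parent RT ^^ Suc i) v) = tb (Suc i)" using that by (meson Suc_le_mono)
      then show ?thesis by (simp add: funpow_swap1)
    qed
    moreover have "vshape c n v = tb 0" using v by force
    ultimately show "v \<in> ?R" using kid d v by auto
  next
    fix v assume "v \<in> ?R"
    then obtain w where w: "w \<in> ?S" "v \<in> kids RT w" "vshape c n v = tb 0" by auto
    have d: "depth RT v = Suc (depth RT w)" using kids_depth[OF rooted_recursive_tree w(2)] by simp
    have p: "parent RT v = w" using w(2) by (simp add: kids_def)
    have "vshape c n ((parent RT ^^ i) v) = tb i" if "i \<le> Suc k" for i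
      using that w(1,3) by (cases i) (auto simp: funpow_swap1 p)
    then show "v \<in> ?L" using w d by (auto simp: kids_def)
  qed
  then have "card ?L = (\<Sum>w\<in>?S. card (?K w))"
    using finite_kids by (simp, intro card_UN_disjoint) (auto simp: kids_def)
  also have "\<dots> = card ?S * count (subtrees (tb 1)) (tb 0)" using K by simp
  also have "\<dots> = card {w \<in> {1..n}. vshape c n w = tb (Suc k)} * ((\<Prod>m=1..k. count (subtrees (tb (Suc m))) (tb m)) * count (subtrees (tb 1)) (tb 0))"
    using Suc.IH[of "\<lambda>i. tb (Suc i)"] by simp
  also have "(\<Prod>m=1..k. count (subtrees (tb (Suc m))) (tb m)) * count (subtrees (tb 1)) (tb 0)
    = (\<Prod>m=1..Suc k. count (subtrees (tb m)) (tb (m - 1)))"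
    by (induction k) (simp_all add: mult_ac)
  finally show ?case .
qed

end

section \<open>Revealing the choices from the last to the first\<close>

text \<open>Fubini for the choice that is revealed last.\<close>

lemma expectation_Pi_pmf_insert:
  fixes F :: "('i \<Rightarrow> 'b) \<Rightarrow> real"
  assumes fin: "finite A" "x \<notin> A" and set: "\<And>i. i \<in> insert x A \<Longrightarrow> finite (set_pmf (p i))"
  shows "measure_pmf.expectation (Pi_pmf (insert x A) d p) F
    = measure_pmf.expectation (Pi_pmf A d p) (\<lambda>f. measure_pmf.expectation (p x) (\<lambda>y. F (f(x := y))))"
proof -
  have finPi: "finite (set_pmf (Pi_pmf A d p))"
    using fin set by (subst set_Pi_pmf) (auto intro!: finite_PiE_dflt)
  have "Pi_pmf (insert x A) d p = Pi_pmf A d p \<bind> (\<lambda>f. p x \<bind> (\<lambda>y. return_pmf (f(x := y))))"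
    by (simp add: Pi_pmf_insert'[OF fin] bind_commute_pmf[of "p x"])
  then have "measure_pmf.expectation (Pi_pmf (insert x A) d p) F
    = (\<Sum>f\<in>set_pmf (Pi_pmf A d p). pmf (Pi_pmf A d p) f *\<^sub>R measure_pmf.expectation (p x \<bind> (\<lambda>y. return_pmf (f(x := y)))) F)"
    using finPi set by (simp only:, intro pmf_expectation_bind) auto
  also have "\<dots> = measure_pmf.expectation (Pi_pmf A d p) (\<lambda>f. measure_pmf.expectation (p x \<bind> (\<lambda>y. return_pmf (f(x := y)))) F)"
    by (rule integral_measure_pmf[OF finPi, symmetric]) auto
  also have "(\<lambda>f. measure_pmf.expectation (p x \<bind> (\<lambda>y. return_pmf (f(x := y)))) F)
    = (\<lambda>f. measure_pmf.expectation (p x) (\<lambda>y. F (f(x := y))))"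
    by (simp add: map_pmf_def[symmetric])
  finally show ?thesis .
qed

text \<open>Each factor depends on the present and later choices only and is divided by its mean given the
  later choices, so that the mean of the product telescopes.\<close>

lemma expectation_prod_normalised:
  fixes R :: "nat \<Rightarrow> (nat \<Rightarrow> 'b) \<Rightarrow> real"
  assumes "m \<le> n" and fin: "\<And>k. finite (set_pmf (p k))"
    and dep: "\<And>k c c'. (\<And>j. k \<le> j \<Longrightarrow> c j = c' j) \<Longrightarrow> R k c = R k c'"
    and D: "\<And>k c. k < n \<Longrightarrow> m \<le> k \<Longrightarrow> D k c = measure_pmf.expectation (p k) (\<lambda>y. R k (c(k := y)))"
    and D0: "\<And>k c. k < n \<Longrightarrow> m \<le> k \<Longrightarrow> D k c \<noteq> 0"
  shows "measure_pmf.expectation (Pi_pmf {m..<n} d p) (\<lambda>c. \<Prod>k\<in>{m..<n}. R k c / D k c) = 1"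
  using assms(1) D D0
proof (induction m rule: inc_induct)
  case base
  then show ?case by simp
next
  case (step m)
  have ins: "{m..<n} = insert m {Suc m..<n}" using step by auto
  have D_upd: "D k (f(m := y)) = D k f" if "m \<le> k" "k < n" for k f y
  proof -
    have "R k (f(m := y, k := z)) = R k (f(k := z))" for z by (rule dep) (use that in auto)
    then show ?thesis by (simp only: step.prems(1)[OF that(2,1)])
  qed
  have R_upd: "R k (f(m := y)) = R k f" if "m < k" for k f y
    by (rule dep) (use that in auto)
  have "measure_pmf.expectation (Pi_pmf {m..<n} d p) (\<lambda>c. \<Prod>k\<in>{m..<n}. R k c / D k c)
    = measure_pmf.expectation (Pi_pmf {Suc m..<n} d p) (\<lambda>f. measure_pmf.expectation (p m)
        (\<lambda>y. \<Prod>k\<in>{m..<n}. R k (f(m := y)) / D k (f(m := y))))"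
    unfolding ins by (rule expectation_Pi_pmf_insert) (use fin in auto)
  also have "(\<lambda>f. measure_pmf.expectation (p m) (\<lambda>y. \<Prod>k\<in>{m..<n}. R k (f(m := y)) / D k (f(m := y))))
    = (\<lambda>f. \<Prod>k\<in>{Suc m..<n}. R k f / D k f)"
  proof
    fix f
    have "(\<Prod>k\<in>{m..<n}. R k (f(m := y)) / D k (f(m := y)))
      = R m (f(m := y)) * (inverse (D m f) * (\<Prod>k\<in>{Suc m..<n}. R k f / D k f))" for y
    proof -
      have "(\<Prod>k\<in>{Suc m..<n}. R k (f(m := y)) / D k (f(m := y))) = (\<Prod>k\<in>{Suc m..<n}. R k f / D k f)"
        by (rule prod.cong) (auto simp: D_upd R_upd)
      then show ?thesis unfolding ins using step.hyps by (simp add: D_upd field_simps)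
    qed
    then have "measure_pmf.expectation (p m) (\<lambda>y. \<Prod>k\<in>{m..<n}. R k (f(m := y)) / D k (f(m := y)))
      = D m f * (inverse (D m f) * (\<Prod>k\<in>{Suc m..<n}. R k f / D k f))"
      unfolding step.prems(1)[OF \<open>m < n\<close> order_refl, of f] by (simp only: integral_mult_left_zero)
    then show "measure_pmf.expectation (p m) (\<lambda>y. \<Prod>k\<in>{m..<n}. R k (f(m := y)) / D k (f(m := y)))
      = (\<Prod>k\<in>{Suc m..<n}. R k f / D k f)"
      using step.prems(2)[of m f] step.hyps by simp
  qed
  also have "measure_pmf.expectation (Pi_pmf {Suc m..<n} d p) \<dots> = 1"
    using step by auto
  finally show ?case .
qed

definition window :: "real \<Rightarrow> nat \<Rightarrow> nat set" where
  "window \<theta> k = {v \<in> {1..k}. nat \<lfloor>\<theta> * real k\<rfloor> \<le> v}"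

text \<open>Choices outside of \<open>{1..<n}\<close> take the default value 0.  The window is empty at \<open>k = 0\<close>, where \<open>{0}\<close> takes its
  place to make every factor a law with finite support.\<close>

definition choice_pmf :: "real \<Rightarrow> nat \<Rightarrow> (nat \<Rightarrow> nat) pmf" where
  "choice_pmf \<theta> n = Pi_pmf {1..<n} 0 (\<lambda>k. pmf_of_set (if k = 0 then {0} else window \<theta> k))"

definition mset_pgf :: "('a \<Rightarrow> real) \<Rightarrow> 'a multiset \<Rightarrow> real" where
  "mset_pgf s A = prod_mset (image_mset s A)"

lemma mset_pgf_bounds:
  assumes "\<And>x. 0 \<le> s x \<and> s x \<le> 1"
  shows "0 \<le> mset_pgf s A" "mset_pgf s A \<le> 1"
  by (induction A) (use assms in \<open>auto simp: mset_pgf_def mult_le_one\<close>)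

lemma mset_pgf_mset_set: "finite K \<Longrightarrow> mset_pgf s (image_mset f (mset_set K)) = (\<Prod>k\<in>K. s (f k))"
  by (simp add: mset_pgf_def multiset.map_comp comp_def prod_unfold_prod_mset)

lemma finite_window [simp]: "finite (window \<theta> k)" by (simp add: window_def)

text \<open>When the vertex \<open>k + 1\<close>, whose fringe tree is already known, chooses its parent, the product of the
  \<open>s\<close>-weights of the subtrees at the children of \<open>v\<close> is multiplied by \<open>s (vshape c n (Suc k))\<close> or by 1; \<open>drift\<close> is
  the mean of this factor minus 1.\<close>

definition drift :: "real \<Rightarrow> nat \<Rightarrow> nat \<Rightarrow> (rtree \<Rightarrow> real) \<Rightarrow> (nat \<Rightarrow> nat) \<Rightarrow> nat \<Rightarrow> real" where
  "drift \<theta> n v s c k = (if v \<in> window \<theta> k then (s (vshape c n (Suc k)) - 1) / card (window \<theta> k) else 0)"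

context
  fixes \<theta> :: real
  assumes \<theta>: "0 < \<theta>" "\<theta> < 1"
begin

lemma window_nonempty: "1 \<le> k \<Longrightarrow> k \<in> window \<theta> k"
proof -
  assume "1 \<le> k"
  have "\<theta> * real k \<le> real k" using \<theta> by (simp add: mult_left_le_one_le)
  then have "nat \<lfloor>\<theta> * real k\<rfloor> \<le> k" using \<theta> by (simp add: nat_le_iff floor_le_iff)
  then show ?thesis using \<open>1 \<le> k\<close> by (simp add: window_def)
qed

lemma set_window_pmf: "1 \<le> k \<Longrightarrow> set_pmf (pmf_of_set (window \<theta> k)) = window \<theta> k"
  using window_nonempty[of k] by (subst set_pmf_of_set) auto

lemma finite_set_choice: "finite (set_pmf (pmf_of_set (if k = 0 then {0} else window \<theta> k)))"
  using window_nonempty[of k] by (subst set_pmf_of_set) auto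

lemma finite_choice_pmf: "finite (set_pmf (choice_pmf \<theta> n))"
  unfolding choice_pmf_def by (subst set_Pi_pmf) (auto intro!: finite_PiE_dflt simp: set_window_pmf)

lemma choice_pmf_valid: "c \<in> set_pmf (choice_pmf \<theta> n) \<Longrightarrow> choices_valid n c"
proof -
  assume "c \<in> set_pmf (choice_pmf \<theta> n)"
  then have "c \<in> PiE_dflt {1..<n} 0 (\<lambda>k. set_pmf (pmf_of_set (if k = 0 then {0} else window \<theta> k)))"
    by (simp add: choice_pmf_def set_Pi_pmf comp_def)
  then have "c k \<in> window \<theta> k" if "k \<in> {1..<n}" for k
    using that set_window_pmf[of k] unfolding PiE_dflt_def by auto
  then show ?thesis by (fastforce simp: choices_valid_def window_def)
qed

lemma drift_bounds:
  assumes "\<And>x. 0 \<le> s x \<and> s x \<le> 1"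
  shows "drift \<theta> n v s c k \<le> 0" "\<bar>drift \<theta> n v s c k\<bar> \<le> (if v \<in> window \<theta> k then 1 / card (window \<theta> k) else 0)"
  using assms[of "vshape c n (Suc k)"] by (auto simp: drift_def divide_nonpos_nonneg divide_simps abs_if)

text \<open>The factors of the telescoping product are the weights that a vertex contributes to \<open>v\<close> or to \<open>v'\<close>.  Since it
  has only one parent, the two drifts add up in the conditional mean.\<close>

lemma expectation_normalised_pgf:
  fixes s s' :: "rtree \<Rightarrow> real"
  assumes vv: "1 \<le> v" "1 \<le> v'" "v \<noteq> v'"
    and nz: "\<And>k c. 1 \<le> k \<Longrightarrow> k < n \<Longrightarrow> 1 + drift \<theta> n v s c k + drift \<theta> n v' s' c k \<noteq> 0"
    and n: "1 \<le> n"
  shows "measure_pmf.expectation (choice_pmf \<theta> n) (\<lambda>c. mset_pgf s (subtrees (vshape c n v)) *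
      mset_pgf s' (subtrees (vshape c n v')) / (\<Prod>k\<in>{1..<n}. 1 + drift \<theta> n v s c k + drift \<theta> n v' s' c k)) = 1"
proof -
  define R where "R k c = (if c k = v then s (vshape c n (Suc k)) else if c k = v' then s' (vshape c n (Suc k)) else 1)" for k c
  define D where "D k c = 1 + drift \<theta> n v s c k + drift \<theta> n v' s' c k" for k c
  have R: "(\<Prod>k\<in>{1..<n}. R k c) = mset_pgf s (subtrees (vshape c n v)) * mset_pgf s' (subtrees (vshape c n v'))"
    if "choices_valid n c" for c
  proof -
    have K: "(\<Prod>k\<in>{1..<n}. if c k = w then t (vshape c n (Suc k)) else 1) = mset_pgf t (subtrees (vshape c n w))"
      if w: "1 \<le> w" for w t
    proof -
      have "{k \<in> {w..<n}. c k = w} = {k \<in> {1..<n}. c k = w}"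
        using w \<open>choices_valid n c\<close> by (fastforce simp: choices_valid_def)
      then show ?thesis
        by (subst vshape.simps) (simp add: mset_pgf_mset_set prod.If_cases Int_def conj_commute)
    qed
    have "R k c = (if c k = v then s (vshape c n (Suc k)) else 1) * (if c k = v' then s' (vshape c n (Suc k)) else 1)" for k
      using vv by (auto simp: R_def)
    then show ?thesis using K[OF vv(1), of s] K[OF vv(2), of s'] by (simp add: prod.distrib)
  qed
  have "measure_pmf.expectation (choice_pmf \<theta> n) (\<lambda>c. mset_pgf s (subtrees (vshape c n v)) *
      mset_pgf s' (subtrees (vshape c n v')) / (\<Prod>k\<in>{1..<n}. D k c))
    = measure_pmf.expectation (choice_pmf \<theta> n) (\<lambda>c. \<Prod>k\<in>{1..<n}. R k c / D k c)"
    using R choice_pmf_valid by (intro integral_cong_AE) (auto simp: AE_measure_pmf_iff prod_dividef)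
  also have "\<dots> = 1"
    unfolding choice_pmf_def
  proof (rule expectation_prod_normalised)
    show "R k c = R k c'" if "\<And>j. k \<le> j \<Longrightarrow> c j = c' j" for k c c'
      using vshape_cong[of "Suc k" n c c'] that by (simp add: R_def)
    show "D k c \<noteq> 0" if "k < n" "1 \<le> k" for k c using nz that by (simp add: D_def)
    show "D k c = measure_pmf.expectation (pmf_of_set (if k = 0 then {0} else window \<theta> k)) (\<lambda>y. R k (c(k := y)))"
      if k: "k < n" "1 \<le> k" for k c
    proof -
      let ?W = "window \<theta> k" and ?t = "vshape c n (Suc k)"
      have ne: "?W \<noteq> {}" using window_nonempty[OF k(2)] by auto
      then have card: "real (card ?W) > 0" by (simp only: of_nat_0_less_iff card_gt_0_iff finite_window simp_thms)
      have "vshape (c(k := y)) n (Suc k) = ?t" for y by (rule vshape_cong) auto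
      then have "R k (c(k := y)) = 1 + ((if y = v then s ?t - 1 else 0) + (if y = v' then s' ?t - 1 else 0))" for y
        using vv by (auto simp: R_def)
      then have "measure_pmf.expectation (pmf_of_set ?W) (\<lambda>y. R k (c(k := y)))
        = (\<Sum>y\<in>?W. 1 + ((if y = v then s ?t - 1 else 0) + (if y = v' then s' ?t - 1 else 0))) / card ?W"
        using ne by (simp add: integral_pmf_of_set)
      also have "\<dots> = D k c"
        using ne card by (simp add: sum.distrib D_def drift_def sum.delta field_simps)
      finally show ?thesis using k by simp
    qed
  qed (use n finite_set_choice in auto)
  finally show ?thesis by (simp add: D_def)
qed

text \<open>With \<open>F\<close> the product of the weights and \<open>P\<close> the product of the conditional means, \<open>F / P\<close> has mean 1, so
  \<open>F - d\<close> and \<open>F / P * (P - d)\<close> have the same mean.  Windows of at least 4 elements keep the two drifts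
  together above \<open>- 1 / 2\<close>, where \<open>1 + u \<ge> exp (2 * u)\<close>, so that \<open>P\<close> is bounded below by \<open>exp (- 2 * L)\<close>.\<close>

lemma pgf_error_bound:
  fixes s s' :: "rtree \<Rightarrow> real"
  assumes vv: "1 \<le> v" "1 \<le> v'" "v \<noteq> v'" and n: "1 \<le> n"
    and s: "\<And>x. 0 \<le> s x \<and> s x \<le> 1" and s': "\<And>x. 0 \<le> s' x \<and> s' x \<le> 1"
    and large: "\<And>k. v \<in> window \<theta> k \<or> v' \<in> window \<theta> k \<Longrightarrow> k < n \<Longrightarrow> 4 \<le> card (window \<theta> k)"
    and L: "\<And>c. - (\<Sum>k\<in>{1..<n}. drift \<theta> n v s c k + drift \<theta> n v' s' c k) \<le> L"
  shows "\<bar>measure_pmf.expectation (choice_pmf \<theta> n) (\<lambda>c. mset_pgf s (subtrees (vshape c n v)) *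
      mset_pgf s' (subtrees (vshape c n v'))) - d\<bar>
    \<le> exp (2 * L) * measure_pmf.expectation (choice_pmf \<theta> n)
        (\<lambda>c. \<bar>(\<Prod>k\<in>{1..<n}. 1 + drift \<theta> n v s c k + drift \<theta> n v' s' c k) - d\<bar>)"
proof -
  define D where "D k c = 1 + drift \<theta> n v s c k + drift \<theta> n v' s' c k" for k c
  define F where "F c = mset_pgf s (subtrees (vshape c n v)) * mset_pgf s' (subtrees (vshape c n v'))" for c
  define P where "P c = (\<Prod>k\<in>{1..<n}. D k c)" for c
  have dr: "drift \<theta> n v s c k + drift \<theta> n v' s' c k \<le> 0" "- (1/2) \<le> drift \<theta> n v s c k + drift \<theta> n v' s' c k"
    if "k < n" for k c
  proof -
    show "drift \<theta> n v s c k + drift \<theta> n v' s' c k \<le> 0"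
      by (rule add_nonpos_nonpos) (rule drift_bounds(1)[OF s] drift_bounds(1)[OF s'])+
    have "\<bar>drift \<theta> n v s c k\<bar> \<le> 1 / 4"
      by (rule order_trans[OF drift_bounds(2)[OF s]]) (use large[of k] that in \<open>auto simp: field_simps\<close>)
    moreover have "\<bar>drift \<theta> n v' s' c k\<bar> \<le> 1 / 4"
      by (rule order_trans[OF drift_bounds(2)[OF s']]) (use large[of k] that in \<open>auto simp: field_simps\<close>)
    ultimately show "- (1/2) \<le> drift \<theta> n v s c k + drift \<theta> n v' s' c k" by simp
  qed
  have exp_le: "exp (2 * x) \<le> 1 + x" if "x \<le> 0" "- (1/2) \<le> x" for x :: real
  proof -
    have "0 \<le> (- x) * (1 + 2 * x)" by (rule mult_nonneg_nonneg) (use that in auto)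
    then have "1 \<le> (1 + x) * (1 - 2 * x)" by (simp add: algebra_simps)
    then have "1 / (1 - 2 * x) \<le> 1 + x" using that by (simp add: pos_divide_le_eq)
    moreover have "exp (2 * x) \<le> 1 / (1 - 2 * x)"
      using exp_ge_add_one_self[of "- 2 * x"] that by (simp add: exp_minus divide_simps mult.commute)
    ultimately show ?thesis by linarith
  qed
  have P_ge: "exp (- 2 * L) \<le> P c" for c
  proof -
    have "- 2 * L \<le> 2 * (\<Sum>k\<in>{1..<n}. drift \<theta> n v s c k + drift \<theta> n v' s' c k)" using L[of c] by simp
    then have "exp (- 2 * L) \<le> exp (\<Sum>k\<in>{1..<n}. 2 * (drift \<theta> n v s c k + drift \<theta> n v' s' c k))"
      by (simp add: sum_distrib_left)
    also have "\<dots> = (\<Prod>k\<in>{1..<n}. exp (2 * (drift \<theta> n v s c k + drift \<theta> n v' s' c k)))" by (simp add: exp_sum)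
    also have "\<dots> \<le> P c"
      unfolding P_def D_def add.assoc by (intro prod_mono conjI exp_le dr) auto
    finally show ?thesis .
  qed
  have P_pos: "0 < P c" for c using P_ge[of c] exp_gt_zero[of "-2 * L"] by linarith
  have F: "0 \<le> F c" "F c \<le> 1" for c
    unfolding F_def using mset_pgf_bounds[of s, OF s] mset_pgf_bounds[of s', OF s'] by (auto intro!: mult_le_one)
  have int: "integrable (measure_pmf (choice_pmf \<theta> n)) g" for g :: "_ \<Rightarrow> real"
    by (rule integrable_measure_pmf_finite[OF finite_choice_pmf])
  have one: "measure_pmf.expectation (choice_pmf \<theta> n) (\<lambda>c. F c / P c) = 1"
    unfolding F_def P_def D_def
  proof (rule expectation_normalised_pgf[OF vv _ n])
    show "1 + drift \<theta> n v s c k + drift \<theta> n v' s' c k \<noteq> 0" if "k < n" for k c using dr(2)[OF that, of c] by linarith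
  qed
  have "measure_pmf.expectation (choice_pmf \<theta> n) F - d = measure_pmf.expectation (choice_pmf \<theta> n) (\<lambda>c. F c / P c * (P c - d))"
  proof -
    have eq: "F c / P c * (P c - d) = F c - F c / P c * d" for c using P_pos[of c] by (simp add: field_simps)
    have "measure_pmf.expectation (choice_pmf \<theta> n) (\<lambda>c. F c / P c * d) = d"
      by (simp only: integral_mult_left_zero one mult_1_left)
    then show ?thesis unfolding eq by (subst Bochner_Integration.integral_diff[OF int int]) simp
  qed
  also have "\<bar>\<dots>\<bar> \<le> measure_pmf.expectation (choice_pmf \<theta> n) (\<lambda>c. \<bar>F c / P c * (P c - d)\<bar>)"
    by (rule integral_abs_bound)
  also have "\<dots> \<le> measure_pmf.expectation (choice_pmf \<theta> n) (\<lambda>c. exp (2 * L) * \<bar>P c - d\<bar>)"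
  proof (rule integral_mono[OF int int])
    fix c
    have "\<bar>F c / P c\<bar> \<le> 1 / exp (- 2 * L)"
      using F[of c] P_ge[of c] P_pos[of c] by (simp add: frac_le)
    then have "\<bar>F c / P c\<bar> \<le> exp (2 * L)" by (simp add: exp_minus divide_inverse)
    then show "\<bar>F c / P c * (P c - d)\<bar> \<le> exp (2 * L) * \<bar>P c - d\<bar>"
      by (simp only: abs_mult) (rule mult_right_mono, auto)
  qed
  finally show ?thesis by (simp add: F_def[abs_def] P_def D_def)
qed

lemma prod_one_plus_approx_exp:
  fixes x :: "nat \<Rightarrow> real"
  assumes "finite K" "\<And>k. k \<in> K \<Longrightarrow> -1 \<le> x k \<and> x k \<le> 0"
  shows "\<bar>(\<Prod>k\<in>K. 1 + x k) - exp (\<Sum>k\<in>K. x k)\<bar> \<le> (\<Sum>k\<in>K. (x k)\<^sup>2)"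
proof -
  have "norm ((\<Prod>k\<in>K. 1 + x k) - (\<Prod>k\<in>K. exp (x k))) \<le> (\<Sum>k\<in>K. norm ((1 + x k) - exp (x k)))"
    by (rule norm_prod_diff) (use assms in \<open>force simp: abs_le_iff\<close>)+
  also have "\<dots> \<le> (\<Sum>k\<in>K. (x k)\<^sup>2)"
  proof (rule sum_mono)
    fix k assume k: "k \<in> K"
    have "0 \<le> (- x k) * (x k)\<^sup>2" by (rule mult_nonneg_nonneg) (use assms(2)[OF k] in auto)
    then have "1 \<le> (1 + x k + (x k)\<^sup>2) * (1 - x k)" by (simp add: algebra_simps power2_eq_square)
    then have "1 / (1 - x k) \<le> 1 + x k + (x k)\<^sup>2" using assms(2)[OF k] by (simp add: pos_divide_le_eq)
    moreover have "exp (x k) \<le> 1 / (1 - x k)"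
      using exp_ge_add_one_self[of "- x k"] assms(2)[OF k] by (simp add: exp_minus divide_simps mult.commute)
    ultimately show "norm ((1 + x k) - exp (x k)) \<le> (x k)\<^sup>2"
      using exp_ge_add_one_self[of "x k"] assms(2)[OF k] by simp
  qed
  finally show ?thesis using assms(1) by (simp add: exp_sum)
qed

end

section \<open>Vertices placed by logarithmic age\<close>

definition expo :: "real measure" where "expo = density lborel (exponential_density 1)"

lemma sets_expo [simp, measurable_cong]: "sets expo = sets borel" by (simp add: expo_def)
lemma space_expo [simp]: "space expo = UNIV" by (simp add: expo_def)

interpretation expo: prob_space expo
  unfolding expo_def by (rule prob_space_exponential_density) simp

lemma AE_expo_pos: "AE x in expo. 0 < x"
proof -
  have "AE x in lborel. x \<noteq> (0::real)" by (rule AE_lborel_singleton)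
  then have "AE x in lborel. 0 < ennreal (exponential_density 1 x) \<longrightarrow> 0 < x"
    by eventually_elim (auto simp: exponential_density_def)
  then show ?thesis unfolding expo_def by (subst AE_density) auto
qed

lemma AE_expo_neq: "AE x in expo. x \<noteq> a"
proof -
  have "AE x in lborel. x \<noteq> (a::real)" by (rule AE_lborel_singleton)
  then show ?thesis unfolding expo_def by (subst AE_density) auto
qed

lemma measure_expo_atLeast: "0 \<le> a \<Longrightarrow> measure expo {a..} = exp (- a)"
proof -
  assume a: "0 \<le> a"
  have "emeasure expo {..<a} = emeasure expo {..a}"
    by (rule emeasure_eq_AE) (use AE_expo_neq[of a] in \<open>auto elim!: eventually_mono\<close>)
  also have "\<dots> = ennreal (1 - exp (- a))"
    using emeasure_erlang_density[of 1 0 a] a by (simp add: expo_def erlang_CDF_0)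
  finally have "measure expo {..<a} = 1 - exp (- a)" using a by (simp add: measure_def)
  then have "measure expo (space expo - {..<a}) = exp (- a)" by (subst expo.prob_compl) auto
  moreover have "space expo - {..<a} = {a..}" by auto
  ultimately show ?thesis by simp
qed

text \<open>The vertex \<open>pos n x\<close> was born at logarithmic age \<open>x\<close> before time \<open>n\<close>; under the exponential law of
  \<open>x\<close> it is uniform, which is the origin of the exponential age in the limit law.\<close>

definition pos :: "nat \<Rightarrow> real \<Rightarrow> nat" where
  "pos n x = nat \<lceil>real n * exp (- x)\<rceil>"

lemma measurable_pos [measurable]: "pos n \<in> borel \<rightarrow>\<^sub>M count_space UNIV"
  unfolding pos_def by measurable

lemma pos_range: "1 \<le> n \<Longrightarrow> 0 \<le> x \<Longrightarrow> 1 \<le> pos n x \<and> pos n x \<le> n"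
proof -
  assume "1 \<le> n" "0 \<le> x"
  then have "0 < real n * exp (- x)" "real n * exp (- x) \<le> real n" by (auto simp: mult_le_cancel_left1)
  then have "0 < \<lceil>real n * exp (- x)\<rceil>" "\<lceil>real n * exp (- x)\<rceil> \<le> int n" by (auto simp: ceiling_le_iff)
  then show ?thesis unfolding pos_def by linarith
qed

lemma pos_bounds: "real n * exp (- x) \<le> real (pos n x)" "real (pos n x) \<le> real n * exp (- x) + 1"
proof -
  have "0 \<le> real n * exp (- x)" by simp
  then have "real (pos n x) = of_int \<lceil>real n * exp (- x)\<rceil>" unfolding pos_def by (subst of_nat_nat) linarith+
  then show "real n * exp (- x) \<le> real (pos n x)" "real (pos n x) \<le> real n * exp (- x) + 1" by linarith+
qed

lemma measure_pos:
  assumes n: "1 \<le> n" and w: "w \<in> {1..n}"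
  shows "measure expo {x. pos n x = w} = 1 / n"
proof -
  have eq: "{x. pos n x \<le> v} = (if v = 0 then {} else {ln (n / v)..})" for v
  proof (cases "v = 0")
    case True
    have "\<not> pos n x \<le> 0" for x
      using pos_bounds(1)[of n x] n by (metis exp_gt_zero le_zero_eq linorder_not_less mult_pos_pos of_nat_0 of_nat_0_less_iff order_less_le_trans zero_less_one)
    then show ?thesis using True by auto
  next
    case False
    have "pos n x \<le> v \<longleftrightarrow> real n * exp (- x) \<le> v" for x
      by (auto simp: pos_def nat_le_iff ceiling_le_iff)
    also have "real n * exp (- x) \<le> v \<longleftrightarrow> ln (n / v) \<le> x" for x
    proof -
      have "real n * exp (- x) \<le> v \<longleftrightarrow> n / v \<le> exp x" using False by (simp add: exp_minus field_simps)
      also have "\<dots> \<longleftrightarrow> ln (n / v) \<le> x" using False n by (metis divide_pos_pos exp_le_cancel_iff exp_ln of_nat_0_less_iff not_gr_zero zero_less_one order_less_le_trans of_nat_0_le_iff less_one linorder_not_less)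
      finally show ?thesis .
    qed
    finally show ?thesis using False by auto
  qed
  have m: "measure expo {x. pos n x \<le> v} = v / n" if "v \<le> n" for v
  proof (cases "v = 0")
    case False
    then have "0 \<le> ln (real n / v)" using that n by (simp add: ln_ge_zero)
    then show ?thesis using False n unfolding eq by (simp add: measure_expo_atLeast exp_minus)
  next
    case True
    then show ?thesis using eq[of 0] by (simp only: if_True measure_empty) simp
  qed
  have w1: "w \<le> n" "w - 1 \<le> n" using w by auto
  have "{x. pos n x = w} = {x. pos n x \<le> w} - {x. pos n x \<le> w - 1}" using w by auto
  also have "measure expo \<dots> = measure expo {x. pos n x \<le> w} - measure expo {x. pos n x \<le> w - 1}"
  proof (rule expo.finite_measure_Diff)
    show "{x. pos n x \<le> w} \<in> sets expo" "{x. pos n x \<le> w - 1} \<in> sets expo" by (simp_all add: eq)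
  qed auto
  also have "\<dots> = 1 / n" using m[OF w1(1)] m[OF w1(2)] w by (simp add: of_nat_diff diff_divide_distrib)
  finally show ?thesis .
qed

lemma integral_pos:
  fixes a :: "nat \<Rightarrow> real"
  assumes n: "1 \<le> n"
  shows "(\<integral>x. a (pos n x) \<partial>expo) = (\<Sum>w=1..n. a w) / n"
proof -
  have "(\<integral>x. a (pos n x) \<partial>expo) = (\<integral>x. (\<Sum>w=1..n. a w * indicator {x. pos n x = w} x) \<partial>expo)"
  proof (rule integral_cong_AE)
    show "AE x in expo. a (pos n x) = (\<Sum>w=1..n. a w * indicator {x. pos n x = w} x)"
      using AE_expo_pos
    proof eventually_elim
      case (elim x)
      have "(\<Sum>w=1..n. a w * indicator {x. pos n x = w} x) = (\<Sum>w=1..n. if w = pos n x then a w else 0)"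
        by (intro sum.cong) (auto simp: indicator_def)
      then show ?case using pos_range[OF n, of x] elim by (simp add: sum.delta)
    qed
  qed measurable
  also have "\<dots> = (\<Sum>w=1..n. a w * measure expo {x. pos n x = w})"
    by (subst Bochner_Integration.integral_sum) (auto simp: expo.integrable_const_bound intro!: expo.integrable_const_bound[of _ 1])
  also have "\<dots> = (\<Sum>w=1..n. a w) / n" using measure_pos[OF n] by (simp add: sum_divide_distrib)
  finally show ?thesis .
qed

lemma pos_over_n: "(\<lambda>n. real (pos n x) / real n) \<longlonglongrightarrow> exp (- x)"
proof (rule tendsto_sandwich)
  show "\<forall>\<^sub>F n in sequentially. exp (- x) \<le> real (pos n x) / real n"
    using eventually_gt_at_top[of 0] by eventually_elim (use pos_bounds(1)[of _ x] in \<open>simp add: field_simps\<close>)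
  show "\<forall>\<^sub>F n in sequentially. real (pos n x) / real n \<le> exp (- x) + 1 / real n"
    using eventually_gt_at_top[of 0] by eventually_elim (use pos_bounds(2)[of _ x] in \<open>simp add: field_simps\<close>)
  have "(\<lambda>n. exp (- x) + 1 / real n) \<longlonglongrightarrow> exp (- x) + 0" by (intro tendsto_intros lim_1_over_n)
  then show "(\<lambda>n. exp (- x) + 1 / real n) \<longlonglongrightarrow> exp (- x)" by simp
qed simp

text \<open>The rate density at which a vertex of age \<open>x\<close> has received children of present age \<open>x'\<close>, relative to the
  exponential law of ages; \<open>attach\<close> is its finite-size counterpart.\<close>

definition kernel :: "real \<Rightarrow> real \<Rightarrow> real \<Rightarrow> real" where
  "kernel \<theta> x x' = (if x - ln (1 / \<theta>) \<le> x' \<and> x' \<le> x then exp x' / (1 - \<theta>) else 0)"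

definition attach :: "real \<Rightarrow> nat \<Rightarrow> real \<Rightarrow> real \<Rightarrow> real" where
  "attach \<theta> n x x' = (if pos n x \<in> window \<theta> (pos n x' - 1) then n / card (window \<theta> (pos n x' - 1)) else 0)"

context
  fixes \<theta> :: real
  assumes \<theta>: "0 < \<theta>" "\<theta> < 1"
begin

lemma card_window: "1 \<le> k \<Longrightarrow> card (window \<theta> k) = k + 1 - max 1 (nat \<lfloor>\<theta> * real k\<rfloor>)"
proof -
  have "window \<theta> k = {max 1 (nat \<lfloor>\<theta> * real k\<rfloor>)..k}" by (auto simp: window_def)
  then show ?thesis by simp
qed

lemma card_window_ge: "(1 - \<theta>) * real k \<le> real (card (window \<theta> k))"
proof (cases "k = 0")
  case False
  have m: "\<theta> * real k \<le> real k" using \<theta> by (simp add: mult_left_le_one_le)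
  have f: "real (nat \<lfloor>\<theta> * real k\<rfloor>) \<le> \<theta> * real k" using \<theta> by (simp add: of_nat_nat)
  then have "nat \<lfloor>\<theta> * real k\<rfloor> \<le> k" using m by linarith
  then have "max 1 (nat \<lfloor>\<theta> * real k\<rfloor>) \<le> k + 1" by simp
  then have "real (card (window \<theta> k)) = real k + 1 - max 1 (real (nat \<lfloor>\<theta> * real k\<rfloor>))"
    using False by (subst card_window) (auto simp: of_nat_diff of_nat_max)
  moreover have "max 1 (real (nat \<lfloor>\<theta> * real k\<rfloor>)) \<le> 1 + \<theta> * real k"
  proof (rule max.boundedI)
    show "1 \<le> 1 + \<theta> * real k" using \<theta> by simp
  qed (use f in linarith)
  moreover have "(1 - \<theta>) * real k = real k - \<theta> * real k" by (simp add: algebra_simps)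
  ultimately show ?thesis by linarith
qed (simp add: window_def)

lemma card_window_ge_exp: "pos n x \<in> window \<theta> k \<Longrightarrow> (1 - \<theta>) * (real n * exp (- x)) \<le> real (card (window \<theta> k))"
proof -
  assume "pos n x \<in> window \<theta> k"
  then have "real (pos n x) \<le> real k" by (simp add: window_def)
  then have "real n * exp (- x) \<le> real k" using pos_bounds(1)[of n x] by linarith
  then have "(1 - \<theta>) * (real n * exp (- x)) \<le> (1 - \<theta>) * real k" using \<theta> by (intro mult_left_mono) auto
  then show ?thesis using card_window_ge[of k] by linarith
qed

lemma attach_bounds: "0 \<le> attach \<theta> n x x'" "attach \<theta> n x x' \<le> exp x / (1 - \<theta>)"
proof -
  show "0 \<le> attach \<theta> n x x'" by (simp add: attach_def)
  show "attach \<theta> n x x' \<le> exp x / (1 - \<theta>)"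
  proof (cases "pos n x \<in> window \<theta> (pos n x' - 1) \<and> n \<noteq> 0")
    case True
    let ?w = "real (card (window \<theta> (pos n x' - 1)))"
    have le: "(1 - \<theta>) * (real n * exp (- x)) \<le> ?w" using card_window_ge_exp True by blast
    moreover have "0 < (1 - \<theta>) * (real n * exp (- x))" using True \<theta> by simp
    ultimately have "0 < ?w" by linarith
    then have "real n / ?w \<le> real n / ((1 - \<theta>) * (real n * exp (- x)))"
      using le by (intro divide_left_mono mult_pos_pos) (use True \<theta> in auto)
    also have "\<dots> = (real n / real n) * (exp x / (1 - \<theta>))" by (simp add: exp_minus divide_simps)
    also have "\<dots> = exp x / (1 - \<theta>)" using True by simp
    finally show ?thesis using True by (simp add: attach_def)
  qed (use \<theta> in \<open>auto simp: attach_def\<close>)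
qed

lemma measurable_attach [measurable]: "(\<lambda>x'. attach \<theta> n x x') \<in> borel_measurable borel"
proof -
  have "(\<lambda>p. if pos n x \<in> window \<theta> (p - 1) then n / card (window \<theta> (p - 1)) else 0) \<in> count_space UNIV \<rightarrow>\<^sub>M (borel :: real measure)" by simp
  from measurable_compose[OF measurable_pos this] show ?thesis by (simp add: attach_def)
qed

lemma measurable_kernel [measurable]: "(\<lambda>(x, x'). kernel \<theta> x x') \<in> borel_measurable (borel \<Otimes>\<^sub>M borel)"
  unfolding kernel_def by measurable

lemma kernel_bounds: "0 \<le> kernel \<theta> x x'" "kernel \<theta> x x' \<le> exp x / (1 - \<theta>)"
  using \<theta> by (auto simp: kernel_def divide_simps)

text \<open>The window at time \<open>k\<close> has about \<open>(1 - \<theta>) * k\<close> elements, with \<open>k\<close> about \<open>n * exp (- x')\<close>.  It contains \<open>pos n x\<close>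
  eventually or eventually not, unless \<open>x'\<close> is at one of the two edges of the support of the kernel.\<close>

lemma attach_tendsto:
  assumes "x' \<noteq> x" "x' \<noteq> x - ln (1 / \<theta>)" "0 \<le> x'"
  shows "(\<lambda>n. attach \<theta> n x x') \<longlonglongrightarrow> kernel \<theta> x x'"
proof -
  define k where "k n = pos n x' - 1" for n
  have th: "exp (- ln (1 / \<theta>)) = \<theta>" using \<theta> by (simp add: exp_minus)
  have ev1: "\<forall>\<^sub>F n in sequentially. real (k n) = real (pos n x') - 1"
    using eventually_ge_at_top[of 1] by eventually_elim (use pos_range[of _ x'] assms in \<open>auto simp: k_def of_nat_diff\<close>)
  have kn: "(\<lambda>n. real (k n) / real n) \<longlonglongrightarrow> exp (- x')"
  proof (rule Lim_transform_eventually)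
    show "(\<lambda>n. real (pos n x') / real n - 1 / real n) \<longlonglongrightarrow> exp (- x')"
      using tendsto_diff[OF pos_over_n[of x'] lim_1_over_n] by simp
    show "\<forall>\<^sub>F n in sequentially. real (pos n x') / real n - 1 / real n = real (k n) / real n"
      using ev1 by eventually_elim (simp add: diff_divide_distrib)
  qed
  have fl: "(\<lambda>n. real (nat \<lfloor>\<theta> * real (k n)\<rfloor>) / real n) \<longlonglongrightarrow> \<theta> * exp (- x')"
  proof (rule tendsto_sandwich)
    have *: "\<theta> * real (k n) - 1 \<le> real (nat \<lfloor>\<theta> * real (k n)\<rfloor>)" "real (nat \<lfloor>\<theta> * real (k n)\<rfloor>) \<le> \<theta> * real (k n)" for n
      using \<theta> by (auto simp: of_nat_nat)
    show "\<forall>\<^sub>F n in sequentially. \<theta> * (real (k n) / real n) - 1 / real n \<le> real (nat \<lfloor>\<theta> * real (k n)\<rfloor>) / real n"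
      using eventually_gt_at_top[of 0]
      by eventually_elim (simp add: diff_divide_distrib[symmetric], intro divide_right_mono, use * in auto)
    show "\<forall>\<^sub>F n in sequentially. real (nat \<lfloor>\<theta> * real (k n)\<rfloor>) / real n \<le> \<theta> * (real (k n) / real n)"
      using eventually_gt_at_top[of 0] by eventually_elim (use * in \<open>simp add: divide_right_mono\<close>)
    show "(\<lambda>n. \<theta> * (real (k n) / real n) - 1 / real n) \<longlonglongrightarrow> \<theta> * exp (- x')"
      using tendsto_diff[OF tendsto_mult[OF tendsto_const kn] lim_1_over_n] by simp
    show "(\<lambda>n. \<theta> * (real (k n) / real n)) \<longlonglongrightarrow> \<theta> * exp (- x')" by (intro tendsto_intros kn)
  qed
  have lt_ev: "\<forall>\<^sub>F n in sequentially. f n < g n"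
    if "(\<lambda>n. real (f n) / real n) \<longlonglongrightarrow> a" "(\<lambda>n. real (g n) / real n) \<longlonglongrightarrow> b" "a < b" for f g :: "nat \<Rightarrow> nat" and a b
  proof -
    obtain m where m: "a < m" "m < b" using dense[OF \<open>a < b\<close>] by blast
    have "\<forall>\<^sub>F n in sequentially. real (f n) / real n < m" "\<forall>\<^sub>F n in sequentially. m < real (g n) / real n"
      using order_tendstoD that m by blast+
    then show ?thesis using eventually_gt_at_top[of 0]
      by eventually_elim (metis divide_less_cancel less_trans of_nat_0_less_iff of_nat_less_iff order_less_asym)
  qed
  consider "x' < x \<and> x - ln (1 / \<theta>) < x'" | "x < x'" | "x' < x - ln (1 / \<theta>)" using assms by linarith
  then show ?thesis
  proof cases
    case 1
    then have "exp (- x) < exp (- x')" "\<theta> * exp (- x') < exp (- x)"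
      using th by (simp_all, metis exp_add exp_less_mono diff_less_eq minus_diff_eq add.commute neg_less_iff_less uminus_add_conv_diff)
    then have "\<forall>\<^sub>F n in sequentially. pos n x < k n" "\<forall>\<^sub>F n in sequentially. nat \<lfloor>\<theta> * real (k n)\<rfloor> < pos n x"
      "\<forall>\<^sub>F n in sequentially. 0 < pos n x"
      using lt_ev[OF pos_over_n[of x] kn] lt_ev[OF fl pos_over_n[of x]] lt_ev[of "\<lambda>_. 0" 0, OF _ pos_over_n[of x]] by auto
    moreover have "\<forall>\<^sub>F n in sequentially. 1 < nat \<lfloor>\<theta> * real (k n)\<rfloor>"
      using lt_ev[OF _ fl, of "\<lambda>_. 1" 0] lim_1_over_n \<theta> by simp
    ultimately have ev: "\<forall>\<^sub>F n in sequentially. attach \<theta> n x x' = 1 / (real (k n) / n + 1 / n - real (nat \<lfloor>\<theta> * real (k n)\<rfloor>) / n)"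
      using eventually_gt_at_top[of 0]
    proof eventually_elim
      case (elim n)
      then have "pos n x \<in> window \<theta> (k n)" by (auto simp: window_def)
      moreover have "real (card (window \<theta> (k n))) = real (k n) + 1 - real (nat \<lfloor>\<theta> * real (k n)\<rfloor>)"
      proof -
        have "max 1 (nat \<lfloor>\<theta> * real (k n)\<rfloor>) = nat \<lfloor>\<theta> * real (k n)\<rfloor>" "nat \<lfloor>\<theta> * real (k n)\<rfloor> \<le> k n + 1" "1 \<le> k n"
          using elim by linarith+
        then show ?thesis by (simp add: card_window of_nat_diff)
      qed
      ultimately show ?case using elim(5) unfolding attach_def k_def[symmetric]
        by (simp add: diff_divide_distrib[symmetric] add_divide_distrib[symmetric])
    qed
    have "(\<lambda>n. 1 / (real (k n) / n + 1 / n - real (nat \<lfloor>\<theta> * real (k n)\<rfloor>) / n)) \<longlonglongrightarrow> 1 / (exp (- x') + 0 - \<theta> * exp (- x'))"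
      using \<theta> by (intro tendsto_intros kn fl lim_1_over_n) auto
    also have "1 / (exp (- x') + 0 - \<theta> * exp (- x')) = kernel \<theta> x x'"
      using 1 \<theta> by (simp add: kernel_def exp_minus field_simps)
    finally show ?thesis
    proof (rule Lim_transform_eventually)
      show "\<forall>\<^sub>F n in sequentially. 1 / (real (k n) / n + 1 / n - real (nat \<lfloor>\<theta> * real (k n)\<rfloor>) / n) = attach \<theta> n x x'"
        using ev by eventually_elim simp
    qed
  next
    case 2
    then have "\<forall>\<^sub>F n in sequentially. k n < pos n x" using lt_ev[OF kn pos_over_n[of x]] by simp
    then have "\<forall>\<^sub>F n in sequentially. kernel \<theta> x x' = attach \<theta> n x x'"
      by eventually_elim (use 2 in \<open>auto simp: attach_def k_def window_def kernel_def\<close>)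
    then show ?thesis by (rule Lim_transform_eventually[OF tendsto_const])
  next
    case 3
    then have "exp (- x) < \<theta> * exp (- x')"
      using th by (metis exp_add exp_less_mono less_diff_eq minus_diff_eq add.commute neg_less_iff_less uminus_add_conv_diff)
    then have "\<forall>\<^sub>F n in sequentially. pos n x < nat \<lfloor>\<theta> * real (k n)\<rfloor>" using lt_ev[OF pos_over_n[of x] fl] by simp
    then have "\<forall>\<^sub>F n in sequentially. kernel \<theta> x x' = attach \<theta> n x x'"
      by eventually_elim (use 3 in \<open>auto simp: attach_def k_def window_def kernel_def\<close>)
    then show ?thesis by (rule Lim_transform_eventually[OF tendsto_const])
  qed
qed

lemma sum_drift_eq_integral:
  assumes n: "1 \<le> n"
  shows "(\<Sum>k\<in>{1..<n}. drift \<theta> n (pos n x) s c k) = (\<integral>y. attach \<theta> n x y * (s (vshape c n (pos n y)) - 1) \<partial>expo)"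
proof -
  define a where "a w = (if pos n x \<in> window \<theta> (w - 1) then n / card (window \<theta> (w - 1)) else 0) * (s (vshape c n w) - 1)" for w
  have "(\<integral>y. attach \<theta> n x y * (s (vshape c n (pos n y)) - 1) \<partial>expo) = (\<integral>y. a (pos n y) \<partial>expo)"
    by (simp add: a_def attach_def)
  also have "\<dots> = (\<Sum>w=1..n. a w) / n" by (rule integral_pos[OF n])
  also have "(\<Sum>w=1..n. a w) = (\<Sum>k<n. a (Suc k))"
    by (rule sum.reindex_bij_witness[of _ Suc "\<lambda>w. w - 1"]) auto
  also have "\<dots> / n = (\<Sum>k<n. drift \<theta> n (pos n x) s c k)"
    using n unfolding sum_divide_distrib by (intro sum.cong) (auto simp: a_def drift_def)
  also have "\<dots> = (\<Sum>k\<in>{1..<n}. drift \<theta> n (pos n x) s c k)"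
    by (rule sum.mono_neutral_right) (auto simp: drift_def window_def Suc_le_eq)
  finally show ?thesis ..
qed

end

section \<open>Recovering a multiset from its generating function\<close>

text \<open>The common features of an expectation over the choices and of an expectation over the branching process
  that allow for passing from generating functions to probabilities.  Additivity is asked for bounded functions
  only, as the expectation of a function that is not integrable is 0.\<close>

definition contraction :: "(('a \<Rightarrow> real) \<Rightarrow> real) \<Rightarrow> bool" where
  "contraction \<Phi> \<longleftrightarrow> (\<forall>f K. (\<forall>B. \<bar>f B\<bar> \<le> K) \<longrightarrow> \<bar>\<Phi> f\<bar> \<le> K) \<and>
     (\<forall>f g a K. (\<forall>B. \<bar>f B\<bar> \<le> K \<and> \<bar>g B\<bar> \<le> K) \<longrightarrow> \<Phi> (\<lambda>B. f B + a * g B) = \<Phi> f + a * \<Phi> g)"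

lemma contraction_bound: "contraction \<Phi> \<Longrightarrow> (\<And>B. \<bar>f B\<bar> \<le> K) \<Longrightarrow> \<bar>\<Phi> f\<bar> \<le> K"
  unfolding contraction_def by blast

lemma contraction_add:
  assumes "contraction \<Phi>" "\<And>B. \<bar>f B\<bar> \<le> K" "\<And>B. \<bar>g B\<bar> \<le> K'"
  shows "\<Phi> (\<lambda>B. f B + a * g B) = \<Phi> f + a * \<Phi> g"
proof -
  have "\<forall>B. \<bar>f B\<bar> \<le> max K K' \<and> \<bar>g B\<bar> \<le> max K K'"
    using assms(2,3) by (simp add: le_max_iff_disj)
  then show ?thesis using assms(1) unfolding contraction_def by blast
qed

context
  fixes \<Phi> :: "nat \<Rightarrow> ('a \<Rightarrow> real) \<Rightarrow> real" and \<Phi>' :: "('a \<Rightarrow> real) \<Rightarrow> real"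
  assumes con: "\<And>n. contraction (\<Phi> n)" "contraction \<Phi>'"
begin

lemma contraction_limit_add:
  assumes "\<And>B. \<bar>f B\<bar> \<le> K" "\<And>B. \<bar>g B\<bar> \<le> K'"
    and "(\<lambda>n. \<Phi> n f) \<longlonglongrightarrow> \<Phi>' f" "(\<lambda>n. \<Phi> n g) \<longlonglongrightarrow> \<Phi>' g"
  shows "(\<lambda>n. \<Phi> n (\<lambda>B. f B + a * g B)) \<longlonglongrightarrow> \<Phi>' (\<lambda>B. f B + a * g B)"
proof -
  have "l (\<lambda>B. f B + a * g B) = l f + a * l g" if "contraction l" for l
    by (rule contraction_add[OF that]) (fact assms)+
  from this[OF con(1)] this[OF con(2)]
  show ?thesis using assms(3,4) by (auto intro!: tendsto_intros)
qed

lemma contraction_limit_uniform: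
  assumes f: "\<And>B. \<bar>f B\<bar> \<le> K"
    and g: "\<And>\<epsilon>. 0 < \<epsilon> \<Longrightarrow> \<exists>g. (\<exists>K'. \<forall>B. \<bar>g B\<bar> \<le> K') \<and> (\<forall>B. \<bar>f B - g B\<bar> \<le> \<epsilon>) \<and> (\<lambda>n. \<Phi> n g) \<longlonglongrightarrow> \<Phi>' g"
  shows "(\<lambda>n. \<Phi> n f) \<longlonglongrightarrow> \<Phi>' f"
proof (rule LIMSEQ_I)
  fix e :: real assume "0 < e"
  then obtain g K' where g: "\<And>B. \<bar>g B\<bar> \<le> K'" "\<And>B. \<bar>f B - g B\<bar> \<le> e / 4" "(\<lambda>n. \<Phi> n g) \<longlonglongrightarrow> \<Phi>' g"
    using g[of "e / 4"] by auto
  have "\<bar>l f - l g\<bar> \<le> e / 4" if "contraction l" for l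
  proof -
    have "l (\<lambda>B. f B + (-1) * g B) = l f + (-1) * l g" by (rule contraction_add[OF that]) (fact f g(1))+
    moreover have "\<bar>l (\<lambda>B. f B + (-1) * g B)\<bar> \<le> e / 4" by (rule contraction_bound[OF that]) (use g(2) in simp)
    ultimately show ?thesis by simp
  qed
  note close = this
  obtain N where N: "\<And>n. N \<le> n \<Longrightarrow> norm (\<Phi> n g - \<Phi>' g) < e / 4" using LIMSEQ_D[OF g(3), of "e / 4"] \<open>0 < e\<close> by auto
  then have "norm (\<Phi> n f - \<Phi>' f) < e" if "N \<le> n" for n
    using close[OF con(1)[of n]] close[OF con(2)] N[OF that] \<open>0 < e\<close> unfolding real_norm_def by linarith
  then show "\<exists>no. \<forall>n\<ge>no. norm (\<Phi> n f - \<Phi>' f) < e" by blast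
qed

text \<open>The coefficient of \<open>\<sigma>\<^sup>a\<close> is what remains of a power series in \<open>\<sigma>\<close>, after the lower terms are
  subtracted and \<open>\<sigma>\<^sup>a\<close> is divided out, as \<open>\<sigma>\<close> tends to 0.  For bounded coefficients the remainder is uniformly
  small, which is what the limit of functionals needs.\<close>

lemma contraction_limit_coefficient:
  fixes N :: "'a \<Rightarrow> nat"
  assumes G: "\<And>B. 0 \<le> G B \<and> G B \<le> 1"
    and lim: "\<And>\<sigma>. 0 < \<sigma> \<Longrightarrow> \<sigma> \<le> 1 \<Longrightarrow> (\<lambda>n. \<Phi> n (\<lambda>B. \<sigma> ^ N B * G B)) \<longlonglongrightarrow> \<Phi>' (\<lambda>B. \<sigma> ^ N B * G B)"
  shows "(\<lambda>n. \<Phi> n (\<lambda>B. if N B = a then G B else 0)) \<longlonglongrightarrow> \<Phi>' (\<lambda>B. if N B = a then G B else 0)"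
proof (induction a rule: less_induct)
  case (less a)
  let ?I = "\<lambda>b B. if N B = b then G B else 0"
  have I: "\<bar>?I b B\<bar> \<le> 1" for b B using G[of B] by auto
  show ?case
  proof (rule contraction_limit_uniform)
    show "\<bar>?I a B\<bar> \<le> 1" for B by (rule I)
    fix \<epsilon> :: real assume "0 < \<epsilon>"
    define \<sigma> where "\<sigma> = min \<epsilon> 1"
    have \<sigma>: "0 < \<sigma>" "\<sigma> \<le> 1" "\<sigma> \<le> \<epsilon>" using \<open>0 < \<epsilon>\<close> by (auto simp: \<sigma>_def)
    have part: "(\<forall>B. \<bar>\<sigma> ^ N B * G B - (\<Sum>b<m. \<sigma> ^ b * ?I b B)\<bar> \<le> 1 + real m) \<and>
        (\<lambda>n. \<Phi> n (\<lambda>B. \<sigma> ^ N B * G B - (\<Sum>b<m. \<sigma> ^ b * ?I b B))) \<longlonglongrightarrow> \<Phi>' (\<lambda>B. \<sigma> ^ N B * G B - (\<Sum>b<m. \<sigma> ^ b * ?I b B))"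
      if "m \<le> a" for m
      using that
    proof (induction m)
      case 0
      have "\<bar>\<sigma> ^ N B * G B\<bar> \<le> 1" for B using G[of B] \<sigma> by (simp add: abs_mult mult_le_one power_le_one)
      then show ?case using lim[OF \<sigma>(1,2)] by simp
    next
      case (Suc m)
      have calc1: "\<bar>\<sigma> ^ m * ?I m B\<bar> \<le> 1" for B
      proof (cases "N B = m")
        case True
        then show ?thesis using G[of B] \<sigma> by (simp add: abs_mult mult_le_one power_le_one)
      qed simp
      have calc2: "\<sigma> ^ N B * G B - (\<Sum>b<Suc m. \<sigma> ^ b * ?I b B)
        = (\<sigma> ^ N B * G B - (\<Sum>b<m. \<sigma> ^ b * ?I b B)) + (- (\<sigma> ^ m)) * ?I m B" for B by simp
      have "\<bar>\<sigma> ^ N B * G B - (\<Sum>b<Suc m. \<sigma> ^ b * ?I b B)\<bar> \<le> 1 + real (Suc m)" for B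
      proof -
        have prev: "\<bar>\<sigma> ^ N B * G B - (\<Sum>b<m. \<sigma> ^ b * ?I b B)\<bar> \<le> 1 + real m" using Suc by simp
        have tri: "\<bar>x + (- s) * y\<bar> \<le> \<bar>x\<bar> + \<bar>s * y\<bar>" for x s y :: real by (simp add: abs_triangle_ineq4)
        have "\<bar>\<sigma> ^ N B * G B - (\<Sum>b<m. \<sigma> ^ b * ?I b B)\<bar> + \<bar>\<sigma> ^ m * ?I m B\<bar> \<le> 1 + real (Suc m)"
          using add_mono[OF prev calc1[of B]] by simp
        then show ?thesis unfolding calc2 by (rule order_trans[OF tri])
      qed
      moreover have "(\<lambda>n. \<Phi> n (\<lambda>B. (\<sigma> ^ N B * G B - (\<Sum>b<m. \<sigma> ^ b * ?I b B)) + (- (\<sigma> ^ m)) * ?I m B))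
        \<longlonglongrightarrow> \<Phi>' (\<lambda>B. (\<sigma> ^ N B * G B - (\<Sum>b<m. \<sigma> ^ b * ?I b B)) + (- (\<sigma> ^ m)) * ?I m B)"
      proof (rule contraction_limit_add)
        show "\<bar>\<sigma> ^ N B * G B - (\<Sum>b<m. \<sigma> ^ b * ?I b B)\<bar> \<le> 1 + real m" for B using Suc by simp
        show "\<bar>?I m B\<bar> \<le> 1" for B by (rule I)
        show "(\<lambda>n. \<Phi> n (?I m)) \<longlonglongrightarrow> \<Phi>' (?I m)" by (rule less.IH) (use Suc.prems in simp)
      qed (use Suc in simp)
      ultimately show ?case unfolding calc2 by blast
    qed
    define g where "g B = 0 + (1 / \<sigma> ^ a) * (\<sigma> ^ N B * G B - (\<Sum>b<a. \<sigma> ^ b * ?I b B))" for B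
    have g: "g B = (if N B < a then 0 else \<sigma> ^ (N B - a) * G B)" for B
    proof -
      have "(\<Sum>b<a. \<sigma> ^ b * ?I b B) = (\<Sum>b<a. if b = N B then \<sigma> ^ N B * G B else 0)" by (intro sum.cong) auto
      also have "\<dots> = (if N B < a then \<sigma> ^ N B * G B else 0)" by (simp add: sum.delta)
      finally show ?thesis using \<sigma> by (auto simp: g_def power_diff field_simps)
    qed
    have gb: "0 \<le> g B \<and> g B \<le> 1" for B using G[of B] \<sigma> by (auto simp: g mult_le_one power_le_one)
    have "\<bar>?I a B - g B\<bar> \<le> \<epsilon>" for B
    proof (cases "N B > a")
      case True
      then obtain d where "N B - a = Suc d" by (metis Suc_diff_Suc)
      then have geq: "g B = \<sigma> * (\<sigma> ^ d * G B)" using True by (simp add: g)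
      have "\<sigma> ^ d * G B \<le> 1" using G[of B] \<sigma> by (simp add: mult_le_one power_le_one)
      then have le: "\<sigma> * (\<sigma> ^ d * G B) \<le> \<sigma> * 1" using \<sigma> by (intro mult_left_mono) auto
      then have "g B \<le> \<epsilon>" using \<sigma>(3) geq by linarith
      moreover have "?I a B = 0" using True by simp
      ultimately show ?thesis using gb[of B] by linarith
    qed (use \<open>0 < \<epsilon>\<close> in \<open>auto simp: g\<close>)
    moreover have "(\<lambda>n. \<Phi> n g) \<longlonglongrightarrow> \<Phi>' g"
      unfolding g_def
    proof (rule contraction_limit_add)
      have z: "l (\<lambda>B. 0) = 0" if "contraction l" for l :: "('a \<Rightarrow> real) \<Rightarrow> real"
        using contraction_bound[OF that, of "\<lambda>_. 0" 0] by simp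
      show "(\<lambda>n. \<Phi> n (\<lambda>B. 0)) \<longlonglongrightarrow> \<Phi>' (\<lambda>B. 0)" using con by (simp add: z)
    qed (use part[of a] in auto)
    ultimately show "\<exists>g. (\<exists>K'. \<forall>B. \<bar>g B\<bar> \<le> K') \<and> (\<forall>B. \<bar>?I a B - g B\<bar> \<le> \<epsilon>) \<and> (\<lambda>n. \<Phi> n g) \<longlonglongrightarrow> \<Phi>' g"
      using gb by (intro exI[of _ g]) (auto intro!: exI[of _ 1])
  qed
qed

end

lemma mset_pgf_fun_upd: "mset_pgf (s(c := \<sigma>)) B = \<sigma> ^ count B c * mset_pgf (s(c := 1)) B"
  by (induction B) (auto simp: mset_pgf_def)

text \<open>One colour of \<open>A\<close> after the other is turned from a free weight into the prescription of its multiplicity.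
  Colours outside of \<open>A\<close> have weight 0 from the beginning, so that only weights of finite support occur.\<close>

lemma pgf_inversion:
  fixes \<Phi> :: "nat \<Rightarrow> ('a multiset \<Rightarrow> real) \<Rightarrow> real"
  assumes con: "\<And>n. contraction (\<Phi> n)" "contraction \<Phi>'"
    and lim: "\<And>s. (\<And>x. 0 \<le> s x \<and> s x \<le> 1) \<Longrightarrow> (\<And>x. x \<notin># A \<Longrightarrow> s x = 0) \<Longrightarrow> (\<lambda>n. \<Phi> n (mset_pgf s)) \<longlonglongrightarrow> \<Phi>' (mset_pgf s)"
  shows "(\<lambda>n. \<Phi> n (\<lambda>B. of_bool (B = A))) \<longlonglongrightarrow> \<Phi>' (\<lambda>B. of_bool (B = A))"
proof -
  \<comment> \<open>the colours in \<open>D\<close> have their multiplicity prescribed, the other ones still carry weights\<close>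
  define \<psi> where "\<psi> D s B = (if \<forall>c\<in>D. count B c = count A c then mset_pgf (\<lambda>x. if x \<in> D then 1 else s x) B else 0)" for D s B
  have "(\<lambda>n. \<Phi> n (\<psi> D s)) \<longlonglongrightarrow> \<Phi>' (\<psi> D s)"
    if "D \<subseteq> set_mset A" "\<And>x. 0 \<le> s x \<and> s x \<le> 1" "\<And>x. x \<notin># A \<Longrightarrow> s x = 0" for D s
  proof -
    have "finite D" using that(1) finite_subset by blast
    then show ?thesis
      using that
    proof (induction D arbitrary: s)
      case empty
      then show ?case using lim[of s] by (simp add: \<psi>_def[abs_def])
    next
      case (insert c D)
      let ?G = "\<psi> D (s(c := 1))"
      have c: "c \<in># A" using insert.prems by auto
      have s1: "0 \<le> (s(c := \<sigma>)) x \<and> (s(c := \<sigma>)) x \<le> 1" if "0 \<le> \<sigma>" "\<sigma> \<le> 1" for x \<sigma>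
        using insert.prems(2)[of x] that by auto
      have upd: "\<psi> D (s(c := \<sigma>)) B = \<sigma> ^ count B c * ?G B" for \<sigma> B
      proof -
        have "(\<lambda>x. if x \<in> D then 1 else (s(c := \<sigma>)) x) = (\<lambda>x. if x \<in> D then 1 else s x)(c := \<sigma>)" for \<sigma>
          using insert.hyps by auto
        then show ?thesis unfolding \<psi>_def using mset_pgf_fun_upd[of _ c \<sigma> B] by simp
      qed
      have "(\<lambda>n. \<Phi> n (\<lambda>B. if count B c = count A c then ?G B else 0)) \<longlonglongrightarrow> \<Phi>' (\<lambda>B. if count B c = count A c then ?G B else 0)"
      proof (rule contraction_limit_coefficient[OF con])
        have "0 \<le> (if x \<in> D then 1 else (s(c := 1)) x) \<and> (if x \<in> D then 1 else (s(c := 1)) x) \<le> 1" for x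
          using s1[of 1 x] by simp
        note b = mset_pgf_bounds[of "\<lambda>x. if x \<in> D then 1 else (s(c := 1)) x", OF this]
        show "0 \<le> ?G B \<and> ?G B \<le> 1" for B
          using b[of B] by (simp only: \<psi>_def split: if_split) simp
        show "(\<lambda>n. \<Phi> n (\<lambda>B. \<sigma> ^ count B c * ?G B)) \<longlonglongrightarrow> \<Phi>' (\<lambda>B. \<sigma> ^ count B c * ?G B)" if "0 < \<sigma>" "\<sigma> \<le> 1" for \<sigma>
          unfolding upd[symmetric]
          by (rule insert.IH) (use insert.prems s1[of \<sigma>] c that in auto)
      qed
      moreover have "(\<lambda>B. if count B c = count A c then ?G B else 0) = \<psi> (insert c D) s"
      proof -
        have "(\<lambda>x. if x \<in> D then 1 else (s(c := 1)) x) = (\<lambda>x. if x \<in> insert c D then 1 else s x)" by auto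
        then show ?thesis unfolding \<psi>_def by (intro ext) simp
      qed
      ultimately show ?case by simp
    qed
  qed
  then have "(\<lambda>n. \<Phi> n (\<psi> (set_mset A) (\<lambda>_. 0))) \<longlonglongrightarrow> \<Phi>' (\<psi> (set_mset A) (\<lambda>_. 0))" by simp
  moreover have "\<psi> (set_mset A) (\<lambda>_. 0) B = of_bool (B = A)" for B
  proof (cases "\<forall>c\<in>#A. count B c = count A c")
    case True
    have "mset_pgf (\<lambda>x. if x \<in># A then 1 else (0 :: real)) B = of_bool (set_mset B \<subseteq> set_mset A)"
      by (induction B) (auto simp: mset_pgf_def)
    moreover have "set_mset B \<subseteq> set_mset A \<longleftrightarrow> B = A"
    proof
      assume "set_mset B \<subseteq> set_mset A"
      then have "count B c = count A c" for c using True by (cases "c \<in># A") (auto simp: not_in_iff)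
      then show "B = A" by (rule multiset_eqI)
    qed simp
    ultimately show ?thesis using True by (simp add: \<psi>_def)
  qed (auto simp: \<psi>_def)
  ultimately show ?thesis by (simp add: \<psi>_def[abs_def])
qed

section \<open>Joint limit law of two fringe trees\<close>

abbreviation (input) "EC \<theta> n \<equiv> measure_pmf.expectation (choice_pmf \<theta> n)"

lemma measurable_vshape_pos [measurable]: "(\<lambda>x. f (vshape c n (pos n x))) \<in> borel \<rightarrow>\<^sub>M count_space UNIV"
  by (rule measurable_compose[OF measurable_pos]) simp

text \<open>A law of large numbers: averaged over the vertices with a bounded weight \<open>h\<close> depending on the age, the value
  of \<open>s\<close> at the fringe tree may be replaced by its limit mean \<open>G\<close> at that age.\<close>

definition shape_lln :: "real \<Rightarrow> (rtree \<Rightarrow> real) \<Rightarrow> (real \<Rightarrow> real) \<Rightarrow> bool" where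
  "shape_lln \<theta> s G \<longleftrightarrow> G \<in> borel_measurable borel \<and> (\<forall>x. 0 \<le> G x \<and> G x \<le> 1) \<and>
     (\<forall>h K. h \<in> borel_measurable borel \<longrightarrow> (\<forall>x. \<bar>h x\<bar> \<le> K) \<longrightarrow>
       (\<lambda>n. EC \<theta> n (\<lambda>c. \<bar>\<integral>y. h y * (s (vshape c n (pos n y)) - G y) \<partial>expo\<bar>)) \<longlonglongrightarrow> 0)"

lemma shape_lln_const: "shape_lln \<theta> (\<lambda>_. 1) (\<lambda>_. 1)"
  by (simp add: shape_lln_def)

context
  fixes \<theta> :: real
  assumes \<theta>: "0 < \<theta>" "\<theta> < 1"
begin

lemma integrable_choice [simp]: "integrable (measure_pmf (choice_pmf \<theta> n)) (g :: _ \<Rightarrow> real)"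
  by (rule integrable_measure_pmf_finite[OF finite_choice_pmf[OF \<theta>]])

lemma EC_eq_sum: "EC \<theta> n g = (\<Sum>c\<in>set_pmf (choice_pmf \<theta> n). pmf (choice_pmf \<theta> n) c * g c)"
  using integral_measure_pmf[OF finite_choice_pmf[OF \<theta>, of n], of "choice_pmf \<theta> n" g] by simp

lemma EC_abs_le_sqrt: "EC \<theta> n (\<lambda>c. \<bar>g c\<bar>) \<le> sqrt (EC \<theta> n (\<lambda>c. (g c)\<^sup>2))"
proof -
  have "0 \<le> measure_pmf.variance (choice_pmf \<theta> n) (\<lambda>c. \<bar>g c\<bar>)" by (rule measure_pmf.variance_positive)
  then have "(EC \<theta> n (\<lambda>c. \<bar>g c\<bar>))\<^sup>2 \<le> EC \<theta> n (\<lambda>c. (g c)\<^sup>2)"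
    by (subst (asm) measure_pmf.variance_eq) auto
  then show ?thesis by (rule real_le_rsqrt)
qed

text \<open>Asymptotic pairwise independence gives the law of large numbers by a second moment bound.\<close>

lemma shape_lln_indicator:
  assumes q: "q \<in> borel_measurable borel" "\<And>x. 0 \<le> q x \<and> q x \<le> 1"
    and one: "\<And>x. 0 < x \<Longrightarrow> (\<lambda>n. EC \<theta> n (\<lambda>c. of_bool (vshape c n (pos n x) = t))) \<longlonglongrightarrow> q x"
    and two: "\<And>x y. 0 < x \<Longrightarrow> 0 < y \<Longrightarrow> x \<noteq> y \<Longrightarrow> (\<lambda>n. EC \<theta> n (\<lambda>c. of_bool (vshape c n (pos n x) = t) * of_bool (vshape c n (pos n y) = t))) \<longlonglongrightarrow> q x * q y"
  shows "shape_lln \<theta> (\<lambda>u. of_bool (u = t)) q"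
  unfolding shape_lln_def
proof (intro conjI allI impI)
  fix h :: "real \<Rightarrow> real" and K assume h [measurable]: "h \<in> borel_measurable borel" and K: "\<forall>x. \<bar>h x\<bar> \<le> K"
  note q(1)[measurable]
  define Z :: "nat \<Rightarrow> _ \<Rightarrow> real \<Rightarrow> real" where "Z n c y = of_bool (vshape c n (pos n y) = t) - q y" for n c y
  have Zm [measurable]: "Z n c \<in> borel_measurable borel" for n c unfolding Z_def by measurable
  have Zb: "\<bar>Z n c y\<bar> \<le> 1" for n c y using q(2)[of y] by (cases "vshape c n (pos n y) = t") (simp_all add: Z_def)
  have K0: "0 \<le> K" using K abs_ge_zero order_trans by blast
  have ZZ: "(\<lambda>n. EC \<theta> n (\<lambda>c. Z n c x * Z n c y)) \<longlonglongrightarrow> 0" if "0 < x" "0 < y" "x \<noteq> y" for x y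
  proof -
    have "EC \<theta> n (\<lambda>c. Z n c x * Z n c y) = EC \<theta> n (\<lambda>c. of_bool (vshape c n (pos n x) = t) * of_bool (vshape c n (pos n y) = t))
      - q y * EC \<theta> n (\<lambda>c. of_bool (vshape c n (pos n x) = t)) - q x * EC \<theta> n (\<lambda>c. of_bool (vshape c n (pos n y) = t)) + q x * q y" for n
      unfolding Z_def by (simp add: algebra_simps)
    moreover have "(\<lambda>n. EC \<theta> n (\<lambda>c. of_bool (vshape c n (pos n x) = t) * of_bool (vshape c n (pos n y) = t))
      - q y * EC \<theta> n (\<lambda>c. of_bool (vshape c n (pos n x) = t)) - q x * EC \<theta> n (\<lambda>c. of_bool (vshape c n (pos n y) = t)) + q x * q y)
      \<longlonglongrightarrow> q x * q y - q y * q x - q x * q y + q x * q y"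
      by (intro tendsto_intros one two that)
    ultimately have "(\<lambda>n. EC \<theta> n (\<lambda>c. Z n c x * Z n c y)) \<longlonglongrightarrow> q x * q y - q y * q x - q x * q y + q x * q y"
      by (simp only:)
    moreover have "q x * q y - q y * q x - q x * q y + q x * q y = 0" by (simp add: algebra_simps)
    ultimately show ?thesis by (simp only:)
  qed
  have ZZb: "\<bar>EC \<theta> n (\<lambda>c. Z n c x * Z n c y)\<bar> \<le> 1" for n x y
  proof -
    have "\<bar>EC \<theta> n (\<lambda>c. Z n c x * Z n c y)\<bar> \<le> EC \<theta> n (\<lambda>c. \<bar>Z n c x * Z n c y\<bar>)" by (rule integral_abs_bound)
    also have "\<dots> \<le> EC \<theta> n (\<lambda>c. 1)"
      by (rule integral_mono) (auto simp: abs_mult intro!: mult_le_one Zb)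
    finally show ?thesis by simp
  qed
  have inth: "integrable expo (\<lambda>y. h y * Z n c y)" for n c
  proof (rule expo.integrable_const_bound[of _ K])
    have "\<bar>h y * Z n c y\<bar> \<le> K" for y
      using mult_mono[OF spec[OF K, of y] Zb[of n c y]] K0 by (simp add: abs_mult)
    then show "AE y in expo. norm (h y * Z n c y) \<le> K" by simp
  qed measurable
  define J where "J n x = EC \<theta> n (\<lambda>c. Z n c x * (\<integral>y. h y * Z n c y \<partial>expo))" for n x
  have J_eq: "J n x = (\<integral>y. h y * EC \<theta> n (\<lambda>c. Z n c x * Z n c y) \<partial>expo)" for n x
  proof -
    have "(\<integral>y. h y * EC \<theta> n (\<lambda>c. Z n c x * Z n c y) \<partial>expo)
      = (\<integral>y. (\<Sum>c\<in>set_pmf (choice_pmf \<theta> n). (pmf (choice_pmf \<theta> n) c * Z n c x) * (h y * Z n c y)) \<partial>expo)"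
      unfolding EC_eq_sum by (simp add: sum_distrib_left mult_ac)
    also have "\<dots> = (\<Sum>c\<in>set_pmf (choice_pmf \<theta> n). (pmf (choice_pmf \<theta> n) c * Z n c x) * (\<integral>y. h y * Z n c y \<partial>expo))"
      using inth by (subst Bochner_Integration.integral_sum) auto
    also have "\<dots> = J n x" unfolding J_def EC_eq_sum by (simp add: mult_ac)
    finally show ?thesis ..
  qed
  have Jm [measurable]: "J n \<in> borel_measurable borel" for n unfolding J_def EC_eq_sum by measurable
  have Jb: "\<bar>J n x\<bar> \<le> K" for n x
  proof -
    have "\<bar>J n x\<bar> \<le> (\<integral>y. \<bar>h y * EC \<theta> n (\<lambda>c. Z n c x * Z n c y)\<bar> \<partial>expo)" unfolding J_eq by (rule integral_abs_bound)
    also have "\<dots> \<le> (\<integral>y. K \<partial>expo)"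
    proof (rule integral_mono')
      show "\<bar>h y * EC \<theta> n (\<lambda>c. Z n c x * Z n c y)\<bar> \<le> K" for y
        using mult_mono[OF spec[OF K, of y] ZZb[of n x y]] K0 by (simp add: abs_mult)
    qed (auto simp: K0)
    finally show ?thesis using expo.prob_space by simp
  qed
  have J0: "(\<lambda>n. J n x) \<longlonglongrightarrow> 0" if "0 < x" for x
  proof -
    have "(\<lambda>n. \<integral>y. h y * EC \<theta> n (\<lambda>c. Z n c x * Z n c y) \<partial>expo) \<longlonglongrightarrow> (\<integral>y. 0 \<partial>expo)"
    proof (rule integral_dominated_convergence[where w = "\<lambda>_. K"])
      show "AE y in expo. (\<lambda>n. h y * EC \<theta> n (\<lambda>c. Z n c x * Z n c y)) \<longlonglongrightarrow> 0"
        using AE_expo_pos AE_expo_neq[of x]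
        by eventually_elim (intro tendsto_mult_right_zero ZZ, use that in auto)
      show "AE y in expo. norm (h y * EC \<theta> n (\<lambda>c. Z n c x * Z n c y)) \<le> K" for n
        by (rule always_eventually, rule allI)
          (use mult_mono[OF spec[OF K] ZZb K0 abs_ge_zero] in \<open>simp add: abs_mult\<close>)
      show "(\<lambda>y. h y * EC \<theta> n (\<lambda>c. Z n c x * Z n c y)) \<in> borel_measurable expo" for n
        unfolding EC_eq_sum by measurable
    qed auto
    then show ?thesis by (simp add: J_eq)
  qed
  have "EC \<theta> n (\<lambda>c. (\<integral>y. h y * Z n c y \<partial>expo)\<^sup>2) = (\<integral>x. h x * J n x \<partial>expo)" for n
  proof -
    have "(\<integral>x. h x * J n x \<partial>expo)
      = (\<integral>x. (\<Sum>c\<in>set_pmf (choice_pmf \<theta> n). (pmf (choice_pmf \<theta> n) c * (\<integral>y. h y * Z n c y \<partial>expo)) * (h x * Z n c x)) \<partial>expo)"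
      unfolding J_def EC_eq_sum by (simp add: sum_distrib_left mult_ac)
    also have "\<dots> = (\<Sum>c\<in>set_pmf (choice_pmf \<theta> n). (pmf (choice_pmf \<theta> n) c * (\<integral>y. h y * Z n c y \<partial>expo)) * (\<integral>y. h y * Z n c y \<partial>expo))"
      using inth by (subst Bochner_Integration.integral_sum) auto
    finally show ?thesis unfolding EC_eq_sum by (simp add: mult_ac power2_eq_square)
  qed
  moreover have "(\<lambda>n. \<integral>x. h x * J n x \<partial>expo) \<longlonglongrightarrow> (\<integral>x. 0 \<partial>expo)"
  proof (rule integral_dominated_convergence[where w = "\<lambda>_. K * K"])
    show "AE x in expo. (\<lambda>n. h x * J n x) \<longlonglongrightarrow> 0"
      using AE_expo_pos by eventually_elim (intro tendsto_mult_right_zero J0)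
    show "AE x in expo. norm (h x * J n x) \<le> K * K" for n
      by (rule always_eventually, rule allI)
        (use mult_mono[OF spec[OF K] Jb K0 abs_ge_zero] in \<open>simp add: abs_mult\<close>)
  qed auto
  ultimately have "(\<lambda>n. sqrt (EC \<theta> n (\<lambda>c. (\<integral>y. h y * Z n c y \<partial>expo)\<^sup>2))) \<longlonglongrightarrow> 0"
    using tendsto_real_sqrt[of _ 0] by simp
  then show "(\<lambda>n. EC \<theta> n (\<lambda>c. \<bar>\<integral>y. h y * (of_bool (vshape c n (pos n y) = t) - q y) \<partial>expo\<bar>)) \<longlonglongrightarrow> 0"
    by (rule tendsto_sandwich[OF _ _ tendsto_const, rotated 2])
       (auto intro!: always_eventually EC_abs_le_sqrt integral_nonneg_AE simp: Z_def[symmetric])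
qed (use q in auto)

text \<open>By linearity the law of large numbers extends to weights of finite support, which is all that the recovery of
  a multiset from generating functions asks for.\<close>

lemma shape_lln_sum:
  assumes "finite A" "\<And>t. t \<in> A \<Longrightarrow> shape_lln \<theta> (\<lambda>u. of_bool (u = t)) (q t)"
    and s: "\<And>u. 0 \<le> s u \<and> s u \<le> 1" "\<And>u. u \<notin> A \<Longrightarrow> s u = 0"
    and G: "G = (\<lambda>x. \<Sum>t\<in>A. s t * q t x)" "\<And>x. G x \<le> 1"
  shows "shape_lln \<theta> s G"
  unfolding shape_lln_def
proof (intro conjI allI impI)
  have qm [measurable]: "q t \<in> borel_measurable borel" and qb: "0 \<le> q t x \<and> q t x \<le> 1" if "t \<in> A" for t x
    using assms(2)[OF that] by (auto simp: shape_lln_def)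
  show "G \<in> borel_measurable borel" unfolding G(1) using qm by measurable
  show "0 \<le> G x" for x unfolding G(1) using qb s by (intro sum_nonneg) auto
  fix h :: "real \<Rightarrow> real" and K assume h [measurable]: "h \<in> borel_measurable borel" and K: "\<forall>x. \<bar>h x\<bar> \<le> K"
  have K0: "0 \<le> K" using K abs_ge_zero order_trans by blast
  have bound: "EC \<theta> n (\<lambda>c. \<bar>\<integral>y. h y * (s (vshape c n (pos n y)) - G y) \<partial>expo\<bar>)
    \<le> (\<Sum>t\<in>A. EC \<theta> n (\<lambda>c. \<bar>\<integral>y. h y * (of_bool (vshape c n (pos n y) = t) - q t y) \<partial>expo\<bar>))" for n
  proof -
    have "\<bar>\<integral>y. h y * (s (vshape c n (pos n y)) - G y) \<partial>expo\<bar>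
      \<le> (\<Sum>t\<in>A. \<bar>\<integral>y. h y * (of_bool (vshape c n (pos n y) = t) - q t y) \<partial>expo\<bar>)" for c
    proof -
      have "h y * (s (vshape c n (pos n y)) - G y)
        = (\<Sum>t\<in>A. s t * (h y * (of_bool (vshape c n (pos n y) = t) - q t y)))" for y
      proof -
        have "s u = (\<Sum>t\<in>A. s t * of_bool (u = t))" for u
          using assms(1) s(2)[of u] by (simp add: of_bool_def if_distrib[of "(*) _"] sum.delta' cong: if_cong)
        from this[of "vshape c n (pos n y)"] show ?thesis
          by (simp add: G(1) sum_subtractf[symmetric] sum_distrib_left algebra_simps)
      qed
      moreover have "integrable expo (\<lambda>y. s t * (h y * (of_bool (vshape c n (pos n y) = t) - q t y)))" if "t \<in> A" for t
      proof (rule expo.integrable_const_bound[of _ K])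
        show "AE y in expo. norm (s t * (h y * (of_bool (vshape c n (pos n y) = t) - q t y))) \<le> K"
        proof (rule always_eventually, rule allI)
          fix y
          have "\<bar>of_bool (vshape c n (pos n y) = t) - q t y\<bar> \<le> 1"
            using qb[OF that, of y] by (cases "vshape c n (pos n y) = t") simp_all
          then have hy: "\<bar>h y\<bar> * \<bar>of_bool (vshape c n (pos n y) = t) - q t y\<bar> \<le> K * 1" using K K0 by (intro mult_mono) auto
          then have "\<bar>s t\<bar> * (\<bar>h y\<bar> * \<bar>of_bool (vshape c n (pos n y) = t) - q t y\<bar>) \<le> 1 * (K * 1)"
            by (intro mult_mono[OF _ hy]) (use s(1)[of t] in auto)
          then show "norm (s t * (h y * (of_bool (vshape c n (pos n y) = t) - q t y))) \<le> K" by (simp add: abs_mult)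
        qed
        show "(\<lambda>y. s t * (h y * (of_bool (vshape c n (pos n y) = t) - q t y))) \<in> borel_measurable expo"
          using qm[OF that] by measurable
      qed
      ultimately have "(\<integral>y. h y * (s (vshape c n (pos n y)) - G y) \<partial>expo)
        = (\<Sum>t\<in>A. s t * (\<integral>y. h y * (of_bool (vshape c n (pos n y) = t) - q t y) \<partial>expo))"
        by (simp add: Bochner_Integration.integral_sum)
      also have "\<bar>\<dots>\<bar> \<le> (\<Sum>t\<in>A. \<bar>s t * (\<integral>y. h y * (of_bool (vshape c n (pos n y) = t) - q t y) \<partial>expo)\<bar>)" by (rule sum_abs)
      also have "\<dots> \<le> (\<Sum>t\<in>A. \<bar>\<integral>y. h y * (of_bool (vshape c n (pos n y) = t) - q t y) \<partial>expo\<bar>)"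
        using s(1) by (intro sum_mono) (auto simp: abs_mult mult_left_le_one_le)
      finally show ?thesis .
    qed
    then have "EC \<theta> n (\<lambda>c. \<bar>\<integral>y. h y * (s (vshape c n (pos n y)) - G y) \<partial>expo\<bar>)
      \<le> EC \<theta> n (\<lambda>c. \<Sum>t\<in>A. \<bar>\<integral>y. h y * (of_bool (vshape c n (pos n y) = t) - q t y) \<partial>expo\<bar>)"
      by (intro integral_mono) auto
    then show ?thesis by simp
  qed
  have "(\<lambda>n. \<Sum>t\<in>A. EC \<theta> n (\<lambda>c. \<bar>\<integral>y. h y * (of_bool (vshape c n (pos n y) = t) - q t y) \<partial>expo\<bar>)) \<longlonglongrightarrow> (\<Sum>t\<in>A. 0)"
  proof (rule tendsto_sum)
    show "(\<lambda>n. EC \<theta> n (\<lambda>c. \<bar>\<integral>y. h y * (of_bool (vshape c n (pos n y) = t) - q t y) \<partial>expo\<bar>)) \<longlonglongrightarrow> 0" if "t \<in> A" for t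
      using assms(2)[OF that] h K unfolding shape_lln_def by blast
  qed
  then show "(\<lambda>n. EC \<theta> n (\<lambda>c. \<bar>\<integral>y. h y * (s (vshape c n (pos n y)) - G y) \<partial>expo\<bar>)) \<longlonglongrightarrow> 0"
    by (intro tendsto_sandwich[OF _ always_eventually[OF allI[OF bound]] tendsto_const])
       (auto intro!: always_eventually integral_nonneg_AE)
qed (use G in auto)

lemma exp_diff_le_nonpos: "a \<le> 0 \<Longrightarrow> b \<le> 0 \<Longrightarrow> \<bar>exp a - exp b\<bar> \<le> \<bar>a - b\<bar>" for a b :: real
proof -
  have *: "exp b - exp a \<le> b - a" if "a \<le> b" "b \<le> 0" for a b :: real
  proof -
    have h: "1 - exp (a - b) \<le> b - a" using exp_ge_add_one_self[of "a - b"] by linarith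
    have "exp b * (1 - exp (a - b)) \<le> 1 * (b - a)"
      by (rule mult_mono[OF _ h]) (use that in auto)
    then show ?thesis by (simp add: algebra_simps exp_diff)
  qed
  show "a \<le> 0 \<Longrightarrow> b \<le> 0 \<Longrightarrow> \<bar>exp a - exp b\<bar> \<le> \<bar>a - b\<bar>"
    using *[of a b] *[of b a] by (cases "a \<le> b") auto
qed

lemma drift_small:
  assumes n: "1 \<le> n" and s: "\<And>u. 0 \<le> s u \<and> s u \<le> 1"
  shows "\<bar>drift \<theta> n (pos n x) s c k\<bar> \<le> exp x / (1 - \<theta>) / n"
proof -
  have "\<bar>drift \<theta> n (pos n x) s c k\<bar> \<le> (if pos n x \<in> window \<theta> k then 1 / card (window \<theta> k) else 0)"
    by (rule drift_bounds(2)[OF \<theta>]) (rule s)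
  also have "\<dots> \<le> exp x / (1 - \<theta>) / n"
  proof (cases "pos n x \<in> window \<theta> k")
    case True
    have pos: "0 < (1 - \<theta>) * (real n * exp (- x))" using n \<theta> by simp
    have "1 / real (card (window \<theta> k)) \<le> 1 / ((1 - \<theta>) * (real n * exp (- x)))"
    proof (rule divide_left_mono)
      show "(1 - \<theta>) * (real n * exp (- x)) \<le> real (card (window \<theta> k))" by (rule card_window_ge_exp[OF \<theta> True])
      with pos have "0 < real (card (window \<theta> k))" by linarith
      then show "0 < real (card (window \<theta> k)) * ((1 - \<theta>) * (real n * exp (- x)))" using pos by (rule mult_pos_pos)
    qed simp
    also have "\<dots> = exp x / (1 - \<theta>) / n" by (simp add: exp_minus divide_simps)
    finally show ?thesis using True by simp
  qed (use \<theta> in simp)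
  finally show ?thesis .
qed

lemma integrable_kernel:
  assumes "f \<in> borel_measurable borel" "\<And>y. \<bar>f y\<bar> \<le> 1"
  shows "integrable expo (\<lambda>y. kernel \<theta> x y * f y)"
proof (rule expo.integrable_const_bound[of _ "exp x / (1 - \<theta>)"])
  have "\<bar>kernel \<theta> x y * f y\<bar> \<le> exp x / (1 - \<theta>)" for y
    using mult_mono[OF kernel_bounds(2)[OF \<theta>, of x y] assms(2)[of y]] kernel_bounds(1)[OF \<theta>, of x y] \<theta>
    by (simp add: abs_mult)
  then show "AE y in expo. norm (kernel \<theta> x y * f y) \<le> exp x / (1 - \<theta>)" by simp
  note assms(1)[measurable]
  have [measurable]: "(\<lambda>y. kernel \<theta> x y) \<in> borel_measurable borel"
    using measurable_Pair2[OF measurable_kernel[of \<theta>, OF \<theta>], of x] by simp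
  show "(\<lambda>y. kernel \<theta> x y * f y) \<in> borel_measurable expo" by measurable
qed

lemma integrable_attach:
  assumes "f \<in> borel_measurable borel" "\<And>y. \<bar>f y\<bar> \<le> 1"
  shows "integrable expo (\<lambda>y. attach \<theta> n x y * f y)"
proof (rule expo.integrable_const_bound[of _ "exp x / (1 - \<theta>)"])
  have "\<bar>attach \<theta> n x y * f y\<bar> \<le> exp x / (1 - \<theta>)" for y
    using mult_mono[OF attach_bounds(2)[OF \<theta>, of n x y] assms(2)[of y]] attach_bounds(1)[OF \<theta>, of n x y] \<theta>
    by (simp add: abs_mult)
  then show "AE y in expo. norm (attach \<theta> n x y * f y) \<le> exp x / (1 - \<theta>)" by simp
  note assms(1)[measurable] measurable_attach[OF \<theta>, measurable]
  show "(\<lambda>y. attach \<theta> n x y * f y) \<in> borel_measurable expo" by measurable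
qed

text \<open>Two replacements: the law of large numbers with weight \<open>kernel \<theta> x\<close> replaces \<open>s\<close> by \<open>G\<close>, and dominated convergence
  replaces \<open>attach\<close> by the kernel, uniformly over the choices because \<open>s\<close> takes values in \<open>[0, 1]\<close>.\<close>

lemma sum_drift_tendsto:
  assumes lln: "shape_lln \<theta> s G" and s: "\<And>u. 0 \<le> s u \<and> s u \<le> 1"
  shows "(\<lambda>n. EC \<theta> n (\<lambda>c. \<bar>(\<Sum>k\<in>{1..<n}. drift \<theta> n (pos n x) s c k) - (\<integral>y. kernel \<theta> x y * (G y - 1) \<partial>expo)\<bar>)) \<longlonglongrightarrow> 0"
proof -
  have G [measurable]: "G \<in> borel_measurable borel" "\<And>x. 0 \<le> G x \<and> G x \<le> 1" using lln by (auto simp: shape_lln_def)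
  have k [measurable]: "(\<lambda>y. kernel \<theta> x y) \<in> borel_measurable borel"
    using measurable_Pair2[OF measurable_kernel[of \<theta>, OF \<theta>], of x] by simp
  note measurable_attach[OF \<theta>, measurable]
  define V where "V n c y = s (vshape c n (pos n y))" for n c y
  have V [measurable]: "V n c \<in> borel_measurable borel" for n c unfolding V_def by measurable
  have V01: "0 \<le> V n c y \<and> V n c y \<le> 1" for n c y unfolding V_def by (rule s)
  define B where "B = exp x / (1 - \<theta>)"
  have akb: "\<bar>attach \<theta> n x y - kernel \<theta> x y\<bar> \<le> B" for n y
    using attach_bounds[OF \<theta>, of n x y] kernel_bounds[OF \<theta>, of x y] by (simp add: B_def abs_le_iff)
  have B0: "0 \<le> B" using \<theta> by (simp add: B_def)
  define a where "a n = (\<integral>y. \<bar>attach \<theta> n x y - kernel \<theta> x y\<bar> \<partial>expo)" for n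
  have a: "a \<longlonglongrightarrow> 0"
  proof -
    have "a \<longlonglongrightarrow> (\<integral>y. 0 \<partial>expo)"
      unfolding a_def
    proof (rule integral_dominated_convergence[where w = "\<lambda>_. B"])
      show "AE y in expo. (\<lambda>n. \<bar>attach \<theta> n x y - kernel \<theta> x y\<bar>) \<longlonglongrightarrow> 0"
        using AE_expo_pos AE_expo_neq[of x] AE_expo_neq[of "x - ln (1 / \<theta>)"]
      proof eventually_elim
        case (elim y)
        have "(\<lambda>n. \<bar>attach \<theta> n x y - kernel \<theta> x y\<bar>) \<longlonglongrightarrow> \<bar>kernel \<theta> x y - kernel \<theta> x y\<bar>"
          by (intro tendsto_intros attach_tendsto[OF \<theta>]) (use elim in auto)
        then show ?case by simp
      qed
      show "AE y in expo. norm \<bar>attach \<theta> n x y - kernel \<theta> x y\<bar> \<le> B" for n using akb by simp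
    qed auto
    then show ?thesis by simp
  qed
  define b where "b n c = \<bar>\<integral>y. kernel \<theta> x y * (V n c y - G y) \<partial>expo\<bar>" for n c
  have b: "(\<lambda>n. EC \<theta> n (b n)) \<longlonglongrightarrow> 0"
  proof -
    have "\<forall>y. \<bar>kernel \<theta> x y\<bar> \<le> B" using kernel_bounds[OF \<theta>, of x] by (simp add: B_def)
    then show ?thesis using lln k unfolding shape_lln_def b_def V_def by blast
  qed
  have main: "\<bar>(\<Sum>k\<in>{1..<n}. drift \<theta> n (pos n x) s c k) - (\<integral>y. kernel \<theta> x y * (G y - 1) \<partial>expo)\<bar> \<le> a n + b n c"
    if n: "1 \<le> n" for n c
  proof -
    have i1: "integrable expo (\<lambda>y. attach \<theta> n x y * (V n c y - 1))" "integrable expo (\<lambda>y. kernel \<theta> x y * (V n c y - 1))"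
      "integrable expo (\<lambda>y. kernel \<theta> x y * (G y - 1))" "integrable expo (\<lambda>y. kernel \<theta> x y * (V n c y - G y))"
    proof -
      have b: "\<bar>V n c y - 1\<bar> \<le> 1" "\<bar>G y - 1\<bar> \<le> 1" "\<bar>V n c y - G y\<bar> \<le> 1" for y
        using V01[of n c y] G(2)[of y] by linarith+
      show "integrable expo (\<lambda>y. attach \<theta> n x y * (V n c y - 1))" by (rule integrable_attach[OF _ b(1)]) measurable
      show "integrable expo (\<lambda>y. kernel \<theta> x y * (V n c y - 1))" by (rule integrable_kernel[OF _ b(1)]) measurable
      show "integrable expo (\<lambda>y. kernel \<theta> x y * (G y - 1))" by (rule integrable_kernel[OF _ b(2)]) measurable
      show "integrable expo (\<lambda>y. kernel \<theta> x y * (V n c y - G y))" by (rule integrable_kernel[OF _ b(3)]) measurable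
    qed
    have "(\<Sum>k\<in>{1..<n}. drift \<theta> n (pos n x) s c k) - (\<integral>y. kernel \<theta> x y * (G y - 1) \<partial>expo)
      = (\<integral>y. attach \<theta> n x y * (V n c y - 1) - kernel \<theta> x y * (G y - 1) \<partial>expo)"
      unfolding sum_drift_eq_integral[OF \<theta> n] V_def[symmetric] using i1 by simp
    also have "\<dots> = (\<integral>y. (attach \<theta> n x y * (V n c y - 1) - kernel \<theta> x y * (V n c y - 1)) + kernel \<theta> x y * (V n c y - G y) \<partial>expo)"
      by (rule Bochner_Integration.integral_cong) (auto simp: algebra_simps)
    also have "\<dots> = (\<integral>y. attach \<theta> n x y * (V n c y - 1) - kernel \<theta> x y * (V n c y - 1) \<partial>expo) + (\<integral>y. kernel \<theta> x y * (V n c y - G y) \<partial>expo)"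
      using i1 by simp
    also have "\<bar>\<dots>\<bar> \<le> a n + b n c"
    proof -
      have "\<bar>\<integral>y. attach \<theta> n x y * (V n c y - 1) - kernel \<theta> x y * (V n c y - 1) \<partial>expo\<bar>
        \<le> (\<integral>y. \<bar>attach \<theta> n x y * (V n c y - 1) - kernel \<theta> x y * (V n c y - 1)\<bar> \<partial>expo)" by (rule integral_abs_bound)
      also have "\<dots> \<le> a n"
        unfolding a_def
      proof (rule integral_mono')
        show "integrable expo (\<lambda>y. \<bar>attach \<theta> n x y - kernel \<theta> x y\<bar>)"
          by (rule expo.integrable_const_bound[of _ B]) (use akb in auto)
        show "\<bar>attach \<theta> n x y * (V n c y - 1) - kernel \<theta> x y * (V n c y - 1)\<bar> \<le> \<bar>attach \<theta> n x y - kernel \<theta> x y\<bar>" for y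
        proof -
          have "\<bar>attach \<theta> n x y - kernel \<theta> x y\<bar> * \<bar>V n c y - 1\<bar> \<le> \<bar>attach \<theta> n x y - kernel \<theta> x y\<bar> * 1"
            using V01[of n c y] by (intro mult_left_mono) auto
          then show ?thesis by (simp add: abs_mult[symmetric] algebra_simps)
        qed
      qed auto
      finally show ?thesis unfolding b_def by linarith
    qed
    finally show ?thesis .
  qed
  show ?thesis
  proof (rule tendsto_sandwich[OF _ _ tendsto_const])
    show "\<forall>\<^sub>F n in sequentially. EC \<theta> n (\<lambda>c. \<bar>(\<Sum>k\<in>{1..<n}. drift \<theta> n (pos n x) s c k) - (\<integral>y. kernel \<theta> x y * (G y - 1) \<partial>expo)\<bar>) \<le> a n + EC \<theta> n (b n)"
      using eventually_ge_at_top[of 1]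
    proof eventually_elim
      case (elim n)
      have "EC \<theta> n (\<lambda>c. \<bar>(\<Sum>k\<in>{1..<n}. drift \<theta> n (pos n x) s c k) - (\<integral>y. kernel \<theta> x y * (G y - 1) \<partial>expo)\<bar>)
        \<le> EC \<theta> n (\<lambda>c. a n + b n c)"
        by (rule integral_mono) (use main[OF elim] in auto)
      then show ?case by simp
    qed
    show "(\<lambda>n. a n + EC \<theta> n (b n)) \<longlonglongrightarrow> 0" using tendsto_add[OF a b] by simp
  qed (auto intro!: always_eventually integral_nonneg_AE)
qed

text \<open>Each drift is of order \<open>1 / n\<close>, so the product of the conditional means is close to the exponential of the
  sum of the drifts.  That sum converges, and the drifts of the two vertices enter it additively, which is why the
  limit factorises.\<close>

lemma pgf_pair_limit:
  assumes lln: "shape_lln \<theta> s G" "shape_lln \<theta> s' G'"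
    and s: "\<And>u. 0 \<le> s u \<and> s u \<le> 1" and s': "\<And>u. 0 \<le> s' u \<and> s' u \<le> 1"
    and xy: "0 < x" "0 < y" "x \<noteq> y"
  shows "(\<lambda>n. EC \<theta> n (\<lambda>c. mset_pgf s (subtrees (vshape c n (pos n x))) * mset_pgf s' (subtrees (vshape c n (pos n y)))))
    \<longlonglongrightarrow> exp (\<integral>z. kernel \<theta> x z * (G z - 1) \<partial>expo) * exp (\<integral>z. kernel \<theta> y z * (G' z - 1) \<partial>expo)"
proof -
  define \<sigma> where "\<sigma> = (\<integral>z. kernel \<theta> x z * (G z - 1) \<partial>expo)"
  define \<sigma>' where "\<sigma>' = (\<integral>z. kernel \<theta> y z * (G' z - 1) \<partial>expo)"
  define S where "S n c = (\<Sum>k\<in>{1..<n}. drift \<theta> n (pos n x) s c k)" for n c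
  define S' where "S' n c = (\<Sum>k\<in>{1..<n}. drift \<theta> n (pos n y) s' c k)" for n c
  define P where "P n c = (\<Prod>k\<in>{1..<n}. 1 + drift \<theta> n (pos n x) s c k + drift \<theta> n (pos n y) s' c k)" for n c
  define B where "B = exp x / (1 - \<theta>) + exp y / (1 - \<theta>)"
  have B0: "0 \<le> B" using \<theta> by (simp add: B_def)
  have neg_int: "(\<integral>z. f z \<partial>expo) \<le> 0" if "\<And>z. f z \<le> 0" for f :: "real \<Rightarrow> real"
    using integral_nonneg_AE[of "\<lambda>z. - f z" expo] that by simp
  have neg: "\<sigma> \<le> 0" "\<sigma>' \<le> 0"
    using lln kernel_bounds(1)[OF \<theta>] unfolding \<sigma>_def \<sigma>'_def shape_lln_def
    by (auto intro!: neg_int mult_nonneg_nonpos)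
  have Sneg: "S n c \<le> 0" "S' n c \<le> 0" for n c
    unfolding S_def S'_def by (intro sum_nonpos drift_bounds(1)[OF \<theta>] s s')+
  have dsum: "\<bar>drift \<theta> n (pos n x) s c k + drift \<theta> n (pos n y) s' c k\<bar> \<le> B / n" if "1 \<le> n" for n c k
    using drift_small[where s = s and x = x and c = c and k = k, OF that s] drift_small[where s = s' and x = y and c = c and k = k, OF that s']
    by (simp add: B_def add_divide_distrib)
  have PS: "\<bar>P n c - exp (S n c + S' n c)\<bar> \<le> B\<^sup>2 / n" if n: "1 \<le> n" "B \<le> n" for n c
  proof -
    have "\<bar>P n c - exp (S n c + S' n c)\<bar> \<le> (\<Sum>k\<in>{1..<n}. (drift \<theta> n (pos n x) s c k + drift \<theta> n (pos n y) s' c k)\<^sup>2)"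
      unfolding P_def S_def S'_def sum.distrib[symmetric] add.assoc
    proof (rule prod_one_plus_approx_exp[OF \<theta>])
      fix k
      have "B / n \<le> 1" using n by simp
      then have "\<bar>drift \<theta> n (pos n x) s c k + drift \<theta> n (pos n y) s' c k\<bar> \<le> 1"
        using dsum[OF n(1), of c k] by linarith
      moreover have "drift \<theta> n (pos n x) s c k + drift \<theta> n (pos n y) s' c k \<le> 0"
        by (intro add_nonpos_nonpos drift_bounds(1)[OF \<theta>] s s')
      ultimately show "- 1 \<le> drift \<theta> n (pos n x) s c k + drift \<theta> n (pos n y) s' c k \<and> drift \<theta> n (pos n x) s c k + drift \<theta> n (pos n y) s' c k \<le> 0"
        by linarith
    qed simp
    also have "\<dots> \<le> (\<Sum>k\<in>{1..<n}. (B / n)\<^sup>2)"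
    proof (rule sum_mono)
      show "(drift \<theta> n (pos n x) s c k + drift \<theta> n (pos n y) s' c k)\<^sup>2 \<le> (B / n)\<^sup>2" for k
        using power_mono[OF dsum[OF n(1), of c k] abs_ge_zero, of 2] by simp
    qed
    also have "\<dots> \<le> real n * (B / n)\<^sup>2" by (simp add: mult_right_mono)
    also have "\<dots> = B\<^sup>2 / n" using n by (simp add: power2_eq_square)
    finally show ?thesis .
  qed
  have Pd: "\<bar>P n c - exp \<sigma> * exp \<sigma>'\<bar> \<le> B\<^sup>2 / n + \<bar>S n c - \<sigma>\<bar> + \<bar>S' n c - \<sigma>'\<bar>" if n: "1 \<le> n" "B \<le> n" for n c
  proof -
    have "\<bar>exp (S n c + S' n c) - exp (\<sigma> + \<sigma>')\<bar> \<le> \<bar>(S n c + S' n c) - (\<sigma> + \<sigma>')\<bar>"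
      using Sneg[of n c] neg by (intro exp_diff_le_nonpos) auto
    then show ?thesis using PS[OF n, of c] unfolding exp_add[symmetric] by linarith
  qed
  have lim: "(\<lambda>n. exp (2 * B) * (B\<^sup>2 * (1 / n) + EC \<theta> n (\<lambda>c. \<bar>S n c - \<sigma>\<bar>) + EC \<theta> n (\<lambda>c. \<bar>S' n c - \<sigma>'\<bar>))) \<longlonglongrightarrow> exp (2 * B) * (B\<^sup>2 * 0 + 0 + 0)"
    unfolding S_def S'_def \<sigma>_def \<sigma>'_def
    by (intro tendsto_intros lim_1_over_n sum_drift_tendsto lln s s')
  have ev1: "\<forall>\<^sub>F n in sequentially. pos n x \<noteq> pos n y"
  proof -
    have "(\<lambda>n. real (pos n x) / real n - real (pos n y) / real n) \<longlonglongrightarrow> exp (- x) - exp (- y)"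
      by (intro tendsto_intros pos_over_n)
    moreover have "exp (- x) - exp (- y) \<noteq> 0" using xy by simp
    ultimately have "\<forall>\<^sub>F n in sequentially. real (pos n x) / real n - real (pos n y) / real n \<noteq> 0"
      by (rule tendsto_imp_eventually_ne)
    then show ?thesis by eventually_elim auto
  qed
  have ev2: "\<forall>\<^sub>F n in sequentially. 4 \<le> (1 - \<theta>) * (real n * exp (- z))" for z
  proof -
    have "filterlim (\<lambda>n. ((1 - \<theta>) * exp (- z)) * real n) at_top sequentially"
      by (rule filterlim_tendsto_pos_mult_at_top[OF tendsto_const _ filterlim_real_sequentially]) (use \<theta> in simp)
    then have "\<forall>\<^sub>F n in sequentially. 4 \<le> ((1 - \<theta>) * exp (- z)) * real n" by (simp add: filterlim_at_top)
    then show ?thesis by eventually_elim (simp add: mult_ac)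
  qed
  have ev3: "\<forall>\<^sub>F n in sequentially. B \<le> real n"
    using filterlim_real_sequentially by (simp add: filterlim_at_top)
  have "\<forall>\<^sub>F n in sequentially. norm (EC \<theta> n (\<lambda>c. mset_pgf s (subtrees (vshape c n (pos n x))) * mset_pgf s' (subtrees (vshape c n (pos n y)))) - exp \<sigma> * exp \<sigma>')
    \<le> exp (2 * B) * (B\<^sup>2 * (1 / n) + EC \<theta> n (\<lambda>c. \<bar>S n c - \<sigma>\<bar>) + EC \<theta> n (\<lambda>c. \<bar>S' n c - \<sigma>'\<bar>))"
    using ev1 ev2[of x] ev2[of y] ev3 eventually_ge_at_top[of 1]
  proof eventually_elim
    case (elim n)
    have pr: "1 \<le> pos n x" "1 \<le> pos n y" using pos_range[OF elim(5)] xy by auto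
    have "\<bar>EC \<theta> n (\<lambda>c. mset_pgf s (subtrees (vshape c n (pos n x))) * mset_pgf s' (subtrees (vshape c n (pos n y)))) - exp \<sigma> * exp \<sigma>'\<bar>
      \<le> exp (2 * B) * EC \<theta> n (\<lambda>c. \<bar>(\<Prod>k\<in>{1..<n}. 1 + drift \<theta> n (pos n x) s c k + drift \<theta> n (pos n y) s' c k) - exp \<sigma> * exp \<sigma>'\<bar>)"
    proof (rule pgf_error_bound[OF \<theta> pr elim(1,5) s s'])
      show "4 \<le> card (window \<theta> k)" if "pos n x \<in> window \<theta> k \<or> pos n y \<in> window \<theta> k" for k
        using that card_window_ge_exp[OF \<theta>, of n x k] card_window_ge_exp[OF \<theta>, of n y k] elim(2,3) by linarith
      show "- (\<Sum>k\<in>{1..<n}. drift \<theta> n (pos n x) s c k + drift \<theta> n (pos n y) s' c k) \<le> B" for c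
      proof -
        have "- (\<Sum>k\<in>{1..<n}. drift \<theta> n (pos n x) s c k + drift \<theta> n (pos n y) s' c k) \<le> (\<Sum>k\<in>{1..<n}. B / n)"
          unfolding sum_negf[symmetric] by (rule sum_mono) (use dsum[OF elim(5), of c] in \<open>auto simp: abs_le_iff\<close>)
        also have "\<dots> \<le> real n * (B / n)" unfolding sum_constant by (intro mult_right_mono) (use B0 in auto)
        finally show ?thesis using elim(5) by simp
      qed
    qed
    also have "\<dots> \<le> exp (2 * B) * EC \<theta> n (\<lambda>c. B\<^sup>2 / n + \<bar>S n c - \<sigma>\<bar> + \<bar>S' n c - \<sigma>'\<bar>)"
      unfolding P_def[symmetric] by (intro mult_left_mono integral_mono) (use Pd[OF elim(5,4)] in auto)
    finally show ?case by simp
  qed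
  from Lim_null_comparison[OF this] lim
  have "(\<lambda>n. EC \<theta> n (\<lambda>c. mset_pgf s (subtrees (vshape c n (pos n x))) * mset_pgf s' (subtrees (vshape c n (pos n y)))) - exp \<sigma> * exp \<sigma>') \<longlonglongrightarrow> 0"
    by simp
  then show ?thesis unfolding \<sigma>_def[symmetric] \<sigma>'_def[symmetric] by (rule LIM_zero_cancel)
qed

end

section \<open>The genealogy of the branching process\<close>

lemma genealogy_simps [simp]:
  "verts (genealogy x t) = {u. born x u \<and> birth_time x u \<le> t}"
  "troot (genealogy x t) = []" "parent (genealogy x t) = tl"
  by (simp_all add: genealogy_def)

definition bp_shape :: "(nat list \<Rightarrow> real set) \<Rightarrow> real \<Rightarrow> ftree" where
  "bp_shape x t = iso_class (genealogy x t)"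

text \<open>A word lists birth ranks from the individual back to the root, so \<open>v @ w\<close> is the descendant \<open>v\<close> of \<open>w\<close>.\<close>

definition from_word :: "nat list \<Rightarrow> (nat list \<Rightarrow> real set) \<Rightarrow> nat list \<Rightarrow> real set" where
  "from_word w x = (\<lambda>v. x (v @ w))"

definition kth_point :: "nat \<Rightarrow> real set \<Rightarrow> real" where
  "kth_point k S = (if k < card S then sorted_list_of_set S ! k else 0)"

lemma from_word_Nil [simp]: "from_word [] x = x" by (simp add: from_word_def)

lemma from_word_Cons: "from_word [k] (from_word w x) = from_word (k # w) x" by (simp add: from_word_def)

definition valid_config :: "real set \<Rightarrow> bool" where "valid_config S \<longleftrightarrow> finite S \<and> (\<forall>s\<in>S. 0 \<le> s)"

lemma kth_point_in: "finite S \<Longrightarrow> k < card S \<Longrightarrow> kth_point k S \<in> S"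
  using nth_mem[of k "sorted_list_of_set S"] by (simp add: kth_point_def)

lemma card_below_kth_point:
  assumes S: "finite S" and k: "k < card S"
  shows "kth_point k S \<le> y \<longleftrightarrow> k < card (S \<inter> {..y})"
proof -
  define xs where "xs = sorted_list_of_set S"
  have xs: "sorted xs" "distinct xs" "set xs = S" "length xs = card S" using S by (simp_all add: xs_def)
  have mono: "xs ! i \<le> xs ! j" if "i \<le> j" "j < card S" for i j using sorted_nth_mono[OF xs(1) that(1)] that xs by simp
  have inj: "inj_on ((!) xs) {..<card S}" using xs by (intro inj_on_nth) auto
  show ?thesis
  proof
    assume "kth_point k S \<le> y"
    then have "xs ! k \<le> y" using k by (simp add: kth_point_def xs_def)
    then have "xs ! i \<in> S \<inter> {..y}" if "i \<le> k" for i
      using mono[OF that k] k that nth_mem[of i xs] xs(3,4) by simp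
    then have "(!) xs ` {..k} \<subseteq> S \<inter> {..y}" by blast
    then have "card ((!) xs ` {..k}) \<le> card (S \<inter> {..y})" using S by (intro card_mono) auto
    moreover have "card ((!) xs ` {..k}) = Suc k"
      using inj_on_subset[OF inj, of "{..k}"] k by (simp add: card_image subset_iff)
    ultimately show "k < card (S \<inter> {..y})" by simp
  next
    assume lt: "k < card (S \<inter> {..y})"
    show "kth_point k S \<le> y"
    proof (rule ccontr)
      assume "\<not> ?thesis"
      then have gt: "y < xs ! k" using k by (simp add: kth_point_def xs_def)
      have "S \<inter> {..y} \<subseteq> (!) xs ` {..<k}"
      proof
        fix s assume s: "s \<in> S \<inter> {..y}"
        then obtain i where i: "i < card S" "s = xs ! i" using xs by (metis IntD1 in_set_conv_nth)
        then have "i < k" using mono[of k i] gt s by (metis IntD2 atMost_iff leD not_le order_trans)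
        then show "s \<in> (!) xs ` {..<k}" using i by auto
      qed
      then have "card (S \<inter> {..y}) \<le> card ((!) xs ` {..<k})" by (intro card_mono) auto
      also have "\<dots> \<le> k" using card_image_le[of "{..<k}" "(!) xs"] by simp
      finally show False using lt by simp
    qed
  qed
qed

lemma bij_betw_kth_point:
  assumes S: "finite S"
  shows "bij_betw (\<lambda>k. kth_point k S) {..<card (S \<inter> {..y})} (S \<inter> {..y})"
proof (rule bij_betw_imageI)
  have le: "card (S \<inter> {..y}) \<le> card S" using S by (intro card_mono) auto
  have inj: "inj_on ((!) (sorted_list_of_set S)) {..<card S}" using S by (intro inj_on_nth) auto
  show inj': "inj_on (\<lambda>k. kth_point k S) {..<card (S \<inter> {..y})}"
    using inj le by (auto simp: inj_on_def kth_point_def)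
  have "(\<lambda>k. kth_point k S) ` {..<card (S \<inter> {..y})} \<subseteq> S \<inter> {..y}"
    using card_below_kth_point[OF S, of _ y] kth_point_in[OF S] le by fastforce
  then show "(\<lambda>k. kth_point k S) ` {..<card (S \<inter> {..y})} = S \<inter> {..y}"
    using S inj' by (intro card_subset_eq) (auto simp: card_image)
qed

context
  fixes x :: "nat list \<Rightarrow> real set"
  assumes val: "\<And>u. valid_config (x u)"
begin

lemma born_birth_kth: "k < card (x u) \<Longrightarrow> birth_time x (k # u) = birth_time x u + kth_point k (x u)"
  by (simp add: kth_point_def)

lemma born_append: "born x (v @ w) \<longleftrightarrow> born x w \<and> born (from_word w x) v"
  by (induction v) (auto simp: from_word_def)

lemma birth_time_append: "birth_time x (v @ w) = birth_time x w + birth_time (from_word w x) v"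
  by (induction v) (auto simp: from_word_def)

lemma rooted_genealogy: "0 \<le> t \<Longrightarrow> rooted_tree (genealogy x t)"
proof -
  assume t: "0 \<le> t"
  have h: "(tl ^^ length v) v = []" for v :: "nat list" by (induction v) (simp_all add: funpow_swap1)
  have "tl v \<in> verts (genealogy x t)" if "v \<in> verts (genealogy x t)" "v \<noteq> []" for v
  proof -
    obtain k u where v: "v = k # u" using \<open>v \<noteq> []\<close> by (cases v) auto
    then have "0 \<le> kth_point k (x u)" using that kth_point_in[of "x u" k] val[of u] by (auto simp: valid_config_def)
    then show ?thesis using that v born_birth_kth[of k u] by auto
  qed
  then show ?thesis using t h unfolding rooted_tree_def by auto
qed

lemma append_in_genealogy_iff:
  "v @ [k] \<in> verts (genealogy x t) \<longleftrightarrow> k < card (x [] \<inter> {..t}) \<and> v \<in> verts (genealogy (from_word [k] x) (t - kth_point k (x [])))"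
proof -
  have fin: "finite (x [])" using val by (simp add: valid_config_def)
  have le: "card (x [] \<inter> {..t}) \<le> card (x [])" using fin by (intro card_mono) auto
  have val': "valid_config (from_word [k] x u)" for u using val by (simp add: from_word_def)
  have "birth_time x (v @ [k]) = kth_point k (x []) + birth_time (from_word [k] x) v" if "k < card (x [])"
    using that by (simp add: birth_time_append kth_point_def)
  moreover have "k < card (x [] \<inter> {..t})" if "k < card (x [])" "born (from_word [k] x) v" "birth_time x (v @ [k]) \<le> t"
  proof -
    have "0 \<le> birth_time (from_word [k] x) v"
    proof -
      have "born y v \<Longrightarrow> 0 \<le> birth_time y v" if "\<And>u. valid_config (y u)" for y v
      proof (induction v)
        case (Cons j u)
        have "0 \<le> kth_point j (y u)" using kth_point_in[of "y u" j] Cons.prems that[of u] by (auto simp: valid_config_def)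
        then show ?case using Cons by (simp add: kth_point_def)
      qed simp
      from this[OF val' that(2)] show ?thesis .
    qed
    then have "kth_point k (x []) \<le> t" using that(3) calculation[OF that(1)] by linarith
    then show ?thesis using card_below_kth_point[OF fin that(1)] by simp
  qed
  ultimately show ?thesis using le by (auto simp: born_append)
qed

end

lemma kids_genealogy: "kids (genealogy x t) v = {k # v | k. k # v \<in> verts (genealogy x t)}"
  by (auto simp: kids_def neq_Nil_conv)

lemma shape_upto_genealogy_append:
  assumes val: "\<And>u. valid_config (x u)" and k: "k < card (x [] \<inter> {..t})"
  shows "shape_upto h (genealogy x t) (v @ [k]) = shape_upto h (genealogy (from_word [k] x) (t - kth_point k (x []))) v"
proof (induction h arbitrary: v)
  case (Suc h)
  let ?y = "from_word [k] x" and ?s = "t - kth_point k (x [])"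
  have "kids (genealogy x t) (v @ [k]) = (\<lambda>w. w @ [k]) ` kids (genealogy ?y ?s) v"
  proof -
    have "j # v @ [k] \<in> verts (genealogy x t) \<longleftrightarrow> j # v \<in> verts (genealogy ?y ?s)" for j
      using append_in_genealogy_iff[where x = x, OF val, of "j # v" k t] k by simp
    then show ?thesis unfolding kids_genealogy by (auto simp del: genealogy_simps)
  qed
  moreover have "inj_on (\<lambda>w. w @ [k]) (kids (genealogy ?y ?s) v)" by (simp add: inj_on_def)
  ultimately show ?case
    using Suc.IH by (simp add: multiset.map_comp comp_def image_mset_mset_set[symmetric])
qed simp

text \<open>The genealogy splits at the root into the genealogies started by its children.  It is finite if and only if all
  of these are, as there are finitely many children.\<close>

lemma bp_shape_rec:
  assumes val: "\<And>u. valid_config (x u)" and t: "0 \<le> t"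
  defines "m \<equiv> card (x [] \<inter> {..t})"
  defines "B \<equiv> \<lambda>k. bp_shape (from_word [k] x) (t - kth_point k (x []))"
  shows "bp_shape x t = (if \<forall>k<m. B k \<noteq> None then Some (Node (image_mset (\<lambda>k. the (B k)) (mset_set {..<m}))) else None)"
proof -
  let ?V = "verts (genealogy x t)"
  let ?U = "\<lambda>k. verts (genealogy (from_word [k] x) (t - kth_point k (x [])))"
  have fin: "finite (x [])" using val by (simp add: valid_config_def)
  have le: "m \<le> card (x [])" unfolding m_def using fin by (intro card_mono) auto
  have V: "?V = insert [] (\<Union>k<m. (\<lambda>v. v @ [k]) ` ?U k)"
  proof (intro equalityI subsetI)
    fix u assume u: "u \<in> ?V"
    show "u \<in> insert [] (\<Union>k<m. (\<lambda>v. v @ [k]) ` ?U k)"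
    proof (cases u rule: rev_cases)
      case (snoc v k)
      then show ?thesis using u append_in_genealogy_iff[where x = x, OF val, of v k t] by (auto simp: m_def simp del: genealogy_simps)
    qed simp
  next
    fix u assume "u \<in> insert [] (\<Union>k<m. (\<lambda>v. v @ [k]) ` ?U k)"
    then consider "u = []" | k v where "k < m" "v \<in> ?U k" "u = v @ [k]" by auto
    then show "u \<in> ?V"
    proof cases
      case 2
      then show ?thesis using append_in_genealogy_iff[where x = x, OF val, of v k t] by (simp add: m_def del: genealogy_simps)
    qed (use t in simp)
  qed
  have t': "0 \<le> t - kth_point k (x [])" if "k < m" for k
    using card_below_kth_point[OF fin, of k t] that le by (simp add: m_def)
  have val': "valid_config (from_word [k] x u)" for k u using val by (simp add: from_word_def)
  have root: "[] \<in> ?U k" if "k < m" for k using t'[OF that] by simp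
  have B_None: "B k = None \<longleftrightarrow> infinite (?U k)" if "k < m" for k
    using root[OF that] unfolding B_def bp_shape_def iso_class_def by (auto simp del: genealogy_simps)
  show ?thesis
  proof (cases "\<forall>k<m. B k \<noteq> None")
    case False
    then obtain k where k: "k < m" "infinite (?U k)" using B_None by blast
    have "infinite ((\<lambda>v. v @ [k]) ` ?U k)" using k(2) by (subst finite_image_iff) (auto simp: inj_on_def)
    moreover have "(\<lambda>v. v @ [k]) ` ?U k \<subseteq> ?V" unfolding V using k(1) by blast
    ultimately have "infinite ?V" using finite_subset by blast
    then show ?thesis using False unfolding bp_shape_def iso_class_def by (simp del: genealogy_simps)
  next
    case True
    then have finU: "finite (?U k)" if "k < m" for k using B_None that by blast
    then have finV: "finite ?V" unfolding V by (auto simp del: genealogy_simps)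
    have "[] \<in> ?V" using t by simp
    then obtain h where h: "card ?V = Suc h" using finV by (metis card_gt_0_iff empty_iff gr0_implies_Suc)
    have cardU: "card (?U k) \<le> h" if "k < m" for k
    proof -
      have "card (?U k) = card ((\<lambda>v. v @ [k]) ` ?U k)" by (rule card_image[symmetric]) (simp add: inj_on_def)
      also have "\<dots> \<le> card (?V - {[]})" using that finV unfolding V by (intro card_mono) auto
      also have "\<dots> = h" using h finV \<open>[] \<in> ?V\<close> by (simp del: genealogy_simps)
      finally show ?thesis .
    qed
    have shape: "shape_upto h (genealogy x t) [k] = the (B k)" if k: "k < m" for k
    proof -
      let ?g = "genealogy (from_word [k] x) (t - kth_point k (x []))"
      have rt: "rooted_tree ?g" by (rule rooted_genealogy[where x = "from_word [k] x", OF val' t'[OF k]])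
      have "shape_upto (card (?U k) + (h - card (?U k))) ?g [] = shape_upto (card (?U k)) ?g []"
        by (rule shape_upto_add[OF rt]) (use depth_less_card[OF rt finU[OF k]] in \<open>force simp del: genealogy_simps\<close>)
      then have "shape_upto h ?g [] = shape_upto (card (?U k)) ?g []" using cardU[OF k] by simp
      moreover have "B k = Some (shape_upto (card (?U k)) ?g [])"
      proof -
        have "?U k \<noteq> {}" using root[OF k] by blast
        then show ?thesis
          using finU[OF k] unfolding B_def bp_shape_def iso_class_def by (simp del: genealogy_simps(1))
      qed
      ultimately show ?thesis using shape_upto_genealogy_append[where x = x, OF val, of k t h "[]"] k by (simp add: m_def del: genealogy_simps)
    qed
    have kids: "kids (genealogy x t) [] = (\<lambda>k. [k]) ` {..<m}"
    proof -
      have "[k] \<in> ?V \<longleftrightarrow> k < m" for k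
        using append_in_genealogy_iff[where x = x, OF val, of "[]" k t] root[of k] by (auto simp: m_def simp del: genealogy_simps)
      then show ?thesis unfolding kids_genealogy by auto
    qed
    have "shape_upto (Suc h) (genealogy x t) [] = Node (image_mset (\<lambda>k. the (B k)) (mset_set {..<m}))"
    proof -
      have "mset_set ((\<lambda>k. [k]) ` {..<m}) = image_mset (\<lambda>k. [k]) (mset_set {..<m})"
        by (simp add: image_mset_mset_set inj_on_def)
      then have "image_mset (shape_upto h (genealogy x t)) (mset_set (kids (genealogy x t) []))
        = image_mset (\<lambda>k. shape_upto h (genealogy x t) [k]) (mset_set {..<m})"
        unfolding kids by (simp add: multiset.map_comp comp_def)
      also have "\<dots> = image_mset (\<lambda>k. the (B k)) (mset_set {..<m})"
        by (rule image_mset_cong) (simp add: shape)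
      finally show ?thesis by simp
    qed
    moreover have "?V \<noteq> {}" using \<open>[] \<in> ?V\<close> by blast
    ultimately show ?thesis using True finV h unfolding bp_shape_def iso_class_def
      by (simp del: genealogy_simps(1) shape_upto.simps)
  qed
qed

subsection \<open>Measurability\<close>

lemma space_point_configs: "space (point_configs I) = {S. finite S \<and> S \<subseteq> I}"
  unfolding point_configs_def by (rule space_measure_of) auto

lemma measurable_card_inter [measurable]:
  assumes [measurable]: "A \<in> sets borel"
  shows "(\<lambda>S. card (S \<inter> A)) \<in> point_configs I \<rightarrow>\<^sub>M count_space UNIV"
proof (rule measurable_count_space_eq2_countable[THEN iffD2])
  show "(\<lambda>S. card (S \<inter> A)) \<in> space (point_configs I) \<rightarrow> UNIV \<and>
    (\<forall>a\<in>UNIV. (\<lambda>S. card (S \<inter> A)) -` {a} \<inter> space (point_configs I) \<in> sets (point_configs I))"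
  proof (intro conjI ballI)
    fix a
    have "(\<lambda>S. card (S \<inter> A)) -` {a} \<inter> space (point_configs I) = {S. finite S \<and> S \<subseteq> I \<and> card (S \<inter> A) = a}"
      by (auto simp: space_point_configs)
    also have "\<dots> \<in> sets (point_configs I)"
      unfolding point_configs_def
      by (subst sets_measure_of) (auto intro!: sigma_sets.Basic exI[of _ A] exI[of _ a])
    finally show "(\<lambda>S. card (S \<inter> A)) -` {a} \<inter> space (point_configs I) \<in> sets (point_configs I)" .
  qed simp
qed

lemma measurable_card_config [measurable]: "card \<in> point_configs I \<rightarrow>\<^sub>M count_space UNIV"
  using measurable_card_inter[of UNIV I] by simp

lemma measurable_kth_point [measurable]: "kth_point k \<in> borel_measurable (point_configs I)"
proof (rule borel_measurableI_le)
  fix y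
  have kth0: "kth_point k S = 0" if "\<not> k < card S" for S using that by (simp add: kth_point_def)
  have "{S \<in> space (point_configs I). kth_point k S \<le> y}
    = {S \<in> space (point_configs I). (k < card S \<and> k < card (S \<inter> {..y})) \<or> (\<not> k < card S \<and> 0 \<le> y)}"
  proof (intro Collect_cong conj_cong refl)
    fix S assume "S \<in> space (point_configs I)"
    then have "finite S" by (simp add: space_point_configs)
    then show "kth_point k S \<le> y \<longleftrightarrow> (k < card S \<and> k < card (S \<inter> {..y})) \<or> (\<not> k < card S \<and> 0 \<le> y)"
      by (cases "k < card S") (simp_all add: card_below_kth_point kth0)
  qed
  also have "\<dots> \<in> sets (point_configs I)" by measurable
  finally show "{S \<in> space (point_configs I). kth_point k S \<le> y} \<in> sets (point_configs I)" .
qed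

abbreviation "families I \<equiv> PiM (UNIV :: nat list set) (\<lambda>_. point_configs I)"

lemma measurable_born [measurable]: "Measurable.pred (families I) (\<lambda>x. born x u)"
  by (induction u) (simp_all)

lemma measurable_born_before:
  "Measurable.pred (families I \<Otimes>\<^sub>M borel) (\<lambda>(x, t). u \<in> verts (genealogy x t))"
proof -
  define b where "b x = rec_list (0::real) (\<lambda>k u r. r + kth_point k (x u))" for x :: "nat list \<Rightarrow> real set"
  have b: "b x [] = 0" "b x (k # u) = b x u + kth_point k (x u)" for x k u by (simp_all add: b_def)
  have [measurable]: "(\<lambda>x. b x u) \<in> borel_measurable (families I)" for u by (induction u) (simp_all add: b)
  have "born x u \<Longrightarrow> birth_time x u = b x u" for x
    by (induction u) (auto simp: b kth_point_def)
  then have "(\<lambda>(x, t). u \<in> verts (genealogy x t)) = (\<lambda>(x, t). born x u \<and> b x u \<le> t)" by (auto simp: fun_eq_iff)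
  then show ?thesis by simp
qed

text \<open>The shape of a genealogy is a function of its set of vertices, a random set of words.  Such a set takes only
  countably many finite values, so a function of it is measurable as soon as membership of each word is.\<close>

lemma measurable_finite_set_valued:
  fixes V :: "'a \<Rightarrow> 'b::countable set"
  assumes V: "\<And>u. Measurable.pred M (\<lambda>x. u \<in> V x)"
  shows "(\<lambda>x. if finite (V x) then \<phi> (V x) else d) \<in> M \<rightarrow>\<^sub>M count_space UNIV"
proof (rule measurableI)
  fix K
  note V[measurable]
  have "countable {F :: 'b set. finite F}" by (rule countable_Collect_finite)
  then have cF: "countable {F :: 'b set. finite F \<and> P F}" for P by (rule countable_subset[rotated]) auto
  have F: "{x \<in> space M. V x = F} \<in> sets M" for F
  proof -
    have "{x \<in> space M. V x = F} = {x \<in> space M. \<forall>u. u \<in> V x \<longleftrightarrow> u \<in> F}" by auto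
    also have "\<dots> \<in> sets M" by measurable
    finally show ?thesis .
  qed
  have U: "(\<Union>F\<in>{F. finite F \<and> P F}. {x \<in> space M. V x = F}) \<in> sets M" for P
    by (rule sets.countable_UN''[OF cF]) (rule F)
  have "(\<lambda>x. if finite (V x) then \<phi> (V x) else d) -` K \<inter> space M
    = (\<Union>F\<in>{F. finite F \<and> \<phi> F \<in> K}. {x \<in> space M. V x = F}) \<union>
      (if d \<in> K then space M - (\<Union>F\<in>{F. finite F \<and> True}. {x \<in> space M. V x = F}) else {})"
    by (auto split: if_splits)
  also have "\<dots> \<in> sets M" using U[of "\<lambda>F. \<phi> F \<in> K"] U[of "\<lambda>_. True"] by auto
  finally show "(\<lambda>x. if finite (V x) then \<phi> (V x) else d) -` K \<inter> space M \<in> sets M" .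
qed simp

lemma measurable_bp_shape: "(\<lambda>(x, t). bp_shape x t) \<in> families I \<Otimes>\<^sub>M borel \<rightarrow>\<^sub>M count_space UNIV"
proof -
  define \<phi> where "\<phi> V = iso_class \<lparr>verts = V, troot = [], parent = (tl :: nat list \<Rightarrow> nat list)\<rparr>" for V
  have "Measurable.pred (families I \<Otimes>\<^sub>M borel) (\<lambda>z. u \<in> verts (case z of (x, t) \<Rightarrow> genealogy x t))" for u
    using measurable_born_before[where I = I and u = u] by (simp add: case_prod_beta' del: genealogy_simps)
  from measurable_finite_set_valued[OF this, of \<phi> None]
  have "(\<lambda>z. if finite (verts (case z of (x, t) \<Rightarrow> genealogy x t)) then \<phi> (verts (case z of (x, t) \<Rightarrow> genealogy x t)) else None)
    \<in> families I \<Otimes>\<^sub>M borel \<rightarrow>\<^sub>M count_space UNIV" .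
  moreover have eq: "(if finite (verts (genealogy x t)) then \<phi> (verts (genealogy x t)) else None) = bp_shape x t" for x t
  proof -
    have rec: "\<lparr>verts = verts (genealogy x t), troot = [], parent = tl\<rparr> = genealogy x t" by (simp add: genealogy_def)
    have "iso_class (genealogy x t) = None" if "infinite (verts (genealogy x t))"
      using that unfolding iso_class_def by (simp del: genealogy_simps)
    then show ?thesis unfolding \<phi>_def rec bp_shape_def by (simp del: genealogy_simps)
  qed
  have "(\<lambda>z. if finite (verts (case z of (x, t) \<Rightarrow> genealogy x t)) then \<phi> (verts (case z of (x, t) \<Rightarrow> genealogy x t)) else None)
    = (\<lambda>(x, t). bp_shape x t)" by (rule ext) (simp only: case_prod_beta' eq)
  ultimately show ?thesis by (simp only:)
qed

section \<open>The Poisson process of the ages at birth\<close>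

lemma (in prob_space) expectation_power_poisson:
  assumes K [measurable]: "K \<in> M \<rightarrow>\<^sub>M count_space UNIV" and l: "0 \<le> l" and a: "0 \<le> a" "a \<le> 1"
    and P: "\<And>k. prob {\<omega> \<in> space M. K \<omega> = k} = l ^ k / fact k * exp (- l)"
  shows "expectation (\<lambda>\<omega>. a ^ K \<omega>) = exp (l * (a - 1))"
proof -
  define g where "g k = l ^ k / fact k * exp (- l)" for k :: nat
  have g0: "0 \<le> g k" for k using l by (simp add: g_def)
  have D: "distr M (count_space UNIV) K = density (count_space UNIV) (\<lambda>k. ennreal (g k))"
  proof (rule measure_eqI_countable[where A = UNIV])
    fix k :: nat
    have "emeasure (distr M (count_space UNIV) K) {k} = emeasure M {\<omega> \<in> space M. K \<omega> = k}"
      by (subst emeasure_distr) (auto intro!: arg_cong[where f = "emeasure M"])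
    also have "\<dots> = ennreal (g k)" by (simp add: emeasure_eq_measure P g_def)
    also have "\<dots> = emeasure (density (count_space UNIV) (\<lambda>k. ennreal (g k))) {k}"
      unfolding point_measure_def[symmetric] by (subst emeasure_point_measure_finite2) auto
    finally show "emeasure (distr M (count_space UNIV) K) {k} = emeasure (density (count_space UNIV) (\<lambda>k. ennreal (g k))) {k}" .
  qed auto
  have sums: "(\<lambda>k. g k * a ^ k) sums exp (l * (a - 1))"
  proof -
    have "(\<lambda>k. exp (- l) * ((l * a) ^ k /\<^sub>R fact k)) sums (exp (- l) * exp (l * a))"
      by (intro sums_mult exp_converges)
    moreover have "exp (- l) * exp (l * a) = exp (l * (a - 1))" by (simp add: exp_add[symmetric] algebra_simps)
    ultimately show ?thesis by (simp add: g_def power_mult_distrib divide_inverse mult_ac)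
  qed
  have "expectation (\<lambda>\<omega>. a ^ K \<omega>) = (\<integral>k. a ^ k \<partial>distr M (count_space UNIV) K)" by (subst integral_distr) auto
  also have "\<dots> = (\<integral>k. g k * a ^ k \<partial>count_space UNIV)" unfolding D using g0 by (subst integral_density) auto
  also have "\<dots> = (\<Sum>k. g k * a ^ k)"
    using sums g0 a by (intro integral_count_space_nat) (auto simp: integrable_count_space_nat_iff abs_mult sums_iff)
  finally show ?thesis using sums by (simp add: sums_iff)
qed

context prob_space
begin

lemma poisson_process_config:
  assumes "poisson_process M r I X" "\<omega> \<in> space M"
  shows "finite (X \<omega>)" "X \<omega> \<subseteq> I"
  using assms measurable_space[of X M "point_configs I" \<omega>] by (auto simp: poisson_process_def space_point_configs)

text \<open>The level sets of \<open>f\<close> are disjoint, hence the numbers of points in them are independent Poisson variables.\<close>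

lemma poisson_laplace_finite_range:
  assumes X: "poisson_process M r {0..c} X" and r: "0 \<le> r"
    and f [measurable]: "f \<in> borel_measurable borel" and f01: "\<And>p. 0 \<le> f p \<and> f p \<le> 1" and fin: "finite (range f)"
  shows "(\<lambda>\<omega>. \<Prod>p\<in>X \<omega>. f p) \<in> borel_measurable M"
    and "expectation (\<lambda>\<omega>. \<Prod>p\<in>X \<omega>. f p) = exp (r * (\<integral>p. indicator {0..c} p * (f p - 1) \<partial>lborel))"
proof -
  obtain e where e: "bij_betw e {0..<card (range f)} (range f)" using ex_bij_betw_nat_finite[OF fin] by blast
  define n where "n = card (range f)"
  have e: "bij_betw e {..<n} (range f)" using e by (simp add: n_def atLeast0LessThan)
  have e01: "0 \<le> e i" "e i \<le> 1" if "i < n" for i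
  proof -
    have "e i \<in> range f" using bij_betwE[OF e] that by simp
    then obtain p where "e i = f p" by (rule rangeE)
    then show "0 \<le> e i" "e i \<le> 1" using f01[of p] by simp_all
  qed
  define A where "A i = {p \<in> {0..c}. f p = e i}" for i
  have A [measurable]: "A i \<in> sets borel" for i unfolding A_def by measurable
  have Xm [measurable]: "X \<in> M \<rightarrow>\<^sub>M point_configs {0..c}" using X by (simp add: poisson_process_def)
  define K where "K i \<omega> = card (X \<omega> \<inter> A i)" for i \<omega>
  have Km [measurable]: "K i \<in> M \<rightarrow>\<^sub>M count_space UNIV" for i
    unfolding K_def by (rule measurable_compose[OF Xm]) measurable
  have pw: "(\<Prod>p\<in>X \<omega>. f p) = (\<Prod>i<n. e i ^ K i \<omega>)" if "\<omega> \<in> space M" for \<omega>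
  proof -
    note cfg = poisson_process_config[OF X that]
    have "(\<Prod>p\<in>X \<omega>. f p) = (\<Prod>y\<in>range f. \<Prod>p\<in>{p \<in> X \<omega>. f p = y}. f p)"
      using cfg fin by (intro prod.group[symmetric]) auto
    also have "\<dots> = (\<Prod>y\<in>range f. y ^ card {p \<in> X \<omega>. f p = y})" by (intro prod.cong refl) simp
    also have "\<dots> = (\<Prod>i<n. e i ^ card {p \<in> X \<omega>. f p = e i})" by (rule prod.reindex_bij_betw[OF e, symmetric])
    also have "\<dots> = (\<Prod>i<n. e i ^ K i \<omega>)"
      unfolding K_def A_def using cfg by (intro prod.cong refl arg_cong2[where f = power] arg_cong[where f = card]) auto
    finally show ?thesis .
  qed
  have "(\<lambda>\<omega>. \<Prod>i<n. e i ^ K i \<omega>) \<in> borel_measurable M" by measurable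
  then show "(\<lambda>\<omega>. \<Prod>p\<in>X \<omega>. f p) \<in> borel_measurable M" by (subst measurable_cong[OF pw])
  have disj: "disjoint_family_on A {..<n}"
  proof -
    have "e i \<noteq> e j" if "i < n" "j < n" "i \<noteq> j" for i j using bij_betw_imp_inj_on[OF e] that by (auto simp: inj_on_def)
    then show ?thesis by (auto simp: disjoint_family_on_def A_def)
  qed
  have "\<forall>i<n. A i \<in> sets borel \<and> A i \<subseteq> {0..c}" by (auto simp: A_def[abs_def])
  with X disj have "indep_vars (\<lambda>_. count_space UNIV) K {..<n}"
    unfolding poisson_process_def K_def by blast
  from indep_vars_compose2[OF this, of "\<lambda>i k. e i ^ k" "\<lambda>_. borel"]
  have ind: "indep_vars (\<lambda>_. borel) (\<lambda>i \<omega>. e i ^ K i \<omega>) {..<n}" by simp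
  have "expectation (\<lambda>\<omega>. \<Prod>p\<in>X \<omega>. f p) = expectation (\<lambda>\<omega>. \<Prod>i<n. e i ^ K i \<omega>)"
    by (rule Bochner_Integration.integral_cong) (auto simp: pw)
  also have "\<dots> = (\<Prod>i<n. expectation (\<lambda>\<omega>. e i ^ K i \<omega>))"
  proof (rule indep_vars_lebesgue_integral[OF _ ind])
    show "integrable M (\<lambda>\<omega>. e i ^ K i \<omega>)" if "i \<in> {..<n}" for i
      using e01[of i] that by (intro integrable_const_bound[of _ 1]) (auto simp: power_le_one)
  qed simp
  also have "\<dots> = (\<Prod>i<n. exp ((r * measure lborel (A i)) * (e i - 1)))"
  proof (rule prod.cong[OF refl])
    fix i assume "i \<in> {..<n}"
    moreover have "A i \<subseteq> {0..c}" by (auto simp: A_def)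
    ultimately show "expectation (\<lambda>\<omega>. e i ^ K i \<omega>) = exp ((r * measure lborel (A i)) * (e i - 1))"
      using X A[of i] r e01[of i] Km[of i] unfolding poisson_process_def K_def
      by (intro expectation_power_poisson) auto
  qed
  also have "\<dots> = exp (r * (\<Sum>i<n. (e i - 1) * measure lborel (A i)))"
    by (simp add: exp_sum[symmetric] sum_distrib_left mult_ac)
  also have "(\<Sum>i<n. (e i - 1) * measure lborel (A i)) = (\<integral>p. indicator {0..c} p * (f p - 1) \<partial>lborel)"
  proof -
    have ind_eq: "indicator {0..c} p * (f p - 1) = (\<Sum>i<n. (e i - 1) * indicator (A i) p)" for p :: real
    proof -
      obtain j where j: "j < n" "f p = e j" using e by (metis bij_betw_imp_surj_on imageE lessThan_iff rangeI)
      have "(\<Sum>i<n. (e i - 1) * indicator (A i) p) = (\<Sum>i<n. if i = j then indicator {0..c} p * (f p - 1) else 0)"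
      proof (rule sum.cong[OF refl])
        fix i assume "i \<in> {..<n}"
        then have "i \<noteq> j \<Longrightarrow> e i \<noteq> f p" using bij_betw_imp_inj_on[OF e] j by (auto simp: inj_on_def)
        then show "(e i - 1) * indicator (A i) p = (if i = j then indicator {0..c} p * (f p - 1) else 0)"
          using j by (auto simp: A_def indicator_def)
      qed
      then show ?thesis using j by simp
    qed
    have "integrable lborel (\<lambda>p. (e i - 1) * indicator (A i) p)" for i
    proof -
      have "emeasure lborel (A i) \<le> emeasure lborel {0..c}" by (intro emeasure_mono) (auto simp: A_def)
      also have "\<dots> < \<infinity>" by (simp add: emeasure_lborel_Icc_eq)
      finally show ?thesis by (intro integrable_mult_right integrable_real_indicator) auto
    qed
    note integ = this
    have "(\<integral>p. indicator {0..c} p * (f p - 1) \<partial>lborel) = (\<integral>p. (\<Sum>i<n. (e i - 1) * indicator (A i) p) \<partial>lborel)"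
      by (simp only: ind_eq)
    also have "\<dots> = (\<Sum>i<n. \<integral>p. (e i - 1) * indicator (A i) p \<partial>lborel)"
      by (rule Bochner_Integration.integral_sum) (rule integ)
    also have "\<dots> = (\<Sum>i<n. (e i - 1) * measure lborel (A i))"
      by (intro sum.cong refl) (simp only: integral_mult_right_zero, simp)
    finally show ?thesis ..
  qed
  finally show "expectation (\<lambda>\<omega>. \<Prod>p\<in>X \<omega>. f p) = exp (r * (\<integral>p. indicator {0..c} p * (f p - 1) \<partial>lborel))" .
qed

text \<open>Rounding \<open>f\<close> down to multiples of \<open>1 / (i + 1)\<close> reduces to finite range.\<close>

lemma poisson_laplace:
  assumes X: "poisson_process M r {0..c} X" and r: "0 \<le> r"
    and f [measurable]: "f \<in> borel_measurable borel" and f01: "\<And>p. 0 \<le> f p \<and> f p \<le> 1"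
  shows "expectation (\<lambda>\<omega>. \<Prod>p\<in>X \<omega>. f p) = exp (r * (\<integral>p. indicator {0..c} p * (f p - 1) \<partial>lborel))"
proof -
  define F where "F i p = real_of_int \<lfloor>real (Suc i) * f p\<rfloor> / real (Suc i)" for i p
  have Fm [measurable]: "F i \<in> borel_measurable borel" for i unfolding F_def by measurable
  have F01: "0 \<le> F i p \<and> F i p \<le> 1" for i p
  proof -
    have "real_of_int \<lfloor>real (Suc i) * f p\<rfloor> \<le> real (Suc i) * f p" by simp
    also have "\<dots> \<le> real (Suc i)" using f01[of p] by (simp add: mult_left_le)
    finally show ?thesis using f01[of p] by (simp add: F_def)
  qed
  have Ffin: "finite (range (F i))" for i
  proof (rule finite_subset)
    show "range (F i) \<subseteq> (\<lambda>j. real_of_int j / real (Suc i)) ` {0..int (Suc i)}"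
    proof
      fix y assume "y \<in> range (F i)"
      then obtain p where p: "y = F i p" by blast
      have "real (Suc i) * f p \<le> real (Suc i)" using f01[of p] by (simp add: mult_left_le)
      then have "\<lfloor>real (Suc i) * f p\<rfloor> \<le> \<lfloor>real (Suc i)\<rfloor>" by (rule floor_mono)
      moreover have "0 \<le> \<lfloor>real (Suc i) * f p\<rfloor>" using f01[of p] by (simp del: of_nat_Suc)
      ultimately have "\<lfloor>real (Suc i) * f p\<rfloor> \<in> {0..int (Suc i)}" by (simp del: of_nat_Suc)
      then show "y \<in> (\<lambda>j. real_of_int j / real (Suc i)) ` {0..int (Suc i)}" using p by (auto simp: F_def)
    qed
  qed simp
  have Flim: "(\<lambda>i. F i p) \<longlonglongrightarrow> f p" for p
  proof (rule tendsto_sandwich)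
    show "\<forall>\<^sub>F i in sequentially. f p - inverse (real (Suc i)) \<le> F i p"
    proof (rule always_eventually, rule allI)
      fix i
      have "real (Suc i) * f p - 1 \<le> real_of_int \<lfloor>real (Suc i) * f p\<rfloor>" by linarith
      then have "(real (Suc i) * f p - 1) / real (Suc i) \<le> F i p" unfolding F_def by (rule divide_right_mono) simp
      then show "f p - inverse (real (Suc i)) \<le> F i p" by (simp add: diff_divide_distrib inverse_eq_divide)
    qed
    show "\<forall>\<^sub>F i in sequentially. F i p \<le> f p"
    proof (rule always_eventually, rule allI)
      fix i
      have "real_of_int \<lfloor>real (Suc i) * f p\<rfloor> / real (Suc i) \<le> real (Suc i) * f p / real (Suc i)"
        by (rule divide_right_mono) auto
      then show "F i p \<le> f p" by (simp add: F_def)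
    qed
    show "(\<lambda>i. f p - inverse (real (Suc i))) \<longlonglongrightarrow> f p"
      using tendsto_diff[OF tendsto_const LIMSEQ_inverse_real_of_nat, of "f p"] by simp
  qed simp
  have prod01: "0 \<le> (\<Prod>p\<in>X \<omega>. h p) \<and> (\<Prod>p\<in>X \<omega>. h p) \<le> 1" if "\<And>p. 0 \<le> h p \<and> h p \<le> (1::real)" for h \<omega>
    using that by (auto intro!: prod_nonneg prod_le_1)
  have Pm: "(\<lambda>\<omega>. \<Prod>p\<in>X \<omega>. F i p) \<in> borel_measurable M" for i
    by (rule poisson_laplace_finite_range(1)[OF X r Fm F01 Ffin])
  have Pl: "(\<lambda>i. \<Prod>p\<in>X \<omega>. F i p) \<longlonglongrightarrow> (\<Prod>p\<in>X \<omega>. f p)" for \<omega> by (intro tendsto_prod Flim)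
  have "(\<lambda>i. expectation (\<lambda>\<omega>. \<Prod>p\<in>X \<omega>. F i p)) \<longlonglongrightarrow> expectation (\<lambda>\<omega>. \<Prod>p\<in>X \<omega>. f p)"
  proof (rule integral_dominated_convergence[where w = "\<lambda>_. 1"])
    show "(\<lambda>\<omega>. \<Prod>p\<in>X \<omega>. f p) \<in> borel_measurable M" by (rule borel_measurable_LIMSEQ_real[OF Pl Pm])
    show "AE \<omega> in M. norm (\<Prod>p\<in>X \<omega>. F i p) \<le> 1" for i using prod01[of "F i"] F01 by simp
  qed (use Pm Pl in auto)
  moreover have "(\<lambda>i. exp (r * (\<integral>p. indicator {0..c} p * (F i p - 1) \<partial>lborel))) \<longlonglongrightarrow> exp (r * (\<integral>p. indicator {0..c} p * (f p - 1) \<partial>lborel))"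
  proof (intro tendsto_intros integral_dominated_convergence[where w = "indicator {0..c}"])
    show "integrable lborel (indicator {0..c} :: real \<Rightarrow> real)"
      by (intro integrable_real_indicator) (auto simp: emeasure_lborel_Icc_eq)
    show "AE p in lborel. (\<lambda>i. indicator {0..c} p * (F i p - 1)) \<longlonglongrightarrow> indicator {0..c} p * (f p - 1)"
      by (intro always_eventually allI tendsto_intros Flim)
    show "AE p in lborel. norm (indicator {0..c} p * (F i p - 1)) \<le> indicator {0..c} p" for i
      using F01[of i] by (intro always_eventually allI) (auto simp: indicator_def)
  qed measurable
  ultimately show ?thesis
    using poisson_laplace_finite_range(2)[OF X r Fm F01 Ffin] LIMSEQ_unique by simp
qed

text \<open>The law of the family is a product, so that it stays the same when the coordinates in \<open>J\<close> are taken from an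
  independent copy.\<close>

lemma expectation_resample:
  fixes X :: "'i \<Rightarrow> 'a \<Rightarrow> 'b" and \<Phi> :: "('i \<Rightarrow> 'b) \<Rightarrow> real"
  assumes ind: "indep_vars (\<lambda>_. S) X UNIV" and \<Phi> [measurable]: "\<Phi> \<in> borel_measurable (PiM UNIV (\<lambda>_. S))"
    and b: "\<And>x. \<bar>\<Phi> x\<bar> \<le> 1"
  shows "expectation (\<lambda>\<omega>. \<Phi> (\<lambda>i. X i \<omega>)) = expectation (\<lambda>\<omega>. expectation (\<lambda>\<omega>'. \<Phi> (\<lambda>i. if i \<in> J then X i \<omega>' else X i \<omega>)))"
proof -
  define U where "U \<omega> = restrict (\<lambda>i. X i \<omega>) (- J)" for \<omega>
  define V where "V \<omega> = restrict (\<lambda>i. X i \<omega>) J" for \<omega>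
  let ?P = "PiM (- J) (\<lambda>_. S)" and ?Q = "PiM J (\<lambda>_. S)"
  have iv: "indep_var ?P U ?Q V" unfolding U_def V_def by (rule indep_var_restrict[OF ind]) auto
  have U [measurable]: "U \<in> M \<rightarrow>\<^sub>M ?P" and V [measurable]: "V \<in> M \<rightarrow>\<^sub>M ?Q"
    using iv by (auto dest: indep_var_rv1 indep_var_rv2)
  have eq: "distr M ?P U \<Otimes>\<^sub>M distr M ?Q V = distr M (?P \<Otimes>\<^sub>M ?Q) (\<lambda>\<omega>. (U \<omega>, V \<omega>))"
    using iv by (simp add: indep_var_distribution_eq)
  have mg: "merge (- J) J (U \<omega>, V \<omega>') = (\<lambda>i. if i \<in> J then X i \<omega>' else X i \<omega>)" for \<omega> \<omega>'
    by (auto simp: merge_def U_def V_def)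
  define \<Psi> where "\<Psi> = (\<lambda>z. \<Phi> (merge (- J) J z))"
  have "merge (- J) J \<in> ?P \<Otimes>\<^sub>M ?Q \<rightarrow>\<^sub>M PiM UNIV (\<lambda>_. S)" using measurable_merge[of "- J" J "\<lambda>_. S"] by simp
  from measurable_compose[OF this \<Phi>]
  have \<Psi> [measurable]: "\<Psi> \<in> borel_measurable (?P \<Otimes>\<^sub>M ?Q)" unfolding \<Psi>_def .
  interpret dU: prob_space "distr M ?P U" by (rule prob_space_distr) (rule U)
  interpret dV: prob_space "distr M ?Q V" by (rule prob_space_distr) (rule V)
  interpret pair_prob_space "distr M ?P U" "distr M ?Q V" ..
  have int: "integrable (distr M ?P U \<Otimes>\<^sub>M distr M ?Q V) \<Psi>"
    by (rule P.integrable_const_bound[of _ 1]) (simp add: \<Psi>_def b, measurable)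
  have "(\<integral>\<omega>. \<Phi> (\<lambda>i. X i \<omega>) \<partial>M) = (\<integral>\<omega>. \<Psi> (U \<omega>, V \<omega>) \<partial>M)"
    unfolding \<Psi>_def mg by simp
  also have "\<dots> = (\<integral>z. \<Psi> z \<partial>(distr M ?P U \<Otimes>\<^sub>M distr M ?Q V))"
    unfolding eq by (subst integral_distr) auto
  also have "\<dots> = (\<integral>a. (\<integral>b. \<Psi> (a, b) \<partial>distr M ?Q V) \<partial>distr M ?P U)"
    by (rule integral_fst'[OF int, symmetric])
  also have "\<dots> = (\<integral>\<omega>. (\<integral>b. \<Psi> (U \<omega>, b) \<partial>distr M ?Q V) \<partial>M)"
    by (subst integral_distr) auto
  also have "\<dots> = (\<integral>\<omega>. (\<integral>\<omega>'. \<Psi> (U \<omega>, V \<omega>') \<partial>M) \<partial>M)"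
  proof (rule Bochner_Integration.integral_cong[OF refl])
    fix \<omega> assume "\<omega> \<in> space M"
    then have "U \<omega> \<in> space ?P" using measurable_space[OF U] by blast
    then have "(\<lambda>b. \<Psi> (U \<omega>, b)) \<in> borel_measurable ?Q" using measurable_Pair2[OF \<Psi>] by blast
    then show "(\<integral>b. \<Psi> (U \<omega>, b) \<partial>distr M ?Q V) = (\<integral>\<omega>'. \<Psi> (U \<omega>, V \<omega>') \<partial>M)"
      by (subst integral_distr) auto
  qed
  finally show ?thesis unfolding \<Psi>_def mg .
qed

end

section \<open>The law of the branching process at a fixed age\<close>

text \<open>Finite trees of height at most \<open>h\<close> are countable by induction on \<open>h\<close>.\<close>

lemma countable_rtree: "countable (UNIV :: rtree set)"
proof -
  have "countable {t. trunc n t = t}" for n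
  proof (induction n)
    case 0
    have "{t. trunc 0 t = t} \<subseteq> {Node {#}}" by auto
    then show ?case by (rule countable_subset) simp
  next
    case (Suc n)
    have "{t. trunc (Suc n) t = t} \<subseteq> (\<lambda>xs. Node (mset xs)) ` lists {t. trunc n t = t}"
    proof
      fix t assume "t \<in> {t. trunc (Suc n) t = t}"
      then have t: "t = Node (image_mset (trunc n) (subtrees t))" by simp
      obtain xs where xs: "mset xs = subtrees t" using ex_mset by blast
      have "x \<in># subtrees t \<Longrightarrow> trunc n x = x" for x
      proof -
        assume "x \<in># subtrees t"
        moreover have "subtrees t = image_mset (trunc n) (subtrees t)" using arg_cong[OF t, of subtrees] by simp
        ultimately obtain y where "x = trunc n y" by (metis imageE set_image_mset)
        then show ?thesis by (simp add: trunc_trunc)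
      qed
      then have "xs \<in> lists {t. trunc n t = t}" using xs by (metis (mono_tags, lifting) in_listsI mem_Collect_eq set_mset_mset)
      then show "t \<in> (\<lambda>xs. Node (mset xs)) ` lists {t. trunc n t = t}" using xs by (intro image_eqI[of _ _ xs]) auto
    qed
    then show ?case by (rule countable_subset) (intro countable_image countable_lists Suc)
  qed
  then have "countable (\<Union>n. {t. trunc n t = t})" by simp
  moreover have "(\<Union>n. {t. trunc n t = t}) = (UNIV :: rtree set)" using trunc_eventually by blast
  ultimately show ?thesis by simp
qed

lemma countable_ftree: "countable (A :: ftree set)"
proof (rule countable_subset[OF subset_UNIV])
  show "countable (UNIV :: ftree set)" using countable_rtree by (simp add: UNIV_option_conv)
qed

lemma measurable_from_word [measurable]: "from_word w \<in> families I \<rightarrow>\<^sub>M families I"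
  unfolding from_word_def[abs_def] by (rule measurable_PiM_single') (auto simp: space_PiM)

lemma measurable_prod_lessThan:
  fixes F :: "nat \<Rightarrow> 'a \<Rightarrow> real"
  assumes K: "K \<in> M \<rightarrow>\<^sub>M count_space UNIV" and F [measurable]: "\<And>k. F k \<in> borel_measurable M"
  shows "(\<lambda>x. \<Prod>k<K x. F k x) \<in> borel_measurable M"
  by (rule measurable_compose_countable[OF _ K]) measurable

locale branching =
  fixes N :: "'b measure" and \<theta> :: real and X :: "nat list \<Rightarrow> 'b \<Rightarrow> real set" and T :: "'b \<Rightarrow> real"
  assumes \<theta>: "0 < \<theta>" "\<theta> < 1" and model: "branching_model N \<theta> X T"
begin

sublocale prob_space N using model by (simp add: branching_model_def)

abbreviation c where "c \<equiv> ln (1 / \<theta>)"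

lemma poisson: "poisson_process N (1 / (1 - \<theta>)) {0..c} (X u)"
  and indep: "indep_vars (\<lambda>_. point_configs {0..c}) X UNIV"
  using model by (auto simp: branching_model_def)

lemma measurable_X [measurable]: "X u \<in> N \<rightarrow>\<^sub>M point_configs {0..c}"
  using poisson[of u] by (simp add: poisson_process_def)

lemma measurable_family [measurable]: "(\<lambda>\<omega> u. X u \<omega>) \<in> N \<rightarrow>\<^sub>M families {0..c}"
  by (rule measurable_PiM_single') (auto dest: measurable_space[OF measurable_X])

lemma valid_X: "\<omega> \<in> space N \<Longrightarrow> valid_config (X u \<omega>)"
  using poisson_process_config[OF poisson, of \<omega> u] by (auto simp: valid_config_def)

definition shape :: "nat list \<Rightarrow> 'b \<Rightarrow> real \<Rightarrow> ftree" where
  "shape u \<omega> y = bp_shape (from_word u (\<lambda>v. X v \<omega>)) y"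

lemma measurable_shape_comp [measurable]:
  assumes [measurable]: "f \<in> S \<rightarrow>\<^sub>M N" "h \<in> S \<rightarrow>\<^sub>M borel"
  shows "(\<lambda>z. shape u (f z) (h z)) \<in> S \<rightarrow>\<^sub>M count_space UNIV"
proof -
  have "(\<lambda>z. (from_word u (\<lambda>v. X v (f z)), h z)) \<in> S \<rightarrow>\<^sub>M families {0..c} \<Otimes>\<^sub>M borel" by measurable
  from measurable_compose[OF this measurable_bp_shape] show ?thesis by (simp add: shape_def)
qed

lemma measurable_expectation_shape [measurable]:
  fixes f :: "ftree \<Rightarrow> real"
  shows "(\<lambda>y. expectation (\<lambda>\<omega>. f (shape u \<omega> y))) \<in> borel_measurable borel"
proof (rule borel_measurable_lebesgue_integral)
  have "(\<lambda>z. f (shape u (snd z) (fst z))) \<in> borel_measurable (borel \<Otimes>\<^sub>M N)"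
    by (rule measurable_compose[of _ _ "count_space UNIV"]) measurable
  then show "case_prod (\<lambda>y \<omega>. f (shape u \<omega> y)) \<in> borel_measurable (borel \<Otimes>\<^sub>M N)" by (simp add: case_prod_beta')
qed

lemma shape_rec:
  assumes \<omega>: "\<omega> \<in> space N" and y: "0 \<le> y"
  shows "shape u \<omega> y = (if \<forall>k<card (X u \<omega> \<inter> {..y}). shape (k # u) \<omega> (y - kth_point k (X u \<omega>)) \<noteq> None
    then Some (Node (image_mset (\<lambda>k. the (shape (k # u) \<omega> (y - kth_point k (X u \<omega>)))) (mset_set {..<card (X u \<omega> \<inter> {..y})})))
    else None)"
proof -
  have "valid_config (from_word u (\<lambda>v. X v \<omega>) w)" for w using valid_X[OF \<omega>] by (simp add: from_word_def)
  from bp_shape_rec[where x = "from_word u (\<lambda>v. X v \<omega>)", OF this y]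
  show ?thesis unfolding shape_def from_word_Cons by (simp add: from_word_def)
qed

text \<open>Laplace functional of the children: the subtrees of the children are resampled one after the other,
  which replaces their contribution by its mean, and the remaining product runs over a Poisson process.\<close>

lemma children_laplace:
  fixes s :: "ftree \<Rightarrow> real"
  assumes s: "\<And>t. 0 \<le> s t \<and> s t \<le> 1" and g [measurable]: "g \<in> borel_measurable borel" and g01: "\<And>y. 0 \<le> g y \<and> g y \<le> 1"
    and mean: "\<And>w y. 0 \<le> y \<Longrightarrow> expectation (\<lambda>\<omega>. s (shape w \<omega> y)) = g y" and t: "0 \<le> t"
  shows "expectation (\<lambda>\<omega>. \<Prod>k<card (X u \<omega> \<inter> {..t}). s (shape (k # u) \<omega> (t - kth_point k (X u \<omega>))))
    = exp (\<integral>z. kernel \<theta> t z * (g z - 1) \<partial>expo)"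
proof -
  define A where "A k x = s (bp_shape (from_word (k # u) x) (t - kth_point k (x u)))" for k x
  define B where "B k x = g (t - kth_point k (x u))" for k and x :: "nat list \<Rightarrow> real set"
  \<comment> \<open>the first \<open>j\<close> children carry the weight of their subtree, the other ones already its mean\<close>
  define \<Phi> where "\<Phi> j x = (\<Prod>k<card (x u \<inter> {..t}). if k < j then A k x else B k x)" for j x
  have A01: "0 \<le> A k x \<and> A k x \<le> 1" and B01: "0 \<le> B k x \<and> B k x \<le> 1" for k x
    unfolding A_def B_def using s g01 by auto
  have AB01: "0 \<le> (if k < j then A k x else B k x) \<and> (if k < j then A k x else B k x) \<le> 1" for k j x
    using A01 B01 by simp
  have Am [measurable]: "A k \<in> borel_measurable (families {0..c})" for k
  proof -
    have "(\<lambda>x. (from_word (k # u) x, t - kth_point k (x u))) \<in> families {0..c} \<rightarrow>\<^sub>M families {0..c} \<Otimes>\<^sub>M borel" by measurable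
    from measurable_compose[OF this measurable_bp_shape]
    have "(\<lambda>x. bp_shape (from_word (k # u) x) (t - kth_point k (x u))) \<in> families {0..c} \<rightarrow>\<^sub>M count_space UNIV" by simp
    from measurable_compose[OF this, of s borel] show ?thesis by (simp add: A_def[abs_def])
  qed
  have Bm [measurable]: "B k \<in> borel_measurable (families {0..c})" for k unfolding B_def by measurable
  have Km: "(\<lambda>x. card (x u \<inter> {..t})) \<in> families {0..c} \<rightarrow>\<^sub>M count_space UNIV"
    by (rule measurable_compose[OF measurable_component_singleton]) auto
  have \<Phi>m: "\<Phi> j \<in> borel_measurable (families {0..c})" for j
    unfolding \<Phi>_def by (rule measurable_prod_lessThan[OF Km]) measurable
  have \<Phi>01: "0 \<le> \<Phi> j x \<and> \<Phi> j x \<le> 1" for j x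
    unfolding \<Phi>_def using AB01 by (auto intro!: prod_nonneg prod_le_1)
  let ?F = "\<lambda>\<omega> v. X v \<omega>"
  have step: "expectation (\<lambda>\<omega>. \<Phi> (Suc j) (?F \<omega>)) = expectation (\<lambda>\<omega>. \<Phi> j (?F \<omega>))" for j
  proof -
    \<comment> \<open>the descendants of the child \<open>j\<close>, including itself; they are resampled\<close>
    define J where "J = {v @ (j # u) | v. True}"
    define mix where "mix \<omega> \<omega>' v = (if v \<in> J then X v \<omega>' else X v \<omega>)" for \<omega> \<omega>' v
    have "u \<notin> J" by (auto simp: J_def dest: arg_cong[of _ _ length])
    then have mix_u: "mix \<omega> \<omega>' u = X u \<omega>" for \<omega> \<omega>' by (simp add: mix_def)
    have mix_j: "from_word (j # u) (mix \<omega> \<omega>') = from_word (j # u) (?F \<omega>')" for \<omega> \<omega>'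
      by (auto simp: from_word_def mix_def J_def)
    have mix_k: "from_word (k # u) (mix \<omega> \<omega>') = from_word (k # u) (?F \<omega>)" if "k \<noteq> j" for k \<omega> \<omega>'
    proof -
      have "v @ (k # u) \<notin> J" for v using that by (auto simp: J_def append_eq_append_conv2 Cons_eq_append_conv dest: arg_cong[of _ _ length])
      then show ?thesis by (simp add: from_word_def mix_def)
    qed
    have "expectation (\<lambda>\<omega>'. \<Phi> (Suc j) (mix \<omega> \<omega>')) = \<Phi> j (?F \<omega>)" if \<omega>: "\<omega> \<in> space N" for \<omega>
    proof (cases "j < card (X u \<omega> \<inter> {..t})")
      case True
      define W where "W = (\<Prod>k\<in>{..<card (X u \<omega> \<inter> {..t})} - {j}. if k < j then A k (?F \<omega>) else B k (?F \<omega>))"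
      have "(if k < Suc j then A k (mix \<omega> \<omega>') else B k (mix \<omega> \<omega>')) = (if k < j then A k (?F \<omega>) else B k (?F \<omega>))" if "k \<noteq> j" for k \<omega>'
        using that by (auto simp: A_def B_def mix_k mix_u)
      then have "(\<Prod>k\<in>{..<card (X u \<omega> \<inter> {..t})} - {j}. if k < Suc j then A k (mix \<omega> \<omega>') else B k (mix \<omega> \<omega>')) = W" for \<omega>'
        unfolding W_def by (intro prod.cong) auto
      then have "\<Phi> (Suc j) (mix \<omega> \<omega>') = s (shape (j # u) \<omega>' (t - kth_point j (X u \<omega>))) * W" for \<omega>'
        unfolding \<Phi>_def mix_u using True by (subst prod.remove[of _ j]) (auto simp: A_def mix_j mix_u shape_def)
      then have "expectation (\<lambda>\<omega>'. \<Phi> (Suc j) (mix \<omega> \<omega>')) = expectation (\<lambda>\<omega>'. s (shape (j # u) \<omega>' (t - kth_point j (X u \<omega>)))) * W"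
        by (simp only: integral_mult_left_zero)
      also have "\<dots> = g (t - kth_point j (X u \<omega>)) * W"
      proof -
        have fin: "finite (X u \<omega>)" using valid_X[OF \<omega>] by (simp add: valid_config_def)
        then have "j < card (X u \<omega>)" using True card_mono[OF fin, of "X u \<omega> \<inter> {..t}"] by simp
        then have "kth_point j (X u \<omega>) \<le> t" using card_below_kth_point[OF fin] True by simp
        then show ?thesis by (subst mean) auto
      qed
      also have "\<dots> = \<Phi> j (?F \<omega>)"
        unfolding \<Phi>_def W_def using True by (subst prod.remove[of _ j]) (auto simp: B_def)
      finally show ?thesis .
    next
      case False
      have "\<Phi> (Suc j) (mix \<omega> \<omega>') = \<Phi> j (?F \<omega>)" for \<omega>'
        unfolding \<Phi>_def mix_u using False by (intro prod.cong) (auto simp: A_def B_def mix_k mix_u)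
      then show ?thesis by (simp add: prob_space)
    qed
    moreover have "expectation (\<lambda>\<omega>. \<Phi> (Suc j) (?F \<omega>)) = expectation (\<lambda>\<omega>. expectation (\<lambda>\<omega>'. \<Phi> (Suc j) (mix \<omega> \<omega>')))"
      unfolding mix_def by (rule expectation_resample[OF indep \<Phi>m]) (use \<Phi>01 in \<open>simp add: abs_of_nonneg\<close>)
    ultimately show ?thesis by (simp cong: Bochner_Integration.integral_cong)
  qed
  have const: "expectation (\<lambda>\<omega>. \<Phi> j (?F \<omega>)) = expectation (\<lambda>\<omega>. \<Phi> 0 (?F \<omega>))" for j
    by (induction j) (simp_all add: step)
  define P where "P \<omega> = (\<Prod>k<card (X u \<omega> \<inter> {..t}). s (shape (k # u) \<omega> (t - kth_point k (X u \<omega>))))" for \<omega>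
  have lim: "(\<lambda>j. \<Phi> j (?F \<omega>)) \<longlonglongrightarrow> P \<omega>" for \<omega>
  proof (rule tendsto_eventually)
    show "\<forall>\<^sub>F j in sequentially. \<Phi> j (?F \<omega>) = P \<omega>"
      using eventually_ge_at_top[of "card (X u \<omega> \<inter> {..t})"]
      by eventually_elim (auto simp: \<Phi>_def P_def A_def shape_def intro!: prod.cong)
  qed
  have \<Phi>m': "(\<lambda>\<omega>. \<Phi> j (?F \<omega>)) \<in> borel_measurable N" for j
    by (rule measurable_compose[OF measurable_family \<Phi>m])
  have "(\<lambda>j. expectation (\<lambda>\<omega>. \<Phi> j (?F \<omega>))) \<longlonglongrightarrow> expectation P"
  proof (rule integral_dominated_convergence[where w = "\<lambda>_. 1"])
    show "P \<in> borel_measurable N" by (rule borel_measurable_LIMSEQ_real[OF lim \<Phi>m'])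
    show "AE \<omega> in N. norm (\<Phi> j (?F \<omega>)) \<le> 1" for j using \<Phi>01 by simp
  qed (use \<Phi>m' lim in auto)
  moreover have "(\<lambda>j. expectation (\<lambda>\<omega>. \<Phi> j (?F \<omega>))) = (\<lambda>j. expectation (\<lambda>\<omega>. \<Phi> 0 (?F \<omega>)))"
    by (rule ext) (rule const)
  ultimately have "(\<lambda>j :: nat. expectation (\<lambda>\<omega>. \<Phi> 0 (?F \<omega>))) \<longlonglongrightarrow> expectation P" by (rule subst[rotated])
  then have "expectation P = expectation (\<lambda>\<omega>. \<Phi> 0 (?F \<omega>))" by (rule LIMSEQ_unique[OF _ tendsto_const])
  also have "\<dots> = expectation (\<lambda>\<omega>. \<Prod>p\<in>X u \<omega>. if p \<le> t then g (t - p) else 1)"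
  proof (rule Bochner_Integration.integral_cong[OF refl])
    fix \<omega> assume "\<omega> \<in> space N"
    then have fin: "finite (X u \<omega>)" using valid_X by (simp add: valid_config_def)
    have "\<Phi> 0 (?F \<omega>) = (\<Prod>p\<in>X u \<omega> \<inter> {..t}. g (t - p))"
      unfolding \<Phi>_def B_def using prod.reindex_bij_betw[OF bij_betw_kth_point[OF fin, of t], of "\<lambda>p. g (t - p)"] by simp
    also have "\<dots> = (\<Prod>p\<in>X u \<omega>. if p \<le> t then g (t - p) else 1)"
      using fin by (simp add: prod.inter_restrict)
    finally show "\<Phi> 0 (?F \<omega>) = (\<Prod>p\<in>X u \<omega>. if p \<le> t then g (t - p) else 1)" .
  qed
  also have "\<dots> = exp (1 / (1 - \<theta>) * (\<integral>p. indicator {0..c} p * ((if p \<le> t then g (t - p) else 1) - 1) \<partial>lborel))"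
    by (rule poisson_laplace[OF poisson]) (use \<theta> g01 in auto)
  also have "1 / (1 - \<theta>) * (\<integral>p. indicator {0..c} p * ((if p \<le> t then g (t - p) else 1) - 1) \<partial>lborel)
    = (\<integral>z. kernel \<theta> t z * (g z - 1) \<partial>expo)"
  proof -
    have "(\<integral>z. kernel \<theta> t z * (g z - 1) \<partial>expo) = (\<integral>z. exponential_density 1 z * (kernel \<theta> t z * (g z - 1)) \<partial>lborel)"
    proof -
      have [measurable]: "(\<lambda>z. kernel \<theta> t z) \<in> borel_measurable borel"
        using measurable_Pair2[OF measurable_kernel[of \<theta>, OF \<theta>], of t] by simp
      show ?thesis unfolding expo_def by (subst integral_density) (auto simp: exponential_density_nonneg)
    qed
    also have "\<dots> = (\<integral>p. exponential_density 1 (t - p) * (kernel \<theta> t (t - p) * (g (t - p) - 1)) \<partial>lborel)"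
      by (subst lborel_integral_real_affine[where c = "-1" and t = t]) auto
    also have "\<dots> = (\<integral>p. 1 / (1 - \<theta>) * (indicator {0..c} p * ((if p \<le> t then g (t - p) else 1) - 1)) \<partial>lborel)"
      by (rule Bochner_Integration.integral_cong) (auto simp: exponential_density_def kernel_def indicator_def exp_minus exp_diff divide_simps)
    finally show ?thesis by simp
  qed
  finally show ?thesis by (simp add: P_def)
qed

end

context branching
begin

definition prob_shape :: "nat list \<Rightarrow> rtree \<Rightarrow> real \<Rightarrow> real" where
  "prob_shape u t y = prob {\<omega> \<in> space N. shape u \<omega> y = Some t}"

text \<open>The functional of the multiset of subtrees at the root to which the inversion is applied; infinite genealogies
  contribute 0.\<close>

definition root_functional :: "nat list \<Rightarrow> real \<Rightarrow> (rtree multiset \<Rightarrow> real) \<Rightarrow> real" where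
  "root_functional u y f = expectation (\<lambda>\<omega>. case_option 0 (\<lambda>b. f (subtrees b)) (shape u \<omega> y))"

lemma measurable_fun_shape [measurable]: "(\<lambda>\<omega>. f (shape u \<omega> y)) \<in> N \<rightarrow>\<^sub>M (borel :: real measure)"
  by (rule measurable_compose[of _ _ "count_space UNIV"]) measurable

lemma sets_shape [measurable]: "{\<omega> \<in> space N. Q (shape u \<omega> y)} \<in> sets N"
proof -
  have "(\<lambda>\<omega>. shape u \<omega> y) -` {t. Q t} \<inter> space N \<in> sets N" by (rule measurable_sets[of _ _ "count_space UNIV"]) auto
  then show ?thesis by (simp add: vimage_def Int_def conj_commute)
qed

lemma integrable_fun_shape: "(\<And>t. \<bar>f t\<bar> \<le> K) \<Longrightarrow> integrable N (\<lambda>\<omega>. f (shape u \<omega> y) :: real)"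
  by (rule integrable_const_bound[of _ K]) auto

lemma contraction_root_functional: "contraction (root_functional u y)"
  unfolding contraction_def
proof (intro conjI allI impI)
  fix f :: "rtree multiset \<Rightarrow> real" and K assume K: "\<forall>B. \<bar>f B\<bar> \<le> K"
  have K0: "0 \<le> K" using K abs_ge_zero order_trans by blast
  have b: "\<bar>case_option 0 (\<lambda>b. f (subtrees b)) t\<bar> \<le> K" for t using K K0 by (cases t) auto
  have "\<bar>root_functional u y f\<bar> \<le> expectation (\<lambda>\<omega>. \<bar>case_option 0 (\<lambda>b. f (subtrees b)) (shape u \<omega> y)\<bar>)"
    unfolding root_functional_def by (rule integral_abs_bound)
  also have "\<dots> \<le> expectation (\<lambda>\<omega>. K)" by (rule integral_mono') (use b K0 in auto)
  finally show "\<bar>root_functional u y f\<bar> \<le> K" by (simp add: prob_space)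
next
  fix f g :: "rtree multiset \<Rightarrow> real" and a K assume K: "\<forall>B. \<bar>f B\<bar> \<le> K \<and> \<bar>g B\<bar> \<le> K"
  have K0: "0 \<le> K" using K abs_ge_zero order_trans by blast
  have b: "\<bar>case_option 0 (\<lambda>b. f (subtrees b)) t\<bar> \<le> K" "\<bar>case_option 0 (\<lambda>b. g (subtrees b)) t\<bar> \<le> K" for t
    using K K0 by (cases t; simp)+
  have "case_option 0 (\<lambda>b. f (subtrees b) + a * g (subtrees b)) t
    = case_option 0 (\<lambda>b. f (subtrees b)) t + a * case_option 0 (\<lambda>b. g (subtrees b)) t" for t by (cases t) auto
  moreover have "integrable N (\<lambda>\<omega>. case_option 0 (\<lambda>b. f (subtrees b)) (shape u \<omega> y))"
    by (rule integrable_fun_shape) (rule b)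
  moreover have "integrable N (\<lambda>\<omega>. case_option 0 (\<lambda>b. g (subtrees b)) (shape u \<omega> y))"
    by (rule integrable_fun_shape) (rule b)
  ultimately show "root_functional u y (\<lambda>B. f B + a * g B) = root_functional u y f + a * root_functional u y g"
    unfolding root_functional_def by simp
qed

lemma root_functional_pgf:
  fixes s :: "rtree \<Rightarrow> real"
  assumes s: "\<And>t. 0 \<le> s t \<and> s t \<le> 1" and g: "g \<in> borel_measurable borel" "\<And>y. 0 \<le> g y \<and> g y \<le> 1"
    and mean: "\<And>w y. 0 \<le> y \<Longrightarrow> expectation (\<lambda>\<omega>. case_option 0 s (shape w \<omega> y)) = g y" and y: "0 \<le> y"
  shows "root_functional u y (mset_pgf s) = exp (\<integral>z. kernel \<theta> y z * (g z - 1) \<partial>expo)"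
proof -
  have "root_functional u y (mset_pgf s)
    = expectation (\<lambda>\<omega>. \<Prod>k<card (X u \<omega> \<inter> {..y}). case_option 0 s (shape (k # u) \<omega> (y - kth_point k (X u \<omega>))))"
    unfolding root_functional_def
  proof (rule Bochner_Integration.integral_cong[OF refl])
    fix \<omega> assume \<omega>: "\<omega> \<in> space N"
    define C where "C k = shape (k # u) \<omega> (y - kth_point k (X u \<omega>))" for k
    define m where "m = card (X u \<omega> \<inter> {..y})"
    have rec: "shape u \<omega> y = (if \<forall>k<m. C k \<noteq> None then Some (Node (image_mset (\<lambda>k. the (C k)) (mset_set {..<m}))) else None)"
      unfolding C_def m_def by (rule shape_rec[OF \<omega> y])
    have "case_option 0 (\<lambda>b. mset_pgf s (subtrees b)) (shape u \<omega> y) = (\<Prod>k<m. case_option 0 s (C k))"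
    proof (cases "\<forall>k<m. C k \<noteq> None")
      case True
      then have "case_option 0 (\<lambda>b. mset_pgf s (subtrees b)) (shape u \<omega> y) = (\<Prod>k<m. s (the (C k)))"
        unfolding rec by (simp add: mset_pgf_mset_set)
      also have "\<dots> = (\<Prod>k<m. case_option 0 s (C k))" using True by (intro prod.cong) auto
      finally show ?thesis .
    next
      case False
      then obtain k where "k < m" "C k = None" by blast
      then have "(\<Prod>k<m. case_option 0 s (C k)) = 0" by (intro prod_zero) (auto intro!: bexI[of _ k])
      moreover have "shape u \<omega> y = None" unfolding rec using False by (simp only: if_False)
      ultimately show ?thesis by simp
    qed
    then show "case_option 0 (\<lambda>b. mset_pgf s (subtrees b)) (shape u \<omega> y)
      = (\<Prod>k<card (X u \<omega> \<inter> {..y}). case_option 0 s (shape (k # u) \<omega> (y - kth_point k (X u \<omega>))))"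
      by (simp add: C_def m_def)
  qed
  also have "\<dots> = exp (\<integral>z. kernel \<theta> y z * (g z - 1) \<partial>expo)"
    by (rule children_laplace[OF _ g mean y]) (use s in \<open>auto split: option.split\<close>)
  finally show ?thesis .
qed

lemma mean_finite_support:
  fixes s :: "rtree \<Rightarrow> real"
  assumes "finite C" "\<And>t. t \<notin> C \<Longrightarrow> s t = 0"
  shows "expectation (\<lambda>\<omega>. case_option 0 s (shape w \<omega> y)) = (\<Sum>t\<in>C. s t * prob_shape w t y)"
proof -
  have "case_option 0 s (shape w \<omega> y) = (\<Sum>t\<in>C. s t * indicator {\<omega> \<in> space N. shape w \<omega> y = Some t} \<omega>)"
    if "\<omega> \<in> space N" for \<omega>
  proof (cases "shape w \<omega> y")
    case (Some t')
    have "(\<Sum>t\<in>C. s t * indicator {\<omega> \<in> space N. shape w \<omega> y = Some t} \<omega>) = (\<Sum>t\<in>C. if t = t' then s t' else 0)"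
      using Some that by (intro sum.cong) (auto simp: indicator_def)
    then show ?thesis using Some assms by (simp add: sum.delta)
  qed (simp add: indicator_def)
  then have "expectation (\<lambda>\<omega>. case_option 0 s (shape w \<omega> y))
    = expectation (\<lambda>\<omega>. \<Sum>t\<in>C. s t * indicator {\<omega> \<in> space N. shape w \<omega> y = Some t} \<omega>)"
    by (intro Bochner_Integration.integral_cong) auto
  also have "\<dots> = (\<Sum>t\<in>C. expectation (\<lambda>\<omega>. s t * indicator {\<omega> \<in> space N. shape w \<omega> y = Some t} \<omega>))"
    by (rule Bochner_Integration.integral_sum) (auto intro!: integrable_mult_right integrable_real_indicator simp: emeasure_eq_measure)
  also have "\<dots> = (\<Sum>t\<in>C. s t * prob_shape w t y)"
  proof (intro sum.cong refl)
    fix t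
    have "{\<omega> \<in> space N. shape w \<omega> y = Some t} \<inter> space N = {\<omega> \<in> space N. shape w \<omega> y = Some t}" by auto
    then show "expectation (\<lambda>\<omega>. s t * indicator {\<omega> \<in> space N. shape w \<omega> y = Some t} \<omega>) = s t * prob_shape w t y"
      by (simp add: prob_shape_def)
  qed
  finally show ?thesis .
qed

lemma prob_shape_bounds: "0 \<le> prob_shape u t y \<and> prob_shape u t y \<le> 1"
  by (simp add: prob_shape_def)

lemma measurable_prob_shape [measurable]: "prob_shape u t \<in> borel_measurable borel"
proof -
  have "prob_shape u t y = expectation (\<lambda>\<omega>. case_option 0 (\<lambda>t'. of_bool (t' = t)) (shape u \<omega> y))" for y
    using mean_finite_support[of "{t}" "\<lambda>t'. of_bool (t' = t)" u y] by simp
  then show ?thesis using measurable_expectation_shape[of "case_option 0 (\<lambda>t'. of_bool (t' = t))" u] by (simp add: fun_eq_iff[symmetric] cong: measurable_cong)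
qed

lemma root_functional_Node: "root_functional u y (\<lambda>B. of_bool (B = A)) = prob_shape u (Node A) y"
proof -
  have "subtrees b = A \<longleftrightarrow> b = Node A" for b by (cases b) auto
  then have eq: "(\<lambda>b. of_bool (subtrees b = A)) = (\<lambda>t'. of_bool (t' = Node A) :: real)" by simp
  show ?thesis
    unfolding root_functional_def eq using mean_finite_support[of "{Node A}" "\<lambda>t'. of_bool (t' = Node A)" u y] by simp
qed

text \<open>The assumption on \<open>A\<close> is the induction hypothesis in the comparison of the laws of different individuals.\<close>

lemma root_functional_pgf_finite:
  assumes A: "\<And>t w y. t \<in># A \<Longrightarrow> 0 \<le> y \<Longrightarrow> prob_shape w t y = prob_shape [] t y"
    and s: "\<And>t. 0 \<le> s t \<and> s t \<le> 1" "\<And>t. t \<notin># A \<Longrightarrow> s t = 0" and y: "0 \<le> y"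
  defines "G \<equiv> \<lambda>z. \<Sum>t\<in>set_mset A. s t * prob_shape [] t z"
  shows "root_functional u y (mset_pgf s) = exp (\<integral>z. kernel \<theta> y z * (G z - 1) \<partial>expo)" "\<And>z. 0 \<le> G z \<and> G z \<le> 1"
proof -
  have G: "expectation (\<lambda>\<omega>. case_option 0 s (shape [] \<omega> z)) = G z" for z
    unfolding G_def by (rule mean_finite_support) (use s in auto)
  have s': "0 \<le> case_option 0 s t \<and> case_option 0 s t \<le> 1" for t using s(1) by (cases t) auto
  show G01: "0 \<le> G z \<and> G z \<le> 1" for z
  proof -
    have "expectation (\<lambda>\<omega>. case_option 0 s (shape [] \<omega> z)) \<le> expectation (\<lambda>\<omega>. 1)"
      by (rule integral_mono') (use s' in auto)
    moreover have "0 \<le> expectation (\<lambda>\<omega>. case_option 0 s (shape [] \<omega> z))"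
      by (rule integral_nonneg_AE) (use s' in auto)
    ultimately show ?thesis by (simp add: G prob_space)
  qed
  show "root_functional u y (mset_pgf s) = exp (\<integral>z. kernel \<theta> y z * (G z - 1) \<partial>expo)"
  proof (rule root_functional_pgf[OF s(1) _ G01 _ y])
    show "G \<in> borel_measurable borel" unfolding G_def by measurable
    fix w y assume y: "0 \<le> (y :: real)"
    have "expectation (\<lambda>\<omega>. case_option 0 s (shape w \<omega> y)) = (\<Sum>t\<in>set_mset A. s t * prob_shape w t y)"
      by (rule mean_finite_support) (use s in auto)
    also have "\<dots> = G y" unfolding G_def
    proof (rule sum.cong[OF refl])
      fix t assume "t \<in># A"
      from A[OF this y, of w] show "s t * prob_shape w t y = s t * prob_shape [] t y" by (rule arg_cong)
    qed
    finally show "expectation (\<lambda>\<omega>. case_option 0 s (shape w \<omega> y)) = G y" .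
  qed
qed

text \<open>Induction on the tree: the generating functions of the children of two individuals agree once the laws of the
  smaller trees do, and then inversion applies to a constant sequence of functionals.\<close>

lemma prob_shape_eq_root: "0 \<le> y \<Longrightarrow> prob_shape u t y = prob_shape [] t y"
proof (induction t arbitrary: u y)
  case (Node A)
  have "(\<lambda>n :: nat. root_functional u y (\<lambda>B. of_bool (B = A))) \<longlonglongrightarrow> root_functional [] y (\<lambda>B. of_bool (B = A))"
  proof (rule pgf_inversion)
    fix s :: "rtree \<Rightarrow> real" assume s: "\<And>x. 0 \<le> s x \<and> s x \<le> 1" "\<And>x. x \<notin># A \<Longrightarrow> s x = 0"
    have "root_functional v y (mset_pgf s)
      = exp (\<integral>z. kernel \<theta> y z * ((\<Sum>t\<in>set_mset A. s t * prob_shape [] t z) - 1) \<partial>expo)" for v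
      by (rule root_functional_pgf_finite(1)[OF Node.IH s Node.prems])
    then show "(\<lambda>n :: nat. root_functional u y (mset_pgf s)) \<longlonglongrightarrow> root_functional [] y (mset_pgf s)"
      by (simp only: tendsto_const)
  qed (rule contraction_root_functional)+
  then show ?case unfolding root_functional_Node by (rule LIMSEQ_unique[OF tendsto_const])
qed

lemma prob_not_None: "prob {\<omega> \<in> space N. shape u \<omega> y \<noteq> None} = enn2real (\<integral>\<^sup>+t. ennreal (prob_shape u t y) \<partial>count_space UNIV)"
proof -
  have "{\<omega> \<in> space N. shape u \<omega> y \<noteq> None} = (\<Union>t\<in>UNIV. {\<omega> \<in> space N. shape u \<omega> y = Some t})" by auto
  then have "emeasure N {\<omega> \<in> space N. shape u \<omega> y \<noteq> None} = (\<integral>\<^sup>+t. emeasure N {\<omega> \<in> space N. shape u \<omega> y = Some t} \<partial>count_space UNIV)"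
    by (simp only:, intro emeasure_UN_countable) (auto simp: countable_rtree disjoint_family_on_def)
  then have "enn2real (emeasure N {\<omega> \<in> space N. shape u \<omega> y \<noteq> None})
    = enn2real (\<integral>\<^sup>+t. emeasure N {\<omega> \<in> space N. shape u \<omega> y = Some t} \<partial>count_space UNIV)" by (rule arg_cong)
  then show ?thesis unfolding prob_shape_def emeasure_eq_measure[symmetric] by (simp only: measure_def)
qed

lemma kernel_integral_le:
  assumes f [measurable]: "f \<in> borel_measurable borel" and f0: "\<And>z. 0 \<le> z \<Longrightarrow> 0 \<le> f z"
    and int: "integrable lborel (\<lambda>z. indicator {0..y} z * f z)"
  shows "(\<integral>z. kernel \<theta> y z * f z \<partial>expo) \<le> (\<integral>z. indicator {0..y} z * f z \<partial>lborel) / (1 - \<theta>)"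
proof -
  have [measurable]: "(\<lambda>z. kernel \<theta> y z) \<in> borel_measurable borel"
    using measurable_Pair2[OF measurable_kernel[of \<theta>, OF \<theta>], of y] by simp
  have "(\<integral>z. kernel \<theta> y z * f z \<partial>expo) = (\<integral>z. exponential_density 1 z * (kernel \<theta> y z * f z) \<partial>lborel)"
    unfolding expo_def by (subst integral_density) (auto simp: exponential_density_nonneg)
  also have "\<dots> \<le> (\<integral>z. 1 / (1 - \<theta>) * (indicator {0..y} z * f z) \<partial>lborel)"
  proof (rule integral_mono')
    show "exponential_density 1 z * (kernel \<theta> y z * f z) \<le> 1 / (1 - \<theta>) * (indicator {0..y} z * f z)" for z
      using \<theta> f0[of z] by (auto simp: exponential_density_def kernel_def indicator_def exp_minus divide_simps)
    show "0 \<le> 1 / (1 - \<theta>) * (indicator {0..y} z * f z)" for z using \<theta> f0[of z] by (auto simp: indicator_def)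
  qed (use int in simp)
  finally show ?thesis by simp
qed

text \<open>The probability of an infinite genealogy, as a function of the age, satisfies a Volterra inequality, whose
  iteration makes it smaller than every term of an exponential series.\<close>

lemma no_explosion:
  assumes y: "0 \<le> y"
  shows "prob {\<omega> \<in> space N. shape u \<omega> y = None} = 0"
proof -
  define r where "r = 1 / (1 - \<theta>)"
  have r: "0 \<le> r" using \<theta> by (simp add: r_def)
  define g :: "real \<Rightarrow> real" where "g y = expectation (\<lambda>\<omega>. case_option 0 (\<lambda>_. 1) (shape [] \<omega> y))" for y
  define e where "e y = 1 - g y" for y
  have g_prob: "expectation (\<lambda>\<omega>. case_option 0 (\<lambda>_. 1) (shape w \<omega> y)) = prob {\<omega> \<in> space N. shape w \<omega> y \<noteq> None}" for w y
  proof -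
    have "expectation (\<lambda>\<omega>. case_option 0 (\<lambda>_. 1) (shape w \<omega> y)) = expectation (indicator {\<omega> \<in> space N. shape w \<omega> y \<noteq> None})"
      by (rule Bochner_Integration.integral_cong) (auto simp: indicator_def split: option.split)
    also have "\<dots> = prob ({\<omega> \<in> space N. shape w \<omega> y \<noteq> None} \<inter> space N)" by simp
    also have "{\<omega> \<in> space N. shape w \<omega> y \<noteq> None} \<inter> space N = {\<omega> \<in> space N. shape w \<omega> y \<noteq> None}" by auto
    finally show ?thesis .
  qed
  have g_root: "prob {\<omega> \<in> space N. shape w \<omega> y \<noteq> None} = g y" if "0 \<le> y" for w y
    unfolding g_def g_prob prob_not_None by (simp only: prob_shape_eq_root[OF that, of w])
  have gm [measurable]: "g \<in> borel_measurable borel" unfolding g_def by (rule measurable_expectation_shape)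
  have g01: "0 \<le> g y \<and> g y \<le> 1" for y unfolding g_def g_prob by simp
  have em [measurable]: "e \<in> borel_measurable borel" unfolding e_def by measurable
  have volterra: "e y \<le> (\<integral>z. kernel \<theta> y z * e z \<partial>expo)" if y: "0 \<le> y" for y
  proof -
    have "mset_pgf (\<lambda>_. 1 :: real) = (\<lambda>_ :: rtree multiset. 1)" by (auto simp: mset_pgf_def)
    then have "g y = root_functional [] y (mset_pgf (\<lambda>_. 1))" by (simp add: root_functional_def g_def)
    also have "\<dots> = exp (\<integral>z. kernel \<theta> y z * (g z - 1) \<partial>expo)"
      by (rule root_functional_pgf) (use gm g01 g_prob g_root y in auto)
    also have "(\<integral>z. kernel \<theta> y z * (g z - 1) \<partial>expo) = - (\<integral>z. kernel \<theta> y z * e z \<partial>expo)"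
      unfolding integral_minus[symmetric] by (simp add: e_def algebra_simps)
    finally show ?thesis using exp_ge_add_one_self[of "- (\<integral>z. kernel \<theta> y z * e z \<partial>expo)"] by (simp add: e_def)
  qed
  have e0: "0 \<le> e y" for y using g01 by (simp add: e_def)
  have bound: "e y \<le> (r * y) ^ n / fact n" if "0 \<le> y" for n y
    using that
  proof (induction n arbitrary: y)
    case 0
    then show ?case using g01[of y] by (simp add: e_def)
  next
    case (Suc n)
    have pw: "(\<integral>z. indicator {0..y} z * ((r * z) ^ n / fact n) \<partial>lborel) = r ^ n / fact n * (y ^ Suc n / Suc n)"
    proof -
      have "(\<integral>z. indicator {0..y} z * ((r * z) ^ n / fact n) \<partial>lborel) = (\<integral>z. r ^ n / fact n * (z ^ n * indicator {0..y} z) \<partial>lborel)"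
        by (rule Bochner_Integration.integral_cong) (auto simp: power_mult_distrib)
      then show ?thesis using integral_power[of 0 y n] Suc.prems by simp
    qed
    have int: "integrable lborel (\<lambda>z. indicator {0..y} z * ((r * z) ^ n / fact n))"
      using borel_integrable_atLeastAtMost'[of 0 y "\<lambda>z. (r * z) ^ n / fact n"] by (simp add: set_integrable_def continuous_intros)
    have kint: "integrable expo (\<lambda>z. kernel \<theta> y z * f z)" if "f \<in> borel_measurable borel" "\<And>z. \<bar>f z\<bar> \<le> 1" for f
      by (rule integrable_kernel[OF \<theta> that])
    have "e y \<le> (\<integral>z. kernel \<theta> y z * e z \<partial>expo)" by (rule volterra[OF Suc.prems])
    also have "\<dots> \<le> (\<integral>z. indicator {0..y} z * e z \<partial>lborel) / (1 - \<theta>)"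
    proof (rule kernel_integral_le[OF em e0])
      show "integrable lborel (\<lambda>z. indicator {0..y} z * e z)"
      proof (rule Bochner_Integration.integrable_bound)
        show "integrable lborel (indicator {0..y} :: real \<Rightarrow> real)"
          by (intro integrable_real_indicator) (auto simp: emeasure_lborel_Icc_eq)
        show "AE z in lborel. norm (indicator {0..y} z * e z) \<le> norm (indicator {0..y} z :: real)"
          using e0 g01 by (intro always_eventually allI) (auto simp: indicator_def e_def)
      qed measurable
    qed
    also have "\<dots> \<le> (\<integral>z. indicator {0..y} z * ((r * z) ^ n / fact n) \<partial>lborel) / (1 - \<theta>)"
    proof (intro divide_right_mono integral_mono')
      show "indicator {0..y} z * e z \<le> indicator {0..y} z * ((r * z) ^ n / fact n)" for z
        using Suc.IH[of z] by (auto simp: indicator_def)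
      show "0 \<le> indicator {0..y} z * ((r * z) ^ n / fact n)" for z using r by (auto simp: indicator_def)
    qed (use int \<theta> in auto)
    also have "\<dots> = (r * y) ^ Suc n / fact (Suc n)"
      unfolding pw by (simp add: r_def power_mult_distrib field_simps)
    finally show ?case .
  qed
  have "(\<lambda>n. (r * y) ^ n / fact n) \<longlonglongrightarrow> 0"
    using summable_LIMSEQ_zero[OF summable_exp[of "r * y"]] by (simp add: divide_inverse mult.commute)
  then have "e y \<le> 0" by (rule LIMSEQ_le_const) (use bound[OF y] in auto)
  then have "prob {\<omega> \<in> space N. shape u \<omega> y \<noteq> None} = 1" using e0[of y] g_root[OF y, of u] by (simp add: e_def)
  moreover have "{\<omega> \<in> space N. shape u \<omega> y = None} = space N - {\<omega> \<in> space N. shape u \<omega> y \<noteq> None}" by auto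
  ultimately show ?thesis using prob_compl[of "{\<omega> \<in> space N. shape u \<omega> y \<noteq> None}"] by simp
qed

end

section \<open>The fringe distribution\<close>

context branching
begin

abbreviation law where "law \<equiv> genealogy_law N X T"

lemma measurable_T [measurable]: "T \<in> N \<rightarrow>\<^sub>M borel"
proof -
  have "distributed N lborel T (exponential_density 1)" using model by (simp add: branching_model_def)
  from distributed_measurable[OF this] show ?thesis by simp
qed

lemma law_eq: "law = distr N (count_space UNIV) (\<lambda>\<omega>. shape [] \<omega> (T \<omega>))"
  by (simp add: genealogy_law_def shape_def bp_shape_def)

lemma sets_law [simp]: "sets law = UNIV" and space_law [simp]: "space law = UNIV"
  by (simp_all add: law_eq)

lemma prob_space_law: "prob_space law"
  unfolding law_eq by (rule prob_space_distr) measurable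

text \<open>Independence of the exponential age turns the law into a mixture of the laws at fixed ages.\<close>

lemma nn_integral_law:
  fixes f :: "ftree \<Rightarrow> ennreal"
  shows "(\<integral>\<^sup>+t. f t \<partial>law) = (\<integral>\<^sup>+y. (\<integral>\<^sup>+\<omega>. f (shape [] \<omega> y) \<partial>N) \<partial>expo)"
proof -
  let ?F = "families {0..c}"
  let ?fam = "\<lambda>\<omega> u. X u \<omega>"
  interpret dX: prob_space "distr N ?F ?fam" by (rule prob_space_distr) (rule measurable_family)
  interpret dT: prob_space "distr N borel T" by (rule prob_space_distr) (rule measurable_T)
  have ind: "indep_set (sets (vimage_algebra (space N) T borel)) (sets (vimage_algebra (space N) ?fam ?F))"
    using model by (simp add: branching_model_def)
  have eq: "distr N borel T \<Otimes>\<^sub>M distr N ?F ?fam = distr N (borel \<Otimes>\<^sub>M ?F) (\<lambda>\<omega>. (T \<omega>, ?fam \<omega>))"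
  proof (rule pair_measure_eqI)
    show "sigma_finite_measure (distr N borel T)" "sigma_finite_measure (distr N ?F ?fam)" by unfold_locales
    fix A B assume A: "A \<in> sets (distr N borel T)" and B: "B \<in> sets (distr N ?F ?fam)"
    have AB: "T -` A \<inter> space N \<in> sets (vimage_algebra (space N) T borel)"
      "?fam -` B \<inter> space N \<in> sets (vimage_algebra (space N) ?fam ?F)"
      using A B by (auto intro: in_vimage_algebra)
    have "(\<lambda>\<omega>. (T \<omega>, ?fam \<omega>)) -` (A \<times> B) \<inter> space N = (T -` A \<inter> space N) \<inter> (?fam -` B \<inter> space N)" by auto
    then have "emeasure (distr N (borel \<Otimes>\<^sub>M ?F) (\<lambda>\<omega>. (T \<omega>, ?fam \<omega>))) (A \<times> B) = ennreal (prob ((T -` A \<inter> space N) \<inter> (?fam -` B \<inter> space N)))"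
      using A B by (subst emeasure_distr) (auto simp: emeasure_eq_measure)
    also have "\<dots> = ennreal (prob (T -` A \<inter> space N)) * ennreal (prob (?fam -` B \<inter> space N))"
      by (simp add: indep_setD[OF ind AB] ennreal_mult)
    also have "\<dots> = emeasure (distr N borel T) A * emeasure (distr N ?F ?fam) B"
      using A B by (simp add: emeasure_distr emeasure_eq_measure)
    finally show "emeasure (distr N borel T) A * emeasure (distr N ?F ?fam) B
      = emeasure (distr N (borel \<Otimes>\<^sub>M ?F) (\<lambda>\<omega>. (T \<omega>, ?fam \<omega>))) (A \<times> B)" ..
  qed (simp cong: sets_pair_measure_cong)
  have T: "distr N borel T = expo"
  proof -
    have "distr N lborel T = density lborel (exponential_density 1)"
      using model distributed_distr_eq_density[of N lborel T] by (simp add: branching_model_def)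
    moreover have "distr N borel T = distr N lborel T" by (rule distr_cong) auto
    ultimately show ?thesis by (simp add: expo_def)
  qed
  define h where "h z = f (bp_shape (snd z) (fst z))" for z :: "real \<times> (nat list \<Rightarrow> real set)"
  have hm [measurable]: "h \<in> borel_measurable (borel \<Otimes>\<^sub>M ?F)"
  proof -
    have "(\<lambda>z. (snd z, fst z)) \<in> borel \<Otimes>\<^sub>M ?F \<rightarrow>\<^sub>M ?F \<Otimes>\<^sub>M borel" by measurable
    from measurable_compose[OF this measurable_bp_shape]
    have "(\<lambda>z. bp_shape (snd z) (fst z)) \<in> borel \<Otimes>\<^sub>M ?F \<rightarrow>\<^sub>M count_space UNIV" by simp
    from measurable_compose[OF this, of f borel] show ?thesis by (simp add: h_def[abs_def])
  qed
  have "(\<integral>\<^sup>+t. f t \<partial>law) = (\<integral>\<^sup>+\<omega>. f (shape [] \<omega> (T \<omega>)) \<partial>N)"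
    unfolding law_eq by (rule nn_integral_distr) auto
  also have "\<dots> = (\<integral>\<^sup>+\<omega>. h (T \<omega>, ?fam \<omega>) \<partial>N)" by (simp add: h_def shape_def)
  also have "\<dots> = (\<integral>\<^sup>+z. h z \<partial>(distr N borel T \<Otimes>\<^sub>M distr N ?F ?fam))"
    unfolding eq by (subst nn_integral_distr) auto
  also have "\<dots> = (\<integral>\<^sup>+y. (\<integral>\<^sup>+x. h (y, x) \<partial>distr N ?F ?fam) \<partial>distr N borel T)"
    by (rule dX.nn_integral_fst[symmetric]) measurable
  also have "\<dots> = (\<integral>\<^sup>+y. (\<integral>\<^sup>+\<omega>. f (shape [] \<omega> y) \<partial>N) \<partial>expo)"
    unfolding T
  proof (rule nn_integral_cong)
    fix y
    have "(\<lambda>x. h (y, x)) \<in> borel_measurable ?F" using measurable_Pair2[OF hm, of y] by simp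
    then show "(\<integral>\<^sup>+x. h (y, x) \<partial>distr N ?F ?fam) = (\<integral>\<^sup>+\<omega>. f (shape [] \<omega> y) \<partial>N)"
      by (subst nn_integral_distr) (auto simp: h_def shape_def)
  qed
  finally show ?thesis .
qed

lemma emeasure_law: "emeasure law {t} = (\<integral>\<^sup>+y. emeasure N {\<omega> \<in> space N. shape [] \<omega> y = t} \<partial>expo)"
proof -
  have "emeasure law {t} = (\<integral>\<^sup>+s. indicator {t} s \<partial>law)" by simp
  also have "\<dots> = (\<integral>\<^sup>+y. (\<integral>\<^sup>+\<omega>. indicator {t} (shape [] \<omega> y) \<partial>N) \<partial>expo)" by (rule nn_integral_law)
  also have "\<dots> = (\<integral>\<^sup>+y. emeasure N {\<omega> \<in> space N. shape [] \<omega> y = t} \<partial>expo)"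
  proof (rule nn_integral_cong)
    fix y
    have "(\<integral>\<^sup>+\<omega>. indicator {t} (shape [] \<omega> y) \<partial>N) = (\<integral>\<^sup>+\<omega>. indicator {\<omega> \<in> space N. shape [] \<omega> y = t} \<omega> \<partial>N)"
      by (rule nn_integral_cong) (auto simp: indicator_def)
    then show "(\<integral>\<^sup>+\<omega>. indicator {t} (shape [] \<omega> y) \<partial>N) = emeasure N {\<omega> \<in> space N. shape [] \<omega> y = t}" by simp
  qed
  finally show ?thesis .
qed

lemma measure_law_Some: "measure law {Some t} = (\<integral>y. prob_shape [] t y \<partial>expo)"
proof -
  have i: "integrable expo (prob_shape [] t)"
    by (rule expo.integrable_const_bound[of _ 1]) (use prob_shape_bounds in auto)
  have "emeasure law {Some t} = (\<integral>\<^sup>+y. ennreal (prob_shape [] t y) \<partial>expo)"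
    unfolding emeasure_law prob_shape_def emeasure_eq_measure ..
  also have "\<dots> = ennreal (\<integral>y. prob_shape [] t y \<partial>expo)"
    by (rule nn_integral_eq_integral[OF i]) (use prob_shape_bounds in auto)
  finally show ?thesis
    unfolding measure_def using integral_nonneg_AE[of "prob_shape [] t" expo] prob_shape_bounds by simp
qed

lemma measurable_kernel_left [measurable]: "(\<lambda>y. kernel \<theta> y z) \<in> borel_measurable borel"
  using measurable_Pair1[OF measurable_kernel[of \<theta>, OF \<theta>], of z] by simp

lemma measurable_kernel_right [measurable]: "(\<lambda>z. kernel \<theta> y z) \<in> borel_measurable borel"
  using measurable_Pair2[OF measurable_kernel[of \<theta>, OF \<theta>], of y] by simp

text \<open>The mean number of children of shape \<open>t\<close> is a derivative of the Laplace functional: give these children the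
  weight \<open>1 - \<epsilon>\<close> and let \<open>\<epsilon>\<close> tend to 0.\<close>

lemma mean_child_count:
  assumes y: "0 \<le> y"
  shows "(\<integral>\<^sup>+\<omega>. ennreal (child_count (shape [] \<omega> y) (Some t)) \<partial>N) = ennreal (\<integral>z. kernel \<theta> y z * prob_shape [] t z \<partial>expo)"
proof -
  define C where "C k \<omega> = shape [k] \<omega> (y - kth_point k (X [] \<omega>))" for k \<omega>
  define m where "m \<omega> = card (X [] \<omega> \<inter> {..y})" for \<omega>
  define K where "K \<omega> = card {k. k < m \<omega> \<and> C k \<omega> = Some t}" for \<omega>
  define \<Lambda> where "\<Lambda> = (\<integral>z. kernel \<theta> y z * prob_shape [] t z \<partial>expo)"
  have \<Lambda>0: "0 \<le> \<Lambda>" unfolding \<Lambda>_def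
    by (rule integral_nonneg_AE) (use kernel_bounds(1)[OF \<theta>] prob_shape_bounds in auto)
  define \<epsilon> where "\<epsilon> j = 1 / real (Suc j)" for j
  have \<epsilon>: "0 < \<epsilon> j" "\<epsilon> j \<le> 1" for j by (simp_all add: \<epsilon>_def)
  define s where "s j f = (if f = Some t then 1 - \<epsilon> j else 1)" for j and f :: ftree
  define P where "P j \<omega> = (\<Prod>k<m \<omega>. s j (C k \<omega>))" for j \<omega>
  have s01: "0 \<le> s j f \<and> s j f \<le> 1" for j f using \<epsilon>[of j] by (simp add: s_def)
  have P_pow: "P j \<omega> = (1 - \<epsilon> j) ^ K \<omega>" for j \<omega>
    unfolding P_def K_def s_def by (simp add: prod.If_cases Int_def)
  have mm: "m \<in> N \<rightarrow>\<^sub>M count_space UNIV"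
    unfolding m_def by (rule measurable_compose[OF measurable_X]) auto
  have Pm [measurable]: "P j \<in> borel_measurable N" for j
    unfolding P_def
  proof (rule measurable_prod_lessThan[OF mm])
    fix k
    have "C k \<in> N \<rightarrow>\<^sub>M count_space UNIV" unfolding C_def by measurable
    from measurable_compose[OF this, of "s j" borel] show "(\<lambda>\<omega>. s j (C k \<omega>)) \<in> borel_measurable N" by simp
  qed
  have EP: "expectation (P j) = exp (- \<epsilon> j * \<Lambda>)" for j
  proof -
    have "expectation (P j) = exp (\<integral>z. kernel \<theta> y z * ((1 - \<epsilon> j * prob_shape [] t z) - 1) \<partial>expo)"
      unfolding P_def C_def m_def
    proof (rule children_laplace[OF s01 _ _ _ y])
      show "(\<lambda>z. 1 - \<epsilon> j * prob_shape [] t z) \<in> borel_measurable borel" by measurable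
      show "0 \<le> 1 - \<epsilon> j * prob_shape [] t z \<and> 1 - \<epsilon> j * prob_shape [] t z \<le> 1" for z
        using mult_le_one[of "\<epsilon> j" "prob_shape [] t z"] \<epsilon>[of j] prob_shape_bounds[of "[]" t z] by simp
      fix w z assume z: "0 \<le> (z :: real)"
      have ev: "{\<omega> \<in> space N. shape w \<omega> z = Some t} \<inter> space N = {\<omega> \<in> space N. shape w \<omega> z = Some t}" by auto
      have "expectation (\<lambda>\<omega>. s j (shape w \<omega> z)) = expectation (\<lambda>\<omega>. 1 - \<epsilon> j * indicator {\<omega> \<in> space N. shape w \<omega> z = Some t} \<omega>)"
        by (rule Bochner_Integration.integral_cong) (auto simp: s_def indicator_def)
      also have "\<dots> = 1 - \<epsilon> j * prob_shape w t z"
        by (subst Bochner_Integration.integral_diff) (auto simp: prob_shape_def prob_space ev intro!: integrable_mult_right integrable_real_indicator simp: emeasure_eq_measure)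
      finally show "expectation (\<lambda>\<omega>. s j (shape w \<omega> z)) = 1 - \<epsilon> j * prob_shape [] t z"
        using prob_shape_eq_root[OF z, of w t] by simp
    qed
    also have "(\<integral>z. kernel \<theta> y z * ((1 - \<epsilon> j * prob_shape [] t z) - 1) \<partial>expo) = (\<integral>z. (- \<epsilon> j) * (kernel \<theta> y z * prob_shape [] t z) \<partial>expo)"
      by (rule Bochner_Integration.integral_cong) (auto simp: algebra_simps)
    also have "\<dots> = - \<epsilon> j * \<Lambda>" unfolding \<Lambda>_def by (rule integral_mult_right_zero)
    finally show ?thesis .
  qed
  define Q where "Q j k = (\<Sum>i<k. (1 - \<epsilon> j) ^ i)" for j k :: nat
  have Q_eq: "Q j k = (1 - (1 - \<epsilon> j) ^ k) / \<epsilon> j" for j k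
    unfolding Q_def using \<epsilon>[of j] one_diff_power_eq'[of "1 - \<epsilon> j" k] by (simp add: sum_gp_strict)
  have "(\<lambda>j. \<integral>\<^sup>+\<omega>. ennreal (Q j (K \<omega>)) \<partial>N) \<longlonglongrightarrow> (\<integral>\<^sup>+\<omega>. ennreal (real (K \<omega>)) \<partial>N)"
  proof (rule nn_integral_LIMSEQ)
    show "incseq (\<lambda>j \<omega>. ennreal (Q j (K \<omega>)))"
    proof (intro incseq_SucI le_funI ennreal_leI)
      fix j \<omega>
      have "\<epsilon> (Suc j) \<le> \<epsilon> j" by (simp add: \<epsilon>_def frac_le)
      then show "Q j (K \<omega>) \<le> Q (Suc j) (K \<omega>)"
        unfolding Q_def using \<epsilon>[of j] by (intro sum_mono power_mono) auto
    qed
    show "(\<lambda>\<omega>. ennreal (Q j (K \<omega>))) \<in> borel_measurable N" for j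
      unfolding Q_eq P_pow[symmetric] by measurable
    show "(\<lambda>j. ennreal (Q j (K \<omega>))) \<longlonglongrightarrow> ennreal (real (K \<omega>))" for \<omega>
    proof (rule tendsto_ennrealI)
      have "\<epsilon> \<longlonglongrightarrow> 0" unfolding \<epsilon>_def using LIMSEQ_inverse_real_of_nat by (simp add: inverse_eq_divide)
      then have "(\<lambda>j. Q j (K \<omega>)) \<longlonglongrightarrow> (\<Sum>i<K \<omega>. (1 - 0) ^ i)" unfolding Q_def by (intro tendsto_intros)
      then show "(\<lambda>j. Q j (K \<omega>)) \<longlonglongrightarrow> real (K \<omega>)" by simp
    qed
  qed
  moreover have "(\<integral>\<^sup>+\<omega>. ennreal (Q j (K \<omega>)) \<partial>N) = ennreal ((1 - exp (- \<epsilon> j * \<Lambda>)) / \<epsilon> j)" for j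
  proof -
    have iP: "integrable N (P j)"
      by (rule integrable_const_bound[of _ 1]) (use \<epsilon>[of j] in \<open>auto simp: P_pow power_le_one\<close>)
    have "(\<integral>\<^sup>+\<omega>. ennreal (Q j (K \<omega>)) \<partial>N) = ennreal (expectation (\<lambda>\<omega>. (1 - P j \<omega>) / \<epsilon> j))"
      unfolding Q_eq P_pow[symmetric]
    proof (rule nn_integral_eq_integral)
      show "integrable N (\<lambda>\<omega>. (1 - P j \<omega>) / \<epsilon> j)" using iP by simp
    qed (use \<epsilon>[of j] in \<open>auto simp: P_pow power_le_one\<close>)
    then show ?thesis using iP by (simp add: EP prob_space)
  qed
  moreover have "(\<lambda>j. ennreal ((1 - exp (- \<epsilon> j * \<Lambda>)) / \<epsilon> j)) \<longlonglongrightarrow> ennreal \<Lambda>"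
  proof (rule tendsto_ennrealI, rule tendsto_sandwich)
    have e0: "\<epsilon> \<longlonglongrightarrow> 0" unfolding \<epsilon>_def using LIMSEQ_inverse_real_of_nat by (simp add: inverse_eq_divide)
    have "(\<lambda>j. \<Lambda> / (1 + \<epsilon> j * \<Lambda>)) \<longlonglongrightarrow> \<Lambda> / (1 + 0 * \<Lambda>)" by (intro tendsto_intros e0) simp
    then show "(\<lambda>j. \<Lambda> / (1 + \<epsilon> j * \<Lambda>)) \<longlonglongrightarrow> \<Lambda>" by simp
    show "\<forall>\<^sub>F j in sequentially. (1 - exp (- \<epsilon> j * \<Lambda>)) / \<epsilon> j \<le> \<Lambda>"
    proof (rule always_eventually, rule allI)
      fix j
      have "1 - exp (- \<epsilon> j * \<Lambda>) \<le> \<Lambda> * \<epsilon> j" using exp_ge_add_one_self[of "- \<epsilon> j * \<Lambda>"] by (simp add: mult.commute)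
      then show "(1 - exp (- \<epsilon> j * \<Lambda>)) / \<epsilon> j \<le> \<Lambda>" using \<epsilon>[of j] by (simp add: pos_divide_le_eq)
    qed
    show "\<forall>\<^sub>F j in sequentially. \<Lambda> / (1 + \<epsilon> j * \<Lambda>) \<le> (1 - exp (- \<epsilon> j * \<Lambda>)) / \<epsilon> j"
    proof (rule always_eventually, rule allI)
      fix j
      define a where "a = \<epsilon> j * \<Lambda>"
      have a: "0 \<le> a" using \<Lambda>0 \<epsilon>[of j] by (simp add: a_def)
      have "exp (- a) \<le> 1 / (1 + a)" using exp_ge_add_one_self[of a] a by (simp add: exp_minus inverse_eq_divide frac_le)
      moreover have "1 - 1 / (1 + a) = a / (1 + a)" using a by (simp add: divide_simps)
      ultimately have "a / (1 + a) \<le> 1 - exp (- a)" by linarith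
      then have "a / (1 + a) / \<epsilon> j \<le> (1 - exp (- a)) / \<epsilon> j" using \<epsilon>[of j] by (intro divide_right_mono) auto
      moreover have "a / (1 + a) / \<epsilon> j = \<Lambda> / (1 + a)" using \<epsilon>[of j] by (simp add: a_def)
      ultimately show "\<Lambda> / (1 + \<epsilon> j * \<Lambda>) \<le> (1 - exp (- \<epsilon> j * \<Lambda>)) / \<epsilon> j" by (simp add: a_def)
    qed
  qed simp
  ultimately have "(\<integral>\<^sup>+\<omega>. ennreal (real (K \<omega>)) \<partial>N) = ennreal \<Lambda>" using LIMSEQ_unique by simp
  moreover have "(\<integral>\<^sup>+\<omega>. ennreal (child_count (shape [] \<omega> y) (Some t)) \<partial>N) = (\<integral>\<^sup>+\<omega>. ennreal (real (K \<omega>)) \<partial>N)"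
  proof (rule nn_integral_cong_AE)
    have ae: "AE \<omega> in N. shape [] \<omega> y \<noteq> None"
      using no_explosion[OF y, of "[]"] by (subst AE_iff_measurable[OF sets_shape[of "\<lambda>f. f = None" "[]" y]]) (auto simp: emeasure_eq_measure)
    have cc: "child_count (shape [] \<omega> y) (Some t) = K \<omega>" if \<omega>: "\<omega> \<in> space N" and nN: "shape [] \<omega> y \<noteq> None" for \<omega>
    proof -
      have rec: "shape [] \<omega> y = (if \<forall>k<m \<omega>. C k \<omega> \<noteq> None then Some (Node (image_mset (\<lambda>k. the (C k \<omega>)) (mset_set {..<m \<omega>}))) else None)"
        unfolding C_def m_def by (rule shape_rec[OF \<omega> y])
      then have all: "\<forall>k<m \<omega>. C k \<omega> \<noteq> None" using nN by presburger
      have "child_count (shape [] \<omega> y) (Some t) = count (image_mset (\<lambda>k. the (C k \<omega>)) (mset_set {..<m \<omega>})) t"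
        unfolding rec using all by (simp add: child_count_def)
      also have "\<dots> = card {k. k < m \<omega> \<and> t = the (C k \<omega>)}" by (simp add: count_image_mset')
      also have "{k. k < m \<omega> \<and> t = the (C k \<omega>)} = {k. k < m \<omega> \<and> C k \<omega> = Some t}" using all by auto
      finally show ?thesis by (simp add: K_def)
    qed
    show "AE \<omega> in N. ennreal (child_count (shape [] \<omega> y) (Some t)) = ennreal (real (K \<omega>))"
      by (rule AE_mp[OF ae], rule AE_I2, rule impI, subst cc) auto
  qed
  ultimately show ?thesis by (simp add: \<Lambda>_def)
qed

text \<open>A vertex of age \<open>z\<close> has one parent, whose age has the density \<open>kernel \<theta> y z\<close> in \<open>y\<close>.  Here the rate
  \<open>1 / (1 - \<theta>)\<close>, the length \<open>ln (1 / \<theta>)\<close> and the mean 1 of the exponential age have to match.\<close>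

lemma kernel_left_total: "0 \<le> z \<Longrightarrow> (\<integral>\<^sup>+y. ennreal (kernel \<theta> y z) \<partial>expo) = 1"
proof -
  assume z: "0 \<le> z"
  have cpos: "0 \<le> c" using \<theta> by simp
  have "(\<integral>\<^sup>+y. ennreal (kernel \<theta> y z) \<partial>expo) = (\<integral>\<^sup>+y. ennreal (exp z / (1 - \<theta>)) * indicator {z..<z + c} y \<partial>expo)"
    by (rule nn_integral_cong_AE, rule eventually_mono[OF AE_expo_neq[of "z + c"]]) (auto simp: kernel_def indicator_def)
  also have "\<dots> = ennreal (exp z / (1 - \<theta>)) * emeasure expo {z..<z + c}" by (subst nn_integral_cmult_indicator) auto
  also have "emeasure expo {z..<z + c} = ennreal (exp (- z) * (1 - \<theta>))"
  proof -
    have "{z..<z + c} = {z..} - {z + c..}" using cpos by auto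
    then have "measure expo {z..<z + c} = measure expo {z..} - measure expo {z + c..}"
      using cpos by (simp only:, intro expo.finite_measure_Diff) auto
    also have "\<dots> = exp (- z) - exp (- z) * \<theta>"
    proof -
      have "exp (- (z + c)) = exp (- z) * \<theta>" using \<theta> by (simp add: exp_add exp_diff exp_minus ln_div divide_simps)
      then show ?thesis using measure_expo_atLeast[OF z] measure_expo_atLeast[of "z + c"] z cpos by simp
    qed
    also have "\<dots> = exp (- z) * (1 - \<theta>)" by (simp add: right_diff_distrib)
    finally show ?thesis by (simp only: expo.emeasure_eq_measure)
  qed
  also have "ennreal (exp z / (1 - \<theta>)) * ennreal (exp (- z) * (1 - \<theta>)) = ennreal 1"
    using \<theta> by (subst ennreal_mult[symmetric]) (auto simp: exp_minus)
  finally show ?thesis by simp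
qed

text \<open>Tonelli: counting the children of shape \<open>t\<close> of all ages \<open>z\<close> at a parent of random age \<open>y\<close>, and integrating over
  \<open>y\<close> first.\<close>

lemma fringe_balance: "(\<integral>\<^sup>+s. ennreal (child_count s (Some t)) \<partial>law) = emeasure law {Some t}"
proof -
  interpret E2: pair_sigma_finite expo expo ..
  have ki: "integrable expo (\<lambda>z. kernel \<theta> y z * prob_shape [] t z)" for y
    by (rule integrable_kernel[OF \<theta>]) (use prob_shape_bounds in auto)
  have k0: "0 \<le> kernel \<theta> y z * prob_shape [] t z" for y z
    using kernel_bounds(1)[OF \<theta>] prob_shape_bounds by simp
  have [measurable]: "case_prod (\<lambda>y z. ennreal (kernel \<theta> y z * prob_shape [] t z)) \<in> borel_measurable (expo \<Otimes>\<^sub>M expo)"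
  proof -
    note measurable_kernel[of \<theta>, OF \<theta>, measurable]
    have "(\<lambda>x. ennreal ((case x of (y, z) \<Rightarrow> kernel \<theta> y z) * prob_shape [] t (snd x))) \<in> borel_measurable (borel \<Otimes>\<^sub>M borel)" by measurable
    then show ?thesis by (simp add: case_prod_beta' cong: measurable_cong_sets sets_pair_measure_cong)
  qed
  have "(\<integral>\<^sup>+s. ennreal (child_count s (Some t)) \<partial>law) = (\<integral>\<^sup>+y. (\<integral>\<^sup>+\<omega>. ennreal (child_count (shape [] \<omega> y) (Some t)) \<partial>N) \<partial>expo)"
    by (rule nn_integral_law)
  also have "\<dots> = (\<integral>\<^sup>+y. (\<integral>\<^sup>+z. ennreal (kernel \<theta> y z * prob_shape [] t z) \<partial>expo) \<partial>expo)"
  proof (rule nn_integral_cong_AE, rule eventually_mono[OF AE_expo_pos])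
    fix y :: real assume "0 < y"
    then show "(\<integral>\<^sup>+\<omega>. ennreal (child_count (shape [] \<omega> y) (Some t)) \<partial>N) = (\<integral>\<^sup>+z. ennreal (kernel \<theta> y z * prob_shape [] t z) \<partial>expo)"
      using mean_child_count[of y t] nn_integral_eq_integral[OF ki] k0 by simp
  qed
  also have "\<dots> = (\<integral>\<^sup>+z. (\<integral>\<^sup>+y. ennreal (kernel \<theta> y z * prob_shape [] t z) \<partial>expo) \<partial>expo)"
    by (rule E2.Fubini'[symmetric]) measurable
  also have "\<dots> = (\<integral>\<^sup>+z. ennreal (prob_shape [] t z) \<partial>expo)"
  proof (rule nn_integral_cong_AE, rule eventually_mono[OF AE_expo_pos])
    fix z :: real assume z: "0 < z"
    have "(\<integral>\<^sup>+y. ennreal (kernel \<theta> y z * prob_shape [] t z) \<partial>expo) = (\<integral>\<^sup>+y. ennreal (kernel \<theta> y z) * ennreal (prob_shape [] t z) \<partial>expo)"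
      by (rule nn_integral_cong) (simp add: ennreal_mult kernel_bounds(1)[OF \<theta>] prob_shape_bounds)
    also have "\<dots> = ennreal (prob_shape [] t z)"
      using kernel_left_total[of z] z by (subst nn_integral_multc) auto
    finally show "(\<integral>\<^sup>+y. ennreal (kernel \<theta> y z * prob_shape [] t z) \<partial>expo) = ennreal (prob_shape [] t z)" .
  qed
  also have "\<dots> = emeasure law {Some t}" unfolding emeasure_law prob_shape_def emeasure_eq_measure ..
  finally show ?thesis .
qed

lemma law_None: "measure law {None} = 0"
proof -
  have "emeasure law {None} = (\<integral>\<^sup>+y. 0 \<partial>expo)"
    unfolding emeasure_law
    by (rule nn_integral_cong_AE, rule eventually_mono[OF AE_expo_pos]) (simp add: emeasure_eq_measure no_explosion)
  then show ?thesis by (simp add: measure_def)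
qed

theorem fringe_distribution_law: "fringe_distribution law"
  unfolding fringe_distribution_def
proof (intro conjI allI)
  interpret L: prob_space law by (rule prob_space_law)
  fix t
  show "((\<lambda>s. measure law {s} * real (child_count s t)) has_sum measure law {t}) UNIV"
  proof (cases t)
    case None
    have "child_count s None = 0" for s by (cases s) (auto simp: child_count_def)
    then show ?thesis using None law_None by simp
  next
    case (Some t')
    let ?f = "\<lambda>s. measure law {s} * real (child_count s t)"
    have D: "law = density (count_space UNIV) (\<lambda>s. emeasure law {s})"
    proof (rule measure_eqI_countable[where A = UNIV])
      show "emeasure law {a} = emeasure (density (count_space UNIV) (\<lambda>s. emeasure law {s})) {a}" for a
        unfolding point_measure_def[symmetric] by (subst emeasure_point_measure_finite2) auto
    qed (auto simp: countable_ftree)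
    have "(\<integral>\<^sup>+s. ennreal (?f s) \<partial>count_space UNIV) = (\<integral>\<^sup>+s. ennreal (child_count s (Some t')) \<partial>law)"
      by (subst D, subst nn_integral_density) (auto simp: L.emeasure_eq_measure ennreal_mult Some)
    also have "\<dots> = ennreal (measure law {t})" unfolding fringe_balance by (simp add: L.emeasure_eq_measure Some)
    finally have nn: "(\<integral>\<^sup>+s. ennreal (?f s) \<partial>count_space UNIV) = ennreal (measure law {t})" .
    have int: "integrable (count_space UNIV) ?f" by (rule integrableI_nn_integral_finite[OF _ _ nn]) auto
    then have "Infinite_Set_Sum.abs_summable_on ?f UNIV" by (simp add: Infinite_Set_Sum.abs_summable_on_def)
    note sm = this
    have "infsum ?f UNIV = infsetsum ?f UNIV" by (rule infsetsum_infsum[OF sm, symmetric])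
    also have "\<dots> = measure law {t}"
      unfolding infsetsum_def using integral_eq_nn_integral[of ?f "count_space UNIV"] nn by simp
    finally have "infsum ?f UNIV = measure law {t}" .
    moreover have "?f summable_on UNIV"
      using sm abs_summable_summable abs_summable_equivalent by blast
    ultimately show ?thesis by (metis has_sum_infsum)
  qed
qed (use prob_space_law in auto)

end

section \<open>Fringe trees of the recursive tree converge to the branching process\<close>

lemma contraction_weighted_expectation:
  assumes \<theta>: "0 < \<theta>" "\<theta> < 1" and w: "\<And>c. \<bar>w c\<bar> \<le> 1"
  shows "contraction (\<lambda>f. EC \<theta> n (\<lambda>c. f (\<xi> c) * w c))"
  unfolding contraction_def
proof (intro conjI allI impI)
  fix f :: "'a \<Rightarrow> real" and K assume K: "\<forall>B. \<bar>f B\<bar> \<le> K"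
  have K0: "0 \<le> K" using K abs_ge_zero order_trans by blast
  have "\<bar>EC \<theta> n (\<lambda>c. f (\<xi> c) * w c)\<bar> \<le> EC \<theta> n (\<lambda>c. \<bar>f (\<xi> c) * w c\<bar>)" by (rule integral_abs_bound)
  also have "\<dots> \<le> EC \<theta> n (\<lambda>c. K)"
  proof (rule integral_mono[OF integrable_choice[OF \<theta>] integrable_choice[OF \<theta>]])
    show "\<bar>f (\<xi> c) * w c\<bar> \<le> K" for c
      using mult_mono[OF spec[OF K, of "\<xi> c"] w[of c] K0 abs_ge_zero] by (simp add: abs_mult)
  qed
  finally show "\<bar>EC \<theta> n (\<lambda>c. f (\<xi> c) * w c)\<bar> \<le> K" by simp
next
  fix f g :: "'a \<Rightarrow> real" and a K
  have "EC \<theta> n (\<lambda>c. (f (\<xi> c) + a * g (\<xi> c)) * w c) = EC \<theta> n (\<lambda>c. f (\<xi> c) * w c + a * (g (\<xi> c) * w c))"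
    by (simp add: algebra_simps)
  also have "\<dots> = EC \<theta> n (\<lambda>c. f (\<xi> c) * w c) + a * EC \<theta> n (\<lambda>c. g (\<xi> c) * w c)"
    by (subst Bochner_Integration.integral_add) (simp_all add: integrable_choice[OF \<theta>])
  finally show "EC \<theta> n (\<lambda>c. (f (\<xi> c) + a * g (\<xi> c)) * w c) = EC \<theta> n (\<lambda>c. f (\<xi> c) * w c) + a * EC \<theta> n (\<lambda>c. g (\<xi> c) * w c)" .
qed

lemma contraction_mult_const:
  fixes \<Phi> :: "('a \<Rightarrow> real) \<Rightarrow> real"
  assumes \<Phi>: "contraction \<Phi>" and a: "\<bar>a\<bar> \<le> 1"
  shows "contraction (\<lambda>f. \<Phi> f * a)"
  unfolding contraction_def
proof (intro conjI allI impI)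
  fix f :: "'a \<Rightarrow> real" and K assume K: "\<forall>B. \<bar>f B\<bar> \<le> K"
  have K0: "0 \<le> K" using K abs_ge_zero order_trans by blast
  have "\<bar>\<Phi> f\<bar> \<le> K" by (rule contraction_bound[OF \<Phi>]) (use K in blast)
  then show "\<bar>\<Phi> f * a\<bar> \<le> K" using mult_mono[OF _ a K0 abs_ge_zero] by (simp add: abs_mult)
next
  fix f g :: "'a \<Rightarrow> real" and b K assume K: "\<forall>B. \<bar>f B\<bar> \<le> K \<and> \<bar>g B\<bar> \<le> K"
  have "\<Phi> (\<lambda>B. f B + b * g B) = \<Phi> f + b * \<Phi> g" by (rule contraction_add[OF \<Phi>]) (use K in blast)+
  then show "\<Phi> (\<lambda>B. f B + b * g B) * a = \<Phi> f * a + b * (\<Phi> g * a)" by (simp add: algebra_simps)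
qed

context branching
begin

abbreviation "limit_shape \<equiv> prob_shape []"

text \<open>Induction on \<open>t\<close>: the subtrees of \<open>t\<close> obey the law of large numbers by induction hypothesis, so the generating
  functions with weights on these subtrees converge, for one and for two vertices, to those of the branching
  process, and inverting them gives the probabilities of \<open>t\<close>.\<close>

lemma fringe_tree_limits:
  "(\<forall>x>0. (\<lambda>n. EC \<theta> n (\<lambda>c. of_bool (vshape c n (pos n x) = t))) \<longlonglongrightarrow> limit_shape t x) \<and>
   (\<forall>x>0. \<forall>y>0. x \<noteq> y \<longrightarrow> (\<lambda>n. EC \<theta> n (\<lambda>c. of_bool (vshape c n (pos n x) = t) * of_bool (vshape c n (pos n y) = t)))
      \<longlonglongrightarrow> limit_shape t x * limit_shape t y)"
proof (induction t)
  case (Node A)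
  define \<xi> where "\<xi> n x c = subtrees (vshape c n (pos n x))" for n x c
  have \<xi>: "vshape c n (pos n x) = Node A \<longleftrightarrow> \<xi> n x c = A" for c n x
    unfolding \<xi>_def by (cases "vshape c n (pos n x)") auto
  have lln_ind: "shape_lln \<theta> (\<lambda>u. of_bool (u = t)) (limit_shape t)" if "t \<in># A" for t
    using Node[OF that] by (intro shape_lln_indicator[OF \<theta>]) (auto simp: prob_shape_bounds)
  define ok where "ok s \<longleftrightarrow> (\<forall>x. 0 \<le> s x \<and> s x \<le> 1) \<and> (\<forall>x. x \<notin># A \<longrightarrow> s x = 0)" for s :: "rtree \<Rightarrow> real"
  define G where "G s z = (\<Sum>t\<in>set_mset A. s t * limit_shape t z)" for s z
  have root: "root_functional [] y (mset_pgf s) = exp (\<integral>z. kernel \<theta> y z * (G s z - 1) \<partial>expo)" if "ok s" "0 < y" for s y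
    unfolding G_def
  proof (rule root_functional_pgf_finite(1))
    show "prob_shape w t z = limit_shape t z" if "0 \<le> z" for w t z by (rule prob_shape_eq_root[OF that])
  qed (use that in \<open>auto simp: ok_def\<close>)
  have G01: "0 \<le> G s z \<and> G s z \<le> 1" if "ok s" for s z
    unfolding G_def
  proof (rule root_functional_pgf_finite(2)[where y = 0])
    show "prob_shape w t z = limit_shape t z" if "0 \<le> z" for w t z by (rule prob_shape_eq_root[OF that])
  qed (use that in \<open>auto simp: ok_def\<close>)
  have lln: "shape_lln \<theta> s (G s)" if "ok s" for s
  proof (rule shape_lln_sum[OF \<theta> finite_set_mset lln_ind])
    show "G s = (\<lambda>x. \<Sum>t\<in>set_mset A. s t * limit_shape t x)" by (simp add: G_def[abs_def])
    show "G s x \<le> 1" for x using G01[OF that] by simp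
  qed (use that in \<open>auto simp: ok_def\<close>)
  have pb: "\<bar>mset_pgf s B\<bar> \<le> 1" if "ok s" for s B
    using mset_pgf_bounds[of s B] that by (auto simp: ok_def abs_le_iff)
  have Rb: "\<bar>root_functional [] y (mset_pgf s)\<bar> \<le> 1" if "ok s" for s y
    by (rule contraction_bound[OF contraction_root_functional]) (rule pb[OF that])
  have one: "(\<lambda>n. EC \<theta> n (\<lambda>c. of_bool (\<xi> n x c = A) * 1)) \<longlonglongrightarrow> root_functional [] x (\<lambda>B. of_bool (B = A))" if x: "0 < x" for x
  proof (rule pgf_inversion[where \<Phi> = "\<lambda>n f. EC \<theta> n (\<lambda>c. f (\<xi> n x c) * 1)"])
    show "contraction (\<lambda>f. EC \<theta> n (\<lambda>c. f (\<xi> n x c) * 1))" for n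
      by (rule contraction_weighted_expectation[OF \<theta>]) simp
    fix s :: "rtree \<Rightarrow> real" assume "\<And>x. 0 \<le> s x \<and> s x \<le> 1" "\<And>x. x \<notin># A \<Longrightarrow> s x = 0"
    then have s: "ok s" by (simp add: ok_def)
    have one1: "mset_pgf (\<lambda>_. 1) B = (1 :: real)" for B :: "rtree multiset" by (simp add: mset_pgf_def)
    have "(\<lambda>n. EC \<theta> n (\<lambda>c. mset_pgf s (subtrees (vshape c n (pos n x))) * mset_pgf (\<lambda>_. 1) (subtrees (vshape c n (pos n (x + 1))))))
      \<longlonglongrightarrow> exp (\<integral>z. kernel \<theta> x z * (G s z - 1) \<partial>expo) * exp (\<integral>z. kernel \<theta> (x + 1) z * (1 - 1) \<partial>expo)"
      by (rule pgf_pair_limit[OF \<theta> lln[OF s] shape_lln_const]) (use s x in \<open>auto simp: ok_def\<close>)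
    then show "(\<lambda>n. EC \<theta> n (\<lambda>c. mset_pgf s (\<xi> n x c) * 1)) \<longlonglongrightarrow> root_functional [] x (mset_pgf s)"
      using root[OF s x] by (simp add: one1 \<xi>_def)
  qed (rule contraction_root_functional)
  have two: "(\<lambda>n. EC \<theta> n (\<lambda>c. of_bool (\<xi> n y c = A) * of_bool (\<xi> n x c = A)))
    \<longlonglongrightarrow> root_functional [] y (\<lambda>B. of_bool (B = A)) * root_functional [] x (\<lambda>B. of_bool (B = A))"
    if xy: "0 < x" "0 < y" "x \<noteq> y" for x y
  proof (rule pgf_inversion[where \<Phi> = "\<lambda>n f. EC \<theta> n (\<lambda>c. f (\<xi> n y c) * of_bool (\<xi> n x c = A))"
        and \<Phi>' = "\<lambda>f. root_functional [] y f * root_functional [] x (\<lambda>B. of_bool (B = A))"])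
    show "contraction (\<lambda>f. EC \<theta> n (\<lambda>c. f (\<xi> n y c) * of_bool (\<xi> n x c = A)))" for n
      by (rule contraction_weighted_expectation[OF \<theta>]) simp
    show "contraction (\<lambda>f. root_functional [] y f * root_functional [] x (\<lambda>B. of_bool (B = A)))"
      by (rule contraction_mult_const[OF contraction_root_functional contraction_bound[OF contraction_root_functional]]) simp
    fix s :: "rtree \<Rightarrow> real" assume "\<And>x. 0 \<le> s x \<and> s x \<le> 1" "\<And>x. x \<notin># A \<Longrightarrow> s x = 0"
    then have s: "ok s" by (simp add: ok_def)
    have "(\<lambda>n. EC \<theta> n (\<lambda>c. of_bool (\<xi> n x c = A) * mset_pgf s (\<xi> n y c)))
      \<longlonglongrightarrow> root_functional [] x (\<lambda>B. of_bool (B = A)) * root_functional [] y (mset_pgf s)"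
    proof (rule pgf_inversion[where \<Phi> = "\<lambda>n f. EC \<theta> n (\<lambda>c. f (\<xi> n x c) * mset_pgf s (\<xi> n y c))"
          and \<Phi>' = "\<lambda>f. root_functional [] x f * root_functional [] y (mset_pgf s)"])
      show "contraction (\<lambda>f. EC \<theta> n (\<lambda>c. f (\<xi> n x c) * mset_pgf s (\<xi> n y c)))" for n
        by (rule contraction_weighted_expectation[OF \<theta>]) (rule pb[OF s])
      show "contraction (\<lambda>f. root_functional [] x f * root_functional [] y (mset_pgf s))"
        by (rule contraction_mult_const[OF contraction_root_functional]) (rule Rb[OF s])
      fix s' :: "rtree \<Rightarrow> real" assume "\<And>x. 0 \<le> s' x \<and> s' x \<le> 1" "\<And>x. x \<notin># A \<Longrightarrow> s' x = 0"
      then have s': "ok s'" by (simp add: ok_def)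
      show "(\<lambda>n. EC \<theta> n (\<lambda>c. mset_pgf s' (\<xi> n x c) * mset_pgf s (\<xi> n y c)))
        \<longlonglongrightarrow> root_functional [] x (mset_pgf s') * root_functional [] y (mset_pgf s)"
        unfolding root[OF s xy(2)] root[OF s' xy(1)] \<xi>_def
        by (rule pgf_pair_limit[OF \<theta> lln[OF s'] lln[OF s]]) (use s s' xy in \<open>auto simp: ok_def\<close>)
    qed
    then show "(\<lambda>n. EC \<theta> n (\<lambda>c. mset_pgf s (\<xi> n y c) * of_bool (\<xi> n x c = A)))
      \<longlonglongrightarrow> root_functional [] y (mset_pgf s) * root_functional [] x (\<lambda>B. of_bool (B = A))"
      by (simp add: mult.commute)
  qed
  show ?case
    using one two unfolding root_functional_Node \<xi> by (simp add: mult.commute)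
qed

text \<open>The law of large numbers whose weight \<open>h\<close> is constant is about all vertices alike.\<close>

lemma fringe_proportion_limit:
  "(\<lambda>n. EC \<theta> n (\<lambda>c. \<bar>real (card {w \<in> {1..n}. vshape c n w = t}) / n - (\<integral>y. limit_shape t y \<partial>expo)\<bar>)) \<longlonglongrightarrow> 0"
proof -
  have "shape_lln \<theta> (\<lambda>u. of_bool (u = t)) (limit_shape t)"
    using fringe_tree_limits[of t] by (intro shape_lln_indicator[OF \<theta>]) (auto simp: prob_shape_bounds)
  then have lim: "(\<lambda>n. EC \<theta> n (\<lambda>c. \<bar>\<integral>y. 1 * (of_bool (vshape c n (pos n y) = t) - limit_shape t y) \<partial>expo\<bar>)) \<longlonglongrightarrow> 0"
    unfolding shape_lln_def by (elim conjE allE[of _ "\<lambda>_. 1"] allE[of _ "1 :: real"]) auto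
  show ?thesis
  proof (rule Lim_transform_eventually[OF lim])
    show "\<forall>\<^sub>F n in sequentially. EC \<theta> n (\<lambda>c. \<bar>\<integral>y. 1 * (of_bool (vshape c n (pos n y) = t) - limit_shape t y) \<partial>expo\<bar>)
      = EC \<theta> n (\<lambda>c. \<bar>real (card {w \<in> {1..n}. vshape c n w = t}) / n - (\<integral>y. limit_shape t y \<partial>expo)\<bar>)"
      using eventually_ge_at_top[of 1]
    proof eventually_elim
      case (elim n)
      have "(\<integral>y. 1 * (of_bool (vshape c n (pos n y) = t) - limit_shape t y) \<partial>expo)
        = real (card {w \<in> {1..n}. vshape c n w = t}) / n - (\<integral>y. limit_shape t y \<partial>expo)" for c
      proof -
        have i1: "integrable expo (\<lambda>y. of_bool (vshape c n (pos n y) = t) :: real)"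
          by (rule expo.integrable_const_bound[of _ 1]) (simp, measurable)
        have i2: "integrable expo (limit_shape t)"
          by (rule expo.integrable_const_bound[of _ 1]) (use prob_shape_bounds in auto)
        have "(\<integral>y. of_bool (vshape c n (pos n y) = t) \<partial>expo) = (\<Sum>w=1..n. of_bool (vshape c n w = t)) / real n"
          by (rule integral_pos[OF elim])
        also have "(\<Sum>w=1..n. of_bool (vshape c n w = t)) = real (card {w \<in> {1..n}. vshape c n w = t})"
          by (simp add: Int_def)
        finally show ?thesis using Bochner_Integration.integral_diff[OF i1 i2] by simp
      qed
      then show ?case by simp
    qed
  qed
qed

end

section \<open>The sin-tree of a fringe distribution\<close>

definition graft :: "rtree \<Rightarrow> rtree \<Rightarrow> rtree" where
  "graft s b = Node (add_mset s (subtrees b))"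

lemma monotone_rep_Suc_graft: "monotone_rep \<tau> (Suc i) = graft (monotone_rep \<tau> i) (\<tau> (Suc i))"
  by (simp add: graft_def)

lemma graft_inject: "graft s b = graft s b' \<longleftrightarrow> b = b'"
  by (cases b; cases b') (auto simp: graft_def)

lemma graft_surj: "s \<in># subtrees t \<longleftrightarrow> (\<exists>b. t = graft s b)"
proof
  assume "s \<in># subtrees t"
  then have "t = graft s (Node (subtrees t - {#s#}))" by (cases t) (simp add: graft_def)
  then show "\<exists>b. t = graft s b" ..
qed (auto simp: graft_def)

lemma monotone_rep_agree:
  "(\<forall>m\<le>i. monotone_rep \<tau> m = monotone_rep \<sigma> m) \<longleftrightarrow> (\<forall>m\<le>i. \<tau> m = \<sigma> m)"
proof (induction i)
  case (Suc i)
  have "monotone_rep \<tau> (Suc i) = monotone_rep \<sigma> (Suc i) \<longleftrightarrow> \<tau> (Suc i) = \<sigma> (Suc i)"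
    if "monotone_rep \<tau> i = monotone_rep \<sigma> i"
    unfolding monotone_rep_Suc_graft that by (rule graft_inject)
  then show ?case using Suc by (auto simp: le_Suc_eq simp del: monotone_rep.simps(2))
qed simp

abbreviation sin_space :: "sin_tree measure" where
  "sin_space \<equiv> PiM UNIV (\<lambda>_. count_space UNIV)"

lemma prefix_eq_iff: "map \<tau> [0..<n] = l \<longleftrightarrow> n = length l \<and> (\<forall>i<n. \<tau> i = l ! i)"
  by (simp add: list_eq_iff_nth_eq)

lemma measurable_sin_prefix: "(\<lambda>\<tau>. map \<tau> [0..<n]) \<in> sin_space \<rightarrow>\<^sub>M count_space (UNIV :: rtree list set)"
proof (rule measurable_count_space_eq_countable[THEN iffD2])
  show "countable (UNIV :: rtree list set)" using countable_lists[OF countable_rtree] by simp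
  show "(\<lambda>\<tau>. map \<tau> [0..<n]) \<in> space sin_space \<rightarrow> UNIV \<and>
    (\<forall>a\<in>UNIV. (\<lambda>\<tau>. map \<tau> [0..<n]) -` {a} \<inter> space sin_space \<in> sets sin_space)"
  proof (intro conjI ballI)
    fix l :: "rtree list"
    have "(\<lambda>\<tau>. map \<tau> [0..<n]) -` {l} \<inter> space sin_space = {\<tau> \<in> space sin_space. n = length l \<and> (\<forall>i\<in>{..<n}. \<tau> i = l ! i)}"
      by (simp only: vimage_def Int_def mem_Collect_eq singleton_iff prefix_eq_iff Ball_def lessThan_iff conj_commute)
    also have "\<dots> \<in> sets sin_space" by measurable
    finally show "(\<lambda>\<tau>. map \<tau> [0..<n]) -` {l} \<inter> space sin_space \<in> sets sin_space" .
  qed simp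
qed

text \<open>A law on sin-trees is determined by the laws of the finite prefixes, and these by countably many
  point probabilities.\<close>

lemma sin_tree_law_unique:
  assumes S: "sin_tree_law \<pi> S" and S': "sin_tree_law \<pi> S'"
  shows "S = S'"
proof -
  have sets: "sets S = sets sin_space" "sets S' = sets sin_space" and ps: "prob_space S" "prob_space S'"
    using S S' by (auto simp: sin_tree_law_def)
  interpret S: prob_space S by (rule ps(1))
  interpret S': prob_space S' by (rule ps(2))
  have space: "space S = UNIV" "space S' = UNIV"
    using sets_eq_imp_space_eq[OF sets(1)] sets_eq_imp_space_eq[OF sets(2)] by (simp_all add: space_PiM)
  have cyl: "measure S {\<tau>. \<forall>m\<le>i. \<tau> m = \<sigma> m} = measure S' {\<tau>. \<forall>m\<le>i. \<tau> m = \<sigma> m}" for i \<sigma>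
  proof -
    have "{\<tau>. \<forall>m\<le>i. \<tau> m = \<sigma> m} = {\<tau>. \<forall>m\<le>i. Some (monotone_rep \<tau> m) = Some (monotone_rep \<sigma> m)}"
      using monotone_rep_agree[of i _ \<sigma>] by simp
    note prefix = this
    have "measure Z {\<tau> \<in> space Z. \<forall>m\<le>i. Some (monotone_rep \<tau> m) = Some (monotone_rep \<sigma> m)}
      = measure \<pi> {Some (monotone_rep \<sigma> i)} * (\<Prod>m=1..i. real (child_count (Some (monotone_rep \<sigma> m)) (Some (monotone_rep \<sigma> (m - 1)))))"
      if "sin_tree_law \<pi> Z" for Z
      using that unfolding sin_tree_law_def by (elim conjE allE[of _ i] allE[of _ "\<lambda>m. Some (monotone_rep \<sigma> m)"])
    from this[OF S] this[OF S'] show ?thesis unfolding prefix using space by simp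
  qed
  have dist: "distr S (count_space UNIV) (\<lambda>\<tau>. map \<tau> [0..<Suc i]) = distr S' (count_space UNIV) (\<lambda>\<tau>. map \<tau> [0..<Suc i])" for i
  proof (rule measure_eqI_countable[where A = UNIV])
    have m: "(\<lambda>\<tau>. map \<tau> [0..<Suc i]) \<in> S \<rightarrow>\<^sub>M count_space UNIV" "(\<lambda>\<tau>. map \<tau> [0..<Suc i]) \<in> S' \<rightarrow>\<^sub>M count_space UNIV"
      using measurable_sin_prefix[of "Suc i"] sets by (simp_all cong: measurable_cong_sets)
    show "countable (UNIV :: rtree list set)" using countable_lists[OF countable_rtree] by simp
    fix l :: "rtree list"
    have pre: "(\<lambda>\<tau>. map \<tau> [0..<Suc i]) -` {l} = (if length l = Suc i then {\<tau>. \<forall>m\<le>i. \<tau> m = l ! m} else {})"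
      by (cases "length l = Suc i") (simp_all add: set_eq_iff prefix_eq_iff less_Suc_eq_le del: upt_Suc)
    show "emeasure (distr S (count_space UNIV) (\<lambda>\<tau>. map \<tau> [0..<Suc i])) {l} = emeasure (distr S' (count_space UNIV) (\<lambda>\<tau>. map \<tau> [0..<Suc i])) {l}"
      using m by (simp add: emeasure_distr pre space S.emeasure_eq_measure S'.emeasure_eq_measure cyl[of i "\<lambda>m. l ! m"] del: upt_Suc)
  qed auto
  show ?thesis
  proof (rule measure_eqI_PiM_infinite[where I = UNIV and M = "\<lambda>_. count_space UNIV"])
    fix A :: "nat \<Rightarrow> rtree set" and J :: "nat set" assume J: "finite J"
    obtain i where i: "J \<subseteq> {..i}" using finite_nat_set_iff_bounded_le[THEN iffD1, OF J] by auto
    have eq: "prod_emb UNIV (\<lambda>_. count_space UNIV) J (PiE J A) = (\<lambda>\<tau>. map \<tau> [0..<Suc i]) -` {l. \<forall>j\<in>J. l ! j \<in> A j}"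
    proof -
      have "map \<tau> [0..<Suc i] ! j = \<tau> j" if "j \<in> J" for j and \<tau> :: sin_tree
        using i that by (subst nth_map) (auto simp: less_Suc_eq_le simp del: upt_Suc)
      then show ?thesis by (simp add: prod_emb_def space_PiM PiE_iff vimage_def del: upt_Suc cong: ball_cong)
    qed
    have m: "(\<lambda>\<tau>. map \<tau> [0..<Suc i]) \<in> S \<rightarrow>\<^sub>M count_space UNIV" "(\<lambda>\<tau>. map \<tau> [0..<Suc i]) \<in> S' \<rightarrow>\<^sub>M count_space UNIV"
      using measurable_sin_prefix[of "Suc i"] sets by (simp_all cong: measurable_cong_sets)
    have "emeasure S (prod_emb UNIV (\<lambda>_. count_space UNIV) J (PiE J A)) = emeasure (distr S (count_space UNIV) (\<lambda>\<tau>. map \<tau> [0..<Suc i])) {l. \<forall>j\<in>J. l ! j \<in> A j}"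
      unfolding eq using m(1) space by (simp add: emeasure_distr del: upt_Suc)
    also have "\<dots> = emeasure S' (prod_emb UNIV (\<lambda>_. count_space UNIV) J (PiE J A))"
      unfolding eq dist using m(2) space by (simp add: emeasure_distr del: upt_Suc)
    finally show "emeasure S (prod_emb UNIV (\<lambda>_. count_space UNIV) J (PiE J A)) = emeasure S' (prod_emb UNIV (\<lambda>_. count_space UNIV) J (PiE J A))" .
  qed (use sets S.finite_measure_axioms in auto)
qed

text \<open>The random choices \<open>\<omega> (Some (i, s))\<close> say which tree is grafted at step \<open>i\<close> if the tree
  obtained so far is \<open>s\<close>; since all are independent, the steps form a Markov chain.\<close>

primrec chain_rep :: "((nat \<times> rtree) option \<Rightarrow> rtree) \<Rightarrow> nat \<Rightarrow> rtree" where
  "chain_rep \<omega> 0 = \<omega> None"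
| "chain_rep \<omega> (Suc i) = graft (chain_rep \<omega> i) (\<omega> (Some (i, chain_rep \<omega> i)))"

definition chain_tree :: "((nat \<times> rtree) option \<Rightarrow> rtree) \<Rightarrow> sin_tree" where
  "chain_tree \<omega> i = (case i of 0 \<Rightarrow> \<omega> None | Suc j \<Rightarrow> \<omega> (Some (j, chain_rep \<omega> j)))"

lemma monotone_rep_chain_tree: "monotone_rep (chain_tree \<omega>) i = chain_rep \<omega> i"
  by (induction i) (simp_all add: chain_tree_def graft_def)

context
  fixes \<pi> :: "ftree measure"
  assumes fringe: "fringe_distribution \<pi>"
begin

interpretation \<pi>: prob_space \<pi> using fringe by (simp add: fringe_distribution_def)

lemma sets_fringe: "sets \<pi> = UNIV" and space_fringe: "space \<pi> = UNIV"
  using fringe sets_eq_imp_space_eq[of \<pi> "count_space UNIV"] by (auto simp: fringe_distribution_def)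

lemma fringe_None: "measure \<pi> {None} = 0"
proof -
  have "((\<lambda>s. measure \<pi> {s} * real (child_count s None)) has_sum measure \<pi> {None}) UNIV"
    using fringe unfolding fringe_distribution_def by blast
  moreover have "child_count s None = 0" for s by (cases s) (auto simp: child_count_def)
  ultimately show ?thesis using has_sum_unique[OF _ has_sum_0] by fastforce
qed

text \<open>The transition probability from \<open>s\<close> to \<open>graft s b\<close> of the monotone representation; it sums to one over \<open>b\<close> by the
  identity of a fringe distribution.\<close>

definition step_weight :: "rtree \<Rightarrow> rtree \<Rightarrow> real" where
  "step_weight s b = measure \<pi> {Some (graft s b)} * real (child_count (Some (graft s b)) (Some s)) / measure \<pi> {Some s}"

lemma step_weight_nonneg: "0 \<le> step_weight s b" by (simp add: step_weight_def)

lemma step_weight_sum: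
  assumes s: "measure \<pi> {Some s} \<noteq> 0"
  shows "(step_weight s has_sum 1) UNIV"
proof -
  let ?f = "\<lambda>t. measure \<pi> {t} * real (child_count t (Some s))"
  have "(?f has_sum measure \<pi> {Some s}) UNIV" using fringe unfolding fringe_distribution_def by blast
  then have "(?f has_sum measure \<pi> {Some s}) (range (\<lambda>b. Some (graft s b)))"
  proof (rule has_sum_cong_neutral[THEN iffD1, rotated -1])
    fix t assume t: "t \<in> UNIV - range (\<lambda>b. Some (graft s b))"
    then show "?f t = 0"
    proof (cases t)
      case (Some t')
      then have "s \<notin># subtrees t'" using t graft_surj[of s t'] by auto
      then show ?thesis using Some by (simp add: child_count_def not_in_iff)
    qed (simp add: child_count_def)
  qed auto
  then have "((?f \<circ> (\<lambda>b. Some (graft s b))) has_sum measure \<pi> {Some s}) UNIV"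
    by (subst (asm) has_sum_reindex) (auto simp: inj_on_def graft_inject)
  from has_sum_cmult_left[OF this, of "1 / measure \<pi> {Some s}"] show ?thesis
    using s by (simp add: step_weight_def[abs_def] comp_def)
qed

lemma nn_integral_has_sum_1:
  assumes "(f has_sum 1) UNIV" "\<And>x. 0 \<le> f x"
  shows "(\<integral>\<^sup>+x. ennreal (f x) \<partial>count_space UNIV) = 1"
proof -
  have "f summable_on UNIV" using assms(1) by (auto simp: summable_on_def)
  then have abs: "Infinite_Set_Sum.abs_summable_on f UNIV"
    using assms(2) by (simp add: abs_summable_equivalent[symmetric] abs_of_nonneg cong: summable_on_cong)
  have "infsetsum f UNIV = 1" using infsetsum_infsum[OF abs] infsumI[OF assms(1)] by simp
  then show ?thesis using nn_integral_conv_infsetsum[OF abs] assms(2) by simp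
qed

definition start_pmf :: "rtree pmf" where
  "start_pmf = embed_pmf (\<lambda>t. measure \<pi> {Some t})"

lemma pmf_start: "pmf start_pmf t = measure \<pi> {Some t}"
  unfolding start_pmf_def
proof (rule pmf_embed_pmf)
  have "(\<integral>\<^sup>+t. emeasure \<pi> {Some t} \<partial>count_space UNIV) = emeasure \<pi> (\<Union>t\<in>UNIV. {Some t})"
    by (rule emeasure_UN_countable[symmetric]) (auto simp: sets_fringe countable_rtree disjoint_family_on_def)
  also have "(\<Union>t\<in>UNIV. {Some t}) = space \<pi> - {None}" by (auto simp: space_fringe)
  also have "emeasure \<pi> \<dots> = 1"
    using \<pi>.prob_compl[of "{None}"] fringe_None by (simp add: sets_fringe \<pi>.emeasure_eq_measure)
  finally show "(\<integral>\<^sup>+t. ennreal (measure \<pi> {Some t}) \<partial>count_space UNIV) = 1" by (simp add: \<pi>.emeasure_eq_measure)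
qed simp

text \<open>Trees of probability 0 are never reached, so the law of the step at such a tree is arbitrary.\<close>

definition step_pmf :: "(nat \<times> rtree) option \<Rightarrow> rtree pmf" where
  "step_pmf k = (case k of None \<Rightarrow> start_pmf
     | Some (i, s) \<Rightarrow> if measure \<pi> {Some s} = 0 then start_pmf else embed_pmf (step_weight s))"

lemma pmf_step: "measure \<pi> {Some s} \<noteq> 0 \<Longrightarrow> pmf (step_pmf (Some (i, s))) b = step_weight s b"
  unfolding step_pmf_def
  using pmf_embed_pmf[of "step_weight s" b] step_weight_nonneg nn_integral_has_sum_1[OF step_weight_sum step_weight_nonneg] by simp

definition step_space :: "((nat \<times> rtree) option \<Rightarrow> rtree) measure" where
  "step_space = PiM UNIV (\<lambda>k. measure_pmf (step_pmf k))"

interpretation step: product_prob_space "\<lambda>k. measure_pmf (step_pmf k)" UNIV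
  by unfold_locales

interpretation \<Omega>: prob_space step_space
  unfolding step_space_def by (rule step.prob_space_axioms)

lemma space_step_space [simp]: "space step_space = UNIV"
  by (simp add: step_space_def space_PiM)

lemma measurable_step [measurable]: "(\<lambda>\<omega>. \<omega> k) \<in> step_space \<rightarrow>\<^sub>M count_space UNIV"
proof -
  have "(\<lambda>\<omega>. \<omega> k) \<in> step_space \<rightarrow>\<^sub>M measure_pmf (step_pmf k)" unfolding step_space_def by (rule measurable_component_singleton) simp
  then show ?thesis by (simp cong: measurable_cong_sets)
qed

lemma measurable_chain_rep [measurable]: "(\<lambda>\<omega>. chain_rep \<omega> i) \<in> step_space \<rightarrow>\<^sub>M count_space UNIV"
  and measurable_chain_choice [measurable]: "(\<lambda>\<omega>. \<omega> (Some (i, chain_rep \<omega> i))) \<in> step_space \<rightarrow>\<^sub>M count_space UNIV"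
proof -
  have *: "(\<lambda>\<omega>. \<omega> (Some (i, F \<omega>))) \<in> step_space \<rightarrow>\<^sub>M count_space UNIV" if F: "F \<in> step_space \<rightarrow>\<^sub>M count_space UNIV" for F :: "_ \<Rightarrow> rtree" and i
    by (rule measurable_compose_countable'[OF _ F countable_rtree]) simp
  show 1: "(\<lambda>\<omega>. chain_rep \<omega> i) \<in> step_space \<rightarrow>\<^sub>M count_space UNIV" for i
  proof (induction i)
    case (Suc i)
    have "(\<lambda>\<omega>. (\<lambda>s. graft s (\<omega> (Some (i, s)))) (chain_rep \<omega> i)) \<in> step_space \<rightarrow>\<^sub>M count_space UNIV"
    proof (rule measurable_compose_countable'[OF _ Suc countable_rtree])
      fix s
      show "(\<lambda>\<omega>. graft s (\<omega> (Some (i, s)))) \<in> step_space \<rightarrow>\<^sub>M count_space UNIV"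
        by (rule measurable_compose[OF measurable_step]) simp
    qed
    then show ?case by simp
  qed simp
  show "(\<lambda>\<omega>. \<omega> (Some (i, chain_rep \<omega> i))) \<in> step_space \<rightarrow>\<^sub>M count_space UNIV" by (rule *[OF 1])
qed

lemma measurable_chain_tree [measurable]: "chain_tree \<in> step_space \<rightarrow>\<^sub>M sin_space"
proof (rule measurable_PiM_single')
  show "(\<lambda>\<omega>. chain_tree \<omega> i) \<in> step_space \<rightarrow>\<^sub>M count_space UNIV" for i
    by (cases i) (simp_all add: chain_tree_def)
qed auto

text \<open>If the prescribed trees are successive graftings, the event prescribes finitely many of the independent choices,
  and the probabilities telescope; otherwise both sides vanish.\<close>

lemma prob_chain:
  "measure step_space {\<omega>. \<forall>m\<le>i. chain_rep \<omega> m = s m}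
    = measure \<pi> {Some (s i)} * (\<Prod>m=1..i. real (child_count (Some (s m)) (Some (s (m - 1)))))"
proof (cases "\<forall>m<i. s m \<in># subtrees (s (Suc m))")
  case False
  then obtain m where m: "m < i" "s m \<notin># subtrees (s (Suc m))" by blast
  have "{\<omega>. \<forall>m\<le>i. chain_rep \<omega> m = s m} = {}"
  proof (rule equals0I)
    fix \<omega> assume "\<omega> \<in> {\<omega>. \<forall>m\<le>i. chain_rep \<omega> m = s m}"
    then have "chain_rep \<omega> m = s m" "chain_rep \<omega> (Suc m) = s (Suc m)" using m(1) by (auto simp del: chain_rep.simps)
    moreover have "chain_rep \<omega> m \<in># subtrees (chain_rep \<omega> (Suc m))" by (simp add: graft_def)
    ultimately show False using m(2) by (simp only:)
  qed
  moreover have "(\<Prod>m=1..i. real (child_count (Some (s m)) (Some (s (m - 1))))) = 0"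
    using m by (intro prod_zero) (auto intro!: bexI[of _ "Suc m"] simp: child_count_def not_in_iff)
  ultimately show ?thesis by (simp only: measure_empty mult_zero_right)
next
  case True
  have "\<forall>m. \<exists>b. m < i \<longrightarrow> s (Suc m) = graft (s m) b" using True graft_surj by blast
  then obtain b where b: "\<And>m. m < i \<Longrightarrow> s (Suc m) = graft (s m) (b m)" by metis
  define J where "J j = insert None ((\<lambda>m. Some (m, s m)) ` {..<j})" for j :: nat
  define A where "A k = (case k of None \<Rightarrow> {s 0} | Some (m, _) \<Rightarrow> {b m})" for k :: "(nat \<times> rtree) option"
  have event: "{\<omega>. \<forall>m\<le>j. chain_rep \<omega> m = s m} = {\<omega>. \<forall>k\<in>J j. \<omega> k \<in> A k}" if "j \<le> i" for j
    using that
  proof (induction j)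
    case (Suc j)
    have "chain_rep \<omega> (Suc j) = s (Suc j) \<longleftrightarrow> \<omega> (Some (j, s j)) = b j" if "chain_rep \<omega> j = s j" for \<omega>
      using that b[of j] Suc.prems by (simp add: graft_inject)
    then have "{\<omega>. \<forall>m\<le>Suc j. chain_rep \<omega> m = s m} = {\<omega>. \<forall>m\<le>j. chain_rep \<omega> m = s m} \<inter> {\<omega>. \<omega> (Some (j, s j)) = b j}"
      by (auto simp: le_Suc_eq simp del: chain_rep.simps)
    then show ?case using Suc by (auto simp: J_def A_def lessThan_Suc)
  qed (auto simp: J_def A_def)
  have prob: "measure step_space {\<omega>. \<forall>k\<in>J j. \<omega> k \<in> A k} = (\<Prod>k\<in>J j. measure (step_pmf k) (A k))" for j
  proof -
    have "{\<omega>. \<forall>k\<in>J j. \<omega> k \<in> A k} = step.emb UNIV (J j) (PiE (J j) A)"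
      by (auto simp: prod_emb_def PiE_iff space_PiM)
    moreover have "finite (J j)" by (simp add: J_def)
    ultimately show ?thesis unfolding step_space_def by (simp add: step.measure_PiM_emb)
  qed
  have "(\<Prod>k\<in>J j. measure (step_pmf k) (A k))
    = measure \<pi> {Some (s j)} * (\<Prod>m=1..j. real (child_count (Some (s m)) (Some (s (m - 1)))))" if "j \<le> i" for j
    using that
  proof (induction j)
    case 0
    then show ?case by (simp add: J_def A_def step_pmf_def measure_pmf_single pmf_start)
  next
    case (Suc j)
    define R where "R = (\<Prod>m=1..j. real (child_count (Some (s m)) (Some (s (m - 1)))))"
    define q where "q = real (child_count (Some (s (Suc j))) (Some (s j)))"
    have "J (Suc j) = insert (Some (j, s j)) (J j)" "Some (j, s j) \<notin> J j" "finite (J j)" by (auto simp: J_def lessThan_Suc)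
    then have "(\<Prod>k\<in>J (Suc j). measure (step_pmf k) (A k)) = pmf (step_pmf (Some (j, s j))) (b j) * (measure \<pi> {Some (s j)} * R)"
      using Suc by (simp add: A_def measure_pmf_single R_def)
    also have "\<dots> = measure \<pi> {Some (s (Suc j))} * (R * q)"
    proof (cases "measure \<pi> {Some (s j)} = 0")
      case False
      then show ?thesis using b[of j] Suc.prems by (simp add: pmf_step step_weight_def q_def)
    next
      case True
      have "((\<lambda>t. measure \<pi> {t} * real (child_count t (Some (s j)))) has_sum 0) UNIV"
        using fringe True unfolding fringe_distribution_def by metis
      then have "measure \<pi> {Some (s (Suc j))} * q = 0"
        unfolding q_def by (rule nonneg_has_sum_le_0D) simp_all
      then show ?thesis using True by auto
    qed
    finally show ?case by (simp add: R_def q_def)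
  qed
  then show ?thesis using event[of i] prob[of i] by simp
qed

lemma sin_tree_law_exists: "sin_tree_law \<pi> (distr step_space sin_space chain_tree)"
  unfolding sin_tree_law_def
proof (intro conjI allI)
  show "prob_space (distr step_space sin_space chain_tree)" by (rule \<Omega>.prob_space_distr) measurable
  fix i and s :: "nat \<Rightarrow> ftree"
  let ?E = "{\<tau> \<in> space (distr step_space sin_space chain_tree). \<forall>m\<le>i. Some (monotone_rep \<tau> m) = s m}"
  let ?R = "measure \<pi> {s i} * (\<Prod>m=1..i. real (child_count (s m) (s (m - 1))))"
  show "measure (distr step_space sin_space chain_tree) ?E = ?R"
  proof (cases "\<forall>m\<le>i. s m \<noteq> None")
    case False
    then obtain m where m: "m \<le> i" "s m = None" by blast
    have "Some (monotone_rep \<tau> m) \<noteq> s m" for \<tau> using m(2) by simp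
    then have "?E = {}" using m(1) by blast
    moreover have "?R = 0"
    proof (cases "m = i")
      case False
      have "child_count (s (Suc m)) (s m) = 0" using m by (cases "s (Suc m)") (auto simp: child_count_def)
      then have "(\<Prod>m=1..i. real (child_count (s m) (s (m - 1)))) = 0"
        using m False by (intro prod_zero) (auto intro!: bexI[of _ "Suc m"])
      then show ?thesis by simp
    qed (use m fringe_None in simp)
    ultimately show ?thesis by (simp only: measure_empty)
  next
    case True
    then have "\<forall>m. \<exists>t. m \<le> i \<longrightarrow> s m = Some t" by auto
    then obtain t where t: "\<And>m. m \<le> i \<Longrightarrow> s m = Some (t m)" by metis
    have E: "?E = {\<tau> \<in> space sin_space. \<forall>m\<in>{..i}. monotone_rep \<tau> m = t m}" using t by auto
    have mr: "(\<lambda>\<tau>. monotone_rep \<tau> m) \<in> sin_space \<rightarrow>\<^sub>M count_space UNIV" for m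
    proof -
      have "(\<lambda>\<tau>. (\<lambda>l. monotone_rep (\<lambda>j. l ! j) m) (map \<tau> [0..<Suc m])) \<in> sin_space \<rightarrow>\<^sub>M count_space UNIV"
        by (rule measurable_compose[OF measurable_sin_prefix]) simp
      moreover have "monotone_rep (\<lambda>j. map \<tau> [0..<Suc m] ! j) m = monotone_rep \<tau> m" for \<tau> :: sin_tree
        using monotone_rep_agree[of m "\<lambda>j. map \<tau> [0..<Suc m] ! j" \<tau>] by (auto simp: less_Suc_eq_le simp del: upt_Suc)
      ultimately show ?thesis by (simp del: upt_Suc)
    qed
    have "?E \<in> sets sin_space" unfolding E using mr by measurable
    then have "measure (distr step_space sin_space chain_tree) ?E = measure step_space (chain_tree -` ?E \<inter> space step_space)"
      by (rule measure_distr[OF measurable_chain_tree])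
    also have "chain_tree -` ?E \<inter> space step_space = {\<omega>. \<forall>m\<le>i. chain_rep \<omega> m = t m}"
    proof -
      have "chain_tree \<omega> \<in> ?E \<longleftrightarrow> (\<forall>m\<le>i. chain_rep \<omega> m = t m)" for \<omega>
        unfolding E by (simp add: monotone_rep_chain_tree space_PiM Ball_def)
      then show ?thesis by (simp add: vimage_def space_PiM Int_def)
    qed
    also have "measure step_space \<dots> = ?R"
    proof -
      have "(\<Prod>m=1..i. real (child_count (Some (t m)) (Some (t (m - 1))))) = (\<Prod>m=1..i. real (child_count (s m) (s (m - 1))))"
      proof (rule prod.cong[OF refl])
        fix m assume "m \<in> {1..i}"
        then have "m \<le> i" "m - 1 \<le> i" by auto
        then show "real (child_count (Some (t m)) (Some (t (m - 1)))) = real (child_count (s m) (s (m - 1)))"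
          by (simp only: t)
      qed
      then show ?thesis unfolding prob_chain by (simp add: t)
    qed
    finally show ?thesis .
  qed
qed simp

theorem sin_tree_law_ex1: "\<exists>!S. sin_tree_law \<pi> S"
  using sin_tree_law_exists sin_tree_law_unique by blast

lemma the_sin_tree_law: "sin_tree_law \<pi> (the_sin_tree \<pi>)"
  unfolding the_sin_tree_def by (rule theI'[OF sin_tree_law_ex1])

end

section \<open>The space of tuples of trees is discrete\<close>

lemma trunc_fixed_elements: "trunc (Suc q) x = x \<Longrightarrow> y \<in># subtrees x \<Longrightarrow> trunc q y = y"
proof -
  assume x: "trunc (Suc q) x = x" and y: "y \<in># subtrees x"
  have "subtrees x = image_mset (trunc q) (subtrees x)" using arg_cong[OF x, of subtrees] by simp
  then have "y \<in># image_mset (trunc q) (subtrees x)" using y by simp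
  then obtain z where "y = trunc q z" by auto
  then show ?thesis by (simp add: trunc_trunc)
qed

text \<open>If the ball of radius \<open>q + 1\<close> has no vertex at distance \<open>q + 1\<close>, then the tree has none beyond distance \<open>q\<close>.\<close>

lemma trunc_fixed_of_trunc_Suc: "trunc q (trunc (Suc q) t) = trunc (Suc q) t \<Longrightarrow> trunc q t = t"
proof (induction q arbitrary: t)
  case 0
  then show ?case by (cases t) simp
next
  case (Suc q)
  have "trunc q a = a" if a: "a \<in># subtrees t" for a
  proof (rule Suc.IH)
    have "trunc (Suc q) a \<in># subtrees (trunc (Suc (Suc q)) t)" using a by simp
    from trunc_fixed_elements[OF Suc.prems this] show "trunc q (trunc (Suc q) a) = trunc (Suc q) a" .
  qed
  then have "image_mset (trunc q) (subtrees t) = image_mset (\<lambda>x. x) (subtrees t)" by (rule image_mset_cong)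
  then show ?case by simp
qed

text \<open>A tree that agrees with \<open>x\<close> up to one level above the height of \<open>x\<close> is equal to \<open>x\<close>.\<close>

lemma tree_isolated: "\<exists>\<epsilon>>0. \<forall>t. t \<noteq> x \<longrightarrow> \<epsilon> \<le> tree_dist t x"
proof -
  obtain q where q: "\<forall>r\<ge>q. tree_ball r x = x" using tree_ball_eventually by blast
  have sep: "tree_ball (Suc q) x \<noteq> tree_ball (Suc q) t" if ne: "t \<noteq> x" for t
  proof
    assume eq: "tree_ball (Suc q) x = tree_ball (Suc q) t"
    have x: "tree_ball (Suc q) x = x" "tree_ball q x = x" using q by auto
    show False
    proof (cases t)
      case None
      then show False using eq x ne by (simp add: tree_ball_def)
    next
      case (Some t')
      then obtain x' where x': "x = Some x'" using eq x by (cases x) (auto simp: tree_ball_def)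
      have "trunc (Suc q) t' = x'" using eq x Some x' by (simp add: tree_ball_def)
      moreover have fx: "trunc q x' = x'" using x(2) x' by (simp add: tree_ball_def)
      ultimately have "trunc q t' = t'" using trunc_fixed_of_trunc_Suc[of q t'] by simp
      moreover have "trunc q t' = x'" using \<open>trunc (Suc q) t' = x'\<close> fx trunc_trunc[of q "Suc q" t'] by simp
      ultimately show False using ne Some x' by simp
    qed
  qed
  have "1 / (1 + real q) \<le> tree_dist t x" if ne: "t \<noteq> x" for t
  proof -
    have "agreement_radius t x \<le> enat q"
      unfolding agreement_radius_def
    proof (rule Sup_least)
      fix e assume "e \<in> enat ` {r. tree_ball r x = tree_ball r t}"
      then obtain r where r: "e = enat r" "tree_ball r x = tree_ball r t" by blast
      have "r \<le> q"
      proof (rule ccontr)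
        assume "\<not> r \<le> q"
        then have "tree_ball (Suc q) x = tree_ball (Suc q) t" using tree_ball_mono[OF _ r(2), of "Suc q"] by simp
        then show False using sep[OF ne] by simp
      qed
      then show "e \<le> enat q" using r by simp
    qed
    then obtain R where "agreement_radius t x = enat R" "R \<le> q" by (cases "agreement_radius t x") auto
    then show ?thesis by (simp add: tree_dist_def frac_le)
  qed
  then show ?thesis by (intro exI[of _ "1 / (1 + real q)"]) auto
qed

lemma openin_tuple_topology: "openin (tuple_topology k) U \<longleftrightarrow> U \<subseteq> tuples k"
proof -
  interpret Metric_space "tuples k" "tuple_dist k" by (rule Metric_space_tuples)
  have "\<exists>r>0. mball x r \<subseteq> {x}" for x
  proof -
    obtain \<epsilon> where \<epsilon>: "\<And>i. 0 < \<epsilon> i" "\<And>i t. t \<noteq> x ! i \<Longrightarrow> \<epsilon> i \<le> tree_dist t (x ! i)"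
    proof -
      have "\<forall>i. \<exists>\<epsilon>>0. \<forall>t. t \<noteq> x ! i \<longrightarrow> \<epsilon> \<le> tree_dist t (x ! i)" using tree_isolated by blast
      then obtain \<epsilon> where "\<forall>i. 0 < \<epsilon> i \<and> (\<forall>t. t \<noteq> x ! i \<longrightarrow> \<epsilon> i \<le> tree_dist t (x ! i))" by (auto dest!: choice)
      then show ?thesis using that by blast
    qed
    define r where "r = Min ((\<lambda>i. (1 / 2) ^ i * \<epsilon> i) ` {..k})"
    have r: "r \<le> (1 / 2) ^ i * \<epsilon> i" if "i \<le> k" for i unfolding r_def using that by (intro Min_le) auto
    have "0 < r" unfolding r_def using \<epsilon>(1) by (subst Min_gr_iff) auto
    moreover have "y = x" if y: "y \<in> mball x r" for y
    proof (rule ccontr)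
      assume "y \<noteq> x"
      have mem: "x \<in> tuples k" "y \<in> tuples k" "tuple_dist k x y < r" using y by auto
      then obtain i where i: "i \<le> k" "y ! i \<noteq> x ! i"
        using \<open>y \<noteq> x\<close> by (auto simp: tuples_def list_eq_iff_nth_eq less_Suc_eq_le)
      have "r \<le> (1 / 2) ^ i * tree_dist (y ! i) (x ! i)"
        using order_trans[OF r[OF i(1)] mult_left_mono[OF \<epsilon>(2)[OF i(2)]]] by simp
      also have "\<dots> \<le> tuple_dist k x y"
        unfolding tuple_dist_def using i(1) by (intro member_le_sum) (auto simp: tree_dist_nonneg)
      finally show False using mem(3) by simp
    qed
    ultimately show ?thesis by blast
  qed
  then have "\<exists>r>0. mball x r \<subseteq> U" if "x \<in> U" for x using that by blast
  then show ?thesis unfolding tuple_topology_def openin_mtopology by blast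
qed

lemma topspace_tuple_topology: "topspace (tuple_topology k) = tuples k"
  using openin_tuple_topology[of k "tuples k"] openin_subset[of "tuple_topology k"] openin_tuple_topology[of k "topspace (tuple_topology k)"] by auto

lemma sets_borel_tuples: "sets (borel_of (tuple_topology k)) = Pow (tuples k)"
  and space_borel_tuples: "space (borel_of (tuple_topology k)) = tuples k"
proof -
  have "{U. openin (tuple_topology k) U} = Pow (tuples k)" by (auto simp: openin_tuple_topology)
  then have eq: "borel_of (tuple_topology k) = sigma (tuples k) (Pow (tuples k))"
    by (simp add: borel_of_def topspace_tuple_topology)
  show "sets (borel_of (tuple_topology k)) = Pow (tuples k)" unfolding eq
    by (simp add: sigma_algebra.sigma_sets_eq[OF sigma_algebra_Pow])
  show "space (borel_of (tuple_topology k)) = tuples k" unfolding eq by (rule space_measure_of) simp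
qed

lemma measurable_into_tuples: "f \<in> M \<rightarrow>\<^sub>M count_space UNIV \<Longrightarrow> (\<And>x. f x \<in> tuples k) \<Longrightarrow> f \<in> M \<rightarrow>\<^sub>M borel_of (tuple_topology k)"
  by (rule measurableI) (auto simp: space_borel_tuples sets_borel_tuples dest: measurable_sets)

section \<open>The choices as a product of uniform laws\<close>

lemma countable_finitely_supported: "countable {c :: nat \<Rightarrow> nat. \<forall>m. m \<notin> {1..<n} \<longrightarrow> c m = 0}"
proof (rule countable_subset)
  show "{c :: nat \<Rightarrow> nat. \<forall>m. m \<notin> {1..<n} \<longrightarrow> c m = 0} \<subseteq> range (\<lambda>l m. if m < length l then l ! m else 0)"
  proof
    fix c :: "nat \<Rightarrow> nat" assume "c \<in> {c. \<forall>m. m \<notin> {1..<n} \<longrightarrow> c m = 0}"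
    then have "c = (\<lambda>l m. if m < length l then l ! m else 0) (map c [0..<n])" by (auto simp: fun_eq_iff)
    then show "c \<in> range (\<lambda>l m. if m < length l then l ! m else 0)" by (rule range_eqI)
  qed
qed simp

text \<open>The event depends on finitely many of the independent choices, which take countably many values, and a value is
  taken with the product of the uniform probabilities.\<close>

lemma limited_memory_transfer:
  assumes \<theta>: "0 < \<theta>" "\<theta> < 1" and C: "limited_memory_choices M (\<lambda>n. nat \<lfloor>\<theta> * real n\<rfloor>) C"
    and dep: "\<And>c c'. (\<And>m. m \<in> {1..<n} \<Longrightarrow> c m = c' m) \<Longrightarrow> Q c \<longleftrightarrow> Q c'"
  shows "{\<omega> \<in> space M. Q (\<lambda>m. C m \<omega>)} \<in> sets M"
    and "measure M {\<omega> \<in> space M. Q (\<lambda>m. C m \<omega>)} = measure_pmf.prob (choice_pmf \<theta> n) {c. Q c}"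
proof -
  interpret prob_space M using C by (simp add: limited_memory_choices_def)
  have ind: "indep_vars (\<lambda>_. count_space UNIV) C {1..}"
    and law: "\<And>m. 1 \<le> m \<Longrightarrow> distr M (count_space UNIV) (C m) = measure_pmf (pmf_of_set (window \<theta> m))"
    using C by (auto simp: limited_memory_choices_def window_def)
  have Cm: "C m \<in> M \<rightarrow>\<^sub>M count_space UNIV" if "1 \<le> m" for m
    using ind that by (auto simp: indep_vars_def)
  define R where "R \<omega> m = (if m \<in> {1..<n} then C m \<omega> else 0)" for \<omega> m
  have QR: "Q (\<lambda>m. C m \<omega>) \<longleftrightarrow> Q (R \<omega>)" for \<omega> by (rule dep) (simp add: R_def)
  define Z where "Z = {c :: nat \<Rightarrow> nat. \<forall>m. m \<notin> {1..<n} \<longrightarrow> c m = 0}"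
  have cZ: "countable Z" unfolding Z_def by (rule countable_finitely_supported)
  have RZ: "R \<omega> \<in> Z" for \<omega> by (auto simp: R_def Z_def)
  have R_eq: "{\<omega> \<in> space M. R \<omega> = c} = {\<omega> \<in> space M. \<forall>m\<in>{1..<n}. C m \<omega> = c m}" if "c \<in> Z" for c
    using that by (auto simp: R_def Z_def fun_eq_iff)
  have R_sets: "{\<omega> \<in> space M. R \<omega> = c} \<in> sets M" if "c \<in> Z" for c
  proof -
    have "{\<omega> \<in> space M. C m \<omega> = c m} \<in> sets M" if "m \<in> {1..<n}" for m
      using measurable_sets[OF Cm[of m], of "{c m}"] that by (simp add: vimage_def Int_def conj_commute)
    then show ?thesis unfolding R_eq[OF that] by (intro sets.sets_Collect_finite_All) auto
  qed
  have R_prob: "prob {\<omega> \<in> space M. R \<omega> = c} = pmf (choice_pmf \<theta> n) c" if c: "c \<in> Z" for c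
  proof (cases "{1..<n} = {}")
    case True
    then have "{\<omega> \<in> space M. R \<omega> = c} = space M" using c by (auto simp: R_def Z_def)
    moreover have "pmf (choice_pmf \<theta> n) c = 1"
    proof -
      have "c = (\<lambda>_. 0)" using True c by (auto simp: Z_def)
      then show ?thesis using True by (simp add: choice_pmf_def)
    qed
    ultimately show ?thesis by (simp add: prob_space)
  next
    case False
    have "prob (\<Inter>m\<in>{1..<n}. C m -` {c m} \<inter> space M) = (\<Prod>m\<in>{1..<n}. prob (C m -` {c m} \<inter> space M))"
      by (rule indep_varsD[OF ind False]) auto
    also have "\<dots> = (\<Prod>m\<in>{1..<n}. pmf (pmf_of_set (if m = 0 then {0} else window \<theta> m)) (c m))"
    proof (rule prod.cong[OF refl])
      fix m assume m: "m \<in> {1..<n}"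
      have "prob (C m -` {c m} \<inter> space M) = measure (distr M (count_space UNIV) (C m)) {c m}"
        using Cm[of m] m by (subst measure_distr) auto
      also have "\<dots> = pmf (pmf_of_set (window \<theta> m)) (c m)" using law[of m] m by (simp add: measure_pmf_single)
      finally show "prob (C m -` {c m} \<inter> space M) = pmf (pmf_of_set (if m = 0 then {0} else window \<theta> m)) (c m)" using m by simp
    qed
    also have "\<dots> = pmf (choice_pmf \<theta> n) c" using c by (simp add: choice_pmf_def pmf_Pi Z_def)
    also have "(\<Inter>m\<in>{1..<n}. C m -` {c m} \<inter> space M) = {\<omega> \<in> space M. R \<omega> = c}"
      unfolding R_eq[OF c] using False by auto
    finally show ?thesis .
  qed
  have supp: "set_pmf (choice_pmf \<theta> n) \<subseteq> Z"
    unfolding choice_pmf_def Z_def using set_Pi_pmf_subset[of "{1..<n}" 0] by auto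
  have un: "{\<omega> \<in> space M. P (R \<omega>)} = (\<Union>c\<in>{c \<in> Z. P c}. {\<omega> \<in> space M. R \<omega> = c})" for P
    using RZ by auto
  have meas: "{\<omega> \<in> space M. P (R \<omega>)} \<in> sets M" for P
    unfolding un by (rule sets.countable_UN''[OF countable_subset[OF _ cZ]]) (auto intro: R_sets)
  then show "{\<omega> \<in> space M. Q (\<lambda>m. C m \<omega>)} \<in> sets M" unfolding QR .
  have "emeasure M {\<omega> \<in> space M. Q (R \<omega>)} = (\<integral>\<^sup>+c. emeasure M {\<omega> \<in> space M. R \<omega> = c} \<partial>count_space {c \<in> Z. Q c})"
    unfolding un by (rule emeasure_UN_countable) (auto intro: R_sets countable_subset[OF _ cZ] simp: disjoint_family_on_def)
  also have "\<dots> = (\<integral>\<^sup>+c. ennreal (pmf (choice_pmf \<theta> n) c) \<partial>count_space {c \<in> Z. Q c})"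
    by (rule nn_integral_cong) (simp add: emeasure_eq_measure R_prob)
  also have "\<dots> = emeasure (measure_pmf (choice_pmf \<theta> n)) {c \<in> Z. Q c}" by (rule nn_integral_pmf)
  also have "\<dots> = emeasure (measure_pmf (choice_pmf \<theta> n)) {c. Q c}"
    by (rule emeasure_eq_AE) (use supp in \<open>auto simp: AE_measure_pmf_iff\<close>)
  finally show "measure M {\<omega> \<in> space M. Q (\<lambda>m. C m \<omega>)} = measure_pmf.prob (choice_pmf \<theta> n) {c. Q c}"
    unfolding QR by (simp add: measure_def)
qed

lemma prob_choice_Markov:
  assumes \<theta>: "0 < \<theta>" "\<theta> < 1" and "0 < a" and Z: "\<And>c. 0 \<le> Z c" and imp: "\<And>c. c \<in> set_pmf (choice_pmf \<theta> n) \<Longrightarrow> c \<in> A \<Longrightarrow> a \<le> Z c"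
  shows "measure_pmf.prob (choice_pmf \<theta> n) A \<le> EC \<theta> n Z / a"
proof -
  have "measure_pmf.prob (choice_pmf \<theta> n) A = EC \<theta> n (indicator A)" by simp
  also have "\<dots> \<le> EC \<theta> n (\<lambda>c. Z c / a)"
    by (rule integral_mono_AE[OF integrable_choice[OF \<theta>] integrable_choice[OF \<theta>]])
      (use imp \<open>0 < a\<close> Z in \<open>auto simp: AE_measure_pmf_iff indicator_def field_simps\<close>)
  finally show ?thesis by simp
qed

section \<open>Convergence of the empirical measures\<close>

context branching
begin

abbreviation limit_tree where "limit_tree \<equiv> the_sin_tree law"

lemma sin_law: "sin_tree_law law limit_tree"
  by (rule the_sin_tree_law[OF fringe_distribution_law])

abbreviation limit_fringe where "limit_fringe k \<equiv> distr limit_tree (borel_of (tuple_topology k)) (sin_fringe k)"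

lemma prob_space_sin: "prob_space limit_tree" and sets_sin: "sets limit_tree = sets sin_space" and space_sin: "space limit_tree = UNIV"
  using sin_law sets_eq_imp_space_eq[of limit_tree sin_space] by (auto simp: sin_tree_law_def space_PiM)

lemma sin_fringe_prefix: "sin_fringe k \<tau> = map Some (map \<tau> [0..<Suc k])"
  by (simp add: sin_fringe_def)

lemma sin_fringe_in_tuples: "sin_fringe k \<tau> \<in> tuples k"
  by (simp add: sin_fringe_def tuples_def)

lemma measurable_sin_fringe: "sin_fringe k \<in> limit_tree \<rightarrow>\<^sub>M borel_of (tuple_topology k)"
proof (rule measurable_into_tuples[OF _ sin_fringe_in_tuples])
  have "(\<lambda>\<tau>. map Some (map \<tau> [0..<Suc k])) \<in> sin_space \<rightarrow>\<^sub>M count_space UNIV"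
    by (rule measurable_compose[OF measurable_sin_prefix]) simp
  then show "sin_fringe k \<in> limit_tree \<rightarrow>\<^sub>M count_space UNIV"
    unfolding sin_fringe_prefix[abs_def] by (simp add: measurable_cong_sets[OF sets_sin refl] del: upt_Suc)
qed

lemma prob_space_limit_fringe: "prob_space (limit_fringe k)"
  by (rule prob_space.prob_space_distr[OF prob_space_sin measurable_sin_fringe])

lemma measure_limit_fringe:
  "measure (limit_fringe k) {sin_fringe k \<tau>} = measure law {Some (monotone_rep \<tau> k)} *
    (\<Prod>m=1..k. real (count (subtrees (monotone_rep \<tau> m)) (monotone_rep \<tau> (m - 1))))"
proof -
  have "{\<tau>'. sin_fringe k \<tau>' = sin_fringe k \<tau>} = {\<tau>'. \<forall>m\<le>k. \<tau>' m = \<tau> m}"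
    unfolding sin_fringe_def by (auto simp: list_eq_iff_nth_eq less_Suc_eq_le simp del: upt_Suc)
  also have "\<dots> = {\<tau>' \<in> space limit_tree. \<forall>m\<le>k. Some (monotone_rep \<tau>' m) = Some (monotone_rep \<tau> m)}"
    using monotone_rep_agree[of k _ \<tau>] by (simp add: space_sin)
  finally have eq: "sin_fringe k -` {sin_fringe k \<tau>} \<inter> space limit_tree = {\<tau>' \<in> space limit_tree. \<forall>m\<le>k. Some (monotone_rep \<tau>' m) = Some (monotone_rep \<tau> m)}"
    by (simp add: vimage_def space_sin)
  have "measure (limit_fringe k) {sin_fringe k \<tau>} = measure limit_tree {\<tau>' \<in> space limit_tree. \<forall>m\<le>k. Some (monotone_rep \<tau>' m) = Some (monotone_rep \<tau> m)}"
    using measure_distr[OF measurable_sin_fringe, of "{sin_fringe k \<tau>}" k] sin_fringe_in_tuples by (simp add: eq sets_borel_tuples)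
  also have "\<dots> = measure law {Some (monotone_rep \<tau> k)} * (\<Prod>m=1..k. real (child_count (Some (monotone_rep \<tau> m)) (Some (monotone_rep \<tau> (m - 1)))))"
    using sin_law unfolding sin_tree_law_def by (elim conjE allE[of _ k] allE[of _ "\<lambda>m. Some (monotone_rep \<tau> m)"])
  finally show ?thesis by (simp add: child_count_def)
qed

text \<open>The limit law is carried by a countable set.\<close>

lemma limit_fringe_tight:
  assumes "0 < \<delta>"
  shows "\<exists>F. finite F \<and> 1 - \<delta> < measure (limit_fringe k) (sin_fringe k ` F)"
proof -
  interpret L: prob_space "limit_fringe k" by (rule prob_space_limit_fringe)
  let ?R = "range (sin_fringe k)"
  have cR: "countable ?R"
  proof -
    have "?R \<subseteq> range (map Some :: rtree list \<Rightarrow> ftree list)" unfolding sin_fringe_prefix by blast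
    moreover have "countable (range (map Some :: rtree list \<Rightarrow> ftree list))"
      using countable_lists[OF countable_rtree] by simp
    ultimately show ?thesis by (rule countable_subset)
  qed
  have tot: "measure (limit_fringe k) ?R = 1"
  proof -
    have "?R \<in> sets (borel_of (tuple_topology k))" using sin_fringe_in_tuples by (auto simp: sets_borel_tuples)
    then have "measure (limit_fringe k) ?R = measure limit_tree (sin_fringe k -` ?R \<inter> space limit_tree)" by (rule measure_distr[OF measurable_sin_fringe])
    also have "sin_fringe k -` ?R \<inter> space limit_tree = space limit_tree" by auto
    finally show ?thesis using prob_space.prob_space[OF prob_space_sin] by simp
  qed
  define H where "H m = from_nat_into ?R ` {..<m}" for m
  have HR: "H m \<subseteq> ?R" for m unfolding H_def using from_nat_into[of ?R] by auto
  have "(\<lambda>m. measure (limit_fringe k) (H m)) \<longlonglongrightarrow> measure (limit_fringe k) (\<Union>m. H m)"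
  proof (rule L.finite_Lim_measure_incseq)
    show "range H \<subseteq> sets (limit_fringe k)"
      using HR sin_fringe_in_tuples by (fastforce simp: sets_borel_tuples)
    show "incseq H" by (auto simp: H_def incseq_def)
  qed
  moreover have "(\<Union>m. H m) = ?R"
  proof
    show "?R \<subseteq> (\<Union>m. H m)"
    proof
      fix x assume "x \<in> ?R"
      then obtain i where "from_nat_into ?R i = x" using from_nat_into_surj[OF cR] by blast
      then have "x \<in> H (Suc i)" by (auto simp: H_def)
      then show "x \<in> (\<Union>m. H m)" by blast
    qed
  qed (use HR in blast)
  ultimately have "(\<lambda>m. measure (limit_fringe k) (H m)) \<longlonglongrightarrow> 1" using tot by simp
  then have "\<forall>\<^sub>F m in sequentially. 1 - \<delta> < measure (limit_fringe k) (H m)"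
    using assms by (intro order_tendstoD) auto
  then obtain m where m: "1 - \<delta> < measure (limit_fringe k) (H m)" by (auto dest: eventually_happens)
  have "finite (H m)" by (simp add: H_def)
  then obtain F where "finite F" "H m = sin_fringe k ` F" using HR finite_subset_image[of "H m" "sin_fringe k" UNIV] by auto
  then show ?thesis using m by auto
qed

text \<open>The proportion of vertices whose fringe is a given tuple is a constant multiple of the proportion
  of vertices with a given fringe tree.\<close>

lemma fringe_tuple_proportion:
  "(\<lambda>n. EC \<theta> n (\<lambda>c. \<bar>real (card {v \<in> {1..n}. fringe k (recursive_tree c n) v = sin_fringe k \<tau>}) / n
      - measure (limit_fringe k) {sin_fringe k \<tau>}\<bar>)) \<longlonglongrightarrow> 0"
proof -
  define P where "P = (\<Prod>m=1..k. real (count (subtrees (monotone_rep \<tau> m)) (monotone_rep \<tau> (m - 1))))"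
  have P0: "0 \<le> P" unfolding P_def by (intro prod_nonneg) auto
  let ?D = "\<lambda>n c. \<bar>real (card {w \<in> {1..n}. vshape c n w = monotone_rep \<tau> k}) / n - (\<integral>y. limit_shape (monotone_rep \<tau> k) y \<partial>expo)\<bar>"
  have "(\<lambda>n. P * EC \<theta> n (?D n)) \<longlonglongrightarrow> P * 0" by (intro tendsto_intros fringe_proportion_limit)
  then have lim: "(\<lambda>n. P * EC \<theta> n (?D n)) \<longlonglongrightarrow> 0" by simp
  show ?thesis
  proof (rule Lim_transform_eventually[OF lim])
    show "\<forall>\<^sub>F n in sequentially. P * EC \<theta> n (?D n) = EC \<theta> n (\<lambda>c. \<bar>real (card {v \<in> {1..n}. fringe k (recursive_tree c n) v = sin_fringe k \<tau>}) / n
      - measure (limit_fringe k) {sin_fringe k \<tau>}\<bar>)"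
      using eventually_ge_at_top[of 1]
    proof eventually_elim
      case (elim n)
      have "P * EC \<theta> n (?D n) = EC \<theta> n (\<lambda>c. P * ?D n c)" by simp
      also have "\<dots> = EC \<theta> n (\<lambda>c. \<bar>real (card {v \<in> {1..n}. fringe k (recursive_tree c n) v = sin_fringe k \<tau>}) / n
        - measure (limit_fringe k) {sin_fringe k \<tau>}\<bar>)"
      proof (rule integral_cong_AE, simp, simp, unfold AE_measure_pmf_iff, rule ballI)
        fix c assume "c \<in> set_pmf (choice_pmf \<theta> n)"
        then have valid: "choices_valid n c" by (rule choice_pmf_valid[OF \<theta>])
        have "{v \<in> {1..n}. fringe k (recursive_tree c n) v = sin_fringe k \<tau>}
          = {v \<in> {1..n}. k \<le> depth (recursive_tree c n) v \<and> (\<forall>i\<le>k. vshape c n ((parent (recursive_tree c n) ^^ i) v) = monotone_rep \<tau> i)}"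
          using fringe_eq_sin_fringe_iff[OF valid elim] by (intro Collect_cong conj_cong refl) blast
        then have "real (card {v \<in> {1..n}. fringe k (recursive_tree c n) v = sin_fringe k \<tau>})
          = real (card {w \<in> {1..n}. vshape c n w = monotone_rep \<tau> k}) * P"
          using card_ancestral_line[OF valid elim, of k "monotone_rep \<tau>"] by (simp add: P_def)
        then have "real (card {v \<in> {1..n}. fringe k (recursive_tree c n) v = sin_fringe k \<tau>}) / n - measure (limit_fringe k) {sin_fringe k \<tau>}
          = P * (real (card {w \<in> {1..n}. vshape c n w = monotone_rep \<tau> k}) / n - (\<integral>y. limit_shape (monotone_rep \<tau> k) y \<partial>expo))"
          unfolding measure_limit_fringe measure_law_Some P_def[symmetric] by (simp add: algebra_simps)
        then show "P * ?D n c = \<bar>real (card {v \<in> {1..n}. fringe k (recursive_tree c n) v = sin_fringe k \<tau>}) / n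
          - measure (limit_fringe k) {sin_fringe k \<tau>}\<bar>" using P0 by (simp only: abs_mult abs_of_nonneg)
      qed
      finally show ?case .
    qed
  qed
qed

lemma fringe_in_tuples: "fringe k t v \<in> tuples k"
  by (simp add: fringe_def tuples_def)

lemma measurable_fringe: fixes c :: "nat \<Rightarrow> nat" shows "fringe k (recursive_tree c n) \<in> uniform_count_measure {1..n} \<rightarrow>\<^sub>M borel_of (tuple_topology k)"
  by (rule measurableI) (auto simp: space_borel_tuples fringe_in_tuples sets_uniform_count_measure space_uniform_count_measure)

lemma empirical_fringe_prob:
  fixes c :: "nat \<Rightarrow> nat"
  assumes "1 \<le> n"
  shows "empirical_fringe k (recursive_tree c n) \<in> prob_measures (tuple_topology k)"
  using assms prob_space.prob_space_distr[OF prob_space_uniform_count_measure measurable_fringe, of n k c]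
  by (simp add: prob_measures_def empirical_fringe_def)

lemma integral_empirical_fringe:
  fixes c :: "nat \<Rightarrow> nat" and f :: "ftree list \<Rightarrow> real"
  assumes "1 \<le> n"
  shows "(\<integral>x. f x \<partial>empirical_fringe k (recursive_tree c n)) = (\<Sum>v=1..n. f (fringe k (recursive_tree c n) v)) / n"
proof -
  have verts: "verts (recursive_tree c n) = {1..n}" by simp
  have "f \<in> borel_measurable (borel_of (tuple_topology k))" by (rule measurableI) (auto simp: sets_borel_tuples space_borel_tuples)
  then have "(\<integral>x. f x \<partial>empirical_fringe k (recursive_tree c n)) = (\<integral>v. f (fringe k (recursive_tree c n) v) \<partial>uniform_count_measure {1..n})"
    unfolding empirical_fringe_def verts by (intro integral_distr measurable_fringe)
  also have "\<dots> = (\<Sum>v=1..n. f (fringe k (recursive_tree c n) v)) / n"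
    using assms by (subst integral_uniform_count_measure) auto
  finally show ?thesis .
qed

text \<open>Convergence of finitely many point masses carrying almost all of the limit controls the integrals
  of bounded functions.\<close>

lemma integral_difference_bound:
  fixes c :: "nat \<Rightarrow> nat" and f :: "ftree list \<Rightarrow> real"
  assumes n: "1 \<le> n" and K: "\<And>x. x \<in> tuples k \<Longrightarrow> \<bar>f x\<bar> \<le> K" and G: "finite G" "G \<subseteq> tuples k" "1 - \<delta> < measure (limit_fringe k) G"
  defines "Y \<equiv> \<lambda>x. real (card {v \<in> {1..n}. fringe k (recursive_tree c n) v = x}) / n"
  shows "\<bar>(\<integral>x. f x \<partial>empirical_fringe k (recursive_tree c n)) - (\<integral>x. f x \<partial>limit_fringe k)\<bar>
    \<le> 2 * K * ((\<Sum>x\<in>G. \<bar>Y x - measure (limit_fringe k) {x}\<bar>) + \<delta>)"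
proof -
  interpret L: prob_space "limit_fringe k" by (rule prob_space_limit_fringe)
  define F where "F v = fringe k (recursive_tree c n) v" for v
  define q where "q x = measure (limit_fringe k) {x}" for x
  define D where "D = (\<Sum>x\<in>G. \<bar>Y x - q x\<bar>)"
  have K0: "0 \<le> K" by (rule order_trans[OF abs_ge_zero K[OF sin_fringe_in_tuples]])
  have sL: "sets (limit_fringe k) = Pow (tuples k)" "space (limit_fringe k) = tuples k"
    by (simp_all add: sets_borel_tuples space_borel_tuples)
  have meas: "h \<in> borel_measurable (limit_fringe k)" for h :: "ftree list \<Rightarrow> real" by (rule measurableI) (auto simp: sets_borel_tuples space_borel_tuples)
  have count_sum: "(\<Sum>x\<in>G. g x * Y x) = (\<Sum>v=1..n. if F v \<in> G then g (F v) else 0) / n" for g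
  proof -
    have "real (card {v \<in> {1..n}. F v = x}) = (\<Sum>v=1..n. if F v = x then 1 else 0)" for x using sum.inter_filter[of "{1..n}" "\<lambda>_. 1 :: real" "\<lambda>v. F v = x"] by simp
    then have "(\<Sum>x\<in>G. g x * Y x) = (\<Sum>x\<in>G. \<Sum>v=1..n. if F v = x then g x else 0) / n"
      unfolding Y_def F_def[symmetric] by (simp add: sum_divide_distrib sum_distrib_left if_distrib[of "(*) _"] cong: if_cong)
    also have "(\<Sum>x\<in>G. \<Sum>v=1..n. if F v = x then g x else 0) = (\<Sum>v=1..n. \<Sum>x\<in>G. if F v = x then g x else 0)" by (rule sum.swap)
    also have "\<dots> = (\<Sum>v=1..n. if F v \<in> G then g (F v) else 0)" using G(1) by (intro sum.cong refl) simp
    finally show ?thesis .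
  qed
  have qG: "measure (limit_fringe k) G = (\<Sum>x\<in>G. q x)"
    unfolding q_def using G by (intro L.finite_measure_eq_sum_singleton) (auto simp: sets_borel_tuples space_borel_tuples)
  have YG: "(\<Sum>x\<in>G. Y x) \<ge> 1 - \<delta> - D"
  proof -
    have "(\<Sum>x\<in>G. q x) - (\<Sum>x\<in>G. Y x) \<le> D" unfolding D_def sum_subtractf[symmetric] by (rule sum_mono) linarith
    then show ?thesis using G(3) qG by linarith
  qed
  have emp: "\<bar>(\<integral>x. f x \<partial>empirical_fringe k (recursive_tree c n)) - (\<Sum>x\<in>G. f x * Y x)\<bar> \<le> K * (\<delta> + D)"
  proof -
    have "(\<integral>x. f x \<partial>empirical_fringe k (recursive_tree c n)) - (\<Sum>x\<in>G. f x * Y x) = (\<Sum>v=1..n. if F v \<in> G then 0 else f (F v)) / n"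
      unfolding integral_empirical_fringe[OF n] count_sum F_def[symmetric] diff_divide_distrib[symmetric] sum_subtractf[symmetric]
      by (intro arg_cong2[where f = "(/)"] sum.cong refl) auto
    also have "\<bar>\<dots>\<bar> \<le> (\<Sum>v=1..n. if F v \<in> G then 0 else K) / n"
      using K[OF fringe_in_tuples] unfolding F_def abs_divide
      by (intro divide_mono order_trans[OF sum_abs] sum_mono) (use n in auto)
    also have "\<dots> = K * (1 - (\<Sum>x\<in>G. Y x))"
    proof -
      have "(\<Sum>v=1..n. if F v \<in> G then 0 else K) = (\<Sum>v=1..n. K - (if F v \<in> G then K else 0))" by (intro sum.cong) auto
      also have "\<dots> / n = K - (\<Sum>v=1..n. if F v \<in> G then K else 0) / n" using n by (simp add: sum_subtractf diff_divide_distrib)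
      finally show ?thesis using count_sum[of "\<lambda>_. K"] by (simp add: sum_distrib_left right_diff_distrib)
    qed
    also have "\<dots> \<le> K * (\<delta> + D)" using YG K0 by (intro mult_left_mono) auto
    finally show ?thesis .
  qed
  have lim: "\<bar>(\<integral>x. f x \<partial>limit_fringe k) - (\<Sum>x\<in>G. f x * q x)\<bar> \<le> K * \<delta>"
  proof -
    have iL: "integrable (limit_fringe k) h" if "\<And>x. x \<in> tuples k \<Longrightarrow> \<bar>h x\<bar> \<le> K" for h :: "ftree list \<Rightarrow> real"
      by (rule L.integrable_const_bound[of _ K]) (use that meas sets_borel_tuples space_borel_tuples in \<open>auto intro!: AE_I2\<close>)
    have s1: "(\<Sum>x\<in>G. f x * q x) = (\<integral>y. (\<Sum>x\<in>G. f x * indicator {x} y) \<partial>limit_fringe k)"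
    proof (subst Bochner_Integration.integral_sum)
      show "integrable (limit_fringe k) (\<lambda>y. f x * indicator {x} y)" if "x \<in> G" for x
        using K[of x] G(2) that K0 by (intro iL) (auto simp: indicator_def)
      show "(\<Sum>x\<in>G. f x * q x) = (\<Sum>x\<in>G. \<integral>y. f x * indicator {x} y \<partial>limit_fringe k)"
        using G(2) by (intro sum.cong refl) (auto simp: q_def sets_borel_tuples Int_absorb2)
    qed
    have s2: "(\<Sum>x\<in>G. f x * indicator {x} y) = (if y \<in> G then f y else 0)" for y
      using G(1) by (simp add: indicator_def if_distrib[of "(*) _"] cong: if_cong)
    have "(\<integral>x. f x \<partial>limit_fringe k) - (\<Sum>x\<in>G. f x * q x) = (\<integral>y. f y - (if y \<in> G then f y else 0) \<partial>limit_fringe k)"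
      unfolding s1 s2 by (rule Bochner_Integration.integral_diff[symmetric]) (use K K0 in \<open>auto intro!: iL\<close>)
    also have "\<bar>\<dots>\<bar> \<le> (\<integral>y. \<bar>f y - (if y \<in> G then f y else 0)\<bar> \<partial>limit_fringe k)" by (rule integral_abs_bound)
    also have "\<dots> \<le> (\<integral>y. K * indicator (tuples k - G) y \<partial>limit_fringe k)"
    proof (rule integral_mono)
      show "integrable (limit_fringe k) (\<lambda>y. \<bar>f y - (if y \<in> G then f y else 0)\<bar>)" by (rule iL) (use K K0 in auto)
      show "integrable (limit_fringe k) (\<lambda>y. K * indicator (tuples k - G) y)"
        by (rule iL) (use K0 in \<open>simp add: indicator_def\<close>)
      show "\<bar>f y - (if y \<in> G then f y else 0)\<bar> \<le> K * indicator (tuples k - G) y" if "y \<in> space (limit_fringe k)" for y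
        using that K[of y] by (simp add: indicator_def space_borel_tuples)
    qed
    also have "\<dots> = K * measure (limit_fringe k) (tuples k - G)"
    proof -
      have "tuples k - G \<in> sets (limit_fringe k)" by (simp add: sets_borel_tuples)
      then show ?thesis by (simp add: sets_borel_tuples Int_absorb2)
    qed
    also have "\<dots> \<le> K * \<delta>"
      using L.prob_compl[of G] G(2,3) K0 by (intro mult_left_mono) (auto simp: sets_borel_tuples space_borel_tuples)
    finally show ?thesis .
  qed
  have "\<bar>(\<Sum>x\<in>G. f x * Y x) - (\<Sum>x\<in>G. f x * q x)\<bar> \<le> K * D"
  proof -
    have "\<bar>(\<Sum>x\<in>G. f x * Y x) - (\<Sum>x\<in>G. f x * q x)\<bar> \<le> (\<Sum>x\<in>G. \<bar>f x * (Y x - q x)\<bar>)"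
      unfolding sum_subtractf[symmetric] right_diff_distrib[symmetric] by (rule sum_abs)
    also have "\<dots> \<le> (\<Sum>x\<in>G. K * \<bar>Y x - q x\<bar>)"
      unfolding abs_mult by (intro sum_mono mult_right_mono K) (use G(2) in auto)
    finally show ?thesis by (simp add: D_def sum_distrib_left)
  qed
  then have "\<bar>(\<integral>x. f x \<partial>empirical_fringe k (recursive_tree c n)) - (\<integral>x. f x \<partial>limit_fringe k)\<bar> \<le> K * (\<delta> + D) + K * D + K * \<delta>"
    using emp lim by linarith
  also have "\<dots> = 2 * K * (D + \<delta>)" by (simp add: algebra_simps)
  finally show ?thesis by (simp add: D_def q_def)
qed

lemma recursive_tree_transfer:
  assumes C: "limited_memory_choices M (\<lambda>n. nat \<lfloor>\<theta> * real n\<rfloor>) C"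
  shows "{\<omega> \<in> space M. P (recursive_tree (\<lambda>m. C m \<omega>) n)} \<in> sets M"
    and "measure M {\<omega> \<in> space M. P (recursive_tree (\<lambda>m. C m \<omega>) n)}
      = measure_pmf.prob (choice_pmf \<theta> n) {c. P (recursive_tree c n)}"
proof -
  have dep: "P (recursive_tree c n) \<longleftrightarrow> P (recursive_tree c' n)" if "\<And>m. m \<in> {1..<n} \<Longrightarrow> c m = c' m" for c c'
    by (rule arg_cong[where f = P]) (rule recursive_tree_cong, rule that)
  show "{\<omega> \<in> space M. P (recursive_tree (\<lambda>m. C m \<omega>) n)} \<in> sets M"
    by (rule limited_memory_transfer(1)[OF \<theta> C, where Q = "\<lambda>c. P (recursive_tree c n)" and n = n]) (rule dep)
  show "measure M {\<omega> \<in> space M. P (recursive_tree (\<lambda>m. C m \<omega>) n)}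
      = measure_pmf.prob (choice_pmf \<theta> n) {c. P (recursive_tree c n)}"
    by (rule limited_memory_transfer(2)[OF \<theta> C, where Q = "\<lambda>c. P (recursive_tree c n)" and n = n]) (rule dep)
qed

text \<open>Up to \<open>\<delta>\<close>, the limit lives on a finite set \<open>G\<close> of tuples; the expected sum over \<open>G\<close> of the errors in the
  proportions tends to 0, and Markov's inequality bounds the probability that it exceeds \<open>\<delta>\<close>.\<close>

lemma weak_convergence_subbasic:
  assumes C: "limited_memory_choices M (\<lambda>n. nat \<lfloor>\<theta> * real n\<rfloor>) C"
    and f: "bounded (f ` tuples k)" and V: "open V" "(\<integral>x. f x \<partial>limit_fringe k) \<in> (V :: real set)"
  shows "(\<lambda>n. measure M {\<omega> \<in> space M. empirical_fringe k (recursive_tree (\<lambda>m. C m \<omega>) n) \<notin>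
      {\<mu> \<in> prob_measures (tuple_topology k). integral\<^sup>L \<mu> f \<in> V}}) \<longlonglongrightarrow> 0"
proof -
  let ?U = "{\<mu> \<in> prob_measures (tuple_topology k). integral\<^sup>L \<mu> f \<in> V}"
  define p where "p n = measure_pmf.prob (choice_pmf \<theta> n) {c. empirical_fringe k (recursive_tree c n) \<notin> ?U}" for n
  have tr: "measure M {\<omega> \<in> space M. empirical_fringe k (recursive_tree (\<lambda>m. C m \<omega>) n) \<notin> ?U} = p n" for n
    unfolding p_def by (rule recursive_tree_transfer(2)[OF C, where P = "\<lambda>t. empirical_fringe k t \<notin> ?U"])
  obtain K where K: "0 < K" "\<And>x. x \<in> tuples k \<Longrightarrow> \<bar>f x\<bar> \<le> K" using f unfolding bounded_pos by auto
  obtain e where e: "0 < e" "\<And>x. \<bar>x - (\<integral>x. f x \<partial>limit_fringe k)\<bar> < e \<Longrightarrow> x \<in> V"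
    using V unfolding open_dist dist_real_def by meson
  define \<delta> where "\<delta> = e / (4 * K)"
  have \<delta>: "0 < \<delta>" using e K by (simp add: \<delta>_def)
  obtain F where F: "finite F" "1 - \<delta> < measure (limit_fringe k) (sin_fringe k ` F)" using limit_fringe_tight[OF \<delta>] by blast
  define G where "G = sin_fringe k ` F"
  have G: "finite G" "G \<subseteq> tuples k" using F sin_fringe_in_tuples by (auto simp: G_def)
  define Z where "Z n c = (\<Sum>x\<in>G. \<bar>real (card {v \<in> {1..n}. fringe k (recursive_tree c n) v = x}) / n - measure (limit_fringe k) {x}\<bar>)" for n c
  have lim: "(\<lambda>n. EC \<theta> n (Z n) / \<delta>) \<longlonglongrightarrow> 0"
  proof -
    have "(\<lambda>n. \<Sum>x\<in>G. EC \<theta> n (\<lambda>c. \<bar>real (card {v \<in> {1..n}. fringe k (recursive_tree c n) v = x}) / n - measure (limit_fringe k) {x}\<bar>)) \<longlonglongrightarrow> (\<Sum>x\<in>G. 0)"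
      using fringe_tuple_proportion[of k] by (intro tendsto_sum) (auto simp: G_def)
    then have "(\<lambda>n. EC \<theta> n (Z n)) \<longlonglongrightarrow> 0"
      unfolding Z_def by (subst Bochner_Integration.integral_sum) (auto simp: integrable_choice[OF \<theta>])
    from tendsto_divide[OF this tendsto_const, of \<delta>] show ?thesis using \<delta> by simp
  qed
  have "p \<longlonglongrightarrow> 0"
  proof (rule tendsto_sandwich[OF _ _ tendsto_const lim])
    show "\<forall>\<^sub>F n in sequentially. p n \<le> EC \<theta> n (Z n) / \<delta>"
      using eventually_ge_at_top[of 1]
    proof eventually_elim
      case (elim n)
      show ?case unfolding p_def
      proof (rule prob_choice_Markov[OF \<theta> \<delta>])
        show "0 \<le> Z n c" for c unfolding Z_def by (intro sum_nonneg) auto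
        fix c assume c: "c \<in> {c. empirical_fringe k (recursive_tree c n) \<notin> ?U}"
        show "\<delta> \<le> Z n c"
        proof (rule ccontr)
          assume "\<not> \<delta> \<le> Z n c"
          then have "Z n c < \<delta>" by simp
          have "\<bar>(\<integral>x. f x \<partial>empirical_fringe k (recursive_tree c n)) - (\<integral>x. f x \<partial>limit_fringe k)\<bar> \<le> 2 * K * (Z n c + \<delta>)"
            unfolding Z_def by (rule integral_difference_bound[OF elim K(2) G]) (use F in \<open>auto simp: G_def\<close>)
          also have "\<dots> < 2 * K * (\<delta> + \<delta>)" using K(1) \<open>Z n c < \<delta>\<close> by (intro mult_strict_left_mono) auto
          also have "\<dots> = e" using K(1) by (simp add: \<delta>_def)
          finally have "integral\<^sup>L (empirical_fringe k (recursive_tree c n)) f \<in> V" by (rule e(2))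
          then show False using c empirical_fringe_prob[OF elim, of k c] by simp
        qed
      qed
    qed
  qed (auto simp: p_def)
  then show ?thesis unfolding tr .
qed

text \<open>The weak topology is generated by the sets just treated, and the neighbourhoods to which the property
  applies are closed under finite intersections and unions.\<close>

theorem converges_extended_fringe_recursive_tree:
  assumes C: "limited_memory_choices M (\<lambda>n. nat \<lfloor>\<theta> * real n\<rfloor>) C"
  shows "converges_extended_fringe M (\<lambda>n \<omega>. recursive_tree (\<lambda>m. C m \<omega>) n) limit_tree"
  unfolding converges_extended_fringe_def converges_in_prob_def
proof (intro allI conjI impI)
  interpret M: prob_space M using C by (simp add: limited_memory_choices_def)
  fix k
  define \<S> where "\<S> = {{\<mu> \<in> prob_measures (tuple_topology k). integral\<^sup>L \<mu> f \<in> U} | f U.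
    continuous_map (tuple_topology k) euclideanreal f \<and> bounded (f ` topspace (tuple_topology k)) \<and> open U}"
  have wt: "weak_topology (tuple_topology k) = topology_generated_by \<S>" by (simp add: weak_topology_def \<S>_def)
  have lp: "limit_fringe k \<in> prob_measures (tuple_topology k)"
    using prob_space_limit_fringe by (simp add: prob_measures_def)
  have "{\<mu> \<in> prob_measures (tuple_topology k). integral\<^sup>L \<mu> (\<lambda>_. 0 :: real) \<in> UNIV} \<in> \<S>"
    unfolding \<S>_def by (rule CollectI, rule exI[of _ "\<lambda>_. 0"], rule exI[of _ UNIV]) (auto intro!: boundedI[where B = 0])
  then show "limit_fringe k \<in> topspace (weak_topology (tuple_topology k))"
    unfolding wt topology_generated_by_topspace using lp by blast
  let ?Y = "\<lambda>n \<omega>. empirical_fringe k (recursive_tree (\<lambda>m. C m \<omega>) n)"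
  have meas: "{\<omega> \<in> space M. ?Y n \<omega> \<notin> U} \<in> sets M" for n U
    by (rule recursive_tree_transfer(1)[OF C, where P = "\<lambda>t. empirical_fringe k t \<notin> U"])
  then show "{\<omega> \<in> space M. ?Y n \<omega> \<notin> U} \<in> sets M" for n U .
  fix U assume U: "openin (weak_topology (tuple_topology k)) U \<and> limit_fringe k \<in> U"
  then have "generate_topology_on \<S> U" unfolding wt openin_topology_generated_by_iff by simp
  then have "limit_fringe k \<in> U \<longrightarrow> (\<lambda>n. measure M {\<omega> \<in> space M. ?Y n \<omega> \<notin> U}) \<longlonglongrightarrow> 0"
  proof (induction rule: generate_topology_on.induct)
    case (Int a b)
    show ?case
    proof
      assume l: "limit_fringe k \<in> a \<inter> b"
      have "(\<lambda>n. measure M {\<omega> \<in> space M. ?Y n \<omega> \<notin> a} + measure M {\<omega> \<in> space M. ?Y n \<omega> \<notin> b}) \<longlonglongrightarrow> 0 + 0"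
        using Int l by (intro tendsto_add) auto
      then have lim: "(\<lambda>n. measure M {\<omega> \<in> space M. ?Y n \<omega> \<notin> a} + measure M {\<omega> \<in> space M. ?Y n \<omega> \<notin> b}) \<longlonglongrightarrow> 0" by simp
      have le: "measure M {\<omega> \<in> space M. ?Y n \<omega> \<notin> a \<inter> b} \<le> measure M {\<omega> \<in> space M. ?Y n \<omega> \<notin> a} + measure M {\<omega> \<in> space M. ?Y n \<omega> \<notin> b}" for n
      proof -
        have "{\<omega> \<in> space M. ?Y n \<omega> \<notin> a \<inter> b} = {\<omega> \<in> space M. ?Y n \<omega> \<notin> a} \<union> {\<omega> \<in> space M. ?Y n \<omega> \<notin> b}" by auto
        then show ?thesis by (simp only: measure_Un_le meas)
      qed
      show "(\<lambda>n. measure M {\<omega> \<in> space M. ?Y n \<omega> \<notin> a \<inter> b}) \<longlonglongrightarrow> 0"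
        by (rule tendsto_sandwich[OF _ _ tendsto_const lim]) (use le in auto)
    qed
  next
    case (UN A)
    show ?case
    proof
      assume "limit_fringe k \<in> \<Union>A"
      then obtain a where a: "a \<in> A" "limit_fringe k \<in> a" by blast
      then have lim: "(\<lambda>n. measure M {\<omega> \<in> space M. ?Y n \<omega> \<notin> a}) \<longlonglongrightarrow> 0" using UN by blast
      have le: "measure M {\<omega> \<in> space M. ?Y n \<omega> \<notin> \<Union>A} \<le> measure M {\<omega> \<in> space M. ?Y n \<omega> \<notin> a}" for n
        by (rule M.finite_measure_mono[OF _ meas]) (use a in auto)
      show "(\<lambda>n. measure M {\<omega> \<in> space M. ?Y n \<omega> \<notin> \<Union>A}) \<longlonglongrightarrow> 0"
        by (rule tendsto_sandwich[OF _ _ tendsto_const lim]) (use le in auto)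
    qed
  next
    case (Basis s)
    from Basis(1)[unfolded \<S>_def topspace_tuple_topology]
    obtain f :: "ftree list \<Rightarrow> real" and V :: "real set" where s: "s = {\<mu> \<in> prob_measures (tuple_topology k). integral\<^sup>L \<mu> f \<in> V}"
      and f: "bounded (f ` tuples k)" and V: "open V"
      by (elim CollectE exE conjE) (rule that)
    show ?case
    proof
      assume "limit_fringe k \<in> s"
      then have "(\<integral>x. f x \<partial>limit_fringe k) \<in> V" by (simp add: s)
      from weak_convergence_subbasic[OF C f V this]
      show "(\<lambda>n. measure M {\<omega> \<in> space M. ?Y n \<omega> \<notin> s}) \<longlonglongrightarrow> 0" unfolding s .
    qed
  qed simp
  then show "(\<lambda>n. measure M {\<omega> \<in> space M. ?Y n \<omega> \<notin> U}) \<longlonglongrightarrow> 0" using U by simp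
qed

end

theorem theorem2p1:
  fixes \<theta> :: real
    and M :: "'a measure" and C :: "nat \<Rightarrow> 'a \<Rightarrow> nat"
    and N :: "'b measure" and X :: "nat list \<Rightarrow> 'b \<Rightarrow> real set" and T\<^sub>1 :: "'b \<Rightarrow> real"
  assumes "0 < \<theta>" and "\<theta> < 1"
    and "limited_memory_choices M (\<lambda>n. nat \<lfloor>\<theta> * real n\<rfloor>) C"
    and "branching_model N \<theta> X T\<^sub>1"
  shows "fringe_distribution (genealogy_law N X T\<^sub>1) \<and>
    (\<exists>!S. sin_tree_law (genealogy_law N X T\<^sub>1) S) \<and>
    converges_extended_fringe M (\<lambda>n \<omega>. recursive_tree (\<lambda>m. C m \<omega>) n)
      (the_sin_tree (genealogy_law N X T\<^sub>1))"
proof -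
  interpret branching N \<theta> X T\<^sub>1 using assms by unfold_locales
  show ?thesis
    using fringe_distribution_law sin_tree_law_ex1[OF fringe_distribution_law]
      converges_extended_fringe_recursive_tree[OF assms(3)] by blast
qed

end
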